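(* Let $p\in\{2,3,5,7,11,13\}$. There exists $\delta_p>0$ such that the proportion of pairs $(\lambda,\mu)$ of partitions of $n$ for which $\chi^{\lambda}_{\mu}$ is not divisible by $p$ is at most $O_p(n^{-\delta_p})$, where the implied constant depends only on $p$.
   Context: For partitions $\lambda,\mu$ of $n$, $\chi^{\lambda}_{\mu}$ denotes the value of the irreducible character of the symmetric group $S_n$ indexed by $\lambda$ on the conjugacy class of permutations of cycle type $\mu$ (an integer). The proportion in question is thus the density of entries of the character table of $S_n$ not divisible by $p$. *)

theory Defs
  imports Complex_Main "HOL-Library.Multiset" "HOL-Library.Function_Algebras"
    "HOL-Combinatorics.Permutations" "HOL-Combinatorics.Orbits"
begin

section \<open>Partitions and cycle types\<close>

definition partitions_of :: "nat \<Rightarrow> nat list set" where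
  "partitions_of n = {ks. sorted_wrt (\<ge>) ks \<and> 0 \<notin> set ks \<and> sum_list ks = n}"

text \<open>The symmetric group \<open>S\<^sub>n\<close> acts on \<open>{0, \<dots>, n - 1}\<close>.\<close>

definition sym_grp :: "nat \<Rightarrow> (nat \<Rightarrow> nat) set" where
  "sym_grp n = {\<pi>. \<pi> permutes {..<n}}"

text \<open>Fixed points are counted: they are orbits of size one.\<close>

definition cycle_type :: "nat \<Rightarrow> (nat \<Rightarrow> nat) \<Rightarrow> nat multiset" where
  "cycle_type n \<pi> = image_mset card (mset_set (orbit \<pi> ` {..<n}))"

section \<open>Traces of linear maps on finite-dimensional subspaces\<close>

text \<open>A complex-valued function on a type is a vector for the pointwise operations.
  The group algebra of \<open>S\<^sub>n\<close> is viewed inside the functions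
  \<open>(nat \<Rightarrow> nat) \<Rightarrow> complex\<close>, the function \<open>x\<close> standing for the formal sum
  of the \<open>x \<sigma> \<cdot> \<sigma>\<close>.\<close>

definition cscale :: "complex \<Rightarrow> ('a \<Rightarrow> complex) \<Rightarrow> 'a \<Rightarrow> complex" where
  "cscale c x = (\<lambda>a. c * x a)"

global_interpretation cfun: vector_space "cscale :: complex \<Rightarrow> ('a \<Rightarrow> complex) \<Rightarrow> 'a \<Rightarrow> complex"
  by unfold_locales (simp_all add: cscale_def fun_eq_iff algebra_simps)

text \<open>The trace of the restriction of \<open>T\<close> to a \<open>T\<close>-invariant finite-dimensional subspace
  \<open>V\<close>: the sum of the diagonal entries of the matrix of \<open>T\<close> in some basis of \<open>V\<close>.\<close>

definition trace_on :: "('a \<Rightarrow> complex) set \<Rightarrow> (('a \<Rightarrow> complex) \<Rightarrow> 'a \<Rightarrow> complex) \<Rightarrow> complex" where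
  "trace_on V T =
    (let B = (SOME B. \<not> cfun.dependent B \<and> cfun.span B = V)
     in \<Sum>b\<in>B. cfun.representation B (T b) b)"

section \<open>Irreducible characters of the symmetric group\<close>

text \<open>The reference tableau of shape \<open>\<alpha>\<close> has the entries \<open>0, 1, \<dots>, n - 1\<close> in reading
  order; \<open>tab_row \<alpha> k\<close> and \<open>tab_col \<alpha> k\<close> are the coordinates of the cell containing \<open>k\<close>.\<close>

definition tab_row :: "nat list \<Rightarrow> nat \<Rightarrow> nat" where
  "tab_row \<alpha> k = (LEAST i. k < sum_list (take (Suc i) \<alpha>))"

definition tab_col :: "nat list \<Rightarrow> nat \<Rightarrow> nat" where
  "tab_col \<alpha> k = k - sum_list (take (tab_row \<alpha> k) \<alpha>)"

definition row_grp :: "nat list \<Rightarrow> (nat \<Rightarrow> nat) set" where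
  "row_grp \<alpha> = {\<pi> \<in> sym_grp (sum_list \<alpha>). \<forall>k < sum_list \<alpha>. tab_row \<alpha> (\<pi> k) = tab_row \<alpha> k}"

definition col_grp :: "nat list \<Rightarrow> (nat \<Rightarrow> nat) set" where
  "col_grp \<alpha> = {\<pi> \<in> sym_grp (sum_list \<alpha>). \<forall>k < sum_list \<alpha>. tab_col \<alpha> (\<pi> k) = tab_col \<alpha> k}"

definition ga_single :: "(nat \<Rightarrow> nat) \<Rightarrow> (nat \<Rightarrow> nat) \<Rightarrow> complex" where
  "ga_single \<pi> = (\<lambda>\<sigma>. if \<sigma> = \<pi> then 1 else 0)"

text \<open>Left multiplication by the permutation \<open>\<pi>\<close>; it maps \<open>ga_single \<sigma>\<close> to
  \<open>ga_single (\<pi> \<circ> \<sigma>)\<close>.\<close>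

definition ga_lmult :: "(nat \<Rightarrow> nat) \<Rightarrow> ((nat \<Rightarrow> nat) \<Rightarrow> complex) \<Rightarrow> (nat \<Rightarrow> nat) \<Rightarrow> complex" where
  "ga_lmult \<pi> x = (\<lambda>\<sigma>. x (inv \<pi> \<circ> \<sigma>))"

definition young_symmetrizer :: "nat list \<Rightarrow> (nat \<Rightarrow> nat) \<Rightarrow> complex" where
  "young_symmetrizer \<alpha> =
    (\<Sum>p\<in>row_grp \<alpha>. \<Sum>q\<in>col_grp \<alpha>. cscale (of_int (sign q)) (ga_single (p \<circ> q)))"

text \<open>The Specht module, as the left ideal of the group algebra generated by the Young
  symmetrizer.  With this convention the partition \<open>[n]\<close> gives the trivial module.\<close>

definition specht_module :: "nat list \<Rightarrow> ((nat \<Rightarrow> nat) \<Rightarrow> complex) set" where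
  "specht_module \<alpha> =
    cfun.span ((\<lambda>\<pi>. ga_lmult \<pi> (young_symmetrizer \<alpha>)) ` sym_grp (sum_list \<alpha>))"

definition irr_char :: "nat list \<Rightarrow> (nat \<Rightarrow> nat) \<Rightarrow> complex" where
  "irr_char \<alpha> \<pi> = trace_on (specht_module \<alpha>) (ga_lmult \<pi>)"

text \<open>The entry of the character table: the value of the character indexed by \<open>\<alpha>\<close> at a
  permutation of cycle type \<open>\<beta>\<close>, where \<open>\<alpha>\<close> and \<open>\<beta>\<close> are partitions of the same number.\<close>

definition char_entry :: "nat list \<Rightarrow> nat list \<Rightarrow> complex" where
  "char_entry \<alpha> \<beta> =
    irr_char \<alpha> (SOME \<pi>. \<pi> \<in> sym_grp (sum_list \<alpha>) \<and> cycle_type (sum_list \<alpha>) \<pi> = mset \<beta>)"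

text \<open>Character values are complex numbers here (they are in fact integers), so divisibility
  has to refer to the integers explicitly: \<open>dvd\<close> is trivial on a field.\<close>

definition int_divisible :: "nat \<Rightarrow> complex \<Rightarrow> bool" where
  "int_divisible p z \<longleftrightarrow> (\<exists>k::int. z = of_int (int p * k))"

definition nondivisible_proportion :: "nat \<Rightarrow> nat \<Rightarrow> real" where
  "nondivisible_proportion p n =
    real (card {(\<alpha>, \<beta>). \<alpha> \<in> partitions_of n \<and> \<beta> \<in> partitions_of n
                         \<and> \<not> int_divisible p (char_entry \<alpha> \<beta>)})
    / real (card (partitions_of n \<times> partitions_of n))"

end

theory Submission
  imports Defs "HOL-Library.Poly_Mapping" "HOL-Probability.Probability" "HOL-Real_Asymp.Real_Asymp"
begin

text \<open>Frobenius' formula expresses \<open>\<chi>\<^sup>\<lambda>\<^sub>\<mu>\<close> as the coefficient of \<open>x\<^sup>\<lambda>\<^sup>+\<^sup>\<rho>\<close> in the product of the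
  Vandermonde determinant with the power sums of the parts of \<open>\<mu>\<close>.  Modulo \<open>p\<close> the power sum
  of \<open>k p\<^sup>i\<close> is the \<open>p\<^sup>i\<close>-th power of that of \<open>k\<close>.  If the parts \<open>k, k p, \<dots>, k p\<^sup>L\<close> of \<open>\<mu>\<close> have total
  size at least \<open>k p\<^sup>J\<close>, one may therefore replace some of them by a single part \<open>k p\<^sup>J\<close>, so that the
  character vanishes modulo \<open>p\<close> as soon as \<open>\<lambda>\<close> is a \<open>k p\<^sup>J\<close>-core.

  For \<open>m\<close> slightly larger than \<open>(\<surd>6 / 2\<pi>) \<surd>n ln n\<close>, all but \<open>O(n\<^sup>-\<^sup>\<delta>)\<close> of the partitions of \<open>n\<close> are
  \<open>m\<close>-cores: this follows from the bounds \<open>n\<^sup>-\<^sup>1\<^sup>-\<^sup>\<epsilon> \<lless> p(n) exp(- 2\<pi>\<surd>(n/6)) \<lless> n\<^sup>-\<^sup>1\<^sup>+\<^sup>\<epsilon>\<close>, which are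
  obtained by induction from \<open>n p(n) = \<Sum> \<sigma>(j) p(n - j)\<close>.  On the other hand, multiplicities of parts
  in a random partition are nearly independent geometric variables, and among the many \<open>k\<close> with \<open>k p\<^sup>J\<close> in
  the required range some chain \<open>k, k p, \<dots>, k p\<^sup>L\<close> is heavy enough with overwhelming probability.\<close>

section \<open>Frobenius characters modulo a prime\<close>

text \<open>The characters are defined through Young symmetrizers, so Frobenius' formula has to be
  derived. If \<open>f\<close> is the Frobenius coefficient and \<open>X\<close> the sum of the
  symmetrizer coefficients over all conjugates of a permutation, then \<open>X\<close> is a scalar
  \<open>h\<close> times the Specht character, and the inner products of \<open>f\<close> and
  \<open>X\<close> make the norm of \<open>X - h f\<close> vanish. The analytic constants come from
  a narrow window. Put \<open>t = pi / sqrt (6 n)\<close> and \<open>t m = s ln n\<close>. The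
  expected number of hooks of length \<open>m\<close> is about \<open>m n^(-s)\<close> with
  \<open>m\<close> near \<open>sqrt n ln n\<close>, so cores need \<open>s > 1/2\<close>. But a
  single multiplicity of \<open>k\<close> reaches \<open>p^J\<close> only with probability
  \<open>n^(-s)\<close>, and at most about \<open>sqrt n ln n\<close> values of \<open>k\<close> are
  available, so this alone just fails. Spreading the weight over a chain of length proportional to
  \<open>ln n\<close> multiplies the probability by the number of ways to do so, which gains a power
  of \<open>n\<close>. As \<open>s - 1/2\<close> is then a fixed positive number,
  \<open>p(n)\<close> is needed only up to factors \<open>n^\<epsilon>\<close>.\<close>

type_synonym laurent = "(nat \<Rightarrow> int) \<Rightarrow>\<^sub>0 int"

definition axis_pt :: "nat \<Rightarrow> int \<Rightarrow> nat \<Rightarrow> int" where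
  "axis_pt i m = (\<lambda>j. if j = i then m else 0)"

definition power_sum :: "nat \<Rightarrow> nat \<Rightarrow> laurent" where
  "power_sum l m = (\<Sum>i<l. Poly_Mapping.single (axis_pt i (int m)) 1)"

definition power_sums :: "nat \<Rightarrow> nat multiset \<Rightarrow> laurent" where
  "power_sums l \<mu> = (\<Prod>m\<in>#\<mu>. power_sum l m)"

text \<open>Expanding the Vandermonde determinant turns the coefficient of
  \<open>x^(\<lambda> + \<rho>)\<close> in its product with \<open>F\<close> into a signed sum over
  \<open>w\<close>: as \<open>\<rho>\<close> has the entries \<open>l - 1 - i\<close>, the exponent
  left for \<open>F\<close> is \<open>\<lambda> i - i + w i\<close>. Hence \<open>\<gamma> i\<close>
  stands for \<open>\<lambda> i - i\<close>. Exponents are integers because these differences and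
  their later shifts can be negative.\<close>

definition alt_coeff :: "nat \<Rightarrow> (nat \<Rightarrow> int) \<Rightarrow> laurent \<Rightarrow> int" where
  "alt_coeff l \<gamma> F =
    (\<Sum>w | w permutes {..<l}. sign w * Poly_Mapping.lookup F (\<lambda>i. \<gamma> i + int (w i)))"

definition shape_exp :: "nat list \<Rightarrow> nat \<Rightarrow> int" where
  "shape_exp \<alpha> i = int (if i < length \<alpha> then \<alpha> ! i else 0) - int i"

text \<open>As many variables are taken as the size of the partition, which is at least its number
  of parts.\<close>

definition frob_char :: "nat list \<Rightarrow> nat multiset \<Rightarrow> int" where
  "frob_char \<alpha> \<mu> = alt_coeff (sum_list \<alpha>) (shape_exp \<alpha>) (power_sums (sum_list \<alpha>) \<mu>)"

lemma lookup_single_1_times: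
  fixes k :: "'a::ab_group_add" and F :: "'a \<Rightarrow>\<^sub>0 'b::semiring_1"
  shows "Poly_Mapping.lookup (Poly_Mapping.single k 1 * F) x = Poly_Mapping.lookup F (x - k)"
proof (induction F rule: update_induct)
  case const
  then show ?case by simp
next
  case (update f a b)
  have eq: "Poly_Mapping.update a b f = f + Poly_Mapping.single a b"
    using update(1) by (intro poly_mapping_eqI)
      (auto simp: Poly_Mapping.lookup_update Poly_Mapping.lookup_add Poly_Mapping.lookup_single when_def in_keys_iff)
  show ?case unfolding eq distrib_left Poly_Mapping.lookup_add update.IH mult_single
    by (auto simp: Poly_Mapping.lookup_single when_def)
qed

lemma lookup_power_sum_times:
  "Poly_Mapping.lookup (power_sum l m * F) \<gamma> = (\<Sum>i<l. Poly_Mapping.lookup F (\<gamma> - axis_pt i (int m)))"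
  by (simp add: power_sum_def sum_distrib_right Poly_Mapping.lookup_sum lookup_single_1_times)

lemma power_sums_add_mset [simp]: "power_sums l (add_mset m \<mu>) = power_sum l m * power_sums l \<mu>"
  by (simp add: power_sums_def)

lemma power_sums_union: "power_sums l (\<mu> + \<nu>) = power_sums l \<mu> * power_sums l \<nu>"
  by (simp add: power_sums_def)

lemma power_sums_empty [simp]: "power_sums l {#} = 1"
  by (simp add: power_sums_def)

lemma lookup_power_sums_neg:
  assumes "\<gamma> j < 0"
  shows "Poly_Mapping.lookup (power_sums l \<mu>) \<gamma> = 0"
  using assms
proof (induction \<mu> arbitrary: \<gamma>)
  case empty
  then have "\<gamma> \<noteq> 0" by auto
  then show ?case by (simp add: lookup_one)
next
  case (add m \<mu>)
  have "Poly_Mapping.lookup (power_sums l \<mu>) (\<gamma> - axis_pt i (int m)) = 0" for i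
    by (rule add.IH) (use add.prems in \<open>auto simp: axis_pt_def\<close>)
  then show ?case by (simp add: lookup_power_sum_times)
qed

lemma lookup_power_sums_permute:
  assumes "\<tau> permutes {..<l}"
  shows "Poly_Mapping.lookup (power_sums l \<mu>) (\<gamma> \<circ> \<tau>) = Poly_Mapping.lookup (power_sums l \<mu>) \<gamma>"
proof (induction \<mu> arbitrary: \<gamma>)
  case empty
  have "\<gamma> \<circ> \<tau> = 0 \<longleftrightarrow> \<gamma> = 0"
  proof
    assume "\<gamma> \<circ> \<tau> = 0"
    then have "\<gamma> (\<tau> (inv \<tau> i)) = 0" for i by (metis comp_apply zero_fun_apply)
    then show "\<gamma> = 0" using permutes_inverses[OF assms] by (simp add: fun_eq_iff)
  qed (auto simp: fun_eq_iff)
  then show ?case by (simp only: power_sums_empty lookup_one)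
next
  case (add m \<mu>)
  have *: "(\<gamma> \<circ> \<tau>) - axis_pt i (int m) = (\<gamma> - axis_pt (\<tau> i) (int m)) \<circ> \<tau>" for i
    using permutes_inj[OF assms] by (auto simp: fun_eq_iff axis_pt_def inj_def)
  have "Poly_Mapping.lookup (power_sums l (add_mset m \<mu>)) (\<gamma> \<circ> \<tau>)
    = (\<Sum>i<l. Poly_Mapping.lookup (power_sums l \<mu>) (\<gamma> - axis_pt (\<tau> i) (int m)))"
    by (simp only: power_sums_add_mset lookup_power_sum_times * add.IH)
  also have "\<dots> = (\<Sum>i<l. Poly_Mapping.lookup (power_sums l \<mu>) (\<gamma> - axis_pt i (int m)))"
    by (rule sum.reindex_bij_betw) (use permutes_imp_bij[OF assms] in simp)
  finally show ?case by (simp only: power_sums_add_mset lookup_power_sum_times)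
qed

text \<open>The Murnaghan-Nakayama rule before straightening: a factor \<open>power_sum l m\<close>
  lowers one entry of \<open>\<gamma>\<close> by \<open>m\<close>, that is, it moves one bead of the
  abacus by \<open>m\<close> places.\<close>

lemma lookup_alt_coeff_power_sum:
  "alt_coeff l \<gamma> (power_sum l m * F) = (\<Sum>i<l. alt_coeff l (\<gamma> - axis_pt i (int m)) F)"
proof -
  have "(\<lambda>j. \<gamma> j + int (w j)) - axis_pt i (int m) = (\<lambda>j. (\<gamma> - axis_pt i (int m)) j + int (w j))" for w i
    by (auto simp: fun_eq_iff)
  then show ?thesis
    unfolding alt_coeff_def lookup_power_sum_times sum_distrib_left
    by (subst sum.swap) simp
qed

text \<open>Antisymmetry in the exponents: the terms for \<open>w\<close> and for \<open>w\<close> composed with the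
  transposition of two positions with equal exponents cancel.\<close>

lemma alt_sum_eq_0:
  fixes \<gamma> :: "nat \<Rightarrow> int" and f :: "(nat \<Rightarrow> int) \<Rightarrow> int"
  assumes f: "\<And>\<tau> \<beta>. \<tau> permutes {..<l} \<Longrightarrow> f (\<beta> \<circ> \<tau>) = f \<beta>"
    and ij: "i < l" "j < l" "i \<noteq> j" "\<gamma> i = \<gamma> j"
  shows "(\<Sum>w | w permutes {..<l}. sign w * f (\<lambda>k. \<gamma> k + int (w k))) = 0"
proof -
  let ?t = "Transposition.transpose i j"
  let ?S = "\<Sum>w | w permutes {..<l}. sign w * f (\<lambda>k. \<gamma> k + int (w k))"
  have t: "?t permutes {..<l}" using ij by (simp add: permutes_swap_id)
  have "?S = (\<Sum>w | w permutes {..<l}. sign (w \<circ> ?t) * f (\<lambda>k. \<gamma> k + int ((w \<circ> ?t) k)))"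
    by (rule sum.reindex_bij_witness[of _ "\<lambda>w. w \<circ> ?t" "\<lambda>w. w \<circ> ?t"])
      (simp_all add: comp_assoc permutes_compose[OF t])
  also have "\<dots> = (\<Sum>w | w permutes {..<l}. - (sign w * f (\<lambda>k. \<gamma> k + int (w k))))"
  proof (rule sum.cong[OF refl], clarsimp)
    fix w assume w: "w permutes {..<l}"
    have "sign (w \<circ> ?t) = - sign w"
      using w t ij by (subst sign_compose) (auto simp: sign_swap_id permutation_permutes)
    moreover have "(\<lambda>k. \<gamma> k + int (w (?t k))) = (\<lambda>k. \<gamma> k + int (w k)) \<circ> ?t"
      using ij(4) by (auto simp: fun_eq_iff Transposition.transpose_def)
    ultimately show "sign (w \<circ> ?t) * f (\<lambda>k. \<gamma> k + int (w (?t k))) = - (sign w * f (\<lambda>k. \<gamma> k + int (w k)))"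
      using f[OF t] by simp
  qed
  finally show ?thesis by (simp add: sum_negf)
qed

lemma alt_coeff_eq_0_collision:
  assumes "i < l" "j < l" "i \<noteq> j" "\<gamma> i = \<gamma> j"
  shows "alt_coeff l \<gamma> (power_sums l \<mu>) = 0"
  unfolding alt_coeff_def
  by (rule alt_sum_eq_0[OF lookup_power_sums_permute assms])

text \<open>Every \<open>w i\<close> is at most \<open>l - 1\<close>, so all exponents read off at
  position \<open>i\<close> are negative, and power sums contain no such monomials.\<close>

lemma alt_coeff_eq_0_neg:
  assumes "i < l" "\<gamma> i + int l \<le> 0"
  shows "alt_coeff l \<gamma> (power_sums l \<mu>) = 0"
  unfolding alt_coeff_def
proof (intro sum.neutral ballI)
  fix w assume "w \<in> {w. w permutes {..<l}}"
  then have "w i < l" using assms(1) permutes_in_image[of w "{..<l}" i] by auto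
  then show "sign w * Poly_Mapping.lookup (power_sums l \<mu>) (\<lambda>i. \<gamma> i + int (w i)) = 0"
    using assms(2) by (subst lookup_power_sums_neg[of _ i]) auto
qed

text \<open>First-column hook lengths of the shape padded by zeros to \<open>l\<close> rows: row
  \<open>i\<close> contributes its length plus \<open>l - 1 - i\<close>. In these terms a hook of
  length \<open>m\<close> is an element \<open>x\<close> of size at least \<open>m\<close> with
  \<open>x - m\<close> missing.\<close>

definition beta_set :: "nat \<Rightarrow> nat list \<Rightarrow> int set" where
  "beta_set l \<alpha> = (\<lambda>i. shape_exp \<alpha> i + int l - 1) ` {..<l}"

text \<open>Each of the \<open>l\<close> bead moves produced by the factor
  \<open>power_sum l m\<close> either lands on another bead, so that two entries of the exponent
  coincide, or falls below zero. For a core there is no third case.\<close>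

lemma frob_char_eq_0:
  assumes "\<And>x. x \<in> beta_set (sum_list \<alpha>) \<alpha> \<Longrightarrow> int m \<le> x \<Longrightarrow> x - int m \<in> beta_set (sum_list \<alpha>) \<alpha>"
    and "m > 0"
  shows "frob_char \<alpha> (add_mset m \<mu>) = 0"
proof -
  define l where "l = sum_list \<alpha>"
  have "alt_coeff l (shape_exp \<alpha> - axis_pt i (int m)) (power_sums l \<mu>) = 0" if i: "i < l" for i
  proof (cases "int m \<le> shape_exp \<alpha> i + int l - 1")
    case True
    have "shape_exp \<alpha> i + int l - 1 \<in> beta_set l \<alpha>"
      using i by (auto simp: beta_set_def)
    then have "shape_exp \<alpha> i + int l - 1 - int m \<in> beta_set l \<alpha>"
      using assms(1) True unfolding l_def by blast
    then obtain j where j: "j < l" "shape_exp \<alpha> i - int m = shape_exp \<alpha> j"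
      by (auto simp: beta_set_def)
    then have "j \<noteq> i" using assms(2) by auto
    then show ?thesis using i j
      by (intro alt_coeff_eq_0_collision[of i l j]) (auto simp: axis_pt_def)
  next
    case False
    then show ?thesis using i by (intro alt_coeff_eq_0_neg[of i]) (auto simp: axis_pt_def)
  qed
  then show ?thesis
    by (simp add: frob_char_def lookup_alt_coeff_power_sum flip: l_def)
qed

section \<open>Frobenius congruences for power sums\<close>

lemma frobenius_dvd:
  fixes a b :: "'a::comm_ring_1"
  assumes "prime p"
  shows "of_nat p dvd ((a + b) ^ p - (a ^ p + b ^ p))"
proof -
  have p: "p > 0" using assms prime_gt_0_nat by blast
  have "(a + b) ^ p = (\<Sum>k\<le>p. of_nat (p choose k) * a ^ k * b ^ (p - k))"
    by (rule binomial_ring)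
  also have "\<dots> = (\<Sum>k\<in>{0,p}. of_nat (p choose k) * a ^ k * b ^ (p - k))
      + (\<Sum>k\<in>{..p}-{0,p}. of_nat (p choose k) * a ^ k * b ^ (p - k))"
    by (subst sum.subset_diff[of "{0,p}" "{..p}"]) (auto simp: add.commute)
  also have "(\<Sum>k\<in>{0,p}. of_nat (p choose k) * a ^ k * b ^ (p - k)) = a ^ p + b ^ p"
    using p by simp
  finally have "(a + b) ^ p - (a ^ p + b ^ p)
     = (\<Sum>k\<in>{..p}-{0,p}. of_nat (p choose k) * a ^ k * b ^ (p - k))" by simp
  also have "of_nat p dvd \<dots>"
  proof (rule dvd_sum)
    fix k assume "k \<in> {..p} - {0,p}"
    then have "p dvd (p choose k)" using assms by (intro dvd_choose_prime) auto
    then show "of_nat p dvd of_nat (p choose k) * a ^ k * b ^ (p - k)"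
      by (elim dvdE) (simp add: mult.assoc)
  qed
  finally show ?thesis .
qed

lemma frobenius_sum_dvd:
  fixes f :: "'b \<Rightarrow> 'a::comm_ring_1"
  assumes "prime p" "finite A"
  shows "of_nat p dvd ((\<Sum>x\<in>A. f x) ^ p - (\<Sum>x\<in>A. f x ^ p))"
  using assms(2)
proof (induction A rule: finite_induct)
  case empty
  then show ?case using assms(1) prime_gt_0_nat by (auto simp: zero_power)
next
  case (insert x A)
  have "of_nat p dvd ((f x + sum f A) ^ p - (f x ^ p + sum f A ^ p))
        + (sum f A ^ p - (\<Sum>x\<in>A. f x ^ p))"
    by (intro dvd_add frobenius_dvd insert.IH assms(1))
  then show ?case using insert by (simp add: algebra_simps)
qed

lemma dvd_diff_power:
  fixes a b :: "'a::comm_ring_1"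
  assumes "c dvd a - b"
  shows "c dvd a ^ n - b ^ n"
proof (induction n)
  case (Suc n)
  have "a ^ Suc n - b ^ Suc n = (a - b) * a ^ n + b * (a ^ n - b ^ n)"
    by (simp add: algebra_simps)
  then show ?case using assms Suc by (metis dvd_add dvd_mult dvd_mult2)
qed simp

lemma single_power:
  "Poly_Mapping.single (axis_pt i (int m)) (1::int) ^ n = Poly_Mapping.single (axis_pt i (int (n * m))) 1"
proof (induction n)
  case 0
  have "axis_pt i 0 = 0" by (auto simp: axis_pt_def)
  then show ?case by (simp add: zero_fun_def flip: single_one)
next
  case (Suc n)
  have "axis_pt i (int m) + axis_pt i (int (n * m)) = axis_pt i (int (Suc n * m))"
    by (auto simp: axis_pt_def fun_eq_iff)
  then show ?case using Suc by (simp only: power_Suc mult_single) simp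
qed

text \<open>The \<open>p\<close>-th power of a monomial multiplies its exponent by \<open>p\<close>.
  Coefficients stay integral and congruence is expressed as divisibility by \<open>of_nat p\<close>
  in the ring, which \<open>alt_coeff_cong_dvd\<close> later turns into divisibility of
  integers.\<close>

lemma power_sum_frobenius:
  assumes "prime p"
  shows "of_nat p dvd (power_sum l m ^ p - power_sum l (p * m))"
  using frobenius_sum_dvd[OF assms, of "{..<l}" "\<lambda>i. Poly_Mapping.single (axis_pt i (int m)) (1::int)"]
  by (simp add: power_sum_def single_power)

lemma power_sum_frobenius_iter:
  assumes "prime p"
  shows "of_nat p dvd (power_sum l m ^ (p ^ j) - power_sum l (p ^ j * m))"
proof (induction j)
  case (Suc j)
  have "of_nat p dvd ((power_sum l m ^ (p ^ j)) ^ p - power_sum l (p ^ j * m) ^ p)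
    + (power_sum l (p ^ j * m) ^ p - power_sum l (p * (p ^ j * m)))"
    by (intro dvd_add dvd_diff_power Suc.IH power_sum_frobenius assms)
  then show ?case by (simp add: power_mult[symmetric] mult_ac)
qed simp

lemma alt_coeff_cong_dvd:
  assumes "of_nat p dvd F - G"
  shows "int p dvd alt_coeff l \<gamma> F - alt_coeff l \<gamma> G"
proof -
  obtain H where H: "F - G = of_nat p * H" using assms by (elim dvdE)
  have lk: "Poly_Mapping.lookup F x - Poly_Mapping.lookup G x = int p * Poly_Mapping.lookup H x" for x
  proof -
    have "Poly_Mapping.lookup F x - Poly_Mapping.lookup G x = Poly_Mapping.lookup (of_nat p * H) x"
      by (simp add: Poly_Mapping.lookup_minus flip: H)
    also have "\<dots> = int p * Poly_Mapping.lookup H x"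
      by (induction p) (simp_all add: algebra_simps Poly_Mapping.lookup_add)
    finally show ?thesis .
  qed
  then have lk': "Poly_Mapping.lookup F x = Poly_Mapping.lookup G x + int p * Poly_Mapping.lookup H x" for x
    by (metis add.commute diff_add_cancel)
  have "alt_coeff l \<gamma> F - alt_coeff l \<gamma> G = int p * alt_coeff l \<gamma> H"
    unfolding alt_coeff_def sum_subtractf[symmetric] sum_distrib_left
    by (intro sum.cong refl) (simp add: lk' algebra_simps)
  then show ?thesis by simp
qed

text \<open>Modulo \<open>p\<close>, parts \<open>k p\<^sup>i\<close> may be broken up into \<open>p\<^sup>i\<close> parts \<open>k\<close> and reassembled;
  this produces a part \<open>k p\<^sup>J\<close> as soon as the chain of \<open>k\<close> is heavy enough.\<close>

lemma frob_char_dvd: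
  assumes p: "prime p" and k: "k > 0"
    and heavy: "p ^ J \<le> (\<Sum>i\<le>L. count \<mu> (p ^ i * k) * p ^ i)"
    and core: "\<And>x. x \<in> beta_set (sum_list \<alpha>) \<alpha> \<Longrightarrow> int (p ^ J * k) \<le> x
        \<Longrightarrow> x - int (p ^ J * k) \<in> beta_set (sum_list \<alpha>) \<alpha>"
  shows "int p dvd frob_char \<alpha> \<mu>"
proof -
  define l where "l = sum_list \<alpha>"
  define P where "P = power_sum l"
  have p1: "p > 1" using p prime_gt_1_nat by blast
  \<comment> \<open>\<open>C\<close> holds every part in the chain of \<open>k\<close> with its full
    multiplicity; \<open>D\<close> below is the rest of \<open>\<mu>\<close>.\<close>
  define C where "C = (\<Sum>i\<le>L. replicate_mset (count \<mu> (p ^ i * k)) (p ^ i * k))"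
  have "count C x \<le> count \<mu> x" for x
  proof (cases "\<exists>i\<le>L. x = p ^ i * k")
    case True
    then obtain i where i: "i \<le> L" "x = p ^ i * k" by blast
    have "count C x = (\<Sum>j\<in>{..L}. if j = i then count \<mu> x else 0)"
      unfolding C_def count_sum using i p1 k
      by (intro sum.cong refl) auto
    then show ?thesis using i(1) by simp
  next
    case False
    then have "count C x = 0" unfolding C_def count_sum by auto
    then show ?thesis by simp
  qed
  then have "C \<subseteq># \<mu>" by (simp add: mset_subset_eqI)
  then obtain D where D: "\<mu> = C + D" by (metis subset_mset.add_diff_inverse)
  have ps: "power_sums l (\<Sum>i\<in>I. replicate_mset (c i) (p ^ i * k)) = (\<Prod>i\<in>I. P (p ^ i * k) ^ c i)"
    if "finite I" for I c
    using that
    by (induction I rule: finite_induct) (simp_all add: power_sums_union power_sums_def P_def)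
  define N where "N = (\<Sum>i\<le>L. count \<mu> (p ^ i * k) * p ^ i)"
  have step: "of_nat p dvd ((\<Prod>i\<in>I. P (p ^ i * k) ^ c i) - P k ^ (\<Sum>i\<in>I. c i * p ^ i))"
    if "finite I" for I c
    using that
  proof (induction I rule: finite_induct)
    case (insert i I)
    have 1: "of_nat p dvd (P k ^ (p ^ i)) ^ c i - P (p ^ i * k) ^ c i"
      unfolding P_def by (intro dvd_diff_power power_sum_frobenius_iter p)
    have "of_nat p dvd P (p ^ i * k) ^ c i * ((\<Prod>i\<in>I. P (p ^ i * k) ^ c i) - P k ^ (\<Sum>i\<in>I. c i * p ^ i))
      - ((P k ^ (p ^ i)) ^ c i - P (p ^ i * k) ^ c i) * P k ^ (\<Sum>i\<in>I. c i * p ^ i)"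
      by (intro dvd_diff dvd_mult insert.IH dvd_mult2 1)
    then show ?case using insert
      by (simp add: algebra_simps power_add power_mult[symmetric])
  qed simp
  \<comment> \<open>Two congruences are added: the whole chain becomes \<open>P k ^ N\<close>, and
    then \<open>p ^ J\<close> of these \<open>N\<close> factors merge into
    \<open>P (p ^ J * k)\<close>. Heaviness says \<open>p ^ J \<le> N\<close>, so the truncated
    difference \<open>N - p ^ J\<close> is a true one.\<close>
  have "of_nat p dvd ((\<Prod>i\<le>L. P (p ^ i * k) ^ count \<mu> (p ^ i * k)) - P k ^ N)
      * power_sums l D + P k ^ (N - p ^ J) * (P k ^ (p ^ J) - P (p ^ J * k)) * power_sums l D"
    unfolding N_def
    by (intro dvd_add dvd_mult dvd_mult2 step finite_atMost)
      (auto simp: P_def intro!: power_sum_frobenius_iter p)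
  moreover have "P k ^ N = P k ^ (N - p ^ J) * P k ^ (p ^ J)"
    using heavy unfolding N_def by (simp flip: power_add)
  ultimately have "of_nat p dvd (\<Prod>i\<le>L. P (p ^ i * k) ^ count \<mu> (p ^ i * k)) * power_sums l D
    - P k ^ (N - p ^ J) * P (p ^ J * k) * power_sums l D"
    by (simp add: algebra_simps)
  also have "(\<Prod>i\<le>L. P (p ^ i * k) ^ count \<mu> (p ^ i * k)) * power_sums l D = power_sums l \<mu>"
    by (subst D) (simp add: power_sums_union C_def ps)
  also have "P k ^ (N - p ^ J) * P (p ^ J * k) * power_sums l D
     = power_sums l (add_mset (p ^ J * k) (replicate_mset (N - p ^ J) k + D))"
    by (simp add: P_def power_sums_union power_sums_def mult_ac)
  finally have "int p dvd frob_char \<alpha> \<mu> - frob_char \<alpha> (add_mset (p ^ J * k) (replicate_mset (N - p ^ J) k + D))"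
    unfolding frob_char_def l_def by (rule alt_coeff_cong_dvd)
  also have "frob_char \<alpha> (add_mset (p ^ J * k) (replicate_mset (N - p ^ J) k + D)) = 0"
    by (rule frob_char_eq_0) (use core p1 k in auto)
  finally show ?thesis by simp
qed

section \<open>Orthogonality of the Frobenius characters\<close>

definition content :: "'a set \<Rightarrow> ('a \<Rightarrow> nat) \<Rightarrow> nat \<Rightarrow> int" where
  "content S f i = int (card {k\<in>S. f k = i})"

text \<open>\<open>PiE\<close> fixes the values outside \<open>S\<close>, so that a colouring is a
  single function and cardinalities make sense.\<close>

definition colourings :: "nat \<Rightarrow> 'a set \<Rightarrow> (nat \<Rightarrow> int) \<Rightarrow> ('a \<Rightarrow> nat) set" where
  "colourings l S \<alpha> = {f \<in> S \<rightarrow>\<^sub>E {..<l}. content S f = \<alpha>}"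

definition fixed_colourings :: "nat \<Rightarrow> nat \<Rightarrow> (nat \<Rightarrow> int) \<Rightarrow> (nat \<Rightarrow> nat) \<Rightarrow> (nat \<Rightarrow> nat) set" where
  "fixed_colourings l n \<alpha> \<pi> = {f \<in> colourings l {..<n} \<alpha>. \<forall>k<n. f (\<pi> k) = f k}"

lemma finite_colourings: "finite S \<Longrightarrow> finite (colourings l S \<alpha>)"
  unfolding colourings_def by (rule finite_subset[of _ "S \<rightarrow>\<^sub>E {..<l}"]) (auto intro: finite_PiE)

lemma content_empty: "content {} f = 0"
  by (simp add: content_def fun_eq_iff)

text \<open>Choosing the colour \<open>i\<close> of one block \<open>B\<close> adds
  \<open>card B\<close> to the \<open>i\<close>-th entry of the content, which is exactly the shift
  made by a factor \<open>power_sum l (card B)\<close>. Induction over the blocks matches colourings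
  with monomials.\<close>

lemma card_block_colourings:
  fixes \<O> :: "'a set set"
  assumes "finite \<O>" "disjoint \<O>" "\<And>B. B \<in> \<O> \<Longrightarrow> finite B \<and> B \<noteq> {}"
  shows "int (card {f \<in> colourings l (\<Union>\<O>) \<alpha>. \<forall>B\<in>\<O>. \<forall>x\<in>B. \<forall>y\<in>B. f x = f y})
    = Poly_Mapping.lookup (power_sums l (image_mset card (mset_set \<O>))) \<alpha>"
  using assms
proof (induction \<O> arbitrary: \<alpha> rule: finite_induct)
  case empty
  have "{f \<in> colourings l (\<Union>{}) \<alpha>. \<forall>B\<in>{}. \<forall>x\<in>B. \<forall>y\<in>B. f x = f y}
      = (if \<alpha> = 0 then {\<lambda>_::'a. undefined} else {})"
    by (auto simp: colourings_def content_empty)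
  then show ?case by (simp only: lookup_one mset_set.empty image_mset_empty power_sums_empty) (simp only: when_def card.insert card.empty if_split, simp)
next
  case (insert B \<O>)
  let ?C = "\<lambda>\<O> \<alpha>. {f \<in> colourings l (\<Union>\<O>) \<alpha>. \<forall>B\<in>\<O>. \<forall>x\<in>B. \<forall>y\<in>B. f x = f y}"
  have B: "finite B" "B \<noteq> {}" using insert.prems by auto
  have disj: "B \<inter> \<Union>\<O> = {}"
    using insert.prems(1) insert.hyps(2) by (force simp: disjoint_def)
  have fin: "finite (\<Union>\<O>)" using insert by auto
  obtain b where b: "b \<in> B" using B by blast
  define ext where "ext = (\<lambda>i f x. if x \<in> B then i else f x :: nat)"
  have cont: "content (\<Union>(insert B \<O>)) f = content (\<Union>\<O>) f + axis_pt i (int (card B))"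
    if "\<And>x. x \<in> B \<Longrightarrow> f x = i" for f i
  proof
    fix j
    have "{k \<in> \<Union>(insert B \<O>). f k = j} = {k\<in>\<Union>\<O>. f k = j} \<union> (if j = i then B else {})"
      using that by auto
    moreover have "card ({k\<in>\<Union>\<O>. f k = j} \<union> (if j = i then B else {}))
        = card {k\<in>\<Union>\<O>. f k = j} + card (if j = i then B else {})"
      by (rule card_Un_disjoint) (use finite_subset[OF _ fin, of "{k\<in>\<Union>\<O>. f k = j}"] B disj in auto)
    ultimately show "content (\<Union>(insert B \<O>)) f j = (content (\<Union>\<O>) f + axis_pt i (int (card B))) j"
      by (auto simp: content_def axis_pt_def)
  qed
  have content_ext: "content (\<Union>\<O>) (ext i f) = content (\<Union>\<O>) f" for i f
  proof -
    have "{k\<in>\<Union>\<O>. ext i f k = j} = {k\<in>\<Union>\<O>. f k = j}" for j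
      using disj by (auto simp: ext_def)
    then show ?thesis by (simp add: content_def fun_eq_iff)
  qed
  have eq: "?C (insert B \<O>) \<alpha> = (\<Union>i<l. ext i ` ?C \<O> (\<alpha> - axis_pt i (int (card B))))" (is "?L = ?R")
  proof (intro equalityI subsetI)
    fix f assume f: "f \<in> ?L"
    define i where "i = f b"
    have const: "\<forall>x\<in>B. \<forall>y\<in>B. f x = f y" "\<forall>B\<in>\<O>. \<forall>x\<in>B. \<forall>y\<in>B. f x = f y"
      and fP: "f \<in> \<Union>(insert B \<O>) \<rightarrow>\<^sub>E {..<l}" and fc: "content (\<Union>(insert B \<O>)) f = \<alpha>"
      using f unfolding colourings_def mem_Collect_eq ball_simps by blast+
    have fB: "f x = i" if "x \<in> B" for x using const(1) that b unfolding i_def by blast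
    have i: "i < l" using fP b unfolding i_def by (simp add: PiE_iff)
    define g where "g = restrict f (\<Union>\<O>)"
    have fg: "f = ext i g"
    proof
      fix x show "f x = ext i g x"
        using fP fB by (simp add: ext_def g_def PiE_iff extensional_def)
    qed
    have "content (\<Union>\<O>) g = content (\<Union>\<O>) f" unfolding fg content_ext ..
    also have "\<dots> = \<alpha> - axis_pt i (int (card B))"
      using cont[OF fB] fc by (simp only: eq_diff_eq)
    finally have gc: "content (\<Union>\<O>) g = \<alpha> - axis_pt i (int (card B))" .
    have gP: "g \<in> \<Union>\<O> \<rightarrow>\<^sub>E {..<l}" using fP unfolding g_def by (simp add: PiE_iff)
    have geq: "g x = f x" if "x \<in> B'" "B' \<in> \<O>" for x B'
      unfolding g_def by (rule restrict_apply') (use that in blast)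
    have "\<forall>B\<in>\<O>. \<forall>x\<in>B. \<forall>y\<in>B. g x = g y"
    proof (intro ballI)
      fix B' x y assume "B' \<in> \<O>" "x \<in> B'" "y \<in> B'"
      then show "g x = g y" using const(2) geq by metis
    qed
    then have "g \<in> ?C \<O> (\<alpha> - axis_pt i (int (card B)))"
      using gc gP unfolding colourings_def by blast
    then have "f \<in> ext i ` ?C \<O> (\<alpha> - axis_pt i (int (card B)))" unfolding fg by (rule imageI)
    then show "f \<in> ?R" using i by (intro UN_I) simp_all
  next
    fix f assume "f \<in> ?R"
    then obtain i g where i: "i < l" and g: "g \<in> ?C \<O> (\<alpha> - axis_pt i (int (card B)))" and f: "f = ext i g"
      by (elim UN_E imageE) (simp only: lessThan_iff)
    have gP: "g \<in> \<Union>\<O> \<rightarrow>\<^sub>E {..<l}" and gconst: "\<forall>B\<in>\<O>. \<forall>x\<in>B. \<forall>y\<in>B. g x = g y"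
      and gc: "content (\<Union>\<O>) g = \<alpha> - axis_pt i (int (card B))"
      using g unfolding colourings_def by blast+
    have "content (\<Union>(insert B \<O>)) f = content (\<Union>\<O>) f + axis_pt i (int (card B))"
      by (rule cont) (simp add: f ext_def)
    also have "\<dots> = \<alpha>" unfolding f content_ext gc by (simp only: diff_add_cancel)
    finally have 1: "content (\<Union>(insert B \<O>)) f = \<alpha>" .
    have 2: "f \<in> \<Union>(insert B \<O>) \<rightarrow>\<^sub>E {..<l}"
      using gP i unfolding f by (auto simp: ext_def PiE_iff extensional_def)
    have 3: "\<forall>x\<in>B'. \<forall>y\<in>B'. f x = f y" if B': "B' \<in> insert B \<O>" for B'
    proof (cases "B' = B")
      case False
      then have "B' \<in> \<O>" using B' by blast
      moreover from this have "B \<inter> B' = {}" using disj by blast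
      ultimately show ?thesis using gconst unfolding f ext_def by (metis disjoint_iff)
    qed (simp add: f ext_def)
    show "f \<in> ?L" using 1 2 3 unfolding colourings_def by blast
  qed
  have inj: "inj_on (ext i) (?C \<O> \<beta>)" for i \<beta>
  proof (rule inj_onI)
    fix f g assume fg: "f \<in> ?C \<O> \<beta>" "g \<in> ?C \<O> \<beta>" "ext i f = ext i g"
    then have P: "f \<in> \<Union>\<O> \<rightarrow>\<^sub>E {..<l}" "g \<in> \<Union>\<O> \<rightarrow>\<^sub>E {..<l}"
      unfolding colourings_def by blast+
    show "f = g"
    proof (rule PiE_ext[OF P])
      fix x assume "x \<in> \<Union>\<O>"
      then have "x \<notin> B" using disj by blast
      then show "f x = g x" using fun_cong[OF fg(3), of x] by (simp add: ext_def)
    qed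
  qed
  have finC: "finite (?C \<O> \<beta>)" for \<beta>
    by (rule finite_subset[OF _ finite_colourings[OF fin]]) blast
  have "card (?C (insert B \<O>) \<alpha>) = (\<Sum>i<l. card (ext i ` ?C \<O> (\<alpha> - axis_pt i (int (card B)))))"
    unfolding eq
  proof (rule card_UN_disjoint)
    have eqij: "i = j" if f: "f \<in> range (ext i)" "f \<in> range (ext j)" for i j f
    proof -
      have "ext k g b = k" for k g using b by (simp add: ext_def)
      moreover obtain g h where "f = ext i g" "f = ext j h" using f by blast
      ultimately have "f b = i" "f b = j" by metis+
      then show ?thesis by simp
    qed
    show "\<forall>i\<in>{..<l}. \<forall>j\<in>{..<l}. i \<noteq> j \<longrightarrow> ext i ` ?C \<O> (\<alpha> - axis_pt i (int (card B)))
        \<inter> ext j ` ?C \<O> (\<alpha> - axis_pt j (int (card B))) = {}"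
    proof (intro ballI impI equals0I)
      fix i j f
      assume "i \<noteq> j" "f \<in> ext i ` ?C \<O> (\<alpha> - axis_pt i (int (card B)))
        \<inter> ext j ` ?C \<O> (\<alpha> - axis_pt j (int (card B)))"
      then have "f \<in> range (ext i)" "f \<in> range (ext j)"
        using image_mono[OF subset_UNIV] by (meson IntD1 IntD2 subsetD)+
      then show False using eqij \<open>i \<noteq> j\<close> by blast
    qed
  qed (rule finite_lessThan, intro ballI finite_imageI finC)
  also have "\<dots> = (\<Sum>i<l. card (?C \<O> (\<alpha> - axis_pt i (int (card B)))))"
    by (simp only: card_image[OF inj])
  finally have "int (card (?C (insert B \<O>) \<alpha>))
      = (\<Sum>i<l. int (card (?C \<O> (\<alpha> - axis_pt i (int (card B))))))"
    by (simp only: of_nat_sum)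
  also have "\<dots> = (\<Sum>i<l. Poly_Mapping.lookup (power_sums l (image_mset card (mset_set \<O>))) (\<alpha> - axis_pt i (int (card B))))"
    using insert.prems by (intro sum.cong refl insert.IH) (auto simp: disjoint_def)
  also have "\<dots> = Poly_Mapping.lookup (power_sums l (image_mset card (mset_set (insert B \<O>)))) \<alpha>"
    using insert.hyps by (simp flip: lookup_power_sum_times)
  finally show ?case .
qed

text \<open>A colouring is fixed by \<open>\<pi>\<close> iff it is constant on orbits, so the orbits
  serve as the blocks. Coefficients of power sums thereby become permutation characters of the
  symmetric group on words of given content.\<close>

lemma card_fixed_colourings:
  assumes "\<pi> \<in> sym_grp n"
  shows "int (card (fixed_colourings l n \<alpha> \<pi>)) = Poly_Mapping.lookup (power_sums l (cycle_type n \<pi>)) \<alpha>"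
proof -
  have \<pi>: "\<pi> permutes {..<n}" using assms by (simp add: sym_grp_def)
  have perm: "permutation \<pi>" using \<pi> by (auto intro: permutation_permutes[THEN iffD2])
  have self: "x \<in> orbit \<pi> x" for x by (rule permutation_self_in_orbit[OF perm])
  have sub: "orbit \<pi> x \<subseteq> {..<n}" if "x < n" for x
    by (rule permutes_orbit_subset[OF \<pi>]) (use that in simp)
  define \<O> where "\<O> = orbit \<pi> ` {..<n}"
  have U: "\<Union>\<O> = {..<n}" using self sub by (fastforce simp: \<O>_def)
  have eqI: "orbit \<pi> x = orbit \<pi> y" if "x \<in> orbit \<pi> y" for x y
    by (rule orbit_cyclic_eq3[OF cyclic_on_orbit'[OF perm] that])
  have disj: "disjoint \<O>"
    unfolding disjoint_def
  proof (intro ballI impI)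
    fix A B assume "A \<in> \<O>" "B \<in> \<O>" "A \<noteq> B"
    then obtain x y where "A = orbit \<pi> x" "B = orbit \<pi> y" by (auto simp: \<O>_def)
    then show "A \<inter> B = {}" using eqI \<open>A \<noteq> B\<close> by (metis disjoint_iff)
  qed
  have fix_iff: "(\<forall>k<n. f (\<pi> k) = f k) \<longleftrightarrow> (\<forall>B\<in>\<O>. \<forall>x\<in>B. \<forall>y\<in>B. f x = f y)" for f :: "nat \<Rightarrow> nat"
  proof
    assume f: "\<forall>k<n. f (\<pi> k) = f k"
    have "f y = f x" if "x < n" "y \<in> orbit \<pi> x" for x y
      using that(2)
    proof (induction rule: orbit.induct)
      case base then show ?case using f that by simp
    next
      case (step y)
      then have "y < n" using sub[OF that(1)] by auto
      then show ?case using f step by simp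
    qed
    then show "\<forall>B\<in>\<O>. \<forall>x\<in>B. \<forall>y\<in>B. f x = f y" by (auto simp: \<O>_def)
  next
    assume f: "\<forall>B\<in>\<O>. \<forall>x\<in>B. \<forall>y\<in>B. f x = f y"
    show "\<forall>k<n. f (\<pi> k) = f k"
    proof (intro allI impI)
      fix k assume k: "k < n"
      have "orbit \<pi> k \<in> \<O>" using k by (auto simp: \<O>_def)
      then show "f (\<pi> k) = f k" using f self[of k] orbit.base[of \<pi> k] by blast
    qed
  qed
  have "int (card {f \<in> colourings l (\<Union>\<O>) \<alpha>. \<forall>B\<in>\<O>. \<forall>x\<in>B. \<forall>y\<in>B. f x = f y})
    = Poly_Mapping.lookup (power_sums l (image_mset card (mset_set \<O>))) \<alpha>"
    by (rule card_block_colourings[OF _ disj])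
      (use self sub in \<open>auto simp: \<O>_def intro: finite_subset[OF sub]\<close>)
  then show ?thesis
    unfolding fixed_colourings_def fix_iff U cycle_type_def \<O>_def[symmetric] .
qed

lemma finite_sym_grp: "finite (sym_grp n)"
  by (simp add: sym_grp_def finite_permutations)

lemma card_sym_grp: "card (sym_grp n) = fact n"
  by (simp add: sym_grp_def card_permutations)

lemma sym_grp_comp: "\<sigma> \<in> sym_grp n \<Longrightarrow> \<tau> \<in> sym_grp n \<Longrightarrow> \<sigma> \<circ> \<tau> \<in> sym_grp n"
  by (simp add: sym_grp_def permutes_compose)

lemma sym_grp_inv: "\<sigma> \<in> sym_grp n \<Longrightarrow> inv \<sigma> \<in> sym_grp n"
  by (simp add: sym_grp_def permutes_inv)

lemma sym_grp_id: "id \<in> sym_grp n"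
  by (simp add: sym_grp_def permutes_id)

lemma sym_grp_lt: "\<sigma> \<in> sym_grp n \<Longrightarrow> \<sigma> k < n \<longleftrightarrow> k < n"
  unfolding sym_grp_def using permutes_in_image[of \<sigma> "{..<n}" k] by auto

lemma sym_grp_inv_o [simp]:
  assumes "\<sigma> \<in> sym_grp n"
  shows "inv \<sigma> \<circ> \<sigma> = id" "\<sigma> \<circ> inv \<sigma> = id" "inv \<sigma> (\<sigma> x) = x" "\<sigma> (inv \<sigma> x) = x" "inv (inv \<sigma>) = \<sigma>"
  using assms permutes_inv_o[of \<sigma> "{..<n}"] permutes_inverses[of \<sigma> "{..<n}"] permutes_inv_inv[of \<sigma> "{..<n}"]
  by (auto simp: sym_grp_def)

lemma sym_grp_inv_comp:
  "\<sigma> \<in> sym_grp n \<Longrightarrow> \<tau> \<in> sym_grp n \<Longrightarrow> inv (\<sigma> \<circ> \<tau>) = inv \<tau> \<circ> inv \<sigma>"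
  unfolding sym_grp_def using permutes_bij by (intro o_inv_distrib) blast+

lemma sum_sym_grp_left:
  assumes "\<sigma> \<in> sym_grp n"
  shows "(\<Sum>\<tau>\<in>sym_grp n. f (\<sigma> \<circ> \<tau>)) = (\<Sum>\<tau>\<in>sym_grp n. f \<tau>)"
  by (rule sum.reindex_bij_witness[of _ "\<lambda>\<tau>. inv \<sigma> \<circ> \<tau>" "\<lambda>\<tau>. \<sigma> \<circ> \<tau>"])
    (use assms in \<open>auto simp: sym_grp_comp sym_grp_inv o_assoc\<close>)

lemma sum_sym_grp_right:
  assumes "\<sigma> \<in> sym_grp n"
  shows "(\<Sum>\<tau>\<in>sym_grp n. f (\<tau> \<circ> \<sigma>)) = (\<Sum>\<tau>\<in>sym_grp n. f \<tau>)"
  by (rule sum.reindex_bij_witness[of _ "\<lambda>\<tau>. \<tau> \<circ> inv \<sigma>" "\<lambda>\<tau>. \<tau> \<circ> \<sigma>"])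
    (use assms in \<open>auto simp: sym_grp_comp sym_grp_inv comp_assoc\<close>)

lemma sum_sym_grp_inv: "(\<Sum>\<tau>\<in>sym_grp n. f (inv \<tau>)) = (\<Sum>\<tau>\<in>sym_grp n. f \<tau>)"
  by (rule sum.reindex_bij_witness[of _ inv inv]) (auto simp: sym_grp_inv)

text \<open>The fibres of \<open>\<sigma> \<mapsto> F\<^sub>0 \<circ> \<sigma>\<close> are cosets of the stabilisers.\<close>

lemma burnside_fibre_sizes:
  fixes A :: "'c \<Rightarrow> nat"
  assumes "finite Q" and sumA: "(\<Sum>c\<in>Q. A c) = n"
  shows "(\<Sum>\<pi>\<in>sym_grp n. card {F \<in> {..<n} \<rightarrow>\<^sub>E Q. (\<forall>c\<in>Q. card {k\<in>{..<n}. F k = c} = A c)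
     \<and> (\<forall>k<n. F (\<pi> k) = F k)}) = fact n"
proof -
  let ?G = "sym_grp n"
  define \<F> where "\<F> = {F \<in> {..<n} \<rightarrow>\<^sub>E Q. \<forall>c\<in>Q. card {k\<in>{..<n}. F k = c} = A c}"
  have fin\<F>: "finite \<F>"
    unfolding \<F>_def by (rule finite_subset[of _ "{..<n} \<rightarrow>\<^sub>E Q"]) (auto intro: finite_PiE assms)
  define act where "act F \<pi> = (\<lambda>k. if k < n then F (\<pi> k) else undefined)" for F :: "nat \<Rightarrow> 'c" and \<pi> :: "nat \<Rightarrow> nat"
  have act_mem: "act F \<pi> \<in> \<F>" if F: "F \<in> \<F>" and \<pi>: "\<pi> \<in> ?G" for F \<pi>
  proof -
    have "card {k\<in>{..<n}. act F \<pi> k = c} = card {k\<in>{..<n}. F k = c}" for c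
      by (rule bij_betw_same_card[of \<pi>], rule bij_betw_byWitness[of _ "inv \<pi>"])
        (use \<pi> in \<open>auto simp: act_def sym_grp_lt sym_grp_inv sym_grp_inv[THEN sym_grp_lt]\<close>)
    then show ?thesis using F \<pi> by (auto simp: \<F>_def act_def PiE_iff extensional_def sym_grp_lt)
  qed
  \<comment> \<open>A word with the prescribed content; \<open>F0\<close> reads it as a function and
    is the base point of the transitive action on \<open>\<F>\<close>.\<close>
  obtain xs where xs: "mset xs = (\<Sum>c\<in>Q. replicate_mset (A c) c)"
    using ex_mset by blast
  have "size (\<Sum>c\<in>S. replicate_mset (A c) c) = (\<Sum>c\<in>S. A c)" if "finite S" for S
    using that by (induction S rule: finite_induct) auto
  from this[OF assms(1)] have "size (mset xs) = n" by (simp only: xs sumA)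
  then have len: "length xs = n" by simp
  have cnt: "count (\<Sum>c\<in>Q. replicate_mset (A c) c) c = (if c \<in> Q then A c else 0)" for c
    using assms(1) by (simp add: count_sum)
  define F0 where "F0 = (\<lambda>k. if k < n then xs ! k else undefined)"
  have setxs: "set xs \<subseteq> Q" using xs cnt
    by (metis count_mset count_list_0_iff subsetI)
  have cF0: "card {k\<in>{..<n}. F0 k = c} = A c" if "c \<in> Q" for c
  proof -
    have "{k\<in>{..<n}. F0 k = c} = {k. k < length xs \<and> xs ! k = c}" by (auto simp: F0_def len)
    then have "card {k\<in>{..<n}. F0 k = c} = count (mset xs) c"
      by (simp add: count_mset count_list_eq_length_filter length_filter_conv_card eq_commute)
    then show ?thesis using xs cnt that by simp
  qed
  have F0: "F0 \<in> \<F>" using cF0 setxs unfolding \<F>_def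
    by (auto simp: PiE_iff extensional_def F0_def len subset_iff)
  have trans: "\<exists>\<pi>\<in>?G. act F0 \<pi> = F" if F: "F \<in> \<F>" for F
  proof -
    have "image_mset F (mset_set {..<n}) = image_mset F0 (mset_set {..<n})"
    proof (rule multiset_eqI)
      fix c
      have "count (image_mset G (mset_set {..<n})) c = (if c \<in> Q then A c else 0)" if "G \<in> \<F>" for G
      proof -
        have "count (image_mset G (mset_set {..<n})) c = card {k\<in>{..<n}. G k = c}"
          by (simp add: count_image_mset' sum.If_cases Int_def conj_commute
            flip: sum.inter_filter) (rule arg_cong[where f = card], auto)
        moreover have "c \<notin> Q \<Longrightarrow> {k\<in>{..<n}. G k = c} = {}" using \<open>G \<in> \<F>\<close> by (auto simp: \<F>_def)
        ultimately show ?thesis using \<open>G \<in> \<F>\<close> by (auto simp: \<F>_def)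
      qed
      then show "count (image_mset F (mset_set {..<n})) c = count (image_mset F0 (mset_set {..<n})) c"
        using F F0 by simp
    qed
    then obtain p where "p permutes {..<n}" "\<forall>x\<in>{..<n}. F x = F0 (p x)"
      by (rule image_mset_eq_implies_permutes[rotated]) auto
    then show ?thesis using F
      by (intro bexI[of _ p]) (auto simp: act_def sym_grp_def \<F>_def fun_eq_iff PiE_iff extensional_def)
  qed
  have fibre: "card {\<pi>\<in>?G. act F0 \<pi> = F} = card {\<pi>\<in>?G. act F \<pi> = F}" if F: "F \<in> \<F>" for F
  proof -
    obtain \<sigma> where \<sigma>: "\<sigma> \<in> ?G" "act F0 \<sigma> = F" using trans[OF F] by blast
    have actc: "act (act G \<rho>) \<pi> = act G (\<rho> \<circ> \<pi>)" if "\<pi> \<in> ?G" for G \<rho> \<pi>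
      using that by (auto simp: act_def sym_grp_lt)
    have "bij_betw (\<lambda>\<pi>. \<sigma> \<circ> \<pi>) {\<pi>\<in>?G. act F \<pi> = F} {\<pi>\<in>?G. act F0 \<pi> = F}"
    proof (rule bij_betw_byWitness[of _ "\<lambda>\<pi>. inv \<sigma> \<circ> \<pi>"])
      show "(\<lambda>\<pi>. \<sigma> \<circ> \<pi>) ` {\<pi>\<in>?G. act F \<pi> = F} \<subseteq> {\<pi>\<in>?G. act F0 \<pi> = F}"
        using \<sigma> actc by (auto simp: sym_grp_comp)
      show "(\<lambda>\<pi>. inv \<sigma> \<circ> \<pi>) ` {\<pi>\<in>?G. act F0 \<pi> = F} \<subseteq> {\<pi>\<in>?G. act F \<pi> = F}"
      proof clarify
        fix \<pi> assume \<pi>: "\<pi> \<in> ?G" "F = act F0 \<pi>"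
        have "act (act F0 \<sigma>) (inv \<sigma> \<circ> \<pi>) = act F0 (\<sigma> \<circ> (inv \<sigma> \<circ> \<pi>))"
          using \<pi> \<sigma> by (intro actc sym_grp_comp sym_grp_inv)
        then show "inv \<sigma> \<circ> \<pi> \<in> ?G \<and> act (act F0 \<pi>) (inv \<sigma> \<circ> \<pi>) = act F0 \<pi>"
          using \<pi> \<sigma> by (simp add: sym_grp_comp sym_grp_inv o_assoc)
      qed
    qed (use \<sigma> in \<open>auto simp: o_assoc\<close>)
    from bij_betw_same_card[OF this] show ?thesis by simp
  qed
  have "(\<Sum>\<pi>\<in>?G. card {F\<in>\<F>. \<forall>k<n. F (\<pi> k) = F k}) = (\<Sum>\<pi>\<in>?G. card {F\<in>\<F>. act F \<pi> = F})"
  proof (intro sum.cong refl arg_cong[where f = card] Collect_cong)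
    fix \<pi> F
    have "(\<forall>k<n. F (\<pi> k) = F k) \<longleftrightarrow> act F \<pi> = F" if "F \<in> \<F>"
      using that by (auto simp: act_def \<F>_def fun_eq_iff PiE_iff extensional_def)
    then show "(F \<in> \<F> \<and> (\<forall>k<n. F (\<pi> k) = F k)) \<longleftrightarrow> (F \<in> \<F> \<and> act F \<pi> = F)" by blast
  qed
  \<comment> \<open>Burnside's count: the stabiliser of \<open>F\<close> has the size of the fibre
    over \<open>F\<close>, and the fibres partition the group, so the single orbit contributes the
    group order.\<close>
  also have "\<dots> = (\<Sum>F\<in>\<F>. card {\<pi>\<in>?G. act F \<pi> = F})"
    unfolding card_eq_sum sum.inter_filter[OF finite_sym_grp] sum.inter_filter[OF fin\<F>]
    by (rule sum.swap)
  also have "\<dots> = (\<Sum>F\<in>\<F>. card {\<pi>\<in>?G. act F0 \<pi> = F})"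
    by (simp add: fibre)
  also have "\<dots> = card ?G"
    using sum.group[of ?G \<F> "act F0" "\<lambda>_. 1::nat"] act_mem[OF F0]
    by (simp add: finite_sym_grp fin\<F> image_subset_iff)
  also have "\<dots> = fact n" by (rule card_sym_grp)
  finally show ?thesis unfolding \<F>_def by (simp add: conj_assoc)
qed

section \<open>Contingency tables and triangularity of Kostka numbers\<close>

definition row_vecs :: "nat \<Rightarrow> int \<Rightarrow> (nat \<Rightarrow> int) set" where
  "row_vecs l a = {r. (\<forall>i. 0 \<le> r i) \<and> (\<forall>i\<ge>l. r i = 0) \<and> (\<Sum>i<l. r i) = a}"

text \<open>The number of these matrices is the coefficient of \<open>x^\<beta>\<close> in the
  product of the complete homogeneous polynomials of degrees \<open>\<alpha> i\<close> in
  \<open>l\<close> variables. The numbers of rows and columns are separate so that rows can be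
  removed one at a time while the variables stay.\<close>

definition tables :: "nat \<Rightarrow> nat \<Rightarrow> (nat \<Rightarrow> int) \<Rightarrow> (nat \<Rightarrow> int) \<Rightarrow> (nat \<Rightarrow> nat \<Rightarrow> int) set" where
  "tables l R \<alpha> \<beta> = {A. (\<forall>i<R. A i \<in> row_vecs l (\<alpha> i)) \<and> (\<forall>i\<ge>R. A i = 0) \<and> (\<Sum>i<R. A i) = \<beta>}"

text \<open>The same antisymmetrised coefficient as \<open>alt_coeff\<close>, now of a product of
  complete homogeneous polynomials. At \<open>\<gamma> i = \<nu> i - i\<close> it is the Kostka
  number for shape \<open>\<nu>\<close> and content \<open>\<alpha>\<close>.\<close>

definition alt_tables :: "nat \<Rightarrow> nat \<Rightarrow> (nat \<Rightarrow> int) \<Rightarrow> (nat \<Rightarrow> int) \<Rightarrow> int" where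
  "alt_tables l R \<alpha> \<gamma> = (\<Sum>w | w permutes {..<l}. sign w * int (card (tables l R \<alpha> (\<lambda>i. \<gamma> i + int (w i)))))"

lemma finite_row_vecs: "finite (row_vecs l a)"
proof -
  have "row_vecs l a \<subseteq> (\<lambda>f i. if i < l then f i else 0) ` ({..<l} \<rightarrow>\<^sub>E {0..a})"
  proof
    fix r assume r: "r \<in> row_vecs l a"
    have "r i \<le> a" if "i < l" for i
      using r that member_le_sum[of i "{..<l}" r] by (auto simp: row_vecs_def)
    then show "r \<in> (\<lambda>f i. if i < l then f i else 0) ` ({..<l} \<rightarrow>\<^sub>E {0..a})"
      using r by (intro image_eqI[of _ _ "restrict r {..<l}"]) (auto simp: row_vecs_def fun_eq_iff)
  qed
  then show ?thesis by (rule finite_subset) (intro finite_imageI finite_PiE, auto)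
qed

lemma tables_0: "tables l 0 \<alpha> \<beta> = (if \<beta> = 0 then {0} else {})"
proof -
  have "(\<forall>i\<ge>0. A i = 0) \<longleftrightarrow> A = 0" for A :: "nat \<Rightarrow> nat \<Rightarrow> int"
    by (simp add: fun_eq_iff[of A 0])
  then show ?thesis unfolding tables_def by auto
qed

lemma tables_Suc:
  "tables l (Suc R) \<alpha> \<beta> =
    (\<Union>r\<in>row_vecs l (\<alpha> 0). (\<lambda>A. case_nat r A) ` tables l R (\<alpha> \<circ> Suc) (\<beta> - r))"
proof (intro equalityI subsetI)
  fix A assume A: "A \<in> tables l (Suc R) \<alpha> \<beta>"
  have sum: "(\<Sum>i<Suc R. A i) = A 0 + (\<Sum>i<R. (A \<circ> Suc) i)"
    by (subst sum.lessThan_Suc_shift) simp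
  have "A 0 + (\<Sum>i<R. (A \<circ> Suc) i) = \<beta>" using A unfolding sum[symmetric] tables_def by blast
  then have s: "(\<Sum>i<R. (A \<circ> Suc) i) = \<beta> - A 0" by (simp add: eq_diff_eq add.commute)
  have "A \<circ> Suc \<in> tables l R (\<alpha> \<circ> Suc) (\<beta> - A 0)"
    using A s unfolding tables_def by simp
  moreover have "A = case_nat (A 0) (A \<circ> Suc)" by (auto simp: fun_eq_iff split: nat.splits)
  moreover have "A 0 \<in> row_vecs l (\<alpha> 0)" using A by (simp add: tables_def)
  ultimately show "A \<in> (\<Union>r\<in>row_vecs l (\<alpha> 0). (\<lambda>A. case_nat r A) ` tables l R (\<alpha> \<circ> Suc) (\<beta> - r))"
    by blast
next
  fix A assume "A \<in> (\<Union>r\<in>row_vecs l (\<alpha> 0). (\<lambda>A. case_nat r A) ` tables l R (\<alpha> \<circ> Suc) (\<beta> - r))"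
  then obtain r B where r: "r \<in> row_vecs l (\<alpha> 0)" and B: "B \<in> tables l R (\<alpha> \<circ> Suc) (\<beta> - r)"
    and A: "A = case_nat r B" by blast
  have rowB: "i < R \<Longrightarrow> B i \<in> row_vecs l (\<alpha> (Suc i))" for i using B by (simp add: tables_def)
  have zeroB: "R \<le> i \<Longrightarrow> B i = 0" for i using B by (simp add: tables_def)
  have sumB: "(\<Sum>i<R. B i) = \<beta> - r" using B by (simp add: tables_def)
  have "(\<Sum>i<Suc R. A i) = \<beta>"
    by (subst sum.lessThan_Suc_shift) (simp add: A sumB)
  moreover have "A i \<in> row_vecs l (\<alpha> i)" if "i < Suc R" for i
    using that r rowB by (cases i) (simp_all add: A)
  moreover have "A i = 0" if "Suc R \<le> i" for i
    using that zeroB by (cases i) (simp_all add: A)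
  ultimately show "A \<in> tables l (Suc R) \<alpha> \<beta>" unfolding tables_def by blast
qed

lemma finite_tables: "finite (tables l R \<alpha> \<beta>)"
proof (induction R arbitrary: \<alpha> \<beta>)
  case (Suc R)
  then show ?case unfolding tables_Suc by (intro finite_UN_I finite_row_vecs finite_imageI)
qed (simp add: tables_0)

lemma card_tables_Suc:
  "card (tables l (Suc R) \<alpha> \<beta>) = (\<Sum>r\<in>row_vecs l (\<alpha> 0). card (tables l R (\<alpha> \<circ> Suc) (\<beta> - r)))"
proof -
  have inj: "case_nat r A = case_nat r' A' \<Longrightarrow> r = r' \<and> A = A'" for r r' :: "nat \<Rightarrow> int" and A A'
    by (metis ext old.nat.simps(4,5))
  have "card (tables l (Suc R) \<alpha> \<beta>)
      = (\<Sum>r\<in>row_vecs l (\<alpha> 0). card ((\<lambda>A. case_nat r A) ` tables l R (\<alpha> \<circ> Suc) (\<beta> - r)))"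
    unfolding tables_Suc
    by (rule card_UN_disjoint) (use inj in \<open>auto intro: finite_row_vecs finite_tables\<close>)
  also have "\<dots> = (\<Sum>r\<in>row_vecs l (\<alpha> 0). card (tables l R (\<alpha> \<circ> Suc) (\<beta> - r)))"
    by (intro sum.cong refl card_image inj_onI) (use inj in blast)
  finally show ?thesis .
qed

lemma card_tables_permute:
  assumes \<tau>: "\<tau> permutes {..<l}"
  shows "card (tables l R \<alpha> (\<beta> \<circ> \<tau>)) = card (tables l R \<alpha> \<beta>)"
proof -
  have mem: "(\<lambda>i. A i \<circ> \<tau>) \<in> tables l R \<alpha> (\<beta> \<circ> \<tau>)"
    if \<tau>: "\<tau> permutes {..<l}" and A: "A \<in> tables l R \<alpha> \<beta>" for A \<tau> \<beta>
  proof -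
    have "r \<circ> \<tau> \<in> row_vecs l a" if "r \<in> row_vecs l a" for r a
    proof -
      have "(\<Sum>i<l. (r \<circ> \<tau>) i) = (\<Sum>i<l. r i)"
        using sum.reindex_bij_betw[OF permutes_imp_bij[OF \<tau>], of r] by (simp add: o_def)
      then have "(\<Sum>i<l. (r \<circ> \<tau>) i) = a" using that by (simp add: row_vecs_def)
      moreover have "(r \<circ> \<tau>) i = 0" if "l \<le> i" for i
        using \<open>r \<in> _\<close> permutes_not_in[OF \<tau>, of i] that by (simp add: row_vecs_def)
      moreover have "0 \<le> (r \<circ> \<tau>) i" for i using \<open>r \<in> _\<close> by (simp add: row_vecs_def)
      ultimately show ?thesis unfolding row_vecs_def by blast
    qed
    moreover have "(\<Sum>i<R. A i \<circ> \<tau>) = (\<Sum>i<R. A i) \<circ> \<tau>"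
      by (induction R) (simp_all add: fun_eq_iff)
    moreover have "(0 :: nat \<Rightarrow> int) \<circ> \<tau> = 0" by (simp add: fun_eq_iff)
    ultimately show ?thesis using A unfolding tables_def by simp
  qed
  have inv: "\<beta> \<circ> \<tau> \<circ> inv \<tau> = \<beta>" using permutes_inv_o[OF \<tau>] by (simp add: comp_assoc)
  have "bij_betw (\<lambda>A i. A i \<circ> \<tau>) (tables l R \<alpha> \<beta>) (tables l R \<alpha> (\<beta> \<circ> \<tau>))"
  proof (rule bij_betw_byWitness[of _ "\<lambda>A i. A i \<circ> inv \<tau>"])
    show "(\<lambda>A i. A i \<circ> inv \<tau>) ` tables l R \<alpha> (\<beta> \<circ> \<tau>) \<subseteq> tables l R \<alpha> \<beta>"
      using mem[OF permutes_inv[OF \<tau>], of _ "\<beta> \<circ> \<tau>"] inv by auto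
  qed (use mem[OF \<tau>] permutes_inv_o[OF \<tau>] in \<open>auto simp: comp_assoc\<close>)
  from bij_betw_same_card[OF this] show ?thesis by simp
qed

lemma alt_tables_transpose:
  assumes "i < l" "j < l" "i \<noteq> j"
  shows "alt_tables l R \<alpha> (\<gamma> \<circ> Transposition.transpose i j) = - alt_tables l R \<alpha> \<gamma>"
proof -
  let ?t = "Transposition.transpose i j"
  let ?c = "\<lambda>\<beta>. int (card (tables l R \<alpha> \<beta>))"
  have t: "?t permutes {..<l}" using assms by (simp add: permutes_swap_id)
  have "alt_tables l R \<alpha> (\<gamma> \<circ> ?t)
      = (\<Sum>w | w permutes {..<l}. sign (w \<circ> ?t) * ?c (\<lambda>k. (\<gamma> \<circ> ?t) k + int ((w \<circ> ?t) k)))"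
    unfolding alt_tables_def
    by (rule sum.reindex_bij_witness[of _ "\<lambda>w. w \<circ> ?t" "\<lambda>w. w \<circ> ?t"])
      (simp_all add: comp_assoc permutes_compose[OF t])
  also have "\<dots> = (\<Sum>w | w permutes {..<l}. - (sign w * ?c (\<lambda>k. \<gamma> k + int (w k))))"
  proof (rule sum.cong[OF refl], clarsimp)
    fix w assume w: "w permutes {..<l}"
    have "sign (w \<circ> ?t) = - sign w"
      using w t assms by (subst sign_compose) (auto simp: sign_swap_id permutation_permutes)
    moreover have "(\<lambda>k. \<gamma> (?t k) + int (w (?t k))) = (\<lambda>k. \<gamma> k + int (w k)) \<circ> ?t"
      by (simp add: fun_eq_iff)
    ultimately show "sign (w \<circ> ?t) * ?c (\<lambda>k. \<gamma> (?t k) + int (w (?t k))) = - (sign w * ?c (\<lambda>k. \<gamma> k + int (w k)))"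
      using card_tables_permute[OF t, of R \<alpha> "\<lambda>k. \<gamma> k + int (w k)"] by simp
  qed
  finally show ?thesis by (simp add: alt_tables_def sum_negf)
qed

lemma alt_tables_neg:
  assumes "i < l" "\<gamma> i + int l \<le> 0"
  shows "alt_tables l R \<alpha> \<gamma> = 0"
  unfolding alt_tables_def
proof (intro sum.neutral ballI)
  fix w assume "w \<in> {w. w permutes {..<l}}"
  then have "w i < l" using assms(1) permutes_in_image[of w "{..<l}" i] by auto
  then have neg: "\<gamma> i + int (w i) < 0" using assms by simp
  have "tables l R \<alpha> (\<lambda>i. \<gamma> i + int (w i)) = {}"
  proof (rule equals0I)
    fix A assume A: "A \<in> tables l R \<alpha> (\<lambda>i. \<gamma> i + int (w i))"
    have "(\<Sum>k<m. A k) i = (\<Sum>k<m. A k i)" for m by (induction m) simp_all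
    from this[of R] have "\<gamma> i + int (w i) = (\<Sum>k<R. A k i)"
      using A by (simp add: tables_def)
    moreover have "0 \<le> (\<Sum>k<R. A k i)"
      using A by (intro sum_nonneg) (auto simp: tables_def row_vecs_def)
    ultimately show False using neg by simp
  qed
  then show "sign w * int (card (tables l R \<alpha> (\<lambda>i. \<gamma> i + int (w i)))) = 0" by simp
qed

lemma alt_tables_Suc:
  "alt_tables l (Suc R) \<alpha> \<gamma> = (\<Sum>r\<in>row_vecs l (\<alpha> 0). alt_tables l R (\<alpha> \<circ> Suc) (\<gamma> - r))"
proof -
  have "(\<lambda>i. \<gamma> i + int (w i)) - r = (\<lambda>i. (\<gamma> - r) i + int (w i))" for w r by (auto simp: fun_eq_iff)
  then show ?thesis
    unfolding alt_tables_def card_tables_Suc of_nat_sum sum_distrib_left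
    by (subst sum.swap) simp
qed

lemma alt_tables_0: "alt_tables l 0 \<alpha> (\<lambda>i. - int i) = 1"
proof -
  have eq: "(\<lambda>i. - int i + int (w i)) = 0 \<longleftrightarrow> w = id" for w :: "nat \<Rightarrow> nat"
    by (auto simp: fun_eq_iff)
  have "alt_tables l 0 \<alpha> (\<lambda>i. - int i) = (\<Sum>w | w permutes {..<l}. if w = id then 1 else 0)"
    unfolding alt_tables_def tables_0
    by (intro sum.cong refl) (simp only: eq, simp add: sign_id id_def)
  then show ?thesis by (simp add: finite_permutations permutes_id)
qed

text \<open>The cancellation behind Pieri's rule: at the first position violating the interlacing
  condition, the entries of \<open>\<gamma> - r\<close> at \<open>i\<close> and \<open>i + 1\<close> are swapped.\<close>

lemma alt_tables_pieri:
  fixes \<gamma> :: "nat \<Rightarrow> int"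
  assumes dec: "\<And>i. \<gamma> (Suc i) \<le> \<gamma> i"
  shows "(\<Sum>r\<in>{r\<in>row_vecs l a. \<exists>i. Suc i < l \<and> \<gamma> i - \<gamma> (Suc i) \<le> r i}. alt_tables l R \<alpha> (\<gamma> - r)) = 0"
    (is "sum ?D ?B = 0")
proof -
  define P where "P r i \<longleftrightarrow> Suc i < l \<and> \<gamma> i - \<gamma> (Suc i) \<le> r i" for r i
  define pos where "pos r = (LEAST i. P r i)" for r
  \<comment> \<open>The involution exchanges the entries of \<open>\<gamma> - r\<close> at
    \<open>i\<close> and \<open>i + 1\<close>. It preserves the sum of \<open>r\<close>, and the new
    entry at \<open>i\<close> is still at least \<open>\<gamma> i - \<gamma> (Suc i)\<close>, so
    \<open>i\<close> remains the first violation.\<close>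
  define s where "s r = (let i = pos r in
     r(i := r (Suc i) + \<gamma> i - \<gamma> (Suc i), Suc i := r i - (\<gamma> i - \<gamma> (Suc i))))" for r
  have B: "?B = {r\<in>row_vecs l a. \<exists>i. P r i}" by (simp add: P_def)
  have posP: "P r (pos r)" if "\<exists>i. P r i" for r
    unfolding pos_def using that by (rule LeastI_ex)
  have s_mem: "s r \<in> ?B" and pos_s: "pos (s r) = pos r" and s_s: "s (s r) = r" and D_s: "?D (s r) = - ?D r"
    if r: "r \<in> ?B" for r
  proof -
    define i where "i = pos r"
    have ex: "\<exists>i. P r i" and rv: "r \<in> row_vecs l a" using r by (auto simp: B)
    have Pi: "P r i" using posP[OF ex] by (simp add: i_def)
    then have il: "Suc i < l" "\<gamma> i - \<gamma> (Suc i) \<le> r i" by (auto simp: P_def)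
    have sr: "s r = r(i := r (Suc i) + \<gamma> i - \<gamma> (Suc i), Suc i := r i - (\<gamma> i - \<gamma> (Suc i)))"
      by (simp add: s_def i_def Let_def)
    have nn: "0 \<le> r j" for j using rv by (simp add: row_vecs_def)
    have "(\<Sum>j<l. s r j) = (\<Sum>j<l. r j)"
    proof -
      have split: "(\<Sum>j<l. f j) = f i + (f (Suc i) + (\<Sum>j\<in>{..<l} - {i} - {Suc i}. f j))" for f :: "nat \<Rightarrow> int"
        using il by (subst sum.remove[of _ i], simp, simp, subst sum.remove[of _ "Suc i"]) auto
      have "(\<Sum>j\<in>{..<l} - {i} - {Suc i}. s r j) = (\<Sum>j\<in>{..<l} - {i} - {Suc i}. r j)"
        by (rule sum.cong) (auto simp: sr)
      then show ?thesis unfolding split[of r] split[of "s r"] by (simp add: sr)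
    qed
    moreover have "0 \<le> s r j" for j using nn[of j] nn[of "Suc i"] dec[of i] il by (simp add: sr)
    moreover have "s r j = 0" if "l \<le> j" for j
      using that rv il by (auto simp: sr row_vecs_def)
    ultimately have rv': "s r \<in> row_vecs l a" using rv by (simp add: row_vecs_def)
    have P': "P (s r) i" using il nn[of "Suc i"] by (simp add: P_def sr)
    show "s r \<in> ?B" unfolding B using rv' P' by blast
    have less: "\<not> P (s r) j" if "j < i" for j
    proof -
      have "\<not> P r j" using that not_less_Least[of j "P r"] by (simp add: i_def pos_def)
      then show ?thesis using that by (simp add: P_def sr)
    qed
    have "pos (s r) = i" unfolding pos_def
      by (rule Least_equality) (use P' less in \<open>auto simp: not_less[symmetric]\<close>)
    then show "pos (s r) = pos r" by (simp add: i_def)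
    have "s (s r) = (s r)(i := s r (Suc i) + \<gamma> i - \<gamma> (Suc i), Suc i := s r i - (\<gamma> i - \<gamma> (Suc i)))"
      using \<open>pos (s r) = i\<close> by (simp add: s_def[of "s r"] Let_def)
    then show "s (s r) = r" by (auto simp: sr fun_eq_iff)
    have "\<gamma> - s r = (\<gamma> - r) \<circ> Transposition.transpose i (Suc i)"
      by (auto simp: sr fun_eq_iff Transposition.transpose_def)
    then show "?D (s r) = - ?D r" using il alt_tables_transpose[of i l "Suc i" R \<alpha> "\<gamma> - r"] by simp
  qed
  have "sum ?D ?B = (\<Sum>r\<in>?B. ?D (s r))"
    by (rule sum.reindex_bij_witness[of _ s s]) (use s_s s_mem in simp_all)
  also have "\<dots> = - sum ?D ?B" using D_s by (simp add: sum_negf)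
  finally show ?thesis by simp
qed

text \<open>The rows that survive satisfy \<open>r i \<le> \<nu> i - \<nu> (Suc i)\<close>
  (horizontal strips), and their total is at most \<open>\<nu> 0\<close>. A first row sum of at
  least \<open>\<nu> 0\<close> thus leaves only the maximal strip, and removing that strip deletes
  the first row of \<open>\<nu>\<close>.\<close>

lemma alt_tables_step:
  assumes dec: "\<And>i. \<nu> (Suc i) \<le> \<nu> i" and z: "\<And>i. l \<le> i \<Longrightarrow> \<nu> i = 0" and ge: "\<nu> 0 \<le> \<alpha> 0"
  shows "alt_tables l (Suc R) \<alpha> (\<lambda>i. \<nu> i - int i) =
      (if \<alpha> 0 = \<nu> 0 then alt_tables l R (\<alpha> \<circ> Suc) (\<lambda>i. \<nu> (Suc i) - int i) else 0)"
  proof -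
    define \<gamma> where "\<gamma> = (\<lambda>i. \<nu> i - int i)"
    let ?V = "row_vecs l (\<alpha> 0)"
    let ?B = "{r\<in>?V. \<exists>i. Suc i < l \<and> \<gamma> i - \<gamma> (Suc i) \<le> r i}"
    define \<rho> where "\<rho> = (\<lambda>i. \<nu> i - \<nu> (Suc i))"
    have sum\<rho>: "(\<Sum>i<l. \<rho> i) = \<nu> 0"
      using z[of l] by (simp add: \<rho>_def sum_lessThan_telescope')
    have \<rho>eq: "r = \<rho> \<and> \<alpha> 0 = \<nu> 0" if r: "r \<in> ?V" and le: "\<And>i. i < l \<Longrightarrow> r i \<le> \<rho> i" for r
    proof -
      have "\<alpha> 0 = (\<Sum>i<l. r i)" using r by (simp add: row_vecs_def)
      moreover have "(\<Sum>i<l. r i) \<le> (\<Sum>i<l. \<rho> i)" by (rule sum_mono) (use le in simp)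
      ultimately have eq: "(\<Sum>i<l. r i) = (\<Sum>i<l. \<rho> i)" "\<alpha> 0 = \<nu> 0" using ge sum\<rho> by auto
      have "r i = \<rho> i" for i
      proof (cases "i < l")
        case True
        have "(\<Sum>i<l. \<rho> i - r i) = 0" using eq by (simp add: sum_subtractf)
        then have "\<forall>i\<in>{..<l}. \<rho> i - r i = 0"
          using le by (subst (asm) sum_nonneg_eq_0_iff) auto
        then show ?thesis using True by simp
      next
        case False
        then show ?thesis using r z by (simp add: row_vecs_def \<rho>_def)
      qed
      then show ?thesis using eq by auto
    qed
    have zero: "alt_tables l R (\<alpha> \<circ> Suc) (\<gamma> - r) = 0"
      if r: "r \<in> ?V - ?B" "\<not> (r = \<rho> \<and> \<alpha> 0 = \<nu> 0)" for r
    proof -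
      obtain i where i: "i < l" "\<rho> i < r i" using \<rho>eq[of r] r by force
      \<comment> \<open>Only the last column escapes the interlacing test. There
        \<open>\<nu> l = 0\<close>, so an entry above \<open>\<nu> i\<close> pushes
        \<open>\<gamma> - r\<close> low enough for \<open>alt_tables_neg\<close>.\<close>
      have "\<not> Suc i < l" using r(1) i by (force simp: \<gamma>_def \<rho>_def)
      then have "Suc i = l" using i by simp
      then show ?thesis using i z[of l] by (intro alt_tables_neg[of i]) (auto simp: \<gamma>_def \<rho>_def)
    qed
    have "alt_tables l (Suc R) \<alpha> \<gamma> = (\<Sum>r\<in>?B. alt_tables l R (\<alpha> \<circ> Suc) (\<gamma> - r))
        + (\<Sum>r\<in>?V - ?B. alt_tables l R (\<alpha> \<circ> Suc) (\<gamma> - r))"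
      unfolding alt_tables_Suc by (subst sum.subset_diff[of ?B]) (auto intro: finite_row_vecs)
    also have "(\<Sum>r\<in>?B. alt_tables l R (\<alpha> \<circ> Suc) (\<gamma> - r)) = 0"
      by (rule alt_tables_pieri) (unfold \<gamma>_def, rule diff_mono[OF dec], simp)
    also have "(\<Sum>r\<in>?V - ?B. alt_tables l R (\<alpha> \<circ> Suc) (\<gamma> - r))
       = (\<Sum>r\<in>?V - ?B. if r = \<rho> then (if \<alpha> 0 = \<nu> 0 then alt_tables l R (\<alpha> \<circ> Suc) (\<gamma> - \<rho>) else 0) else 0)"
      by (intro sum.cong refl) (use zero in auto)
    also have "\<dots> = (if \<rho> \<in> ?V - ?B \<and> \<alpha> 0 = \<nu> 0 then alt_tables l R (\<alpha> \<circ> Suc) (\<gamma> - \<rho>) else 0)"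
      by (subst sum.delta) (auto intro: finite_row_vecs)
    finally have "alt_tables l (Suc R) \<alpha> \<gamma>
      = (if \<rho> \<in> ?V - ?B \<and> \<alpha> 0 = \<nu> 0 then alt_tables l R (\<alpha> \<circ> Suc) (\<gamma> - \<rho>) else 0)" by simp
    moreover have "\<rho> \<notin> ?B" by (auto simp: \<gamma>_def \<rho>_def)
    moreover have "\<rho> \<in> ?V" if "\<alpha> 0 = \<nu> 0"
      using that sum\<rho> dec z by (auto simp: row_vecs_def \<rho>_def)
    moreover have "\<gamma> - \<rho> = (\<lambda>i. \<nu> (Suc i) - int i)" by (auto simp: \<gamma>_def \<rho>_def)
    ultimately show ?thesis unfolding \<gamma>_def[symmetric] by (simp only: Diff_iff) simp
  qed

text \<open>Unitriangularity of Kostka numbers in the lexicographic order: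
  \<open>alt_tables_step\<close> removes equal first rows until the first difference is
  reached.\<close>

lemma alt_tables_dominance:
  assumes "\<And>i. \<nu> (Suc i) \<le> \<nu> i" "\<And>i. l \<le> i \<Longrightarrow> \<nu> i = 0" "\<And>i. R \<le> i \<Longrightarrow> \<nu> i = 0"
  shows alt_tables_eq_1: "(\<forall>j<R. \<alpha> j = \<nu> j) \<Longrightarrow> alt_tables l R \<alpha> (\<lambda>i. \<nu> i - int i) = 1"
    and alt_tables_eq_0: "(\<exists>i<R. (\<forall>j<i. \<alpha> j = \<nu> j) \<and> \<alpha> i > \<nu> i) \<Longrightarrow> alt_tables l R \<alpha> (\<lambda>i. \<nu> i - int i) = 0"
proof -
  have "((\<forall>j<R. \<alpha> j = \<nu> j) \<longrightarrow> alt_tables l R \<alpha> (\<lambda>i. \<nu> i - int i) = 1) \<and>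
    ((\<exists>i<R. (\<forall>j<i. \<alpha> j = \<nu> j) \<and> \<alpha> i > \<nu> i) \<longrightarrow> alt_tables l R \<alpha> (\<lambda>i. \<nu> i - int i) = 0)"
    using assms
  proof (induction R arbitrary: \<alpha> \<nu>)
    case 0
    then have "(\<lambda>i. \<nu> i - int i) = (\<lambda>i. - int i)" by (simp add: fun_eq_iff)
    then show ?case using alt_tables_0 by simp
  next
    case (Suc R)
    have step: "alt_tables l (Suc R) \<alpha> (\<lambda>i. \<nu> i - int i) =
        (if \<alpha> 0 = \<nu> 0 then alt_tables l R (\<alpha> \<circ> Suc) (\<lambda>i. \<nu> (Suc i) - int i) else 0)"
      if "\<nu> 0 \<le> \<alpha> 0"
      by (rule alt_tables_step) (use Suc.prems that in simp_all)
    have IH: "((\<forall>j<R. (\<alpha> \<circ> Suc) j = (\<nu> \<circ> Suc) j) \<longrightarrow>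
          alt_tables l R (\<alpha> \<circ> Suc) (\<lambda>i. (\<nu> \<circ> Suc) i - int i) = 1) \<and>
        ((\<exists>i<R. (\<forall>j<i. (\<alpha> \<circ> Suc) j = (\<nu> \<circ> Suc) j) \<and> (\<alpha> \<circ> Suc) i > (\<nu> \<circ> Suc) i) \<longrightarrow>
          alt_tables l R (\<alpha> \<circ> Suc) (\<lambda>i. (\<nu> \<circ> Suc) i - int i) = 0)"
      by (rule Suc.IH) (use Suc.prems in simp_all)
    show ?case
    proof (intro conjI impI)
      assume "\<forall>j<Suc R. \<alpha> j = \<nu> j"
      then show "alt_tables l (Suc R) \<alpha> (\<lambda>i. \<nu> i - int i) = 1" using IH step by simp
    next
      assume "\<exists>i<Suc R. (\<forall>j<i. \<alpha> j = \<nu> j) \<and> \<alpha> i > \<nu> i"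
      then obtain i where i: "i < Suc R" "\<And>j. j < i \<Longrightarrow> \<alpha> j = \<nu> j" "\<alpha> i > \<nu> i" by blast
      show "alt_tables l (Suc R) \<alpha> (\<lambda>i. \<nu> i - int i) = 0"
      proof (cases i)
        case 0
        then show ?thesis using step i by simp
      next
        case (Suc k)
        have "\<exists>i<R. (\<forall>j<i. (\<alpha> \<circ> Suc) j = (\<nu> \<circ> Suc) j) \<and> (\<alpha> \<circ> Suc) i > (\<nu> \<circ> Suc) i"
          using i Suc by (intro exI[of _ k]) auto
        then have "alt_tables l R (\<alpha> \<circ> Suc) (\<lambda>i. (\<nu> \<circ> Suc) i - int i) = 0" using IH by blast
        moreover have "\<alpha> 0 = \<nu> 0" using i(2)[of 0] Suc by simp
        ultimately show ?thesis using step by simp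
      qed
    qed
  qed
  then show "(\<forall>j<R. \<alpha> j = \<nu> j) \<Longrightarrow> alt_tables l R \<alpha> (\<lambda>i. \<nu> i - int i) = 1"
    and "(\<exists>i<R. (\<forall>j<i. \<alpha> j = \<nu> j) \<and> \<alpha> i > \<nu> i) \<Longrightarrow> alt_tables l R \<alpha> (\<lambda>i. \<nu> i - int i) = 0"
    by blast+
qed

lemma card_filter_split:
  assumes "finite S" "finite J" "\<And>k. k \<in> S \<Longrightarrow> g k \<in> J"
  shows "card {k\<in>S. P k} = (\<Sum>j\<in>J. card {k\<in>S. P k \<and> g k = j})"
proof -
  have "{k\<in>S. P k} = (\<Union>j\<in>J. {k\<in>S. P k \<and> g k = j})" using assms(3) by auto
  then show ?thesis by (simp only:) (rule card_UN_disjoint, use assms in auto)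
qed

text \<open>A pair of fixed colourings is one fixed colouring by pairs of colours, and the sizes of
  its colour classes form a table with margins \<open>\<alpha>\<close> and \<open>\<beta>\<close>.
  The product is sorted by this table.\<close>

lemma card_fixed_colourings_mult:
  assumes \<alpha>0: "\<And>i. l \<le> i \<Longrightarrow> \<alpha> i = 0" and "\<pi> \<in> sym_grp n"
  shows "card (fixed_colourings l n \<alpha> \<pi>) * card (fixed_colourings l n \<beta> \<pi>) =
    (\<Sum>A\<in>tables l l \<alpha> \<beta>. card {F \<in> {..<n} \<rightarrow>\<^sub>E {..<l} \<times> {..<l}.
       (\<forall>c\<in>{..<l} \<times> {..<l}. card {k\<in>{..<n}. F k = c} = nat (A (fst c) (snd c))) \<and> (\<forall>k<n. F (\<pi> k) = F k)})"
    (is "_ = (\<Sum>A\<in>?T. card (?S A))")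
proof -
  have \<pi>: "\<forall>k<n. \<pi> k < n" using assms(2) sym_grp_lt by blast
  let ?Q = "{..<l} \<times> {..<l}"
  define \<Phi> where "\<Phi> = (\<lambda>(f, g) k. if k < n then (f k, g k) else undefined :: nat \<times> nat)"
  define \<Psi> where "\<Psi> = (\<lambda>F. (restrict (fst \<circ> F) {..<n}, restrict (snd \<circ> F) {..<n}) :: (nat \<Rightarrow> nat) \<times> (nat \<Rightarrow> nat))"
  have bij: "bij_betw \<Phi> (fixed_colourings l n \<alpha> \<pi> \<times> fixed_colourings l n \<beta> \<pi>) (\<Union>A\<in>?T. ?S A)"
  proof (rule bij_betw_byWitness[of _ \<Psi>])
    show "\<forall>p\<in>fixed_colourings l n \<alpha> \<pi> \<times> fixed_colourings l n \<beta> \<pi>. \<Psi> (\<Phi> p) = p"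
      by (auto simp: \<Psi>_def \<Phi>_def fixed_colourings_def colourings_def fun_eq_iff PiE_iff extensional_def)
    show "\<forall>F\<in>\<Union>A\<in>?T. ?S A. \<Phi> (\<Psi> F) = F"
      by (auto simp: \<Psi>_def \<Phi>_def fun_eq_iff PiE_iff extensional_def)
    show "\<Phi> ` (fixed_colourings l n \<alpha> \<pi> \<times> fixed_colourings l n \<beta> \<pi>) \<subseteq> (\<Union>A\<in>?T. ?S A)"
    proof clarify
      fix f g assume f: "f \<in> fixed_colourings l n \<alpha> \<pi>" and g: "g \<in> fixed_colourings l n \<beta> \<pi>"
      have fl: "f k < l" and gl: "g k < l" if "k < n" for k
        using f g that by (auto simp: fixed_colourings_def colourings_def PiE_iff)
      have fc: "int (card {k\<in>{..<n}. f k = i}) = \<alpha> i" and gc: "int (card {k\<in>{..<n}. g k = i}) = \<beta> i" for i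
        using f g by (auto simp: fixed_colourings_def colourings_def content_def)
      define A where "A i j = (if i < l \<and> j < l then int (card {k\<in>{..<n}. f k = i \<and> g k = j}) else 0)" for i j
      have "A i \<in> row_vecs l (\<alpha> i)" if "i < l" for i
      proof -
        have "(\<Sum>j<l. A i j) = int (\<Sum>j<l. card {k\<in>{..<n}. f k = i \<and> g k = j})"
          using that by (simp add: A_def)
        also have "(\<Sum>j<l. card {k\<in>{..<n}. f k = i \<and> g k = j}) = card {k\<in>{..<n}. f k = i}"
          by (rule card_filter_split[symmetric]) (use gl in auto)
        finally show ?thesis using fc by (simp add: row_vecs_def A_def)
      qed
      moreover have "(\<Sum>i<l. A i) = \<beta>"
      proof
        fix j
        have 1: "(\<Sum>i<m. A i) j = (\<Sum>i<m. A i j)" for m by (induction m) simp_all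
        show "(\<Sum>i<l. A i) j = \<beta> j"
        proof (cases "j < l")
          case True
          then have "(\<Sum>i<l. A i j) = int (\<Sum>i<l. card {k\<in>{..<n}. g k = j \<and> f k = i})"
            by (simp add: A_def conj_commute)
          also have "(\<Sum>i<l. card {k\<in>{..<n}. g k = j \<and> f k = i}) = card {k\<in>{..<n}. g k = j}"
            by (rule card_filter_split[symmetric]) (use fl in auto)
          finally show ?thesis using gc 1 by simp
        next
          case False
          then have 0: "{k\<in>{..<n}. g k = j} = {}" using gl by auto
          have "\<beta> j = 0" using gc[of j] unfolding 0 by simp
          then show ?thesis using False unfolding 1 by (simp add: A_def)
        qed
      qed
      ultimately have "A \<in> ?T" unfolding tables_def by (simp add: A_def fun_eq_iff)
      moreover have "\<Phi> (f, g) \<in> ?S A"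
      proof -
        have "{k\<in>{..<n}. \<Phi> (f, g) k = c} = {k\<in>{..<n}. f k = fst c \<and> g k = snd c}" for c
          by (auto simp: \<Phi>_def)
        moreover have "\<Phi> (f, g) \<in> {..<n} \<rightarrow>\<^sub>E ?Q"
          using fl gl by (auto simp: \<Phi>_def PiE_iff extensional_def)
        moreover have "\<forall>k<n. \<Phi> (f, g) (\<pi> k) = \<Phi> (f, g) k"
          using f g \<pi> by (simp add: \<Phi>_def fixed_colourings_def)
        ultimately show ?thesis by (auto simp: A_def)
      qed
      ultimately show "\<Phi> (f, g) \<in> (\<Union>A\<in>?T. ?S A)" by blast
    qed
    show "\<Psi> ` (\<Union>A\<in>?T. ?S A) \<subseteq> fixed_colourings l n \<alpha> \<pi> \<times> fixed_colourings l n \<beta> \<pi>"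
    proof (intro image_subsetI, elim UN_E)
      fix F A assume A: "A \<in> ?T" and F: "F \<in> ?S A"
      have FQ: "F k \<in> ?Q" if "k < n" for k using F that by (auto simp: PiE_iff)
      have Fc: "int (card {k\<in>{..<n}. F k = (i, j)}) = A i j" if "i < l" "j < l" for i j
        using F A that by (auto simp: tables_def row_vecs_def)
      have row: "A i \<in> row_vecs l (\<alpha> i)" if "i < l" for i using A that by (simp add: tables_def)
      have Asum: "(\<Sum>i<l. A i) = \<beta>" using A by (simp add: tables_def)
      have "content {..<n} (restrict (fst \<circ> F) {..<n}) i = \<alpha> i" for i
      proof -
        have eq: "{k\<in>{..<n}. restrict (fst \<circ> F) {..<n} k = i} = {k\<in>{..<n}. fst (F k) = i}" by auto
        show ?thesis
        proof (cases "i < l")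
          case True
          have "card {k\<in>{..<n}. fst (F k) = i} = (\<Sum>j<l. card {k\<in>{..<n}. fst (F k) = i \<and> snd (F k) = j})"
            by (rule card_filter_split) (use FQ in \<open>auto simp: mem_Times_iff\<close>)
          also have "\<dots> = (\<Sum>j<l. card {k\<in>{..<n}. F k = (i, j)})"
            by (simp add: prod_eq_iff)
          finally have "int (card {k\<in>{..<n}. fst (F k) = i}) = (\<Sum>j<l. A i j)"
            using Fc True by simp
          then show ?thesis using row[OF True] unfolding content_def eq by (simp add: row_vecs_def)
        next
          case False
          then have "{k\<in>{..<n}. fst (F k) = i} = {}" using FQ by (auto simp: mem_Times_iff)
          then show ?thesis using \<alpha>0[of i] False unfolding content_def eq by simp
        qed
      qed
      moreover have "content {..<n} (restrict (snd \<circ> F) {..<n}) j = \<beta> j" for j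
      proof -
        have eq: "{k\<in>{..<n}. restrict (snd \<circ> F) {..<n} k = j} = {k\<in>{..<n}. snd (F k) = j}" by auto
        have "(\<Sum>i<m. A i) j = (\<Sum>i<m. A i j)" for m by (induction m) simp_all
        from this[of l] have \<beta>j: "\<beta> j = (\<Sum>i<l. A i j)" using Asum by simp
        show ?thesis
        proof (cases "j < l")
          case True
          have "card {k\<in>{..<n}. snd (F k) = j} = (\<Sum>i<l. card {k\<in>{..<n}. snd (F k) = j \<and> fst (F k) = i})"
            by (rule card_filter_split) (use FQ in \<open>auto simp: mem_Times_iff\<close>)
          also have "\<dots> = (\<Sum>i<l. card {k\<in>{..<n}. F k = (i, j)})"
            by (simp add: prod_eq_iff conj_commute)
          finally have "int (card {k\<in>{..<n}. snd (F k) = j}) = (\<Sum>i<l. A i j)"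
            using Fc True by simp
          then show ?thesis unfolding content_def eq \<beta>j .
        next
          case False
          then have "{k\<in>{..<n}. snd (F k) = j} = {}" using FQ by (auto simp: mem_Times_iff)
          moreover have "(\<Sum>i<l. A i j) = 0" using row False by (intro sum.neutral) (auto simp: row_vecs_def)
          ultimately show ?thesis unfolding content_def eq \<beta>j by simp
        qed
      qed
      ultimately show "\<Psi> F \<in> fixed_colourings l n \<alpha> \<pi> \<times> fixed_colourings l n \<beta> \<pi>"
        using F \<pi> FQ by (auto simp: \<Psi>_def fixed_colourings_def colourings_def mem_Times_iff)
    qed
  qed
  have "card (fixed_colourings l n \<alpha> \<pi>) * card (fixed_colourings l n \<beta> \<pi>)
      = card (fixed_colourings l n \<alpha> \<pi> \<times> fixed_colourings l n \<beta> \<pi>)"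
    by (simp add: card_cartesian_product)
  also have "\<dots> = card (\<Union>A\<in>?T. ?S A)" by (rule bij_betw_same_card[OF bij])
  also have "\<dots> = (\<Sum>A\<in>?T. card (?S A))"
  proof (rule card_UN_disjoint[OF finite_tables])
    show "\<forall>A\<in>?T. finite (?S A)"
      by (intro ballI finite_subset[OF _ finite_PiE[of "{..<n}" "\<lambda>_. ?Q"]]) auto
    show "\<forall>A\<in>?T. \<forall>B\<in>?T. A \<noteq> B \<longrightarrow> ?S A \<inter> ?S B = {}"
    proof (intro ballI impI, rule ccontr)
      fix A B assume AB: "A \<in> ?T" "B \<in> ?T" "A \<noteq> B" "?S A \<inter> ?S B \<noteq> {}"
      then obtain F where F: "F \<in> ?S A" "F \<in> ?S B" by blast
      have "A i j = B i j" for i j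
      proof (cases "i < l \<and> j < l")
        case True
        then have "nat (A i j) = nat (B i j)" using F by (auto dest!: bspec[of _ _ "(i, j)"])
        moreover have "0 \<le> A i j" "0 \<le> B i j" using True AB by (auto simp: tables_def row_vecs_def)
        ultimately show ?thesis by simp
      next
        case False
        have "C i j = 0" if "C \<in> ?T" for C
        proof (cases "i < l")
          case True
          then have "C i \<in> row_vecs l (\<alpha> i)" using that by (simp add: tables_def)
          then show ?thesis using True False by (simp add: row_vecs_def)
        next
          case i: False
          then have "C i = 0" using that by (simp add: tables_def)
          then show ?thesis by simp
        qed
        then have "A i j = 0" "B i j = 0" using AB(1,2) by blast+
        then show ?thesis by simp
      qed
      then show False using AB(3) by (simp add: fun_eq_iff)
    qed
  qed
  finally show ?thesis .
qed

text \<open>For each table the group is transitive on the colourings with these class sizes, so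
  \<open>burnside_fibre_sizes\<close> yields \<open>n!\<close>. The normalised inner product of two
  permutation characters is thus a number of tables.\<close>

lemma sum_fixed_colourings_mult:
  assumes \<alpha>0: "\<And>i. l \<le> i \<Longrightarrow> \<alpha> i = 0" and sum: "(\<Sum>i<l. \<alpha> i) = int n"
  shows "(\<Sum>\<pi>\<in>sym_grp n. card (fixed_colourings l n \<alpha> \<pi>) * card (fixed_colourings l n \<beta> \<pi>))
    = fact n * card (tables l l \<alpha> \<beta>)"
proof -
  let ?Q = "{..<l} \<times> {..<l}"
  let ?S = "\<lambda>A \<pi>. {F \<in> {..<n} \<rightarrow>\<^sub>E ?Q. (\<forall>c\<in>?Q. card {k\<in>{..<n}. F k = c} = nat (A (fst c) (snd c)))
     \<and> (\<forall>k<n. F (\<pi> k) = F k)}"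
  have "(\<Sum>\<pi>\<in>sym_grp n. card (fixed_colourings l n \<alpha> \<pi>) * card (fixed_colourings l n \<beta> \<pi>))
     = (\<Sum>\<pi>\<in>sym_grp n. \<Sum>A\<in>tables l l \<alpha> \<beta>. card (?S A \<pi>))"
    by (intro sum.cong refl card_fixed_colourings_mult assms)
  also have "\<dots> = (\<Sum>A\<in>tables l l \<alpha> \<beta>. \<Sum>\<pi>\<in>sym_grp n. card (?S A \<pi>))"
    by (rule sum.swap)
  also have "\<dots> = (\<Sum>A\<in>tables l l \<alpha> \<beta>. fact n)"
  proof (intro sum.cong refl burnside_fibre_sizes)
    fix A assume A: "A \<in> tables l l \<alpha> \<beta>"
    have row: "A i \<in> row_vecs l (\<alpha> i)" if "i < l" for i using A that by (simp add: tables_def)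
    have "int (\<Sum>c\<in>?Q. nat (A (fst c) (snd c))) = (\<Sum>i<l. \<Sum>j<l. int (nat (A i j)))"
      by (simp add: sum.cartesian_product case_prod_beta)
    also have "\<dots> = (\<Sum>i<l. \<alpha> i)"
      by (intro sum.cong refl) (use row in \<open>simp add: row_vecs_def\<close>)
    finally show "(\<Sum>c\<in>?Q. nat (A (fst c) (snd c))) = n" using sum by linarith
  qed simp
  finally show ?thesis by simp
qed

text \<open>All smaller indices are fixed and hence already taken as values, so the first moved
  point can only go up.\<close>

lemma permutes_first_moved:
  fixes w :: "nat \<Rightarrow> nat"
  assumes "w permutes {..<l}" "w \<noteq> id"
  obtains i where "i < l" "\<And>j. j < i \<Longrightarrow> w j = j" "i < w i"
proof -
  define i where "i = (LEAST i. w i \<noteq> i)"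
  have ex: "\<exists>i. w i \<noteq> i" using assms(2) by (auto simp: fun_eq_iff)
  have wi: "w i \<noteq> i" unfolding i_def by (rule LeastI_ex[OF ex])
  have less: "w j = j" if "j < i" for j using not_less_Least[of j "\<lambda>i. w i \<noteq> i"] that by (auto simp: i_def)
  have "\<not> w i < i"
  proof
    assume "w i < i"
    then have "w (w i) = w i" by (rule less)
    then show False using permutes_inj[OF assms(1)] wi by (auto simp: inj_def)
  qed
  moreover have "i < l" using wi permutes_not_in[OF assms(1), of i] by auto
  ultimately show ?thesis using wi less by (intro that[of i]) auto
qed

lemma length_le_sum_list: "0 \<notin> set ks \<Longrightarrow> length ks \<le> sum_list (ks :: nat list)"
  by (induction ks) auto

definition part :: "nat list \<Rightarrow> nat \<Rightarrow> int" where
  "part \<alpha> i = int (if i < length \<alpha> then \<alpha> ! i else 0)"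

lemma shape_exp_eq: "shape_exp \<alpha> i = part \<alpha> i - int i"
  by (simp add: shape_exp_def part_def)

lemma part_Suc_le: "sorted_wrt (\<ge>) \<alpha> \<Longrightarrow> part \<alpha> (Suc i) \<le> part \<alpha> i"
  by (auto simp: part_def sorted_wrt_iff_nth_less)

lemma sum_part: "length \<alpha> \<le> l \<Longrightarrow> (\<Sum>i<l. part \<alpha> i) = int (sum_list \<alpha>)"
proof -
  assume len: "length \<alpha> \<le> l"
  have "(\<Sum>i<l. part \<alpha> i) = (\<Sum>i<length \<alpha>. int (\<alpha> ! i))"
    by (rule sum.mono_neutral_cong_right) (use len in \<open>auto simp: part_def\<close>)
  then show ?thesis by (simp add: sum_list_sum_nth atLeast0LessThan)
qed

lemma part_eq_0: "length \<alpha> \<le> i \<Longrightarrow> part \<alpha> i = 0"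
  by (simp add: part_def)

lemma frob_char_cycle_type:
  assumes "\<pi> \<in> sym_grp (sum_list \<alpha>)"
  shows "frob_char \<alpha> (cycle_type (sum_list \<alpha>) \<pi>) = (\<Sum>w | w permutes {..<sum_list \<alpha>}. sign w *
    int (card (fixed_colourings (sum_list \<alpha>) (sum_list \<alpha>) (\<lambda>i. shape_exp \<alpha> i + int (w i)) \<pi>)))"
  unfolding frob_char_def alt_coeff_def by (simp add: card_fixed_colourings[OF assms])

text \<open>Both factors are expanded as signed sums of permutation characters, and the sum over
  \<open>w'\<close> is an \<open>alt_tables\<close> value at the shape. For \<open>w\<close> other
  than \<open>id\<close> the row sums \<open>a w\<close> exceed the shape at the first point moved
  by \<open>w\<close>, so triangularity keeps only \<open>w = id\<close>.\<close>

lemma sum_frob_char_square: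
  assumes "\<alpha> \<in> partitions_of n"
  shows "(\<Sum>\<pi>\<in>sym_grp n. (frob_char \<alpha> (cycle_type n \<pi>))\<^sup>2) = fact n"
proof -
  have n: "sum_list \<alpha> = n" and srt: "sorted_wrt (\<ge>) \<alpha>" and len: "length \<alpha> \<le> n"
    using assms length_le_sum_list[of \<alpha>] by (auto simp: partitions_of_def)
  define a where "a w i = shape_exp \<alpha> i + int (w i)" for w i
  have aw: "a w = (\<lambda>i. shape_exp \<alpha> i + int (w i))" for w by (simp add: fun_eq_iff a_def)
  define W where "W = {w. w permutes {..<n}}"
  have finW: "finite W" by (simp add: W_def finite_permutations)
  let ?\<psi> = "\<lambda>w \<pi>. int (card (fixed_colourings n n (a w) \<pi>))"
  have a0: "a w i = 0" if "w \<in> W" "n \<le> i" for w i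
    using that len permutes_not_in[of w "{..<n}" i] by (simp add: a_def W_def shape_exp_eq part_eq_0)
  have suma: "(\<Sum>i<n. a w i) = int n" if "w \<in> W" for w
  proof -
    have "(\<Sum>i<n. int (w i)) = (\<Sum>i<n. int i)"
      using sum.reindex_bij_betw[OF permutes_imp_bij, of w "{..<n}" int] that by (simp add: W_def)
    then show ?thesis
      using sum_part[OF len] by (simp add: a_def shape_exp_eq sum.distrib sum_subtractf n)
  qed
  have "(\<Sum>\<pi>\<in>sym_grp n. (frob_char \<alpha> (cycle_type n \<pi>))\<^sup>2)
     = (\<Sum>\<pi>\<in>sym_grp n. \<Sum>w\<in>W. \<Sum>w'\<in>W. sign w * sign w' * (?\<psi> w \<pi> * ?\<psi> w' \<pi>))"
  proof (rule sum.cong[OF refl])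
    fix \<pi> assume "\<pi> \<in> sym_grp n"
    then have "frob_char \<alpha> (cycle_type n \<pi>) = (\<Sum>w\<in>W. sign w * ?\<psi> w \<pi>)"
      using frob_char_cycle_type[of \<pi> \<alpha>] by (simp add: n W_def aw)
    then show "(frob_char \<alpha> (cycle_type n \<pi>))\<^sup>2
       = (\<Sum>w\<in>W. \<Sum>w'\<in>W. sign w * sign w' * (?\<psi> w \<pi> * ?\<psi> w' \<pi>))"
      by (simp add: power2_eq_square sum_product mult_ac)
  qed
  also have "\<dots> = (\<Sum>w\<in>W. \<Sum>w'\<in>W. sign w * sign w' * (\<Sum>\<pi>\<in>sym_grp n. ?\<psi> w \<pi> * ?\<psi> w' \<pi>))"
    by (subst sum.swap, rule sum.cong[OF refl], subst sum.swap) (simp add: sum_distrib_left)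
  also have "\<dots> = (\<Sum>w\<in>W. \<Sum>w'\<in>W. sign w * sign w' * (fact n * int (card (tables n n (a w) (a w')))))"
  proof (intro sum.cong refl arg_cong2[where f = "(*)"])
    fix w w' assume w: "w \<in> W" "w' \<in> W"
    have "(\<Sum>\<pi>\<in>sym_grp n. ?\<psi> w \<pi> * ?\<psi> w' \<pi>)
        = int (\<Sum>\<pi>\<in>sym_grp n. card (fixed_colourings n n (a w) \<pi>) * card (fixed_colourings n n (a w') \<pi>))"
      by simp
    also have "\<dots> = int (fact n * card (tables n n (a w) (a w')))"
      using w by (subst sum_fixed_colourings_mult) (simp_all add: a0 suma)
    finally show "(\<Sum>\<pi>\<in>sym_grp n. ?\<psi> w \<pi> * ?\<psi> w' \<pi>) = fact n * int (card (tables n n (a w) (a w')))"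
      by simp
  qed
  also have "\<dots> = fact n * (\<Sum>w\<in>W. sign w * alt_tables n n (a w) (shape_exp \<alpha>))"
    by (simp add: alt_tables_def W_def aw sum_distrib_left mult_ac)
  also have "(\<Sum>w\<in>W. sign w * alt_tables n n (a w) (shape_exp \<alpha>)) = (\<Sum>w\<in>W. if w = id then 1 else 0)"
  proof (rule sum.cong[OF refl])
    fix w assume w: "w \<in> W"
    have se: "shape_exp \<alpha> = (\<lambda>i. part \<alpha> i - int i)" by (simp add: fun_eq_iff shape_exp_eq)
    show "sign w * alt_tables n n (a w) (shape_exp \<alpha>) = (if w = id then 1 else 0)"
    proof (cases "w = id")
      case True
      have "alt_tables n n (a w) (shape_exp \<alpha>) = 1" unfolding se
        by (rule alt_tables_eq_1) (use True len in \<open>auto simp: part_Suc_le[OF srt] part_eq_0 a_def shape_exp_eq\<close>)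
      then show ?thesis using True by (simp add: sign_id)
    next
      case False
      from w obtain i where i: "i < n" "\<And>j. j < i \<Longrightarrow> w j = j" "i < w i"
        using permutes_first_moved[OF _ False, of n] by (auto simp: W_def)
      have "alt_tables n n (a w) (shape_exp \<alpha>) = 0" unfolding se
        by (rule alt_tables_eq_0) (use i len in \<open>auto simp: part_Suc_le[OF srt] part_eq_0 a_def shape_exp_eq intro!: exI[of _ i]\<close>)
      then show ?thesis using False by simp
    qed
  qed
  also have "\<dots> = 1" using finW by (simp add: sum.delta) (simp add: W_def permutes_id)
  finally show ?thesis by simp
qed

section \<open>Young symmetrizers\<close>

locale young =
  fixes \<alpha> :: "nat list" and n :: nat
  assumes partition: "\<alpha> \<in> partitions_of n"
begin

abbreviation "trow \<equiv> tab_row \<alpha>"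
abbreviation "tcol \<equiv> tab_col \<alpha>"
abbreviation "G \<equiv> sym_grp n"
abbreviation "R \<equiv> row_grp \<alpha>"
abbreviation "C \<equiv> col_grp \<alpha>"

lemma sum_list_eq: "sum_list \<alpha> = n" and decreasing: "sorted_wrt (\<ge>) \<alpha>"
  using partition by (auto simp: partitions_of_def)

definition offset :: "nat \<Rightarrow> nat" where "offset i = sum_list (take i \<alpha>)"

lemma offset_Suc: "i < length \<alpha> \<Longrightarrow> offset (Suc i) = offset i + \<alpha> ! i"
  by (simp add: offset_def take_Suc_conv_app_nth)

lemma offset_mono: "i \<le> j \<Longrightarrow> offset i \<le> offset j"
proof -
  assume "i \<le> j"
  then have "take j \<alpha> = take i \<alpha> @ take (j - i) (drop i \<alpha>)"
    by (metis le_add_diff_inverse take_add)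
  then show ?thesis by (simp add: offset_def)
qed

lemma offset_length: "offset (length \<alpha>) = n"
  by (simp add: offset_def sum_list_eq)

lemma row_eqI: "i < length \<alpha> \<Longrightarrow> offset i \<le> k \<Longrightarrow> k < offset (Suc i) \<Longrightarrow> trow k = i"
  unfolding tab_row_def offset_def[symmetric]
  by (rule Least_equality) (auto simp: not_less_eq_eq dest: offset_mono intro: le_trans,
      metis le_trans not_less not_less_eq_eq offset_mono)

lemma row_props:
  assumes "k < n"
  shows "trow k < length \<alpha>" "offset (trow k) \<le> k" "k < offset (Suc (trow k))"
proof -
  have "\<alpha> \<noteq> []" using assms sum_list_eq by auto
  then have ex: "k < offset (Suc (length \<alpha> - 1))" using assms offset_length by simp
  have rk: "trow k = (LEAST i. k < offset (Suc i))" by (simp add: tab_row_def offset_def)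
  show "k < offset (Suc (trow k))" unfolding rk by (rule LeastI[of _ "length \<alpha> - 1"]) (rule ex)
  have "trow k \<le> length \<alpha> - 1" unfolding rk by (rule Least_le) (rule ex)
  then show "trow k < length \<alpha>" using \<open>\<alpha> \<noteq> []\<close> by (cases \<alpha>) auto
  show "offset (trow k) \<le> k"
  proof (cases "trow k")
    case 0
    then show ?thesis by (simp add: offset_def)
  next
    case (Suc m)
    then have "\<not> k < offset (Suc m)" using not_less_Least[of m "\<lambda>i. k < offset (Suc i)"] rk by simp
    then show ?thesis using Suc by simp
  qed
qed

lemma col_eq: "tcol k = k - offset (trow k)"
  by (simp add: tab_col_def offset_def)

lemma col_less: "k < n \<Longrightarrow> tcol k < \<alpha> ! trow k"
  using row_props[of k] offset_Suc[of "trow k"] by (simp add: col_eq)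

lemma cell_eqI: "k < n \<Longrightarrow> k' < n \<Longrightarrow> trow k = trow k' \<Longrightarrow> tcol k = tcol k' \<Longrightarrow> k = k'"
  using row_props(2)[of k] row_props(2)[of k'] by (simp add: col_eq)

lemma cell_exists:
  assumes "i < length \<alpha>" "j < \<alpha> ! i"
  obtains k where "k < n" "trow k = i" "tcol k = j"
proof
  have le: "offset i + j < offset (Suc i)" using assms by (simp add: offset_Suc)
  also have "\<dots> \<le> offset (length \<alpha>)" using assms by (intro offset_mono) simp
  finally show "offset i + j < n" by (simp add: offset_length)
  show r: "trow (offset i + j) = i" using assms le by (intro row_eqI) simp_all
  show "tcol (offset i + j) = j" by (simp add: col_eq r)
qed

text \<open>Row lengths weakly decrease downwards, so a column has no gap above one of its
  cells.\<close>

lemma cell_above: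
  assumes "k < n" "i \<le> trow k"
  obtains k' where "k' < n" "trow k' = i" "tcol k' = tcol k"
proof (rule cell_exists[of i "tcol k"])
  have rk: "trow k < length \<alpha>" by (rule row_props(1)[OF assms(1)])
  then show "i < length \<alpha>" using assms by simp
  have "\<alpha> ! trow k \<le> \<alpha> ! i"
    using decreasing rk assms(2) by (cases "i = trow k") (auto simp: sorted_wrt_iff_nth_less)
  then show "tcol k < \<alpha> ! i" using col_less[OF assms(1)] by simp
qed (use that in blast)

lemma col_lt_n: "k < n \<Longrightarrow> tcol k < n"
  by (simp add: col_eq)

lemma card_row: "card {k\<in>{..<n}. trow k = i} = (if i < length \<alpha> then \<alpha> ! i else 0)"
proof (cases "i < length \<alpha>")
  case True
  have "bij_betw tcol {k\<in>{..<n}. trow k = i} {..<\<alpha> ! i}"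
    unfolding bij_betw_def
  proof
    show "inj_on tcol {k\<in>{..<n}. trow k = i}" by (rule inj_onI) (auto intro: cell_eqI)
    show "tcol ` {k\<in>{..<n}. trow k = i} = {..<\<alpha> ! i}"
    proof (intro equalityI subsetI)
      fix j assume "j \<in> {..<\<alpha> ! i}"
      then obtain k where "k < n" "trow k = i" "tcol k = j" using cell_exists[OF True, of j] by auto
      then show "j \<in> tcol ` {k\<in>{..<n}. trow k = i}" by blast
    qed (use col_less in auto)
  qed
  from bij_betw_same_card[OF this] show ?thesis using True by simp
next
  case False
  then have "{k\<in>{..<n}. trow k = i} = {}" using row_props(1) by auto
  then show ?thesis using False by (simp only: if_False card.empty)
qed

definition col_cells :: "nat \<Rightarrow> nat set" where "col_cells j = {k\<in>{..<n}. tcol k = j}"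

lemma finite_col_cells: "finite (col_cells j)"
  by (simp add: col_cells_def)

lemma row_inj_on_col: "inj_on trow (col_cells j)"
  by (rule inj_onI) (auto simp: col_cells_def intro: cell_eqI)

text \<open>By \<open>cell_above\<close> the rows met by a column form an initial segment; rows
  separate the cells of a column, so its length is the number of cells.\<close>

lemma row_image_col: "trow ` col_cells j = {..<card (col_cells j)}"
proof -
  have down: "i \<in> trow ` col_cells j" if "i' \<in> trow ` col_cells j" "i \<le> i'" for i i'
  proof -
    from that obtain k where k: "k < n" "tcol k = j" "i \<le> trow k" by (auto simp: col_cells_def)
    then obtain k' where "k' < n" "trow k' = i" "tcol k' = tcol k" using cell_above by blast
    then show ?thesis using k by (auto simp: col_cells_def)
  qed
  define S where "S = trow ` col_cells j"
  have fin: "finite S" by (simp add: S_def finite_col_cells)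
  have card: "card S = card (col_cells j)" unfolding S_def by (rule card_image[OF row_inj_on_col])
  have "S = {..<card S}"
  proof (cases "S = {}")
    case False
    have "S = {..Max S}"
    proof (intro equalityI subsetI)
      fix i assume "i \<in> {..Max S}"
      then show "i \<in> S" using down[of "Max S" i] Max_in[OF fin False] by (auto simp: S_def)
    qed (use fin in auto)
    then have "card S = Suc (Max S)" by (metis card_atMost)
    then show ?thesis using \<open>S = {..Max S}\<close> by (simp add: lessThan_Suc_atMost)
  qed simp
  then show ?thesis using card by (simp add: S_def)
qed

lemma card_col_row_less: "card {k\<in>col_cells j. trow k < i} = min i (card (col_cells j))"
proof -
  have "card {k\<in>col_cells j. trow k < i} = card (trow ` {k\<in>col_cells j. trow k < i})"
    by (rule card_image[symmetric]) (rule inj_on_subset[OF row_inj_on_col], auto)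
  also have "trow ` {k\<in>col_cells j. trow k < i} = trow ` col_cells j \<inter> {..<i}" by auto
  also have "\<dots> = {..<min i (card (col_cells j))}" unfolding row_image_col by auto
  finally show ?thesis by simp
qed

text \<open>With \<open>f = trow \<circ> s\<close> the condition is that no two cells of one column
  are sent by \<open>s\<close> to a common row, which is the dichotomy in von Neumann's
  lemma.\<close>

definition rainbow :: "(nat \<Rightarrow> nat) \<Rightarrow> bool" where
  "rainbow f \<longleftrightarrow> (\<forall>j. inj_on f (col_cells j))"

lemma not_rainbowE:
  assumes "\<not> rainbow f"
  obtains k k' where "k < n" "k' < n" "k \<noteq> k'" "tcol k = tcol k'" "f k = f k'"
  using assms by (auto simp: rainbow_def inj_on_def col_cells_def)

lemma card_col_colour_less:
  assumes "rainbow f"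
  shows "card {k\<in>col_cells j. f k < i} \<le> min i (card (col_cells j))"
proof -
  have "card {k\<in>col_cells j. f k < i} \<le> card (col_cells j)"
    by (rule card_mono) (auto simp: finite_col_cells)
  moreover have "card {k\<in>col_cells j. f k < i} \<le> card {..<i}"
    by (rule card_inj_on_le[of f]) (use assms in \<open>auto simp: rainbow_def intro: inj_on_subset\<close>)
  ultimately show ?thesis by simp
qed

lemma card_colour_less_split: "card {k\<in>{..<n}. f k < i} = (\<Sum>j<n. card {k\<in>col_cells j. f k < i})"
proof -
  have "{k\<in>{..<n}. f k < i} = (\<Union>j<n. {k\<in>col_cells j. f k < i})"
    using col_lt_n by (auto simp: col_cells_def)
  then have "card {k\<in>{..<n}. f k < i} = card (\<Union>j<n. {k\<in>col_cells j. f k < i})" by simp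
  also have "\<dots> = (\<Sum>j<n. card {k\<in>col_cells j. f k < i})"
    by (rule card_UN_disjoint) (auto simp: finite_col_cells col_cells_def)
  finally show ?thesis .
qed

text \<open>In a column of length \<open>c\<close> at most \<open>min i c\<close> cells can carry
  distinct colours below \<open>i\<close>, and colouring by rows attains this. Summed over the
  columns it is a dominance inequality.\<close>

lemma rainbow_card_le:
  assumes "rainbow f"
  shows "card {k\<in>{..<n}. f k < i} \<le> card {k\<in>{..<n}. trow k < i}"
  unfolding card_colour_less_split[of f] card_colour_less_split[of trow]
  by (rule sum_mono) (use card_col_colour_less[OF assms] card_col_row_less in simp)

lemma col_grp_iff: "\<pi> \<in> C \<longleftrightarrow> \<pi> \<in> G \<and> (\<forall>k<n. tcol (\<pi> k) = tcol k)"
  by (simp add: col_grp_def sum_list_eq)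

lemma row_grp_iff: "\<pi> \<in> R \<longleftrightarrow> \<pi> \<in> G \<and> (\<forall>k<n. trow (\<pi> k) = trow k)"
  by (simp add: row_grp_def sum_list_eq)

text \<open>Equality in the dominance bound forces equality in every column, so a column of length
  \<open>c\<close> uses each of the colours \<open>0, ..., c - 1\<close> exactly once;
  \<open>q\<close> sorts the columns.\<close>

lemma rainbow_straighten:
  assumes rb: "rainbow f" and eq: "\<And>i. card {k\<in>{..<n}. f k < i} = card {k\<in>{..<n}. trow k < i}"
  obtains q where "q \<in> C" "\<And>k. k < n \<Longrightarrow> f (q k) = trow k"
proof -
  have col_eq: "card {k\<in>col_cells j. f k < i} = min i (card (col_cells j))" if "j < n" for i j
  proof -
    have "(\<Sum>j<n. min i (card (col_cells j)) - card {k\<in>col_cells j. f k < i}) = 0"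
      using eq[of i] card_col_colour_less[OF rb]
      unfolding card_colour_less_split[of f] card_colour_less_split[of trow] card_col_row_less
      by (subst sum_subtractf_nat) auto
    then show ?thesis using that card_col_colour_less[OF rb, of j i] by (simp add: le_antisym)
  qed
  have img: "f ` col_cells j = trow ` col_cells j" if "j < n" for j
  proof -
    have "{k\<in>col_cells j. f k < card (col_cells j)} = col_cells j"
      using col_eq[OF that, of "card (col_cells j)"]
      by (intro card_subset_eq finite_col_cells) auto
    then have "f ` col_cells j \<subseteq> {..<card (col_cells j)}" by blast
    moreover have "card (f ` col_cells j) = card (col_cells j)"
      using rb by (simp add: card_image rainbow_def)
    ultimately show ?thesis unfolding row_image_col by (intro card_subset_eq) auto
  qed
  have ex: "\<exists>k'<n. tcol k' = tcol k \<and> f k' = trow k" if "k < n" for k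
  proof -
    have "trow k \<in> f ` col_cells (tcol k)"
      unfolding img[OF col_lt_n[OF that]] using that by (auto simp: col_cells_def)
    then show ?thesis by (auto simp: col_cells_def)
  qed
  then obtain g where g: "\<And>k. k < n \<Longrightarrow> g k < n \<and> tcol (g k) = tcol k \<and> f (g k) = trow k" by metis
  define q where "q k = (if k < n then g k else k)" for k
  have inj: "inj_on q {..<n}"
  proof (rule inj_onI)
    fix k k' assume "k \<in> {..<n}" "k' \<in> {..<n}" "q k = q k'"
    then show "k = k'" using g[of k] g[of k'] cell_eqI[of k k'] by (simp add: q_def)
  qed
  have "q ` {..<n} \<subseteq> {..<n}" using g by (auto simp: q_def)
  then have "bij_betw q {..<n} {..<n}"
    using inj by (simp add: bij_betw_def endo_inj_surj)
  then have "q permutes {..<n}" by (rule bij_imp_permutes) (simp add: q_def)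
  then have "q \<in> C" using g by (simp add: col_grp_iff sym_grp_def q_def)
  then show ?thesis using that g by (simp add: q_def)
qed

lemma C_sub: "q \<in> C \<Longrightarrow> q \<in> G" and R_sub: "p \<in> R \<Longrightarrow> p \<in> G"
  by (simp_all add: col_grp_iff row_grp_iff)

lemmas G_comp = sym_grp_comp[where n = n] and G_inv = sym_grp_inv[where n = n]
  and G_inv_comp = sym_grp_inv_comp[where n = n] and G_inv_o [simp] = sym_grp_inv_o[where n = n]

lemma C_comp: "q \<in> C \<Longrightarrow> q' \<in> C \<Longrightarrow> q \<circ> q' \<in> C"
  by (simp add: col_grp_iff G_comp sym_grp_lt)

lemma R_comp: "p \<in> R \<Longrightarrow> p' \<in> R \<Longrightarrow> p \<circ> p' \<in> R"
  by (simp add: row_grp_iff G_comp sym_grp_lt)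

lemma C_inv: "q \<in> C \<Longrightarrow> inv q \<in> C"
  unfolding col_grp_iff using G_inv sym_grp_lt G_inv_o(4) by metis

lemma R_inv: "p \<in> R \<Longrightarrow> inv p \<in> R"
  unfolding row_grp_iff using G_inv sym_grp_lt G_inv_o(4) by metis

lemma C_id: "id \<in> C" and R_id: "id \<in> R"
  by (simp_all add: col_grp_iff row_grp_iff sym_grp_id)

lemma finite_R: "finite R" and finite_C: "finite C"
  using finite_subset[OF _ finite_sym_grp, of _ n] R_sub C_sub by blast+

lemma R_Int_C:
  assumes "\<pi> \<in> R" "\<pi> \<in> C"
  shows "\<pi> = id"
proof
  fix k
  show "\<pi> k = id k"
  proof (cases "k < n")
    case True
    then show ?thesis using assms sym_grp_lt[of \<pi> n k]
      by (auto simp: row_grp_iff col_grp_iff intro: cell_eqI)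
  next
    case False
    then show ?thesis using assms permutes_not_in[of \<pi> "{..<n}" k]
      by (simp add: row_grp_iff sym_grp_def)
  qed
qed

lemma factor_unique:
  assumes "p \<in> R" "q \<in> C" "p' \<in> R" "q' \<in> C" "p \<circ> q = p' \<circ> q'"
  shows "p = p' \<and> q = q'"
proof -
  have G: "p \<in> G" "q \<in> G" "p' \<in> G" "q' \<in> G" using assms C_sub R_sub by auto
  have "inv p' \<circ> p = inv p' \<circ> (p \<circ> q) \<circ> inv q" using G by (simp add: comp_assoc)
  also have "\<dots> = q' \<circ> inv q" unfolding assms(5) using G by (simp add: o_assoc)
  finally have e: "inv p' \<circ> p = q' \<circ> inv q" .
  have "inv p' \<circ> p = id"
    by (rule R_Int_C) (use assms in \<open>simp_all add: R_comp R_inv C_comp C_inv e\<close>, simp add: R_comp R_inv flip: e)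
  then have "p' \<circ> (inv p' \<circ> p) = p'" "q' \<circ> inv q \<circ> q = q" using e by simp_all
  then show ?thesis using G by (simp add: o_assoc) (simp add: comp_assoc)
qed

lemma sum_R_right: "p \<in> R \<Longrightarrow> (\<Sum>x\<in>R. F (x \<circ> p)) = (\<Sum>x\<in>R. F x)"
  by (rule sum.reindex_bij_witness[of _ "\<lambda>x. x \<circ> inv p" "\<lambda>x. x \<circ> p"])
    (auto simp: R_comp R_inv comp_assoc R_sub)

lemma sum_C_left: "q \<in> C \<Longrightarrow> (\<Sum>x\<in>C. F (q \<circ> x)) = (\<Sum>x\<in>C. F x)"
  by (rule sum.reindex_bij_witness[of _ "\<lambda>x. inv q \<circ> x" "\<lambda>x. q \<circ> x"])
    (auto simp: C_comp C_inv o_assoc C_sub)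

lemma sum_C_right: "q \<in> C \<Longrightarrow> (\<Sum>x\<in>C. F (x \<circ> q)) = (\<Sum>x\<in>C. F x)"
  by (rule sum.reindex_bij_witness[of _ "\<lambda>x. x \<circ> inv q" "\<lambda>x. x \<circ> q"])
    (auto simp: C_comp C_inv comp_assoc C_sub)

lemma sum_C_inv: "(\<Sum>x\<in>C. F (inv x)) = (\<Sum>x\<in>C. F x)"
  by (rule sum.reindex_bij_witness[of _ inv inv]) (auto simp: C_inv C_sub)

lemma sum_R_inv: "(\<Sum>x\<in>R. F (inv x)) = (\<Sum>x\<in>R. F x)"
  by (rule sum.reindex_bij_witness[of _ inv inv]) (auto simp: R_inv R_sub)

lemma sgn_comp: "\<sigma> \<in> G \<Longrightarrow> \<tau> \<in> G \<Longrightarrow> sign (\<sigma> \<circ> \<tau>) = sign \<sigma> * sign \<tau>"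
  by (intro sign_compose) (auto simp: sym_grp_def permutation_permutes)

lemma sgn_inv: "\<sigma> \<in> G \<Longrightarrow> sign (inv \<sigma>) = sign \<sigma>"
  by (intro sign_inverse) (auto simp: sym_grp_def permutation_permutes)

lemma sgn_sq: "sign \<sigma> * sign \<sigma> = 1"
  by (simp add: sign_def)

text \<open>The coefficients of the Young symmetrizer, kept in the integers so that sums of squares
  can be compared; \<open>young_symmetrizer_eq\<close> gives the link with the complex-valued
  function.\<close>

definition c :: "(nat \<Rightarrow> nat) \<Rightarrow> int" where
  "c \<sigma> = (\<Sum>p\<in>R. \<Sum>q\<in>C. if p \<circ> q = \<sigma> then sign q else 0)"

lemma c_eq:
  assumes "p \<in> R" "q \<in> C"
  shows "c (p \<circ> q) = sign q"
proof -
  have "c (p \<circ> q) = (\<Sum>p'\<in>R. \<Sum>q'\<in>C. if p' = p \<and> q' = q then sign q else 0)"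
    unfolding c_def by (intro sum.cong refl) (use factor_unique assms in \<open>auto split: if_splits\<close>)
  also have "\<dots> = (\<Sum>p'\<in>R. if p' = p then (\<Sum>q'\<in>C. if q' = q then sign q else 0) else 0)"
    by (intro sum.cong refl) auto
  finally show ?thesis using assms by (simp add: finite_R finite_C)
qed

lemma c_id: "c id = 1"
  using c_eq[OF R_id C_id] by (simp add: sign_id)

lemma transpose_in_sym_grp: "k < n \<Longrightarrow> k' < n \<Longrightarrow> Transposition.transpose k k' \<in> G"
  by (simp add: sym_grp_def permutes_swap_id)

lemma transpose_in_C:
  "k < n \<Longrightarrow> k' < n \<Longrightarrow> tcol k = tcol k' \<Longrightarrow> Transposition.transpose k k' \<in> C"
  by (auto simp: col_grp_iff transpose_in_sym_grp Transposition.transpose_def)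

lemma transpose_in_R:
  "k < n \<Longrightarrow> k' < n \<Longrightarrow> trow k = trow k' \<Longrightarrow> Transposition.transpose k k' \<in> R"
  by (auto simp: row_grp_iff transpose_in_sym_grp Transposition.transpose_def)

text \<open>Von Neumann's lemma for Young symmetrizers: \<open>a s b = c(s) a b\<close> in the group algebra.\<close>

lemma sum_row_col_sandwich:
  assumes s: "s \<in> G"
  shows "(\<Sum>p\<in>R. \<Sum>q\<in>C. if p \<circ> s \<circ> q = w then sign q else 0) = c s * c w" (is "?L = _")
proof (cases "\<exists>p\<in>R. \<exists>q\<in>C. s = p \<circ> q")
  case True
  then obtain p0 q0 where s: "p0 \<in> R" "q0 \<in> C" "s = p0 \<circ> q0" by blast
  have "?L = (\<Sum>p\<in>R. \<Sum>q\<in>C. if (p \<circ> p0) \<circ> (q0 \<circ> q) = w then sign q0 * sign (q0 \<circ> q) else 0)"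
    using s by (intro sum.cong refl) (simp add: comp_assoc sgn_comp C_sub mult.assoc[symmetric] sgn_sq)
  also have "\<dots> = (\<Sum>p\<in>R. \<Sum>q\<in>C. if p \<circ> (q0 \<circ> q) = w then sign q0 * sign (q0 \<circ> q) else 0)"
    by (rule sum_R_right[OF s(1)])
  also have "\<dots> = (\<Sum>p\<in>R. \<Sum>q\<in>C. if p \<circ> q = w then sign q0 * sign q else 0)"
    by (intro sum.cong refl sum_C_left[OF s(2)])
  also have "\<dots> = sign q0 * c w"
    unfolding c_def sum_distrib_left by (intro sum.cong refl) simp
  also have "sign q0 = c s" using c_eq s by simp
  finally show ?thesis .
next
  case False
  have cs: "c s = 0" unfolding c_def by (intro sum.neutral ballI) (use False in auto)
  \<comment> \<open>Were \<open>trow \<circ> s\<close> rainbow, straightening by some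
    \<open>q\<close> in \<open>C\<close> would put \<open>s \<circ> q\<close> into \<open>R\<close>
    and give the excluded factorisation of \<open>s\<close>.\<close>
  have "\<not> rainbow (trow \<circ> s)"
  proof
    assume rb: "rainbow (trow \<circ> s)"
    have "card {k\<in>{..<n}. (trow \<circ> s) k < i} = card {k\<in>{..<n}. trow k < i}" for i
      by (rule bij_betw_same_card[of s], rule bij_betw_byWitness[of _ "inv s"])
        (use s in \<open>auto simp: sym_grp_lt G_inv[THEN sym_grp_lt]\<close>)
    then obtain q where q: "q \<in> C" "\<And>k. k < n \<Longrightarrow> (trow \<circ> s) (q k) = trow k"
      using rainbow_straighten[OF rb] by blast
    have "s \<circ> q \<in> R" using q s C_sub by (simp add: row_grp_iff G_comp)
    moreover have "s = (s \<circ> q) \<circ> inv q" using q C_sub by (simp add: comp_assoc)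
    ultimately show False using False C_inv[OF q(1)] by blast
  qed
  then obtain k k' where k: "k < n" "k' < n" "k \<noteq> k'" "tcol k = tcol k'" "trow (s k) = trow (s k')"
    by (rule not_rainbowE) auto
  \<comment> \<open>\<open>?t\<close> swaps two cells of a column, and \<open>?t'\<close> their
    images under \<open>s\<close>, which lie in one row. Moved through \<open>s\<close>, the
    transposition \<open>?t\<close> becomes \<open>?t'\<close>, which \<open>R\<close> absorbs,
    while the sign of \<open>q\<close> flips; so \<open>?L\<close> is its own negative.\<close>
  let ?t = "Transposition.transpose k k'" and ?t' = "Transposition.transpose (s k) (s k')"
  have t: "?t \<in> C" by (rule transpose_in_C) (use k in auto)
  have t': "?t' \<in> R" by (rule transpose_in_R) (use k s in \<open>auto simp: sym_grp_lt\<close>)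
  have "inj s" using s permutes_inj by (auto simp: sym_grp_def)
  then have st: "s \<circ> ?t = ?t' \<circ> s"
    by (auto simp: fun_eq_iff Transposition.transpose_def dest: injD)
  have sg: "sign (?t \<circ> q) = - sign q" if "q \<in> C" for q
    using that t k by (simp add: sgn_comp C_sub sign_swap_id)
  have "?L = (\<Sum>p\<in>R. \<Sum>q\<in>C. if p \<circ> s \<circ> (?t \<circ> q) = w then sign (?t \<circ> q) else 0)"
    by (intro sum.cong refl sum_C_left[OF t, symmetric])
  also have "\<dots> = (\<Sum>p\<in>R. \<Sum>q\<in>C. if (p \<circ> ?t') \<circ> s \<circ> q = w then - sign q else 0)"
  proof (intro sum.cong refl)
    fix p q :: "nat \<Rightarrow> nat" assume "q \<in> C"
    have "p \<circ> s \<circ> (?t \<circ> q) = p \<circ> (s \<circ> ?t) \<circ> q" by (simp add: comp_assoc)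
    also have "\<dots> = (p \<circ> ?t') \<circ> s \<circ> q" unfolding st by (simp add: comp_assoc)
    finally show "(if p \<circ> s \<circ> (?t \<circ> q) = w then sign (?t \<circ> q) else 0) =
        (if (p \<circ> ?t') \<circ> s \<circ> q = w then - sign q else 0)" using sg[OF \<open>q \<in> C\<close>] by simp
  qed
  also have "\<dots> = (\<Sum>p\<in>R. \<Sum>q\<in>C. if p \<circ> s \<circ> q = w then - sign q else 0)"
    by (rule sum_R_right[OF t'])
  also have "\<dots> = - ?L" unfolding sum_negf[symmetric] by (intro sum.cong refl) simp
  finally show ?thesis using cs by simp
qed

lemma sum_c_mult: "(\<Sum>u\<in>G. c u * F u) = (\<Sum>p\<in>R. \<Sum>q\<in>C. sign q * F (p \<circ> q))"
proof -
  have "(\<Sum>u\<in>G. c u * F u) = (\<Sum>u\<in>G. \<Sum>p\<in>R. \<Sum>q\<in>C. if p \<circ> q = u then sign q * F (p \<circ> q) else 0)"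
    unfolding c_def sum_distrib_right by (intro sum.cong refl) auto
  also have "\<dots> = (\<Sum>p\<in>R. \<Sum>u\<in>G. \<Sum>q\<in>C. if p \<circ> q = u then sign q * F (p \<circ> q) else 0)"
    by (rule sum.swap)
  also have "\<dots> = (\<Sum>p\<in>R. \<Sum>q\<in>C. \<Sum>u\<in>G. if p \<circ> q = u then sign q * F (p \<circ> q) else 0)"
    by (intro sum.cong refl sum.swap)
  also have "\<dots> = (\<Sum>p\<in>R. \<Sum>q\<in>C. sign q * F (p \<circ> q))"
    by (intro sum.cong refl) (simp add: finite_sym_grp G_comp R_sub C_sub)
  finally show ?thesis .
qed

text \<open>The scalar with \<open>y y = h y\<close> for the Young symmetrizer \<open>y\<close>, as
  \<open>c_convolution\<close> shows; it equals \<open>n!\<close> divided by the dimension of the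
  Specht module.\<close>

definition h :: int where "h = (\<Sum>q\<in>C. \<Sum>p\<in>R. sign q * c (q \<circ> p))"

lemma comp_eq_iff:
  assumes "u \<in> G" "v \<in> G" "w \<in> G"
  shows "v = inv u \<circ> w \<longleftrightarrow> u \<circ> v = w" and "v = w \<circ> inv u \<longleftrightarrow> v \<circ> u = w"
proof -
  have "v = inv u \<circ> w \<Longrightarrow> u \<circ> v = w" "u \<circ> v = w \<Longrightarrow> v = inv u \<circ> w"
    using assms by (auto simp: o_assoc)
  then show "v = inv u \<circ> w \<longleftrightarrow> u \<circ> v = w" by blast
  have "v = w \<circ> inv u \<Longrightarrow> v \<circ> u = w" "v \<circ> u = w \<Longrightarrow> v = w \<circ> inv u"
    using assms by (auto simp: comp_assoc)
  then show "v = w \<circ> inv u \<longleftrightarrow> v \<circ> u = w" by blast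
qed

text \<open>In \<open>y y\<close> the factors stand as \<open>p (q p') q'\<close>. Von Neumann's
  lemma, applied to the middle element \<open>q \<circ> p'\<close>, extracts the scalar
  \<open>c (q \<circ> p')\<close>, and the signed sum of these scalars is \<open>h\<close>.\<close>

lemma c_convolution:
  assumes w: "w \<in> G"
  shows "(\<Sum>u\<in>G. c u * c (inv u \<circ> w)) = h * c w"
proof -
  have "(\<Sum>u\<in>G. c u * c (inv u \<circ> w)) = (\<Sum>p\<in>R. \<Sum>q\<in>C. sign q * c (inv (p \<circ> q) \<circ> w))"
    by (rule sum_c_mult)
  also have "\<dots> = (\<Sum>p\<in>R. \<Sum>q\<in>C. \<Sum>p'\<in>R. \<Sum>q'\<in>C. if p \<circ> (q \<circ> p') \<circ> q' = w then sign q * sign q' else 0)"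
  proof (intro sum.cong refl)
    fix p q assume pq: "p \<in> R" "q \<in> C"
    show "sign q * c (inv (p \<circ> q) \<circ> w)
        = (\<Sum>p'\<in>R. \<Sum>q'\<in>C. if p \<circ> (q \<circ> p') \<circ> q' = w then sign q * sign q' else 0)"
      unfolding c_def sum_distrib_left
    proof (intro sum.cong refl)
      fix p' q' assume "p' \<in> R" "q' \<in> C"
      then have "p' \<circ> q' = inv (p \<circ> q) \<circ> w \<longleftrightarrow> p \<circ> q \<circ> (p' \<circ> q') = w"
        using pq w by (intro comp_eq_iff) (auto intro: G_comp R_sub C_sub)
      then show "sign q * (if p' \<circ> q' = inv (p \<circ> q) \<circ> w then sign q' else 0)
         = (if p \<circ> (q \<circ> p') \<circ> q' = w then sign q * sign q' else 0)"
        by (simp add: comp_assoc)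
    qed
  qed
  also have "\<dots> = (\<Sum>q\<in>C. \<Sum>p'\<in>R. \<Sum>p\<in>R. \<Sum>q'\<in>C. if p \<circ> (q \<circ> p') \<circ> q' = w then sign q * sign q' else 0)"
    by (subst sum.swap, rule sum.cong[OF refl], rule sum.swap)
  also have "\<dots> = (\<Sum>q\<in>C. \<Sum>p'\<in>R. sign q * (c (q \<circ> p') * c w))"
    by (intro sum.cong refl, subst sum_row_col_sandwich[symmetric])
      (auto simp: sum_distrib_left G_comp R_sub C_sub intro!: sum.cong)
  also have "\<dots> = h * c w"
    by (simp add: h_def sum_distrib_left mult_ac)
  finally show ?thesis .
qed

text \<open>The symmetrizer summed over conjugates. Up to inverting \<open>g\<close> it is the
  trace, on the whole group algebra, of left multiplication by \<open>g\<close> combined with right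
  multiplication by the symmetrizer, hence \<open>h\<close> times the character.\<close>

definition X :: "(nat \<Rightarrow> nat) \<Rightarrow> int" where
  "X g = (\<Sum>\<sigma>\<in>G. c (inv \<sigma> \<circ> g \<circ> \<sigma>))"

lemma c_inv:
  assumes v: "v \<in> G"
  shows "c (inv v) = (\<Sum>p\<in>R. \<Sum>q\<in>C. if q \<circ> p = v then sign q else 0)"
proof -
  have "c (inv v) = (\<Sum>p\<in>R. \<Sum>q\<in>C. if inv q \<circ> inv p = v then sign (inv q) else 0)"
    unfolding c_def
  proof (intro sum.cong refl)
    fix p q assume pq: "p \<in> R" "q \<in> C"
    have "p \<circ> q = inv v \<longleftrightarrow> inv (p \<circ> q) = v"
      using pq v G_inv_o(5)[OF v] G_inv_o(5)[OF G_comp[of p q]] R_sub C_sub by metis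
    then show "(if p \<circ> q = inv v then sign q else 0) = (if inv q \<circ> inv p = v then sign (inv q) else 0)"
      using pq by (simp add: G_inv_comp R_sub C_sub sgn_inv)
  qed
  also have "\<dots> = (\<Sum>p\<in>R. \<Sum>q\<in>C. if q \<circ> inv p = v then sign q else 0)"
    by (intro sum.cong refl sum_C_inv[where F = "\<lambda>q. if q \<circ> inv _ = v then sign q else 0"])
  also have "\<dots> = (\<Sum>p\<in>R. \<Sum>q\<in>C. if q \<circ> p = v then sign q else 0)"
    by (rule sum_R_inv[where F = "\<lambda>p. \<Sum>q\<in>C. if q \<circ> p = v then sign q else 0"])
  finally show ?thesis .
qed

text \<open>Inversion turns the products \<open>p \<circ> q\<close> into \<open>q \<circ> p\<close>
  without changing signs, and \<open>q \<circ> p\<close> is conjugate to \<open>p \<circ> q\<close>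
  by \<open>q\<close>. The conjugation is absorbed by the sum over \<open>\<sigma>\<close>.\<close>

lemma X_inv:
  assumes g: "g \<in> G"
  shows "X (inv g) = X g"
proof -
  have "X (inv g) = (\<Sum>\<sigma>\<in>G. \<Sum>p\<in>R. \<Sum>q\<in>C. if p \<circ> q = inv (\<sigma> \<circ> q) \<circ> g \<circ> (\<sigma> \<circ> q) then sign q else 0)"
    unfolding X_def
  proof (rule sum.cong[OF refl])
    fix \<sigma> assume s: "\<sigma> \<in> G"
    have "inv \<sigma> \<circ> inv g \<circ> \<sigma> = inv (inv \<sigma> \<circ> g \<circ> \<sigma>)"
      using s g by (simp add: G_inv_comp G_comp G_inv comp_assoc)
    then have "c (inv \<sigma> \<circ> inv g \<circ> \<sigma>) = (\<Sum>p\<in>R. \<Sum>q\<in>C. if q \<circ> p = inv \<sigma> \<circ> g \<circ> \<sigma> then sign q else 0)"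
      using s g by (simp add: c_inv G_comp G_inv)
    also have "\<dots> = (\<Sum>p\<in>R. \<Sum>q\<in>C. if p \<circ> q = inv (\<sigma> \<circ> q) \<circ> g \<circ> (\<sigma> \<circ> q) then sign q else 0)"
    proof (intro sum.cong refl if_cong)
      fix p q assume pq: "p \<in> R" "q \<in> C"
      then have pqG: "p \<in> G" "q \<in> G" by (simp_all add: R_sub C_sub)
      let ?v = "inv \<sigma> \<circ> g \<circ> \<sigma>"
      have v: "?v \<in> G" using s g by (intro G_comp G_inv)
      have "q \<circ> p = ?v \<longleftrightarrow> q \<circ> p \<circ> q = ?v \<circ> q"
      proof
        assume "q \<circ> p \<circ> q = ?v \<circ> q"
        then have "q \<circ> p \<circ> q \<circ> inv q = ?v \<circ> q \<circ> inv q" by simp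
        then show "q \<circ> p = ?v" using pqG by (simp add: comp_assoc)
      qed simp
      also have "\<dots> \<longleftrightarrow> q \<circ> (p \<circ> q) = ?v \<circ> q" by (simp add: comp_assoc)
      also have "\<dots> \<longleftrightarrow> p \<circ> q = inv q \<circ> (?v \<circ> q)"
        by (rule comp_eq_iff(1)[symmetric, OF pqG(2) G_comp[OF pqG] G_comp[OF v pqG(2)]])
      also have "inv q \<circ> (?v \<circ> q) = inv (\<sigma> \<circ> q) \<circ> g \<circ> (\<sigma> \<circ> q)"
        using pqG s by (simp add: G_inv_comp comp_assoc)
      finally show "q \<circ> p = ?v \<longleftrightarrow> p \<circ> q = inv (\<sigma> \<circ> q) \<circ> g \<circ> (\<sigma> \<circ> q)" .
    qed
    finally show "c (inv \<sigma> \<circ> inv g \<circ> \<sigma>) =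
      (\<Sum>p\<in>R. \<Sum>q\<in>C. if p \<circ> q = inv (\<sigma> \<circ> q) \<circ> g \<circ> (\<sigma> \<circ> q) then sign q else 0)" .
  qed
  also have "\<dots> = (\<Sum>p\<in>R. \<Sum>q\<in>C. \<Sum>\<sigma>\<in>G. if p \<circ> q = inv (\<sigma> \<circ> q) \<circ> g \<circ> (\<sigma> \<circ> q) then sign q else 0)"
    by (subst sum.swap, rule sum.cong[OF refl], rule sum.swap)
  also have "\<dots> = (\<Sum>p\<in>R. \<Sum>q\<in>C. \<Sum>\<sigma>\<in>G. if p \<circ> q = inv \<sigma> \<circ> g \<circ> \<sigma> then sign q else 0)"
    by (intro sum.cong refl sum_sym_grp_right[where f = "\<lambda>\<sigma>. if _ = inv \<sigma> \<circ> g \<circ> \<sigma> then _ else 0"] C_sub)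
  also have "\<dots> = (\<Sum>\<sigma>\<in>G. \<Sum>p\<in>R. \<Sum>q\<in>C. if p \<circ> q = inv \<sigma> \<circ> g \<circ> \<sigma> then sign q else 0)"
    by (subst (2) sum.swap, rule sum.cong[OF refl], rule sum.swap)
  also have "\<dots> = X g" by (simp add: X_def c_def)
  finally show ?thesis .
qed

lemma sum_conj:
  assumes "\<sigma> \<in> G"
  shows "(\<Sum>g\<in>G. F (inv \<sigma> \<circ> g \<circ> \<sigma>)) = (\<Sum>g\<in>G. F g)"
proof -
  have "(\<Sum>g\<in>G. F (inv \<sigma> \<circ> g \<circ> \<sigma>)) = (\<Sum>g\<in>G. F (inv \<sigma> \<circ> (g \<circ> \<sigma>)))" by (simp add: comp_assoc)
  also have "\<dots> = (\<Sum>g\<in>G. F (inv \<sigma> \<circ> g))" using assms by (rule sum_sym_grp_right)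
  also have "\<dots> = (\<Sum>g\<in>G. F g)" using assms by (intro sum_sym_grp_left G_inv)
  finally show ?thesis .
qed

lemma sum_class_fun_X:
  assumes F: "\<And>\<sigma> g. \<sigma> \<in> G \<Longrightarrow> g \<in> G \<Longrightarrow> F (inv \<sigma> \<circ> g \<circ> \<sigma>) = F g"
  shows "(\<Sum>g\<in>G. F g * X g) = fact n * (\<Sum>g\<in>G. F g * c g)"
proof -
  have "(\<Sum>g\<in>G. F g * X g) = (\<Sum>\<sigma>\<in>G. \<Sum>g\<in>G. F g * c (inv \<sigma> \<circ> g \<circ> \<sigma>))"
    unfolding X_def sum_distrib_left by (rule sum.swap)
  also have "\<dots> = (\<Sum>\<sigma>\<in>G. \<Sum>g\<in>G. F (inv \<sigma> \<circ> g \<circ> \<sigma>) * c (inv \<sigma> \<circ> g \<circ> \<sigma>))"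
    using F by (intro sum.cong refl) simp
  also have "\<dots> = (\<Sum>\<sigma>\<in>G. \<Sum>g\<in>G. F g * c g)"
    by (intro sum.cong refl sum_conj)
  finally show ?thesis by (simp add: card_sym_grp)
qed

lemma X_conj: "\<sigma> \<in> G \<Longrightarrow> X (inv \<sigma> \<circ> g \<circ> \<sigma>) = X g"
proof -
  assume s: "\<sigma> \<in> G"
  have "X (inv \<sigma> \<circ> g \<circ> \<sigma>) = (\<Sum>\<tau>\<in>G. c (inv (\<sigma> \<circ> \<tau>) \<circ> g \<circ> (\<sigma> \<circ> \<tau>)))"
    unfolding X_def using s by (intro sum.cong refl) (simp add: G_inv_comp comp_assoc)
  also have "\<dots> = X g" unfolding X_def by (rule sum_sym_grp_left[OF s])
  finally show ?thesis .
qed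

text \<open>Averaging reduces the claim to showing that the sum of \<open>X (inv g) * c g\<close> is
  \<open>h^2\<close>. Von Neumann's lemma separates the conjugating element \<open>z\<close>: the
  inner sum becomes \<open>c z\<close> times a sum of convolution type. Then
  \<open>c_convolution\<close> applies twice, at \<open>inv u\<close> and at
  \<open>id\<close>.\<close>

lemma sum_X_square: "(\<Sum>g\<in>G. (X g)\<^sup>2) = fact n * h\<^sup>2"
proof -
  have "(\<Sum>g\<in>G. (X g)\<^sup>2) = (\<Sum>g\<in>G. X (inv g) * X g)"
    by (intro sum.cong refl) (simp add: X_inv power2_eq_square)
  also have "\<dots> = fact n * (\<Sum>g\<in>G. X (inv g) * c g)"
  proof (rule sum_class_fun_X)
    fix \<sigma> g assume "\<sigma> \<in> G" "g \<in> G"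
    then show "X (inv (inv \<sigma> \<circ> g \<circ> \<sigma>)) = X (inv g)"
      by (simp add: X_inv X_conj G_comp G_inv)
  qed
  also have "(\<Sum>g\<in>G. X (inv g) * c g) = (\<Sum>z\<in>G. \<Sum>u\<in>G. c u * c (inv (inv z) \<circ> inv u \<circ> inv z))"
    unfolding X_def sum_distrib_right
    by (subst sum.swap, subst sum_sym_grp_inv[symmetric]) (simp add: mult.commute)
  also have "\<dots> = (\<Sum>z\<in>G. \<Sum>u\<in>G. c u * c (z \<circ> inv u \<circ> inv z))"
    by (intro sum.cong refl) simp
  also have "\<dots> = (\<Sum>z\<in>G. c z * (\<Sum>u\<in>G. c u * c (inv z \<circ> inv u)))"
  proof (rule sum.cong[OF refl])
    fix z assume z: "z \<in> G"
    have "(\<Sum>u\<in>G. c u * c (z \<circ> inv u \<circ> inv z))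
        = (\<Sum>p\<in>R. \<Sum>q\<in>C. sign q * c (z \<circ> inv (p \<circ> q) \<circ> inv z))" by (rule sum_c_mult)
    also have "\<dots> = (\<Sum>p\<in>R. \<Sum>q\<in>C. \<Sum>p'\<in>R. \<Sum>q'\<in>C.
        if p' \<circ> (q' \<circ> z \<circ> p) \<circ> q = z then sign q' * sign q else 0)"
    proof (intro sum.cong refl)
      fix p q assume pq: "p \<in> R" "q \<in> C"
      then have pqG: "p \<in> G" "q \<in> G" by (simp_all add: R_sub C_sub)
      show "sign q * c (z \<circ> inv (p \<circ> q) \<circ> inv z) = (\<Sum>p'\<in>R. \<Sum>q'\<in>C.
        if p' \<circ> (q' \<circ> z \<circ> p) \<circ> q = z then sign q' * sign q else 0)"
        unfolding c_def sum_distrib_left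
      proof (intro sum.cong refl)
        fix p' q' assume "p' \<in> R" "q' \<in> C"
        then have pq': "p' \<circ> q' \<in> G" by (simp add: G_comp R_sub C_sub)
        have pqz: "p \<circ> q \<in> G" using pqG by (rule G_comp)
        have "z \<circ> inv (p \<circ> q) \<circ> inv z = z \<circ> inv (z \<circ> (p \<circ> q))"
          using z pqG by (simp add: G_inv_comp G_comp comp_assoc)
        moreover have "p' \<circ> q' = z \<circ> inv (z \<circ> (p \<circ> q)) \<longleftrightarrow> p' \<circ> q' \<circ> (z \<circ> (p \<circ> q)) = z"
          by (rule comp_eq_iff(2)[OF G_comp[OF z pqz] pq' z])
        ultimately have "p' \<circ> q' = z \<circ> inv (p \<circ> q) \<circ> inv z \<longleftrightarrow> p' \<circ> q' \<circ> (z \<circ> (p \<circ> q)) = z"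
          by (simp only:)
        also have "p' \<circ> q' \<circ> (z \<circ> (p \<circ> q)) = p' \<circ> (q' \<circ> z \<circ> p) \<circ> q" by (simp add: comp_assoc)
        finally show "sign q * (if p' \<circ> q' = z \<circ> inv (p \<circ> q) \<circ> inv z then sign q' else 0)
          = (if p' \<circ> (q' \<circ> z \<circ> p) \<circ> q = z then sign q' * sign q else 0)"
          by (simp only: mult.commute[of "sign q"] if_distrib[of "\<lambda>x. x * sign q"] mult_zero_left)
      qed
    qed
    also have "\<dots> = (\<Sum>p\<in>R. \<Sum>q'\<in>C. \<Sum>p'\<in>R. \<Sum>q\<in>C.
        if p' \<circ> (q' \<circ> z \<circ> p) \<circ> q = z then sign q' * sign q else 0)"
      by (rule sum.cong[OF refl], subst sum.swap, subst (2) sum.swap, rule sum.swap)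
    \<comment> \<open>The element \<open>q' \<circ> z \<circ> p\<close> stands between a row and a
      column permutation, so the sandwich formula with \<open>w = z\<close> splits off
      \<open>c z\<close>.\<close>
    also have "\<dots> = (\<Sum>p\<in>R. \<Sum>q'\<in>C. sign q' * (c (q' \<circ> z \<circ> p) * c z))"
      using z by (intro sum.cong refl, subst sum_row_col_sandwich[symmetric])
        (auto simp: sum_distrib_left G_comp R_sub C_sub intro!: sum.cong)
    also have "\<dots> = c z * (\<Sum>p\<in>R. \<Sum>q'\<in>C. sign q' * c (q' \<circ> z \<circ> p))"
      by (simp add: sum_distrib_left mult_ac)
    also have "(\<Sum>p\<in>R. \<Sum>q'\<in>C. sign q' * c (q' \<circ> z \<circ> p)) = (\<Sum>u\<in>G. c u * c (inv z \<circ> inv u))"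
    proof -
      have "(\<Sum>p\<in>R. \<Sum>q'\<in>C. sign q' * c (q' \<circ> z \<circ> p)) = (\<Sum>p\<in>R. \<Sum>q'\<in>C. \<Sum>p1\<in>R. \<Sum>q1\<in>C.
          if p1 \<circ> q' \<circ> z \<circ> (p \<circ> q1) = id then sign q' * sign q1 else 0)"
      proof (intro sum.cong refl)
        fix p q' assume pq: "p \<in> R" "q' \<in> C"
        \<comment> \<open>The sandwich formula is read backwards with \<open>w = id\<close>, where
          \<open>c id = 1\<close>, in order to regroup the four permutations around
          \<open>z\<close>.\<close>
        then have "c (q' \<circ> z \<circ> p) = (\<Sum>p1\<in>R. \<Sum>q1\<in>C. if p1 \<circ> (q' \<circ> z \<circ> p) \<circ> q1 = id then sign q1 else 0)"
          using z by (subst sum_row_col_sandwich) (auto simp: c_id G_comp R_sub C_sub)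
        then show "sign q' * c (q' \<circ> z \<circ> p) = (\<Sum>p1\<in>R. \<Sum>q1\<in>C.
          if p1 \<circ> q' \<circ> z \<circ> (p \<circ> q1) = id then sign q' * sign q1 else 0)"
          by (simp add: sum_distrib_left comp_assoc if_distrib cong: if_cong)
      qed
      also have "\<dots> = (\<Sum>p1\<in>R. \<Sum>q'\<in>C. \<Sum>p\<in>R. \<Sum>q1\<in>C.
          if p1 \<circ> q' \<circ> z \<circ> (p \<circ> q1) = id then sign q' * sign q1 else 0)"
        by (subst sum.swap, subst (2) sum.swap, rule sum.swap)
      also have "\<dots> = (\<Sum>p1\<in>R. \<Sum>q'\<in>C. sign q' * c (inv z \<circ> inv (p1 \<circ> q')))"
        unfolding c_def sum_distrib_left
      proof (intro sum.cong refl)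
        fix p1 q' p q1 assume "p1 \<in> R" "q' \<in> C" "p \<in> R" "q1 \<in> C"
        then have u: "p1 \<circ> q' \<in> G" and v: "p \<circ> q1 \<in> G" by (simp_all add: G_comp R_sub C_sub)
        have "inv z \<circ> inv (p1 \<circ> q') = inv (p1 \<circ> q' \<circ> z) \<circ> id"
          using z u by (simp add: G_inv_comp)
        then have "p \<circ> q1 = inv z \<circ> inv (p1 \<circ> q') \<longleftrightarrow> p1 \<circ> q' \<circ> z \<circ> (p \<circ> q1) = id"
          by (simp only:) (rule comp_eq_iff(1)[OF G_comp[OF u z] v sym_grp_id])
        then show "(if p1 \<circ> q' \<circ> z \<circ> (p \<circ> q1) = id then sign q' * sign q1 else 0)
          = sign q' * (if p \<circ> q1 = inv z \<circ> inv (p1 \<circ> q') then sign q1 else 0)" by simp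
      qed
      also have "\<dots> = (\<Sum>u\<in>G. c u * c (inv z \<circ> inv u))" by (rule sum_c_mult[symmetric])
      finally show ?thesis .
    qed
    finally show "(\<Sum>u\<in>G. c u * c (z \<circ> inv u \<circ> inv z)) = c z * (\<Sum>u\<in>G. c u * c (inv z \<circ> inv u))" .
  qed
  also have "\<dots> = (\<Sum>u\<in>G. c u * (\<Sum>z\<in>G. c z * c (inv z \<circ> inv u)))"
    unfolding sum_distrib_left by (subst sum.swap) (simp add: mult_ac)
  also have "\<dots> = (\<Sum>u\<in>G. c u * (h * c (inv u \<circ> id)))"
    by (intro sum.cong refl) (simp add: c_convolution G_inv)
  also have "\<dots> = h * (\<Sum>u\<in>G. c u * c (inv u \<circ> id))"
    by (simp add: sum_distrib_left mult_ac)
  also have "\<dots> = h\<^sup>2" by (subst c_convolution) (simp_all add: sym_grp_id c_id power2_eq_square)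
  finally show ?thesis .
qed

end

section \<open>Young symmetrizers acting on colourings\<close>

context young
begin

lemma int_card_filter: "finite S \<Longrightarrow> int (card {x\<in>S. P x}) = (\<Sum>x\<in>S. if P x then 1 else 0)"
  by (simp flip: sum.inter_filter)

lemma mult_if_1: "a * (if P then 1 else 0) = (if P then a else (0::int))"
  by simp

definition act :: "(nat \<Rightarrow> nat) \<Rightarrow> (nat \<Rightarrow> nat) \<Rightarrow> nat \<Rightarrow> nat" where
  "act f \<sigma> = (\<lambda>k. if k < n then f (\<sigma> k) else undefined)"

lemma content_act:
  assumes "\<sigma> \<in> G"
  shows "content {..<n} (act f \<sigma>) = content {..<n} f"
proof
  fix i
  have "card {k\<in>{..<n}. act f \<sigma> k = i} = card {k\<in>{..<n}. f k = i}"
    by (rule bij_betw_same_card[of \<sigma>], rule bij_betw_byWitness[of _ "inv \<sigma>"])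
      (use assms in \<open>auto simp: act_def sym_grp_lt G_inv[THEN sym_grp_lt]\<close>)
  then show "content {..<n} (act f \<sigma>) i = content {..<n} f i" by (simp only: content_def)
qed

lemma act_colourings: "\<sigma> \<in> G \<Longrightarrow> f \<in> colourings l {..<n} \<beta> \<Longrightarrow> act f \<sigma> \<in> colourings l {..<n} \<beta>"
proof -
  assume s: "\<sigma> \<in> G" and f: "f \<in> colourings l {..<n} \<beta>"
  then have fl: "f k < l" if "k < n" for k using that by (simp add: colourings_def PiE_iff)
  have "act f \<sigma> \<in> {..<n} \<rightarrow>\<^sub>E {..<l}"
    using fl sym_grp_lt[OF s] by (simp add: act_def PiE_iff extensional_def)
  then show ?thesis using f content_act[OF s, of f] unfolding colourings_def by blast
qed

lemma act_fixed:
  assumes "\<sigma> \<in> G" "g \<in> G" "f \<in> fixed_colourings l n \<beta> g"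
  shows "act f \<sigma> \<in> fixed_colourings l n \<beta> (inv \<sigma> \<circ> g \<circ> \<sigma>)"
proof -
  have "act f \<sigma> ((inv \<sigma> \<circ> g \<circ> \<sigma>) k) = act f \<sigma> k" if "k < n" for k
    using assms that by (simp add: act_def fixed_colourings_def sym_grp_lt G_inv[THEN sym_grp_lt])
  then show ?thesis using assms by (simp add: fixed_colourings_def act_colourings)
qed

lemma card_fixed_conj:
  assumes s: "\<sigma> \<in> G" and g: "g \<in> G"
  shows "card (fixed_colourings l n \<beta> (inv \<sigma> \<circ> g \<circ> \<sigma>)) = card (fixed_colourings l n \<beta> g)"
proof -
  have "bij_betw (\<lambda>f. act f \<sigma>) (fixed_colourings l n \<beta> g) (fixed_colourings l n \<beta> (inv \<sigma> \<circ> g \<circ> \<sigma>))"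
  proof (rule bij_betw_byWitness[of _ "\<lambda>f. act f (inv \<sigma>)"])
    show "(\<lambda>f. act f (inv \<sigma>)) ` fixed_colourings l n \<beta> (inv \<sigma> \<circ> g \<circ> \<sigma>) \<subseteq> fixed_colourings l n \<beta> g"
    proof clarify
      fix f assume f: "f \<in> fixed_colourings l n \<beta> (inv \<sigma> \<circ> g \<circ> \<sigma>)"
      have "act f (inv \<sigma>) \<in> fixed_colourings l n \<beta> (inv (inv \<sigma>) \<circ> (inv \<sigma> \<circ> g \<circ> \<sigma>) \<circ> inv \<sigma>)"
        by (rule act_fixed[OF G_inv[OF s] _ f]) (intro G_comp G_inv s g)
      also have "inv (inv \<sigma>) \<circ> (inv \<sigma> \<circ> g \<circ> \<sigma>) \<circ> inv \<sigma> = (\<sigma> \<circ> inv \<sigma>) \<circ> g \<circ> (\<sigma> \<circ> inv \<sigma>)"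
        using s by (simp only: G_inv_o(5) comp_assoc)
      also have "\<dots> = g" using s by simp
      finally show "act f (inv \<sigma>) \<in> fixed_colourings l n \<beta> g" .
    qed
  qed (use s g act_fixed in \<open>auto simp: act_def fixed_colourings_def colourings_def PiE_iff extensional_def
      sym_grp_lt G_inv[THEN sym_grp_lt] fun_eq_iff\<close>)
  from bij_betw_same_card[OF this] show ?thesis by simp
qed

text \<open>The diagonal entry at \<open>f\<close> of the Young symmetrizer acting on colourings;
  its sum over the colourings of one content is the trace on that permutation module.\<close>

definition T :: "(nat \<Rightarrow> nat) \<Rightarrow> int" where
  "T f = (\<Sum>p\<in>R. \<Sum>q\<in>C. if \<forall>k<n. f (p (q k)) = f k then sign q else 0)"

lemma sum_card_fixed_X:
  "(\<Sum>g\<in>G. int (card (fixed_colourings l n \<beta> g)) * X g) = fact n * (\<Sum>f\<in>colourings l {..<n} \<beta>. T f)"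
proof -
  have fin: "finite (colourings l {..<n} \<beta>)" by (simp add: finite_colourings)
  have "(\<Sum>g\<in>G. int (card (fixed_colourings l n \<beta> g)) * X g)
      = fact n * (\<Sum>g\<in>G. int (card (fixed_colourings l n \<beta> g)) * c g)"
    by (rule sum_class_fun_X) (simp add: card_fixed_conj)
  also have "(\<Sum>g\<in>G. int (card (fixed_colourings l n \<beta> g)) * c g)
     = (\<Sum>g\<in>G. \<Sum>f\<in>colourings l {..<n} \<beta>. c g * (if \<forall>k<n. f (g k) = f k then 1 else 0))"
  proof (rule sum.cong[OF refl])
    fix g
    have "int (card (fixed_colourings l n \<beta> g)) = (\<Sum>f\<in>colourings l {..<n} \<beta>. if \<forall>k<n. f (g k) = f k then 1 else 0)"
      unfolding fixed_colourings_def by (rule int_card_filter[OF fin])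
    then show "int (card (fixed_colourings l n \<beta> g)) * c g
        = (\<Sum>f\<in>colourings l {..<n} \<beta>. c g * (if \<forall>k<n. f (g k) = f k then 1 else 0))"
      by (simp only: sum_distrib_left mult.commute[of _ "c g"])
  qed
  also have "\<dots> = (\<Sum>f\<in>colourings l {..<n} \<beta>. \<Sum>g\<in>G. c g * (if \<forall>k<n. f (g k) = f k then 1 else 0))"
    by (rule sum.swap)
  also have "\<dots> = (\<Sum>f\<in>colourings l {..<n} \<beta>. T f)"
    unfolding sum_c_mult unfolding T_def mult_if_1 o_apply by (rule refl)
  finally show ?thesis .
qed

text \<open>Two equally coloured cells in one column are exchanged by a transposition in
  \<open>C\<close> that fixes \<open>f\<close>; reindexing \<open>C\<close> by it changes every
  sign.\<close>

lemma T_not_rainbow: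
  assumes "\<not> rainbow f"
  shows "T f = 0"
proof -
  from assms obtain k0 k1 where k: "k0 < n" "k1 < n" "k0 \<noteq> k1" "tcol k0 = tcol k1" "f k0 = f k1"
    by (rule not_rainbowE)
  let ?t = "Transposition.transpose k0 k1"
  have t: "?t \<in> C" by (rule transpose_in_C) (use k in auto)
  have ft: "f (?t k) = f k" for k using k by (simp add: Transposition.transpose_def)
  have sg: "sign (q \<circ> ?t) = - sign q" if "q \<in> C" for q
    using that t k by (simp add: sgn_comp C_sub sign_swap_id)
  have iff: "(\<forall>k<n. f (p ((q \<circ> ?t) k)) = f k) \<longleftrightarrow> (\<forall>k<n. f (p (q k)) = f k)" for p q
  proof
    have tn: "?t k < n" if "k < n" for k using k that by (simp add: Transposition.transpose_def)
    assume a: "\<forall>k<n. f (p ((q \<circ> ?t) k)) = f k"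
    show "\<forall>k<n. f (p (q k)) = f k"
    proof (intro allI impI)
      fix k assume "k < n"
      then have "f (p ((q \<circ> ?t) (?t k))) = f (?t k)" using a tn by blast
      then show "f (p (q k)) = f k" by (simp add: ft)
    qed
  next
    assume a: "\<forall>k<n. f (p (q k)) = f k"
    show "\<forall>k<n. f (p ((q \<circ> ?t) k)) = f k"
    proof (intro allI impI)
      fix k' assume "k' < n"
      then have "?t k' < n" using k by (simp add: Transposition.transpose_def)
      then have "f (p (q (?t k'))) = f (?t k')" using a by blast
      then show "f (p ((q \<circ> ?t) k')) = f k'" by (simp only: ft o_apply)
    qed
  qed
  have "T f = (\<Sum>p\<in>R. \<Sum>q\<in>C. if \<forall>k<n. f (p ((q \<circ> ?t) k)) = f k then sign (q \<circ> ?t) else 0)"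
    unfolding T_def by (intro sum.cong refl sum_C_right[OF t, symmetric])
  also have "\<dots> = (\<Sum>p\<in>R. \<Sum>q\<in>C. - (if \<forall>k<n. f (p (q k)) = f k then sign q else 0))"
    unfolding iff by (intro sum.cong refl) (simp add: sg)
  also have "\<dots> = - T f" by (simp add: T_def sum_negf)
  finally show ?thesis by simp
qed

lemma card_less_eq_content:
  "int (card {k\<in>{..<n}. f k < i}) = (\<Sum>j<i. content {..<n} f j)"
proof -
  have "{k\<in>{..<n}. f k < i} = (\<Union>j<i. {k\<in>{..<n}. f k = j})" by auto
  then have "card {k\<in>{..<n}. f k < i} = card (\<Union>j<i. {k\<in>{..<n}. f k = j})" by (rule arg_cong)
  also have "\<dots> = (\<Sum>j<i. card {k\<in>{..<n}. f k = j})"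
    by (rule card_UN_disjoint) auto
  finally show ?thesis by (simp add: content_def)
qed

lemma content_row: "content {..<n} trow = part \<alpha>"
  by (rule ext) (simp only: content_def card_row part_def)

lemma not_rainbow_dominated:
  assumes "f \<in> colourings l {..<n} \<beta>" "(\<Sum>j<i. part \<alpha> j) < (\<Sum>j<i. \<beta> j)"
  shows "\<not> rainbow f"
proof
  assume "rainbow f"
  then have "int (card {k\<in>{..<n}. f k < i}) \<le> int (card {k\<in>{..<n}. trow k < i})"
    using rainbow_card_le by simp
  then show False using assms unfolding card_less_eq_content content_row by (simp add: colourings_def)
qed

definition tabloid :: "(nat \<Rightarrow> nat) \<Rightarrow> nat \<Rightarrow> nat" where "tabloid q = act trow (inv q)"

lemma length_le: "length \<alpha> \<le> n"
  using length_le_sum_list[of \<alpha>] partition by (auto simp: partitions_of_def)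

text \<open>Content \<open>part \<alpha>\<close> is the equality case of the dominance bound, so a
  rainbow colouring is the row colouring rearranged inside the columns.\<close>

lemma rainbow_colourings:
  "{f \<in> colourings n {..<n} (part \<alpha>). rainbow f} = tabloid ` C"
proof (intro equalityI subsetI)
  fix f assume f: "f \<in> {f \<in> colourings n {..<n} (part \<alpha>). rainbow f}"
  then have cf: "content {..<n} f = part \<alpha>" and ext: "f \<in> extensional {..<n}"
    by (auto simp: colourings_def PiE_iff)
  have "card {k\<in>{..<n}. f k < i} = card {k\<in>{..<n}. trow k < i}" for i
  proof -
    have "int (card {k\<in>{..<n}. f k < i}) = int (card {k\<in>{..<n}. trow k < i})"
      unfolding card_less_eq_content cf content_row ..
    then show ?thesis by simp
  qed
  then obtain q where q: "q \<in> C" "\<And>k. k < n \<Longrightarrow> f (q k) = trow k"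
    using rainbow_straighten[of f] f by blast
  have "f = tabloid q"
  proof
    fix k
    show "f k = tabloid q k"
    proof (cases "k < n")
      case True
      then have "inv q k < n" using q C_sub G_inv[THEN sym_grp_lt] by blast
      then show ?thesis using q(2)[of "inv q k"] True C_sub[OF q(1)] by (simp add: tabloid_def act_def)
    next
      case False
      then show ?thesis using ext by (simp add: tabloid_def act_def extensional_def)
    qed
  qed
  then show "f \<in> tabloid ` C" using q by blast
next
  fix f assume "f \<in> tabloid ` C"
  then obtain q where q: "q \<in> C" "f = tabloid q" by blast
  then have qG: "inv q \<in> G" by (simp add: C_sub G_inv)
  have "f \<in> {..<n} \<rightarrow>\<^sub>E {..<n}"
  proof -
    have "trow (inv q k) < n" if "k < n" for k
      using row_props(1)[of "inv q k"] length_le sym_grp_lt[OF qG] that by fastforce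
    then show ?thesis by (auto simp: q tabloid_def act_def PiE_iff extensional_def)
  qed
  moreover have "content {..<n} f = part \<alpha>"
    unfolding q(2) tabloid_def content_act[OF qG] content_row ..
  moreover have "rainbow f"
    unfolding rainbow_def
  proof (intro allI inj_onI)
    fix j k k' assume kk: "k \<in> col_cells j" "k' \<in> col_cells j" "f k = f k'"
    then have kn: "k < n" "k' < n" "tcol k = tcol k'" by (auto simp: col_cells_def)
    then have "trow (inv q k) = trow (inv q k')" using kk by (simp add: q tabloid_def act_def)
    moreover have "tcol (inv q k) = tcol (inv q k')"
      using C_inv[OF q(1)] kn by (simp add: col_grp_iff)
    ultimately have "inv q k = inv q k'" using kn sym_grp_lt[OF qG] cell_eqI by blast
    then have "q (inv q k) = q (inv q k')" by simp
    then show "k = k'" using C_sub[OF q(1)] by simp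
  qed
  ultimately show "f \<in> {f \<in> colourings n {..<n} (part \<alpha>). rainbow f}" by (simp add: colourings_def)
qed

text \<open>The stabiliser of the row colouring is \<open>R\<close>, and \<open>tabloid q\<close> is
  its translate by \<open>q\<close>, so its stabiliser is the conjugate of \<open>R\<close> by
  \<open>q\<close>.\<close>

lemma row_fixed_iff:
  assumes "g \<in> G" "q \<in> C"
  shows "(\<forall>k<n. tabloid q (g k) = tabloid q k) \<longleftrightarrow> inv q \<circ> g \<circ> q \<in> R"
proof -
  have qG: "q \<in> G" "inv q \<in> G" using assms C_sub G_inv by auto
  have "(\<forall>k<n. tabloid q (g k) = tabloid q k) \<longleftrightarrow> (\<forall>k<n. trow (inv q (g k)) = trow (inv q k))"
    using assms by (simp add: tabloid_def act_def sym_grp_lt)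
  also have "\<dots> \<longleftrightarrow> (\<forall>k<n. trow (inv q (g (q k))) = trow k)"
  proof
    assume a: "\<forall>k<n. trow (inv q (g k)) = trow (inv q k)"
    show "\<forall>k<n. trow (inv q (g (q k))) = trow k"
    proof (intro allI impI)
      fix k assume "k < n"
      then have "q k < n" using qG sym_grp_lt by blast
      then have "trow (inv q (g (q k))) = trow (inv q (q k))" using a by blast
      then show "trow (inv q (g (q k))) = trow k" using qG by simp
    qed
  next
    assume a: "\<forall>k<n. trow (inv q (g (q k))) = trow k"
    show "\<forall>k<n. trow (inv q (g k)) = trow (inv q k)"
    proof (intro allI impI)
      fix k assume "k < n"
      then have "inv q k < n" using qG sym_grp_lt by blast
      then have "trow (inv q (g (q (inv q k)))) = trow (inv q k)" using a by blast
      then show "trow (inv q (g k)) = trow (inv q k)" using qG by simp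
    qed
  qed
  also have "\<dots> \<longleftrightarrow> inv q \<circ> g \<circ> q \<in> R"
    using assms qG by (simp add: row_grp_iff G_comp)
  finally show ?thesis .
qed

lemma inj_on_tabloid: "inj_on tabloid C"
proof (rule inj_onI)
  fix q q' assume q: "q \<in> C" "q' \<in> C" "tabloid q = tabloid q'"
  have G: "q \<in> G" "q' \<in> G" using q C_sub by auto
  have "inv q \<circ> q' \<in> R"
    unfolding row_grp_iff
  proof (intro conjI allI impI)
    show "inv q \<circ> q' \<in> G" using G by (intro G_comp G_inv)
    fix k assume k: "k < n"
    then have "q' k < n" using G sym_grp_lt by blast
    then have "trow (inv q (q' k)) = trow (inv q' (q' k))"
      using fun_cong[OF q(3), of "q' k"] by (simp add: tabloid_def act_def)
    then show "trow ((inv q \<circ> q') k) = trow k" using G by simp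
  qed
  moreover have "inv q \<circ> q' \<in> C" using q by (intro C_comp C_inv)
  ultimately have "inv q \<circ> q' = id" by (rule R_Int_C)
  then have "q \<circ> (inv q \<circ> q') = q" by simp
  then show "q = q'" using G by (simp add: o_assoc)
qed

text \<open>Only the colourings \<open>tabloid q0\<close> contribute. Stability of
  \<open>tabloid q0\<close> under \<open>p \<circ> q\<close> means that
  \<open>p \<circ> q \<circ> q0 = q0 \<circ> p'\<close> with \<open>p'\<close> in \<open>R\<close>,
  and substituting \<open>q\<close> for \<open>q \<circ> q0\<close> produces the double sum that
  defines \<open>h\<close>.\<close>

lemma sum_T_part: "(\<Sum>f\<in>colourings n {..<n} (part \<alpha>). T f) = h"
proof -
  have "(\<Sum>f\<in>colourings n {..<n} (part \<alpha>). T f) = (\<Sum>f\<in>{f \<in> colourings n {..<n} (part \<alpha>). rainbow f}. T f)"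
    by (rule sum.mono_neutral_right) (auto simp: finite_colourings T_not_rainbow)
  also have "\<dots> = (\<Sum>q0\<in>C. T (tabloid q0))"
    unfolding rainbow_colourings by (simp add: sum.reindex[OF inj_on_tabloid])
  also have "\<dots> = (\<Sum>q0\<in>C. \<Sum>p\<in>R. \<Sum>q\<in>C. \<Sum>p'\<in>R. if p \<circ> (q \<circ> q0) = q0 \<circ> p' then sign q else 0)"
    unfolding T_def
  proof (intro sum.cong refl)
    fix q0 p q assume q0: "q0 \<in> C" and pq: "p \<in> R" "q \<in> C"
    have G: "q0 \<in> G" "p \<in> G" "q \<in> G" using q0 pq C_sub R_sub by auto
    have pqG: "p \<circ> q \<in> G" using G by (intro G_comp)
    have "(\<forall>k<n. tabloid q0 (p (q k)) = tabloid q0 k) \<longleftrightarrow> inv q0 \<circ> (p \<circ> q) \<circ> q0 \<in> R"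
      using row_fixed_iff[OF pqG q0] by simp
    moreover have "p \<circ> (q \<circ> q0) = q0 \<circ> p' \<longleftrightarrow> p' = inv q0 \<circ> (p \<circ> q) \<circ> q0" if "p' \<in> R" for p'
    proof -
      have "p' = inv q0 \<circ> (p \<circ> q \<circ> q0) \<longleftrightarrow> q0 \<circ> p' = p \<circ> q \<circ> q0"
        by (rule comp_eq_iff(1)[OF G(1) R_sub[OF that] G_comp[OF pqG G(1)]])
      then show ?thesis by (auto simp: comp_assoc)
    qed
    ultimately have "(\<Sum>p'\<in>R. if p \<circ> (q \<circ> q0) = q0 \<circ> p' then sign q else 0)
      = (\<Sum>p'\<in>R. if p' = inv q0 \<circ> (p \<circ> q) \<circ> q0 then sign q else 0)" by (intro sum.cong refl) simp
    also have "\<dots> = (if \<forall>k<n. tabloid q0 (p (q k)) = tabloid q0 k then sign q else 0)"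
      using \<open>_ \<longleftrightarrow> inv q0 \<circ> (p \<circ> q) \<circ> q0 \<in> R\<close> by (simp add: finite_R)
    finally show "(if \<forall>k<n. tabloid q0 (p (q k)) = tabloid q0 k then sign q else 0)
      = (\<Sum>p'\<in>R. if p \<circ> (q \<circ> q0) = q0 \<circ> p' then sign q else 0)" ..
  qed
  also have "\<dots> = (\<Sum>q0\<in>C. \<Sum>p\<in>R. \<Sum>q\<in>C. \<Sum>p'\<in>R. if p \<circ> (q \<circ> q0) = q0 \<circ> p' then sign q0 * sign (q \<circ> q0) else 0)"
    by (intro sum.cong refl if_cong) (simp only: sgn_comp C_sub, simp add: sign_def)
  also have "\<dots> = (\<Sum>q0\<in>C. \<Sum>p\<in>R. \<Sum>q\<in>C. \<Sum>p'\<in>R. if p \<circ> q = q0 \<circ> p' then sign q0 * sign q else 0)"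
  proof (rule sum.cong[OF refl], rule sum.cong[OF refl])
    fix q0 p assume "q0 \<in> C"
    then show "(\<Sum>q\<in>C. \<Sum>p'\<in>R. if p \<circ> (q \<circ> q0) = q0 \<circ> p' then sign q0 * sign (q \<circ> q0) else 0)
      = (\<Sum>q\<in>C. \<Sum>p'\<in>R. if p \<circ> q = q0 \<circ> p' then sign q0 * sign q else 0)"
      by (rule sum_C_right[where F = "\<lambda>q. \<Sum>p'\<in>R. if p \<circ> q = q0 \<circ> p' then sign q0 * sign q else 0"])
  qed
  also have "\<dots> = (\<Sum>q0\<in>C. \<Sum>p\<in>R. \<Sum>p'\<in>R. \<Sum>q\<in>C. if p \<circ> q = q0 \<circ> p' then sign q0 * sign q else 0)"
    by (rule sum.cong[OF refl], rule sum.cong[OF refl], rule sum.swap)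
  also have "\<dots> = (\<Sum>q0\<in>C. \<Sum>p'\<in>R. \<Sum>p\<in>R. \<Sum>q\<in>C. if p \<circ> q = q0 \<circ> p' then sign q0 * sign q else 0)"
    by (rule sum.cong[OF refl], rule sum.swap)
  also have "\<dots> = h"
    unfolding h_def c_def sum_distrib_left by (simp only: if_distrib mult_zero_right eq_commute)
  finally show ?thesis .
qed

text \<open>The term for \<open>w\<close> is a trace on colourings of content \<open>a w\<close>. Up
  to and including the first point moved by \<open>w\<close>, the partial sum of \<open>a w\<close>
  exceeds that of the shape, so no rainbow colouring has this content and only \<open>w = id\<close>
  survives.\<close>

lemma sum_frob_X: "(\<Sum>g\<in>G. frob_char \<alpha> (cycle_type n g) * X g) = fact n * h"
proof -
  define a where "a w = (\<lambda>i. shape_exp \<alpha> i + int (w i))" for w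
  define W where "W = {w. w permutes {..<n}}"
  have finW: "finite W" by (simp add: W_def finite_permutations)
  have "(\<Sum>g\<in>G. frob_char \<alpha> (cycle_type n g) * X g)
      = (\<Sum>g\<in>G. \<Sum>w\<in>W. sign w * (int (card (fixed_colourings n n (a w) g)) * X g))"
    by (intro sum.cong refl, subst frob_char_cycle_type[of _ \<alpha>, unfolded sum_list_eq])
      (auto simp: W_def a_def sum_distrib_left mult_ac)
  also have "\<dots> = (\<Sum>w\<in>W. sign w * (\<Sum>g\<in>G. int (card (fixed_colourings n n (a w) g)) * X g))"
    by (subst sum.swap) (simp add: sum_distrib_left)
  also have "\<dots> = (\<Sum>w\<in>W. sign w * (fact n * (\<Sum>f\<in>colourings n {..<n} (a w). T f)))"
    by (simp only: sum_card_fixed_X)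
  also have "\<dots> = (\<Sum>w\<in>W. if w = id then fact n * h else 0)"
  proof (rule sum.cong[OF refl])
    fix w assume w: "w \<in> W"
    show "sign w * (fact n * (\<Sum>f\<in>colourings n {..<n} (a w). T f)) = (if w = id then fact n * h else 0)"
    proof (cases "w = id")
      case True
      have "a w = part \<alpha>" using True by (simp add: a_def shape_exp_eq fun_eq_iff)
      then show ?thesis using True sum_T_part by (simp add: sign_id)
    next
      case False
      from w obtain i where i: "i < n" "\<And>j. j < i \<Longrightarrow> w j = j" "i < w i"
        using permutes_first_moved[OF _ False, of n] by (auto simp: W_def)
      have "(\<Sum>j<i. a w j) = (\<Sum>j<i. part \<alpha> j)"
        by (intro sum.cong refl) (simp add: a_def shape_exp_eq i(2))
      then have lt: "(\<Sum>j<Suc i. part \<alpha> j) < (\<Sum>j<Suc i. a w j)"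
        using i(3) by (simp add: a_def shape_exp_eq)
      have "(\<Sum>f\<in>colourings n {..<n} (a w). T f) = 0"
        by (intro sum.neutral ballI T_not_rainbow not_rainbow_dominated[OF _ lt])
      then show ?thesis using False by simp
    qed
  qed
  also have "\<dots> = fact n * h" using finW by (simp add: sum.delta) (simp add: W_def permutes_id)
  finally show ?thesis .
qed

text \<open>Equality case of Cauchy-Schwarz: the inner products are \<open>n! h^2\<close> for
  \<open>X\<close> with itself, \<open>n! h\<close> for the mixed one and \<open>n!\<close> for
  \<open>frob_char\<close>, so a sum of integer squares over the group is zero.\<close>

theorem X_eq_frob_char:
  assumes "g \<in> G"
  shows "X g = h * frob_char \<alpha> (cycle_type n g)"
proof -
  let ?f = "\<lambda>g. frob_char \<alpha> (cycle_type n g)"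
  have "(\<Sum>g\<in>G. (X g - h * ?f g)\<^sup>2) = (\<Sum>g\<in>G. (X g)\<^sup>2 - 2 * h * (?f g * X g) + h\<^sup>2 * (?f g)\<^sup>2)"
    by (intro sum.cong refl) (simp add: power2_eq_square algebra_simps)
  also have "\<dots> = (\<Sum>g\<in>G. (X g)\<^sup>2) - 2 * h * (\<Sum>g\<in>G. ?f g * X g) + h\<^sup>2 * (\<Sum>g\<in>G. (?f g)\<^sup>2)"
    by (simp add: sum.distrib sum_subtractf sum_distrib_left)
  also have "\<dots> = 0"
    unfolding sum_X_square sum_frob_X sum_frob_char_square[OF partition] by (simp add: power2_eq_square)
  finally have "\<forall>g\<in>G. (X g - h * ?f g)\<^sup>2 = 0"
    by (subst (asm) sum_nonneg_eq_0_iff) (auto simp: finite_sym_grp)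
  then show ?thesis using assms by auto
qed

end

section \<open>Traces and the Specht module\<close>

lemma sum_fun_apply: "(\<Sum>a\<in>A. f a) x = (\<Sum>a\<in>A. f a x)"
  by (induction A rule: infinite_finite_induct) simp_all

text \<open>\<open>trace_on\<close> picks its basis from \<open>V\<close> alone, so a single
  \<open>B\<close> serves all operators. The finite spanning set makes \<open>B\<close>
  finite.\<close>

lemma trace_on_basis:
  assumes "finite S" "V = cfun.span S"
  obtains B where "finite B" "\<not> cfun.dependent B" "cfun.span B = V"
    "\<And>T. trace_on V T = (\<Sum>b\<in>B. cfun.representation B (T b) b)"
proof -
  obtain B0 where B0: "B0 \<subseteq> V" "\<not> cfun.dependent B0" "V \<subseteq> cfun.span B0"
    by (rule cfun.maximal_independent_subset)
  have "cfun.span B0 \<subseteq> V"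
    unfolding assms(2) by (rule cfun.span_minimal) (use B0(1) assms(2) in \<open>simp_all add: cfun.subspace_span\<close>)
  then have ex: "\<exists>B. \<not> cfun.dependent B \<and> cfun.span B = V" using B0 by blast
  define B where "B = (SOME B. \<not> cfun.dependent B \<and> cfun.span B = V)"
  have B: "\<not> cfun.dependent B \<and> cfun.span B = V" unfolding B_def by (rule someI_ex[OF ex])
  have "B \<subseteq> cfun.span S" using B assms(2) cfun.span_superset by blast
  then have "finite B" using cfun.independent_span_bound[OF assms(1)] B by blast
  moreover have "trace_on V T = (\<Sum>b\<in>B. cfun.representation B (T b) b)" for T
    by (simp add: trace_on_def B_def Let_def)
  ultimately show ?thesis using that B by blast
qed

text \<open>For an operator \<open>P\<close> onto \<open>V\<close> that acts on \<open>V\<close> as the scalar \<open>c\<close>, the trace of \<open>T\<close> on \<open>V\<close>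
  is read off from the diagonal of \<open>T P\<close> in the basis of point masses.\<close>

lemma trace_on_projection:
  fixes T P :: "('a \<Rightarrow> complex) \<Rightarrow> 'a \<Rightarrow> complex" and c :: complex
  assumes V: "finite S" "V = cfun.span S" and fin: "finite A"
    and supp: "\<And>x a. x \<in> V \<Longrightarrow> a \<notin> A \<Longrightarrow> x a = 0"
    and TP: "\<And>x y. T (x + y) = T x + T y" "\<And>r x. T (cscale r x) = cscale r (T x)"
    and P: "\<And>x y. P (x + y) = P x + P y" "\<And>r x. P (cscale r x) = cscale r (P x)"
    and TV: "\<And>x. x \<in> V \<Longrightarrow> T x \<in> V" and PV: "\<And>x. P x \<in> V" and Pc: "\<And>x. x \<in> V \<Longrightarrow> P x = cscale c x"
  shows "(\<Sum>a\<in>A. T (P (\<lambda>b. if b = a then 1 else 0)) a) = c * trace_on V T"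
proof -
  obtain B where B: "finite B" "\<not> cfun.dependent B" "cfun.span B = V"
    and tr: "\<And>T. trace_on V T = (\<Sum>b\<in>B. cfun.representation B (T b) b)"
    using trace_on_basis[OF V] by blast
  let ?r = "cfun.representation B"
  define d where "d a = (\<lambda>b. if b = a then 1 else 0 :: complex)" for a :: 'a
  have TP_sum: "T (P (\<Sum>a\<in>I. cscale (f a) (g a))) = (\<Sum>a\<in>I. cscale (f a) (T (P (g a))))"
    if "finite I" for I :: "'a set" and f g
  proof -
    have 0: "T (P 0) = 0"
      using TP(2)[of 0 "P 0"] P(2)[of 0 0] by (simp only: cfun.scale_zero_left)
    show ?thesis using that by (induction I rule: finite_induct) (simp_all add: 0 P TP del: plus_fun_apply zero_fun_apply)
  qed
  have in_V: "T (P x) \<in> cfun.span B" for x unfolding B(3) by (intro TV PV)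
  have expand: "b = (\<Sum>a\<in>A. cscale (b a) (d a))" if "b \<in> V" for b
  proof
    fix x
    have "(\<Sum>a\<in>A. cscale (b a) (d a)) x = (\<Sum>a\<in>A. if a = x then b a else 0)"
      unfolding sum_fun_apply by (intro sum.cong refl) (simp add: cscale_def d_def)
    then show "b x = (\<Sum>a\<in>A. cscale (b a) (d a)) x" using supp[OF that, of x] fin by simp
  qed
  have BV: "b \<in> V" if "b \<in> B" for b using that B(3) cfun.span_base by blast
  \<comment> \<open>The trace of \<open>T P\<close> is moved from point masses to the basis
    \<open>B\<close>: expand \<open>T (P (d a))\<close> in \<open>B\<close>, exchange the sums, and
    reassemble each \<open>b\<close> from its point masses.\<close>
  have "(\<Sum>a\<in>A. T (P (d a)) a) = (\<Sum>a\<in>A. \<Sum>b\<in>B. b a * ?r (T (P (d a))) b)"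
  proof (rule sum.cong[OF refl])
    fix a
    have "T (P (d a)) = (\<Sum>b\<in>B. cscale (?r (T (P (d a))) b) b)"
      by (rule cfun.sum_representation_eq[OF B(2) in_V B(1) order_refl, symmetric])
    then have "T (P (d a)) a = (\<Sum>b\<in>B. cscale (?r (T (P (d a))) b) b) a" by (rule fun_cong)
    then show "T (P (d a)) a = (\<Sum>b\<in>B. b a * ?r (T (P (d a))) b)"
      unfolding sum_fun_apply by (simp add: cscale_def mult.commute)
  qed
  also have "\<dots> = (\<Sum>b\<in>B. \<Sum>a\<in>A. b a * ?r (T (P (d a))) b)" by (rule sum.swap)
  also have "\<dots> = (\<Sum>b\<in>B. ?r (T (P b)) b)"
  proof (rule sum.cong[OF refl])
    fix b assume b: "b \<in> B"
    have "T (P b) = (\<Sum>a\<in>A. cscale (b a) (T (P (d a))))"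
      by (subst expand[OF BV[OF b]]) (rule TP_sum[OF fin])
    then have "?r (T (P b)) = (\<lambda>x. \<Sum>a\<in>A. ?r (cscale (b a) (T (P (d a)))) x)"
      by (simp only:) (rule cfun.representation_sum[OF B(2) cfun.span_scale[OF in_V]])
    then show "(\<Sum>a\<in>A. b a * ?r (T (P (d a))) b) = ?r (T (P b)) b"
      by (simp add: cfun.representation_scale[OF B(2) in_V])
  qed
  also have "\<dots> = (\<Sum>b\<in>B. c * ?r (T b) b)"
    by (intro sum.cong refl)
      (use BV TV B in \<open>simp add: Pc TP cfun.representation_scale[OF B(2)]\<close>)
  also have "\<dots> = c * trace_on V T" by (simp add: tr sum_distrib_left)
  finally show ?thesis by (simp add: d_def)
qed

context young
begin

lemma young_symmetrizer_eq: "young_symmetrizer \<alpha> \<sigma> = of_int (c \<sigma>)"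
proof -
  have "young_symmetrizer \<alpha> \<sigma> = (\<Sum>p\<in>R. \<Sum>q\<in>C. if p \<circ> q = \<sigma> then of_int (sign q) else 0)"
    unfolding young_symmetrizer_def sum_fun_apply
    by (intro sum.cong refl) (simp add: cscale_def ga_single_def)
  then show ?thesis by (simp add: c_def if_distrib cong: if_cong)
qed

lemma c_outside:
  assumes "\<sigma> \<notin> G"
  shows "c \<sigma> = 0"
proof -
  have "p \<circ> q \<noteq> \<sigma>" if "p \<in> R" "q \<in> C" for p q
    using G_comp[OF R_sub[OF that(1)] C_sub[OF that(2)]] assms by blast
  then show ?thesis unfolding c_def by simp
qed

text \<open>Right multiplication by the Young symmetrizer in the group algebra: it maps into the
  Specht module and acts on it as the scalar \<open>h\<close>.\<close>

definition right_mult :: "((nat \<Rightarrow> nat) \<Rightarrow> complex) \<Rightarrow> (nat \<Rightarrow> nat) \<Rightarrow> complex" where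
  "right_mult x = (\<lambda>\<sigma>. \<Sum>\<tau>\<in>G. x \<tau> * of_int (c (inv \<tau> \<circ> \<sigma>)))"

abbreviation "V \<equiv> specht_module \<alpha>"

lemma specht_eq: "V = cfun.span ((\<lambda>\<pi>. ga_lmult \<pi> (young_symmetrizer \<alpha>)) ` G)"
  by (simp add: specht_module_def sum_list_eq)

lemma ga_lmult_add: "ga_lmult \<pi> (x + y) = ga_lmult \<pi> x + ga_lmult \<pi> y"
  and ga_lmult_scale: "ga_lmult \<pi> (cscale r x) = cscale r (ga_lmult \<pi> x)"
  by (rule ext, simp add: ga_lmult_def cscale_def)+

lemma ga_lmult_comp: "\<sigma> \<in> G \<Longrightarrow> \<tau> \<in> G \<Longrightarrow> ga_lmult \<sigma> (ga_lmult \<tau> x) = ga_lmult (\<sigma> \<circ> \<tau>) x"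
  by (rule ext) (simp add: ga_lmult_def G_inv_comp comp_assoc)

lemma right_mult_add: "right_mult (x + y) = right_mult x + right_mult y"
  and right_mult_scale: "right_mult (cscale r x) = cscale r (right_mult x)"
  by (rule ext, simp add: right_mult_def cscale_def sum.distrib sum_distrib_left distrib_right mult.assoc)+

lemma right_mult_in: "right_mult x \<in> V"
proof -
  have "right_mult x = (\<Sum>\<tau>\<in>G. cscale (x \<tau>) (ga_lmult \<tau> (young_symmetrizer \<alpha>)))"
    by (rule ext) (simp add: sum_fun_apply right_mult_def cscale_def ga_lmult_def young_symmetrizer_eq)
  also have "\<dots> \<in> V"
    unfolding specht_eq by (intro cfun.span_sum cfun.span_scale cfun.span_base imageI)
  finally show ?thesis .
qed

lemma specht_induct [consumes 1, case_names zero step]: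
  assumes "x \<in> V" "Q 0"
    and "\<And>r \<pi> y. \<pi> \<in> G \<Longrightarrow> y \<in> V \<Longrightarrow> Q y \<Longrightarrow> Q (cscale r (ga_lmult \<pi> (young_symmetrizer \<alpha>)) + y)"
  shows "Q x"
proof -
  have "Q x \<and> x \<in> V"
    using assms(1) unfolding specht_eq
  proof (induction rule: cfun.span_induct_alt)
    case base
    then show ?case using assms(2) cfun.span_zero by blast
  next
    case (step r z y)
    then obtain \<pi> where "\<pi> \<in> G" "z = ga_lmult \<pi> (young_symmetrizer \<alpha>)" by blast
    then show ?case using assms(3)[of \<pi> y r] step unfolding specht_eq
      by (auto simp del: plus_fun_apply zero_fun_apply intro!: cfun.span_add cfun.span_scale intro: cfun.span_base)
  qed
  then show ?thesis by blast
qed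

lemma specht_support: "x \<in> V \<Longrightarrow> \<sigma> \<notin> G \<Longrightarrow> x \<sigma> = 0"
proof (induction rule: specht_induct)
  case (step r \<pi> y)
  have "inv \<pi> \<circ> \<sigma> \<notin> G"
  proof
    assume "inv \<pi> \<circ> \<sigma> \<in> G"
    then have "\<pi> \<circ> (inv \<pi> \<circ> \<sigma>) \<in> G" by (rule G_comp[OF step(1)])
    then show False using step by (simp add: o_assoc)
  qed
  then show ?case using step by (simp add: cscale_def ga_lmult_def young_symmetrizer_eq c_outside)
qed simp

lemma ga_lmult_specht:
  assumes "\<sigma> \<in> G" "x \<in> V"
  shows "ga_lmult \<sigma> x \<in> V"
  using assms(2)
proof (induction rule: specht_induct)
  case zero
  have "ga_lmult \<sigma> 0 = 0" by (simp add: ga_lmult_def fun_eq_iff)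
  then show ?case by (simp only: specht_eq cfun.span_zero)
next
  case (step r \<pi> y)
  then show ?case using assms(1)
    by (simp add: ga_lmult_add ga_lmult_scale ga_lmult_comp del: plus_fun_apply zero_fun_apply)
      (auto simp: specht_eq G_comp simp del: plus_fun_apply zero_fun_apply intro!: cfun.span_add cfun.span_scale intro: cfun.span_base)
qed

lemma right_mult_specht:
  assumes "x \<in> V"
  shows "right_mult x = cscale (of_int h) x"
  using assms
proof (induction rule: specht_induct)
  case zero
  then show ?case by (simp add: right_mult_def cscale_def fun_eq_iff)
next
  case (step r \<pi> y)
  let ?y = "young_symmetrizer \<alpha>"
  have "right_mult (ga_lmult \<pi> ?y) = cscale (of_int h) (ga_lmult \<pi> ?y)"
  proof
    fix \<sigma>
    have "right_mult (ga_lmult \<pi> ?y) \<sigma> = (\<Sum>\<tau>\<in>G. of_int (c (inv \<pi> \<circ> \<tau>)) * of_int (c (inv \<tau> \<circ> \<sigma>)))"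
      by (simp add: right_mult_def ga_lmult_def young_symmetrizer_eq)
    also have "\<dots> = (\<Sum>u\<in>G. of_int (c (inv \<pi> \<circ> (\<pi> \<circ> u))) * of_int (c (inv (\<pi> \<circ> u) \<circ> \<sigma>)))"
      by (rule sum_sym_grp_left[OF step(1), symmetric])
    also have "\<dots> = (\<Sum>u\<in>G. of_int (c u) * of_int (c (inv u \<circ> (inv \<pi> \<circ> \<sigma>))))"
      using step(1) by (intro sum.cong refl) (simp add: G_inv_comp o_assoc)
    also have "\<dots> = of_int (\<Sum>u\<in>G. c u * c (inv u \<circ> (inv \<pi> \<circ> \<sigma>)))" by simp
    also have "\<dots> = of_int (h * c (inv \<pi> \<circ> \<sigma>))"
    proof (cases "inv \<pi> \<circ> \<sigma> \<in> G")
      case True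
      then show ?thesis by (simp only: c_convolution)
    next
      case False
      have "c (inv u \<circ> (inv \<pi> \<circ> \<sigma>)) = 0" if "u \<in> G" for u
      proof (rule c_outside)
        show "inv u \<circ> (inv \<pi> \<circ> \<sigma>) \<notin> G"
        proof
          assume "inv u \<circ> (inv \<pi> \<circ> \<sigma>) \<in> G"
          then have "u \<circ> (inv u \<circ> (inv \<pi> \<circ> \<sigma>)) \<in> G" by (rule G_comp[OF that])
          then show False using False that by (simp add: o_assoc)
        qed
      qed
      then show ?thesis using c_outside[OF False] by simp
    qed
    also have "\<dots> = cscale (of_int h) (ga_lmult \<pi> ?y) \<sigma>"
      by (simp add: cscale_def ga_lmult_def young_symmetrizer_eq)
    finally show "right_mult (ga_lmult \<pi> ?y) \<sigma> = cscale (of_int h) (ga_lmult \<pi> ?y) \<sigma>" .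
  qed
  then show ?case using step
    by (simp add: right_mult_add right_mult_scale cfun.scale_right_distrib cfun.scale_left_commute del: plus_fun_apply zero_fun_apply)
qed

text \<open>\<open>right_mult\<close> takes the role of \<open>P\<close> in
  \<open>trace_on_projection\<close>, with scalar \<open>h\<close>. The diagonal entries of left
  multiplication by \<open>g\<close> after it are
  \<open>c (inv \<sigma> \<circ> inv g \<circ> \<sigma>)\<close>, and they sum to
  \<open>X (inv g) = X g\<close>.\<close>

lemma trace_specht:
  assumes g: "g \<in> G"
  shows "of_int (X g) = of_int h * irr_char \<alpha> g"
proof -
  have "(\<Sum>\<sigma>\<in>G. ga_lmult g (right_mult (\<lambda>\<tau>. if \<tau> = \<sigma> then 1 else 0)) \<sigma>) = of_int h * trace_on V (ga_lmult g)"
    by (rule trace_on_projection[OF _ specht_eq])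
      (simp_all add: finite_sym_grp specht_support ga_lmult_add ga_lmult_scale right_mult_add right_mult_scale
         ga_lmult_specht[OF g] right_mult_in right_mult_specht del: plus_fun_apply zero_fun_apply)
  also have "(\<Sum>\<sigma>\<in>G. ga_lmult g (right_mult (\<lambda>\<tau>. if \<tau> = \<sigma> then 1 else 0)) \<sigma>)
     = (\<Sum>\<sigma>\<in>G. of_int (c (inv \<sigma> \<circ> inv g \<circ> \<sigma>)))"
  proof (rule sum.cong[OF refl])
    fix \<sigma> assume s: "\<sigma> \<in> G"
    have "right_mult (\<lambda>\<tau>. if \<tau> = \<sigma> then 1 else 0) \<rho>
       = (\<Sum>\<tau>\<in>G. if \<tau> = \<sigma> then of_int (c (inv \<tau> \<circ> \<rho>)) else 0)" for \<rho>
      unfolding right_mult_def by (intro sum.cong refl) simp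
    then have "right_mult (\<lambda>\<tau>. if \<tau> = \<sigma> then 1 else 0) \<rho> = of_int (c (inv \<sigma> \<circ> \<rho>))" for \<rho>
      using s by (simp add: finite_sym_grp)
    then show "ga_lmult g (right_mult (\<lambda>\<tau>. if \<tau> = \<sigma> then 1 else 0)) \<sigma> = of_int (c (inv \<sigma> \<circ> inv g \<circ> \<sigma>))"
      by (simp add: ga_lmult_def comp_assoc)
  qed
  also have "\<dots> = of_int (X (inv g))" by (simp add: X_def)
  also have "X (inv g) = X g" by (rule X_inv[OF g])
  finally show ?thesis by (simp add: irr_char_def)
qed

text \<open>At the identity \<open>X\<close> is \<open>n!\<close>, which by
  \<open>trace_specht\<close> would vanish together with \<open>h\<close>.\<close>

lemma h_nonzero: "h \<noteq> 0"
proof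
  assume "h = 0"
  then have "X id = 0" using trace_specht[OF sym_grp_id] by simp
  moreover have "X id = fact n" by (simp add: X_def c_id card_sym_grp)
  ultimately show False by simp
qed

theorem irr_char_eq:
  assumes "g \<in> G"
  shows "irr_char \<alpha> g = of_int (frob_char \<alpha> (cycle_type n g))"
proof -
  have "of_int h * irr_char \<alpha> g = of_int h * of_int (frob_char \<alpha> (cycle_type n g))"
    unfolding trace_specht[OF assms, symmetric] X_eq_frob_char[OF assms] by (rule of_int_mult)
  then show ?thesis using h_nonzero by (simp only: mult_cancel_left of_int_eq_0_iff) blast
qed

end

section \<open>Permutations of prescribed cycle type\<close>

lemma cycle_type_add_cycle:
  assumes \<pi>: "\<pi> \<in> sym_grp n" and m: "m > 0"
  obtains \<pi>' where "\<pi>' \<in> sym_grp (n + m)" "cycle_type (n + m) \<pi>' = add_mset m (cycle_type n \<pi>)"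
proof -
  define \<rho> where "\<rho> x = (if x < n then \<pi> x else if x < n + m then (if Suc x = n + m then n else Suc x) else x)" for x
  have lt: "\<pi> x < n \<longleftrightarrow> x < n" for x using sym_grp_lt[OF \<pi>] .
  have inj\<pi>: "inj \<pi>" using \<pi> permutes_inj by (auto simp: sym_grp_def)
  have \<rho>_lt: "\<rho> x < n \<longleftrightarrow> x < n" for x by (simp add: \<rho>_def lt)
  have "inj_on \<rho> {..<n + m}"
  proof (rule inj_onI)
    fix x y assume xy: "x \<in> {..<n + m}" "y \<in> {..<n + m}" "\<rho> x = \<rho> y"
    then have iff: "x < n \<longleftrightarrow> y < n" using \<rho>_lt[of x] \<rho>_lt[of y] by simp
    show "x = y"
    proof (cases "x < n")
      case True
      then have "\<pi> x = \<pi> y" using xy(3) iff by (simp add: \<rho>_def)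
      then show ?thesis using inj\<pi> by (rule injD[rotated])
    next
      case False
      then show ?thesis using xy iff by (simp add: \<rho>_def split: if_splits)
    qed
  qed
  moreover have "\<rho> ` {..<n + m} \<subseteq> {..<n + m}"
  proof (intro image_subsetI)
    fix x assume "x \<in> {..<n + m}"
    then show "\<rho> x \<in> {..<n + m}" using lt[of x] by (cases "x < n") (simp_all add: \<rho>_def)
  qed
  ultimately have "bij_betw \<rho> {..<n + m} {..<n + m}" by (simp add: bij_betw_def endo_inj_surj)
  then have "\<rho> permutes {..<n + m}" by (rule bij_imp_permutes) (simp add: \<rho>_def)
  then have \<rho>: "\<rho> \<in> sym_grp (n + m)" by (simp add: sym_grp_def)
  have low: "x < n \<Longrightarrow> \<rho> x = \<pi> x" and mid: "n \<le> x \<Longrightarrow> Suc x < n + m \<Longrightarrow> \<rho> x = Suc x"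
    and last: "n \<le> x \<Longrightarrow> Suc x = n + m \<Longrightarrow> \<rho> x = n" for x
    by (simp_all add: \<rho>_def)
  have orb1: "orbit \<rho> x = orbit \<pi> x" if x: "x < n" for x
  proof -
    have "y \<in> orbit \<pi> x \<and> y < n" if "y \<in> orbit \<rho> x" for y
      using that
    proof (induction rule: orbit.induct)
      case base
      then show ?case using orbit.base[of \<pi> x] low[OF x] lt[of x] x by simp
    next
      case (step y)
      then show ?case using orbit.step[of y \<pi> x] low[of y] lt[of y] by simp
    qed
    moreover have "y \<in> orbit \<rho> x \<and> y < n" if "y \<in> orbit \<pi> x" for y
      using that
    proof (induction rule: orbit.induct)
      case base
      then show ?case using orbit.base[of \<rho> x] low[OF x] lt[of x] x by simp
    next
      case (step y)
      then show ?case using orbit.step[of y \<rho> x] low[of y] lt[of y] by simp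
    qed
    ultimately show ?thesis by blast
  qed
  have orb2: "orbit \<rho> x = {n..<n + m}" if x: "x \<in> {n..<n + m}" for x
  proof
    have block: "\<rho> y \<in> {n..<n + m}" if "y \<in> {n..<n + m}" for y
      using that mid[of y] last[of y] m by (cases "Suc y < n + m") auto
    show "orbit \<rho> x \<subseteq> {n..<n + m}"
    proof
      fix y assume "y \<in> orbit \<rho> x"
      then show "y \<in> {n..<n + m}"
        by (induction rule: orbit.induct) (rule block[OF x], erule block)
    qed
    \<comment> \<open>Backwards along the new cycle: \<open>d + 1\<close> steps lead from
      \<open>n + m - Suc d\<close> to \<open>n\<close>.\<close>
    have n_in: "n \<in> orbit \<rho> (n + m - Suc d)" if "d < m" for d
      using that
    proof (induction d)
      case 0
      then have "\<rho> (n + m - Suc 0) = n" by (intro last) simp_all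
      then show ?case using orbit.base[of \<rho> "n + m - Suc 0"] by simp
    next
      case (Suc d)
      then have "\<rho> (n + m - Suc (Suc d)) = Suc (n + m - Suc (Suc d))" by (intro mid) simp_all
      then have "\<rho> (n + m - Suc (Suc d)) = n + m - Suc d" using Suc.prems by simp
      then show ?case using Suc orbit_subset[of n \<rho> "n + m - Suc (Suc d)"] by simp
    qed
    have "n + m - Suc (n + m - Suc x) = x" "n + m - Suc x < m" using x by auto
    then have nx: "n \<in> orbit \<rho> x" using n_in[of "n + m - Suc x"] by simp
    have ni: "n + i \<in> orbit \<rho> x" if "i < m" for i
      using that
    proof (induction i)
      case (Suc i)
      then have "n + i \<in> orbit \<rho> x" by simp
      then have "\<rho> (n + i) \<in> orbit \<rho> x" by (rule orbit.step)
      then show ?case using Suc mid[of "n + i"] by simp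
    qed (use nx in simp)
    show "{n..<n + m} \<subseteq> orbit \<rho> x"
    proof
      fix y assume "y \<in> {n..<n + m}"
      then have "n + (y - n) = y" "y - n < m" by auto
      then show "y \<in> orbit \<rho> x" using ni[of "y - n"] by simp
    qed
  qed
  have sub: "orbit \<pi> x \<subseteq> {..<n}" if "x < n" for x
    by (rule permutes_orbit_subset[of _ "{..<n}"]) (use \<pi> that in \<open>simp_all add: sym_grp_def\<close>)
  have "{..<n + m} = {..<n} \<union> {n..<n + m}" by auto
  then have "orbit \<rho> ` {..<n + m} = orbit \<rho> ` {..<n} \<union> orbit \<rho> ` {n..<n + m}"
    by (simp only: image_Un)
  also have "orbit \<rho> ` {..<n} = orbit \<pi> ` {..<n}" using orb1 by (intro image_cong) auto
  also have "orbit \<rho> ` {n..<n + m} = (\<lambda>_. {n..<n + m}) ` {n..<n + m}"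
    by (rule image_cong[OF refl]) (rule orb2)
  also have "\<dots> = {{n..<n + m}}" using m by (simp add: image_constant_conv)
  finally have "orbit \<rho> ` {..<n + m} = insert {n..<n + m} (orbit \<pi> ` {..<n})" by simp
  moreover have "{n..<n + m} \<notin> orbit \<pi> ` {..<n}"
  proof
    assume "{n..<n + m} \<in> orbit \<pi> ` {..<n}"
    then obtain x where "x < n" "{n..<n + m} = orbit \<pi> x" by blast
    then have "{n..<n + m} \<subseteq> {..<n}" using sub[of x] by simp
    moreover have "n \<in> {n..<n + m}" using m by simp
    ultimately have "n \<in> {..<n}" by blast
    then show False by simp
  qed
  ultimately have "cycle_type (n + m) \<rho> = add_mset m (cycle_type n \<pi>)"
    by (simp add: cycle_type_def)
  then show ?thesis using that \<rho> by blast
qed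

text \<open>\<open>char_entry\<close> chooses a permutation of the given cycle type; appending one
  cycle per part shows that there is one to choose.\<close>

lemma cycle_type_exists: "0 \<notin> set ks \<Longrightarrow> \<exists>\<pi>\<in>sym_grp (sum_list ks). cycle_type (sum_list ks) \<pi> = mset ks"
proof (induction ks)
  case Nil
  then show ?case by (auto simp: cycle_type_def sym_grp_def permutes_id intro!: bexI[of _ id])
next
  case (Cons k ks)
  then obtain \<pi> where "\<pi> \<in> sym_grp (sum_list ks)" "cycle_type (sum_list ks) \<pi> = mset ks" by auto
  then show ?case using cycle_type_add_cycle[of \<pi> "sum_list ks" k] Cons.prems
    by (metis add.commute list.set_intros(1) mset.simps(2) not_gr_zero sum_list.Cons)
qed

text \<open>The right-hand side of \<open>irr_char_eq\<close> depends on the permutation only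
  through its cycle type, so whichever permutation \<open>SOME\<close> selects gives this
  value.\<close>

theorem char_entry_eq:
  assumes "\<alpha> \<in> partitions_of n" "\<beta> \<in> partitions_of n"
  shows "char_entry \<alpha> \<beta> = of_int (frob_char \<alpha> (mset \<beta>))"
proof -
  interpret young \<alpha> n by (rule young.intro[OF assms(1)])
  let ?P = "\<lambda>\<pi>. \<pi> \<in> sym_grp (sum_list \<alpha>) \<and> cycle_type (sum_list \<alpha>) \<pi> = mset \<beta>"
  have "\<exists>\<pi>. ?P \<pi>" using cycle_type_exists[of \<beta>] assms by (auto simp: partitions_of_def)
  define \<pi> where "\<pi> = (SOME \<pi>. ?P \<pi>)"
  from \<open>\<exists>\<pi>. ?P \<pi>\<close> have "?P \<pi>" unfolding \<pi>_def by (rule someI_ex)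
  then have "\<pi> \<in> sym_grp n" "cycle_type n \<pi> = mset \<beta>"
    unfolding sum_list_eq by blast+
  then have "irr_char \<alpha> \<pi> = of_int (frob_char \<alpha> (mset \<beta>))" using irr_char_eq[of \<pi>] by (simp only:)
  then show ?thesis unfolding char_entry_def \<pi>_def .
qed

lemma int_divisible_of_int: "int_divisible p (of_int k) \<longleftrightarrow> int p dvd k"
  by (simp only: int_divisible_def dvd_def of_int_eq_iff)

section \<open>The growth of the number of partitions\<close>

text \<open>With \<open>w = cosh^(1/3)\<close> the quotient \<open>sinh / w\<close> has derivative
  \<open>(2 w^2 + w^(-4)) / 3\<close>, which is at least 1 by the inequality of the means. This is
  the input for the monotonicity of \<open>\<G>\<close>.\<close>

lemma lazarevic:
  fixes y :: real
  assumes "y > 0"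
  shows "y ^ 3 * cosh y \<le> sinh y ^ 3"
proof -
  define w where "w y = cosh y powr (1/3)" for y :: real
  have w3: "w y ^ 3 = cosh y" and w1: "w y \<ge> 1" for y
  proof -
    show "w y \<ge> 1" unfolding w_def using cosh_real_ge_1[of y] by (intro ge_one_powr_ge_zero) auto
    have "w y ^ 3 = w y powr 3" using cosh_real_pos[of y] by (simp add: w_def powr_numeral)
    then show "w y ^ 3 = cosh y" using cosh_real_pos[of y] by (simp add: w_def powr_powr)
  qed
  define q where "q y = sinh y / w y" for y
  have w': "(w has_real_derivative (sinh y / (3 * w y ^ 2))) (at y)" for y
  proof -
    have "(w has_real_derivative (1/3) * cosh y powr (1/3 - 1) * sinh y) (at y)"
      unfolding w_def using cosh_real_pos[of y] by (auto intro!: derivative_eq_intros)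
    also have "cosh y powr (1/3 - 1) = w y / cosh y"
      using cosh_real_pos[of y] by (subst powr_diff) (simp_all add: w_def)
    also have "w y / cosh y = 1 / w y ^ 2" using w1[of y] by (simp add: w3[symmetric] field_simps power3_eq_cube power2_eq_square)
    finally show ?thesis by (simp add: field_simps)
  qed
  have q': "(q has_real_derivative ((2 * w y ^ 2 + 1 / w y ^ 4) / 3)) (at y)" for y
  proof -
    have "(q has_real_derivative ((cosh y * w y - sinh y * (sinh y / (3 * w y ^ 2))) / (w y * w y))) (at y)"
      unfolding q_def using w1[of y] by (auto intro!: derivative_eq_intros w')
    also have "(cosh y * w y - sinh y * (sinh y / (3 * w y ^ 2))) / (w y * w y)
      = (w y ^ 4 - (w y ^ 6 - 1) / (3 * w y ^ 2)) / w y ^ 2"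
    proof -
      have "sinh y * sinh y = w y ^ 6 - 1"
        using cosh_square_eq[of y] w3[of y] by (simp add: power2_eq_square flip: power_mult) (metis add_diff_cancel_right' mult_2 numeral_Bit0 power2_eq_square power_add w3)
      moreover have "cosh y * w y = w y ^ 4" by (simp add: w3[symmetric] flip: power_Suc2)
      ultimately show ?thesis by (simp add: power2_eq_square)
    qed
    also have "\<dots> = (2 * w y ^ 2 + 1 / w y ^ 4) / 3"
      using w1[of y] by (simp add: divide_simps)
    finally show ?thesis .
  qed
  have ge1: "(2 * w y ^ 2 + 1 / w y ^ 4) / 3 \<ge> 1" for y
  proof -
    define z where "z = w y ^ 2"
    have z: "z \<ge> 1" using w1[of y] by (simp add: z_def)
    \<comment> \<open>The product is \<open>2 z^3 - 3 z^2 + 1\<close>; its double root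
      \<open>z = 1\<close> corresponds to \<open>y = 0\<close>.\<close>
    have "0 \<le> (z - 1)\<^sup>2 * (2 * z + 1)" using z by simp
    then have "3 * z\<^sup>2 \<le> 2 * z ^ 3 + 1" by (simp add: power2_eq_square power3_eq_cube algebra_simps)
    then have "3 \<le> (2 * z ^ 3 + 1) / z\<^sup>2" using z by (simp add: pos_le_divide_eq)
    also have "\<dots> = 2 * z + 1 / z\<^sup>2" using z by (simp add: field_simps power2_eq_square power3_eq_cube)
    finally show ?thesis by (simp add: z_def flip: power_mult)
  qed
  have "q 0 - 0 \<le> q y - y"
  proof (rule DERIV_nonneg_imp_nondecreasing[of 0 y "\<lambda>y. q y - y"])
    fix x assume "0 \<le> x" "x \<le> y"
    have "((\<lambda>y. q y - y) has_real_derivative ((2 * w x ^ 2 + 1 / w x ^ 4) / 3 - 1)) (at x)"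
      by (auto intro!: derivative_eq_intros q')
    then show "\<exists>d. ((\<lambda>y. q y - y) has_real_derivative d) (at x) \<and> 0 \<le> d" using ge1[of x] by fastforce
  qed (use assms in simp)
  then have "y \<le> sinh y / w y" by (simp add: q_def)
  then have "y * w y \<le> sinh y" using w1[of y] by (simp add: pos_le_divide_eq)
  then have "(y * w y) ^ 3 \<le> sinh y ^ 3" using w1[of y] assms by (intro power_mono) auto
  then show ?thesis by (simp add: power_mult_distrib w3)
qed

text \<open>\<open>bose x\<close> is the sum of \<open>v exp (- v x)\<close> over
  \<open>v \<ge> 1\<close> when \<open>x > 0\<close>. \<open>\<G>\<close> subtracts it from its
  double pole, and \<open>\<Phi>\<close> is the antiderivative of \<open>\<G>\<close> that vanishes
  at infinity.\<close>

definition bose :: "real \<Rightarrow> real" where "bose x = exp (-x) / (1 - exp (-x))\<^sup>2"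
definition \<G> :: "real \<Rightarrow> real" where "\<G> x = 1 / x\<^sup>2 - bose x"
definition \<Phi> :: "real \<Rightarrow> real" where "\<Phi> x = 1 / (exp x - 1) - 1 / x"

lemma bose_sinh: "x > 0 \<Longrightarrow> bose x = 1 / (4 * (sinh (x / 2))\<^sup>2)"
proof -
  assume x: "x > 0"
  have "exp (-x) = exp (-(x/2)) ^ 2" by (simp add: power2_eq_square flip: exp_add)
  moreover have "1 - exp (-x) = exp (-(x/2)) * (2 * sinh (x / 2))"
    by (simp add: sinh_field_def algebra_simps flip: exp_add)
  ultimately have "bose x = exp (-(x/2)) ^ 2 / (exp (-(x/2)) * (2 * sinh (x / 2)))\<^sup>2"
    unfolding bose_def by (simp only:)
  then show ?thesis by (simp add: power_mult_distrib)
qed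

text \<open>Written with \<open>sinh\<close>, the sign of the derivative at \<open>z\<close> is
  \<open>lazarevic\<close> at \<open>z / 2\<close>.\<close>

lemma G_antimono:
  assumes "0 < x" "x \<le> y"
  shows "\<G> y \<le> \<G> x"
proof (rule DERIV_nonpos_imp_nonincreasing[OF assms(2)])
  fix z assume "x \<le> z" "z \<le> y"
  then have z: "z > 0" using assms by simp
  have s: "sinh (z/2) > 0" using z by simp
  have D: "((\<lambda>z. 1 / z\<^sup>2 - 1 / (4 * (sinh (z / 2))\<^sup>2)) has_real_derivative
      (cosh (z/2) / (4 * sinh (z/2) ^ 3) - 2 / z ^ 3)) (at z)"
    using z s by (auto intro!: derivative_eq_intros simp: field_simps power2_eq_square power3_eq_cube power4_eq_xxxx)
  have "(\<G> has_real_derivative (cosh (z/2) / (4 * sinh (z/2) ^ 3) - 2 / z ^ 3)) (at z)"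
    by (rule has_field_derivative_transform_within_open[OF D, of "{0<..}"]) (use z in \<open>auto simp: \<G>_def bose_sinh\<close>)
  moreover have "cosh (z/2) / (4 * sinh (z/2) ^ 3) - 2 / z ^ 3 \<le> 0"
    using lazarevic[of "z/2"] z s by (simp add: divide_simps) (simp add: field_simps)
  ultimately show "\<exists>d. (\<G> has_real_derivative d) (at z) \<and> d \<le> 0" by blast
qed

lemma Phi_deriv: "x > 0 \<Longrightarrow> (\<Phi> has_real_derivative \<G> x) (at x)"
proof -
  assume x: "x > 0"
  have e: "exp x - 1 > 0" "exp x > 0" using x by simp_all
  have "(\<Phi> has_real_derivative (- exp x / (exp x - 1)\<^sup>2 + 1 / x\<^sup>2)) (at x)"
    unfolding \<Phi>_def using x e by (auto intro!: derivative_eq_intros simp: power2_eq_square)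
  moreover have "bose x = exp x / (exp x - 1)\<^sup>2"
  proof -
    have "1 - exp (-x) = (exp x - 1) / exp x" by (simp add: exp_minus field_simps)
    then show ?thesis using e unfolding bose_def by (simp add: exp_minus power2_eq_square field_simps)
  qed
  ultimately show ?thesis by (simp add: \<G>_def algebra_simps)
qed

lemma Phi_diff:
  assumes "0 < x" "0 < t"
  shows "\<Phi> (x + t) - \<Phi> x \<le> t * \<G> x" "t * \<G> (x + t) \<le> \<Phi> (x + t) - \<Phi> x"
proof -
  have "\<exists>z. x < z \<and> z < x + t \<and> \<Phi> (x + t) - \<Phi> x = (x + t - x) * \<G> z"
    by (rule MVT2) (use assms Phi_deriv in auto)
  then obtain z where z: "x < z" "z < x + t" "\<Phi> (x + t) - \<Phi> x = t * \<G> z" by auto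
  show "\<Phi> (x + t) - \<Phi> x \<le> t * \<G> x" "t * \<G> (x + t) \<le> \<Phi> (x + t) - \<Phi> x"
    unfolding z(3) using z assms by (auto intro!: mult_left_mono G_antimono)
qed

lemma Phi_at_top: "(\<Phi> \<longlongrightarrow> 0) at_top"
  unfolding \<Phi>_def by real_asymp

lemma Phi_0: "(\<Phi> \<longlongrightarrow> -1/2) (at_right 0)"
  unfolding \<Phi>_def by real_asymp

lemma G_0: "((\<lambda>t. t * \<G> t) \<longlongrightarrow> 0) (at_right 0)"
  unfolding \<G>_def bose_def by real_asymp

lemma G_nonneg: "x > 0 \<Longrightarrow> 0 \<le> \<G> x"
proof -
  assume x: "x > 0"
  have "(\<G> \<longlongrightarrow> 0) at_top" unfolding \<G>_def bose_def by real_asymp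
  then show ?thesis
    by (rule tendsto_upperbound) (auto intro!: eventually_at_top_linorderI[of x] G_antimono x)
qed

lemma bose_nonneg: "0 \<le> bose x"
  by (simp add: bose_def)

text \<open>For \<open>t > 0\<close> this is the sum of \<open>\<sigma>(j) exp (- t j)\<close> over
  \<open>j \<ge> 1\<close>, with \<open>\<sigma>\<close> the divisor sum, arranged by the
  factorisations \<open>j = k v\<close>.\<close>

definition bose_sum :: "real \<Rightarrow> real" where "bose_sum t = suminf (\<lambda>k. bose (real (Suc k) * t))"

lemma zeta2: "(\<lambda>k. 1 / (real (Suc k) * t)\<^sup>2) sums (pi\<^sup>2 / 6 / t\<^sup>2)"
  using sums_divide[OF inverse_squares_sums, of "t\<^sup>2"] by (simp add: power_mult_distrib)

lemma bose_summable:
  assumes "t > 0"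
  shows "summable (\<lambda>k. bose (real (Suc k) * t))"
proof (rule summable_comparison_test[OF _ sums_summable[OF zeta2[of t]]], intro exI allI impI)
  fix k
  have "0 \<le> \<G> (real (Suc k) * t)" using assms by (intro G_nonneg) simp
  then show "norm (bose (real (Suc k) * t)) \<le> 1 / (real (Suc k) * t)\<^sup>2"
    using bose_nonneg by (simp add: \<G>_def)
qed

text \<open>A Riemann sum of the decreasing function \<open>\<G>\<close> with step \<open>t\<close>
  is compared with the increase 1/2 of \<open>\<Phi>\<close> from 0 to infinity. The resulting term
  \<open>- 1 / (2 t)\<close> of \<open>bose_sum\<close> is part of what puts the critical exponent
  of \<open>growth\<close> at 1.\<close>

lemma bose_sum_asymp: "((\<lambda>t. (bose_sum t - pi\<^sup>2 / 6 / t\<^sup>2) * t) \<longlongrightarrow> -1/2) (at_right 0)"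
proof (rule tendsto_sandwich)
  have sumG: "(\<lambda>k. \<G> (real (Suc k) * t)) sums (pi\<^sup>2 / 6 / t\<^sup>2 - bose_sum t)" if "t > 0" for t
    unfolding \<G>_def bose_sum_def by (intro sums_diff zeta2 summable_sums bose_summable that)
  have "\<Phi> t - t * \<G> t \<le> (bose_sum t - pi\<^sup>2 / 6 / t\<^sup>2) * t" if t: "t > 0" for t
  proof -
    \<comment> \<open>\<open>\<Phi>\<close> is used only at positive arguments, so the comparison
      starts at \<open>t\<close> and the term \<open>t * \<G> t\<close> is kept apart; it is the gap
      between the two bounds and tends to 0.\<close>
    have fin: "t * (\<Sum>k<N. \<G> (real (Suc (Suc k)) * t)) \<le> \<Phi> (real (Suc N) * t) - \<Phi> t" for N
    proof (induction N)
      case (Suc N)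
      have "t * \<G> (real (Suc N) * t + t) \<le> \<Phi> (real (Suc N) * t + t) - \<Phi> (real (Suc N) * t)"
        by (rule Phi_diff) (use t in auto)
      then show ?case using Suc by (simp add: algebra_simps)
    qed simp
    have "(\<lambda>N. \<Phi> (real (Suc N) * t) - \<Phi> t) \<longlonglongrightarrow> 0 - \<Phi> t"
      by (intro tendsto_diff tendsto_const filterlim_compose[OF Phi_at_top])
        (use t in real_asymp)
    moreover have "(\<lambda>k. \<G> (real (Suc (Suc k)) * t)) sums (pi\<^sup>2 / 6 / t\<^sup>2 - bose_sum t - \<G> t)"
      using sumG[OF t] by (subst sums_Suc_iff) simp
    then have "(\<lambda>N. t * (\<Sum>k<N. \<G> (real (Suc (Suc k)) * t))) \<longlonglongrightarrow> t * (pi\<^sup>2 / 6 / t\<^sup>2 - bose_sum t - \<G> t)"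
      unfolding sums_def by (intro tendsto_mult tendsto_const)
    ultimately have "t * (pi\<^sup>2 / 6 / t\<^sup>2 - bose_sum t - \<G> t) \<le> 0 - \<Phi> t"
      by (intro LIMSEQ_le[of "\<lambda>N. t * (\<Sum>k<N. \<G> (real (Suc (Suc k)) * t))"]) (use fin in auto)
    then show ?thesis by (simp add: algebra_simps)
  qed
  then show "\<forall>\<^sub>F t in at_right 0. \<Phi> t - t * \<G> t \<le> (bose_sum t - pi\<^sup>2 / 6 / t\<^sup>2) * t"
    by (intro eventually_at_rightI[of 0 1]) auto
  have "(bose_sum t - pi\<^sup>2 / 6 / t\<^sup>2) * t \<le> \<Phi> t" if t: "t > 0" for t
  proof -
    have fin: "\<Phi> (real (Suc N) * t) - \<Phi> t \<le> t * (\<Sum>k<N. \<G> (real (Suc k) * t))" for N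
    proof (induction N)
      case (Suc N)
      have "\<Phi> (real (Suc N) * t + t) - \<Phi> (real (Suc N) * t) \<le> t * \<G> (real (Suc N) * t)"
        by (rule Phi_diff) (use t in auto)
      then show ?case using Suc by (simp add: algebra_simps)
    qed simp
    have "(\<lambda>N. \<Phi> (real (Suc N) * t) - \<Phi> t) \<longlonglongrightarrow> 0 - \<Phi> t"
      by (intro tendsto_diff tendsto_const filterlim_compose[OF Phi_at_top])
        (use t in real_asymp)
    moreover have "(\<lambda>N. t * (\<Sum>k<N. \<G> (real (Suc k) * t))) \<longlonglongrightarrow> t * (pi\<^sup>2 / 6 / t\<^sup>2 - bose_sum t)"
      using sumG[OF t] unfolding sums_def by (intro tendsto_mult tendsto_const)
    ultimately have "0 - \<Phi> t \<le> t * (pi\<^sup>2 / 6 / t\<^sup>2 - bose_sum t)"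
      by (intro LIMSEQ_le[of "\<lambda>N. \<Phi> (real (Suc N) * t) - \<Phi> t"]) (use fin in auto)
    then show ?thesis by (simp add: algebra_simps)
  qed
  then show "\<forall>\<^sub>F t in at_right 0. (bose_sum t - pi\<^sup>2 / 6 / t\<^sup>2) * t \<le> \<Phi> t"
    by (intro eventually_at_rightI[of 0 1]) auto
  show "((\<lambda>t. \<Phi> t - t * \<G> t) \<longlongrightarrow> -1/2) (at_right 0)"
    using tendsto_diff[OF Phi_0 G_0] by simp
  show "(\<Phi> \<longlongrightarrow> -1/2) (at_right 0)" by (rule Phi_0)
qed

lemma bose_sum_asymp': "((\<lambda>t. bose_sum t * t\<^sup>2) \<longlongrightarrow> pi\<^sup>2 / 6) (at_right 0)"
proof -
  have "((\<lambda>t. (bose_sum t - pi\<^sup>2 / 6 / t\<^sup>2) * t * t + pi\<^sup>2 / 6) \<longlongrightarrow> pi\<^sup>2 / 6) (at_right 0)"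
    by (rule tendsto_eq_rhs[OF tendsto_add[OF tendsto_mult[OF bose_sum_asymp tendsto_ident_at] tendsto_const]]) simp
  then show ?thesis
    by (rule Lim_transform_eventually)
      (auto intro!: eventually_at_rightI[of 0 1] simp: field_simps power2_eq_square)
qed

abbreviation "posn \<equiv> {1::nat..}"

lemma has_sum_bose_sum:
  assumes t: "t > 0"
  shows "((\<lambda>(k, v). real v * exp (- t * real (k * v))) has_sum bose_sum t) (posn \<times> posn)"
proof -
  have inner: "((\<lambda>v. real v * exp (- t * real (k * v))) has_sum bose (real k * t)) posn" if k: "k \<in> posn" for k
  proof -
    define z where "z = exp (- (real k * t))"
    have z: "0 < z" "z < 1" using k t by (auto simp: z_def)
    have "(\<lambda>v. real (Suc v) * z ^ v) sums (1 / (1 - z)\<^sup>2)"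
      using geometric_deriv_sums[of z] z by simp
    then have "(\<lambda>v. z * (real (Suc v) * z ^ v)) sums (z * (1 / (1 - z)\<^sup>2))" by (rule sums_mult)
    then have "((\<lambda>v. z * (real (Suc v) * z ^ v)) has_sum (z * (1 / (1 - z)\<^sup>2))) UNIV"
      using z by (intro norm_summable_imp_has_sum) (auto simp: sums_iff)
    then have "((\<lambda>v. real v * z ^ v) has_sum (z * (1 / (1 - z)\<^sup>2))) (Suc ` UNIV)"
      by (subst has_sum_reindex) (auto simp: o_def mult_ac)
    moreover have "Suc ` UNIV = posn" by (auto simp: image_def) (metis Suc_le_D)
    moreover have "z ^ v = exp (- t * real (k * v))" for v
      by (simp add: z_def flip: exp_of_nat_mult)
    ultimately show ?thesis by (simp add: bose_def z_def)
  qed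
  have "(\<lambda>k. bose (real (Suc k) * t)) sums bose_sum t"
    unfolding bose_sum_def by (intro summable_sums bose_summable t)
  then have "((\<lambda>k. bose (real (Suc k) * t)) has_sum bose_sum t) UNIV"
    by (intro norm_summable_imp_has_sum) (use bose_summable[OF t] bose_nonneg in auto)
  then have "((\<lambda>k. bose (real k * t)) has_sum bose_sum t) (Suc ` UNIV)"
    by (subst has_sum_reindex) (auto simp: o_def)
  moreover have "Suc ` UNIV = posn" by (auto simp: image_def) (metis Suc_le_D)
  ultimately have outer: "((\<lambda>k. bose (real k * t)) has_sum bose_sum t) posn" by simp
  have "(\<lambda>(k, v). real v * exp (- t * real (k * v))) summable_on (posn \<times> posn)"
    by (rule summable_on_SigmaI[where g = "\<lambda>k. bose (real k * t)"])
      (use inner outer in \<open>auto simp: has_sum_imp_summable\<close>)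
  then show ?thesis
    by (intro has_sum_SigmaI[where g = "\<lambda>k. bose (real k * t)"]) (use inner outer in auto)
qed

text \<open>The index set of the recursion \<open>n p(n) = \<Sum> \<sigma>(j) p(n - j)\<close> with
  the divisor sum unfolded: \<open>k\<close> copies of a part \<open>v\<close>.\<close>

definition div_pairs :: "nat \<Rightarrow> (nat \<times> nat) set" where
  "div_pairs n = {(k, v). 1 \<le> k \<and> 1 \<le> v \<and> k * v \<le> n}"

lemma div_pairs_subset: "div_pairs n \<subseteq> posn \<times> posn"
  by (auto simp: div_pairs_def)

lemma finite_div_pairs: "finite (div_pairs n)"
proof (rule finite_subset)
  show "div_pairs n \<subseteq> {..n} \<times> {..n}"
  proof clarify
    fix k v assume "(k, v) \<in> div_pairs n"
    then have kv: "1 \<le> k" "1 \<le> v" "k * v \<le> n" by (auto simp: div_pairs_def)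
    have "k \<le> k * v" "v \<le> k * v" using kv by simp_all
    then show "k \<in> {..n} \<and> v \<in> {..n}" using kv(3) unfolding atMost_iff by (meson order_trans)
  qed
qed simp

text \<open>The exponential is that of the Hardy-Ramanujan asymptotics, and \<open>a\<close> is
  varied around the true exponent 1. The shift to \<open>real n + 1\<close> keeps the value at 0
  positive.\<close>

definition growth :: "real \<Rightarrow> nat \<Rightarrow> real" where
  "growth a n = exp (2 * pi / sqrt 6 * sqrt (real n)) * (real n + 1) powr (-a)"

lemma growth_pos: "growth a n > 0"
  by (simp add: growth_def)

text \<open>The saddle point: for \<open>n > 0\<close> it solves
  \<open>\<zeta>(2) / t^2 = n\<close>, and the exponent in \<open>growth\<close> equals
  \<open>2 n t\<close>.\<close>

definition tn :: "nat \<Rightarrow> real" where "tn n = pi / sqrt (6 * real n)"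

lemma tn_pos: "n > 0 \<Longrightarrow> tn n > 0"
  by (simp add: tn_def)

lemma tn_sq: "n > 0 \<Longrightarrow> real n = pi\<^sup>2 / 6 / (tn n)\<^sup>2"
  by (simp add: tn_def power_divide)

lemma exponent_tn: "n > 0 \<Longrightarrow> 2 * pi / sqrt 6 * sqrt (real n) = 2 * real n * tn n"
  by (simp add: tn_def real_sqrt_mult field_simps)

lemma filterlim_tn: "filterlim tn (at_right 0) sequentially"
  unfolding tn_def by real_asymp

section \<open>Inequalities for powers, square roots and exponentials\<close>

lemma powr_Bernoulli_le:
  assumes "0 \<le> a" "a \<le> 1" "(z::real) > 0"
  shows "z powr a \<le> 1 + a * (z - 1)"
proof -
  define m where "m = a * ln z"
  \<comment> \<open>The tangent to \<open>exp\<close> at \<open>m\<close>, the weighted mean of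
    \<open>ln z\<close> and 0; averaging it at these two points gives the weighted inequality of the
    means.\<close>
  have *: "exp m * (1 + (s - m)) \<le> exp s" for s
  proof -
    have "exp m * (1 + (s - m)) \<le> exp m * exp (s - m)"
      using exp_ge_add_one_self[of "s - m"] by (intro mult_left_mono) auto
    then show ?thesis by (simp flip: exp_add)
  qed
  have "a * (exp m * (1 + (ln z - m))) + (1 - a) * (exp m * (1 + (0 - m))) \<le> a * exp (ln z) + (1 - a) * exp 0"
    using assms by (intro add_mono mult_left_mono *) auto
  moreover have "a * (exp m * (1 + (ln z - m))) + (1 - a) * (exp m * (1 + (0 - m))) = exp m"
    by (simp add: m_def algebra_simps)
  ultimately show ?thesis using assms by (simp add: powr_def m_def algebra_simps)
qed

lemma powr_Bernoulli_ge:
  assumes "1 \<le> a" "(z::real) > 0"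
  shows "1 + a * (z - 1) \<le> z powr a"
proof -
  have "(z powr a) powr (1/a) \<le> 1 + (1/a) * (z powr a - 1)"
    by (rule powr_Bernoulli_le) (use assms in auto)
  then have "z \<le> 1 + (1/a) * (z powr a - 1)" using assms by (simp add: powr_powr)
  then show ?thesis using assms by (simp add: field_simps)
qed

lemma sqrt_1_minus_upper: "0 \<le> x \<Longrightarrow> x \<le> 1 \<Longrightarrow> sqrt (1 - x) \<le> 1 - x / 2 - x\<^sup>2 / (8::real)"
proof (rule real_le_lsqrt)
  assume x: "0 \<le> x" "x \<le> 1"
  have "x\<^sup>2 \<le> 1" using x by (simp add: power_le_one)
  then show "0 \<le> 1 - x / 2 - x\<^sup>2 / 8" using x by simp
  have "(1 - x / 2 - x\<^sup>2 / 8)\<^sup>2 = 1 - x + x ^ 3 / 8 + x ^ 4 / 64"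
    by (simp add: power2_eq_square power3_eq_cube power4_eq_xxxx algebra_simps)
  then show "1 - x \<le> (1 - x / 2 - x\<^sup>2 / 8)\<^sup>2" using x by simp
qed

text \<open>The quadratic Taylor polynomial squares to \<open>1 - x + x^3 / 8 + x^4 / 64\<close>;
  subtracting the generous term \<open>x^3 / 2\<close> outweighs this excess wherever the left-hand
  side is still positive.\<close>

lemma sqrt_1_minus_lower: "0 \<le> x \<Longrightarrow> x \<le> 1 \<Longrightarrow> 1 - x / 2 - x\<^sup>2 / 8 - x ^ 3 / 2 \<le> sqrt (1 - x :: real)"
proof (cases "1 - x / 2 - x\<^sup>2 / 8 - x ^ 3 / 2 \<le> 0")
  case False
  assume x: "0 \<le> x" "x \<le> 1"
  let ?p = "1 - x / 2 - x\<^sup>2 / 8"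
  have p0: "0 \<le> ?p - x ^ 3 / 2" using False by simp
  have "(?p - x ^ 3 / 2)\<^sup>2 = ?p\<^sup>2 - x ^ 3 / 2 * (?p + (?p - x ^ 3 / 2))"
    by (simp add: power2_eq_square algebra_simps)
  moreover have "?p\<^sup>2 = 1 - x + x ^ 3 / 8 + x ^ 4 / 64"
    by (simp add: power2_eq_square power3_eq_cube power4_eq_xxxx algebra_simps)
  moreover have "x ^ 4 / 64 \<le> x ^ 3 / 64" using x by (simp add: power_decreasing)
  moreover have "3/8 \<le> ?p + (?p - x ^ 3 / 2)"
  proof -
    have "x\<^sup>2 \<le> 1" using x by (simp add: power_le_one)
    then have "3/8 \<le> ?p" using x by simp
    then show ?thesis using p0 by simp
  qed
  then have "x ^ 3 / 2 * (3/8) \<le> x ^ 3 / 2 * (?p + (?p - x ^ 3 / 2))" using x by (intro mult_left_mono) auto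
  ultimately have "(?p - x ^ 3 / 2)\<^sup>2 \<le> 1 - x" using x zero_le_power[of x 3] by linarith
  then show ?thesis using p0 by (intro real_le_rsqrt) simp
next
  case True
  assume "0 \<le> x" "x \<le> 1"
  then show ?thesis using True order_trans[of _ 0 "sqrt (1 - x)"] by simp
qed

lemma exp_minus_le: "0 \<le> (u::real) \<Longrightarrow> exp (-u) \<le> 1 - u + u\<^sup>2 / 2"
proof -
  assume u: "0 \<le> u"
  have "1 - 0 + 0\<^sup>2 / 2 - exp (- 0) \<le> 1 - u + u\<^sup>2 / 2 - exp (-u)"
  proof (rule DERIV_nonneg_imp_nondecreasing[OF u])
    fix x :: real assume "0 \<le> x"
    have "((\<lambda>u. 1 - u + u\<^sup>2 / 2 - exp (-u)) has_real_derivative (-1 + x + exp (-x))) (at x)"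
      by (auto intro!: derivative_eq_intros)
    moreover have "0 \<le> -1 + x + exp (-x)" using exp_ge_add_one_self[of "-x"] by simp
    ultimately show "\<exists>d. ((\<lambda>u. 1 - u + u\<^sup>2 / 2 - exp (-u)) has_real_derivative d) (at x) \<and> 0 \<le> d" by blast
  qed
  then show ?thesis by simp
qed

text \<open>Error terms carry powers of \<open>x\<close>. Half of the exponential decay pays for
  them, so their sums are bounded by \<open>bose_sum (t / 2)\<close> times a power of
  \<open>1 / t\<close>.\<close>

lemma power_exp_le:
  assumes "t > 0" "x \<ge> (0::real)"
  shows "x ^ m * exp (-t * x) \<le> fact m * (2 / t) ^ m * exp (-(t / 2) * x)"
proof -
  define y where "y = t * x / 2"
  have y: "y \<ge> 0" using assms by (simp add: y_def)
  have "sum (\<lambda>i. y ^ i /\<^sub>R fact i) {m} \<le> exp y"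
    unfolding exp_def by (rule sum_le_suminf[OF summable_exp_generic]) (use y in simp_all)
  then have "y ^ m \<le> fact m * exp y" by (simp add: field_simps)
  then have "(2 / t) ^ m * y ^ m * exp (-t * x) \<le> (2 / t) ^ m * (fact m * exp y) * exp (-t * x)"
    using assms by (intro mult_right_mono mult_left_mono) auto
  moreover have "(2 / t) ^ m * y ^ m = x ^ m"
    unfolding power_mult_distrib[symmetric] using assms by (simp add: y_def)
  moreover have "exp y * exp (-t * x) = exp (-(t / 2) * x)" by (simp add: y_def flip: exp_add)
  ultimately show ?thesis by (simp only: mult.assoc mult.left_commute)
qed

text \<open>Difference quotients in \<open>t\<close> express the weight \<open>x\<close> here, and
  \<open>x^2\<close> in \<open>second_difference\<close>, through values \<open>exp (- s x)\<close>.
  The sums then involve \<open>bose_sum\<close> at nearby arguments instead of its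
  derivatives.\<close>

lemma first_difference:
  assumes "h > 0" "x \<ge> (0::real)"
  shows "x * exp (-t * x) \<le> (exp (-(t - h) * x) - exp (-t * x)) / h"
    and "(exp (-t * x) - exp (-(t + h) * x)) / h \<le> x * exp (-t * x)"
proof -
  have "exp (-t * x) * (1 + h * x) \<le> exp (-t * x) * exp (h * x)"
    using exp_ge_add_one_self[of "h * x"] by (intro mult_left_mono) auto
  also have "\<dots> = exp (-(t - h) * x)" by (simp add: algebra_simps flip: exp_add)
  finally show "x * exp (-t * x) \<le> (exp (-(t - h) * x) - exp (-t * x)) / h"
    using assms by (simp add: field_simps)
  have "exp (-t * x) * (1 - h * x) \<le> exp (-t * x) * exp (-h * x)"
    using exp_ge_add_one_self[of "-h * x"] by (intro mult_left_mono) auto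
  also have "\<dots> = exp (-(t + h) * x)" by (simp add: algebra_simps flip: exp_add)
  finally show "(exp (-t * x) - exp (-(t + h) * x)) / h \<le> x * exp (-t * x)"
    using assms by (simp add: field_simps)
qed

lemma second_difference:
  assumes "h > 0" "x \<ge> (0::real)"
  shows "(exp (-t * x) - 2 * exp (-(t + h) * x) + exp (-(t + 2 * h) * x)) / h\<^sup>2 \<le> x\<^sup>2 * exp (-t * x)"
    and "x\<^sup>2 * exp (-t * x) \<le> (exp (-(t - h) * x) - 2 * exp (-t * x) + exp (-(t + h) * x)) / h\<^sup>2"
proof -
  let ?z = "exp (-h * x)"
  have e1: "exp (-(t + h) * x) = exp (-t * x) * ?z" "exp (-(t + 2 * h) * x) = exp (-t * x) * (?z * ?z)"
    "exp (-(t - h) * x) = exp (-t * x) * exp (h * x)"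
    by (simp_all add: algebra_simps flip: exp_add)
  have "0 \<le> 1 - ?z" "1 - ?z \<le> h * x" using exp_ge_add_one_self[of "-h * x"] assms by auto
  then have "(1 - ?z)\<^sup>2 \<le> (h * x)\<^sup>2" by (rule power_mono[rotated])
  then have "exp (-t * x) * (1 - ?z)\<^sup>2 \<le> exp (-t * x) * (h * x)\<^sup>2" by (intro mult_left_mono) auto
  also have "exp (-t * x) * (1 - ?z)\<^sup>2 = exp (-t * x) - 2 * exp (-(t + h) * x) + exp (-(t + 2 * h) * x)"
    unfolding e1 by (simp add: power2_eq_square algebra_simps)
  finally show "(exp (-t * x) - 2 * exp (-(t + h) * x) + exp (-(t + 2 * h) * x)) / h\<^sup>2 \<le> x\<^sup>2 * exp (-t * x)"
    using assms by (simp add: pos_divide_le_eq power_mult_distrib mult_ac)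
  let ?y = "exp (h * x / 2)" and ?y' = "exp (- (h * x) / 2)"
  \<comment> \<open>The central second difference factors as the square of \<open>?y - ?y'\<close>,
    which is \<open>2 sinh (h x / 2)\<close>.\<close>
  have "h * x \<le> ?y - ?y'"
  proof -
    have "h * x / 2 \<le> sinh (h * x / 2)"
    proof -
      have "sinh 0 - 0 \<le> sinh (h * x / 2) - h * x / 2"
      proof (rule DERIV_nonneg_imp_nondecreasing[of 0 _ "\<lambda>z. sinh z - z"])
        fix z :: real
        have "((\<lambda>z. sinh z - z) has_real_derivative (cosh z - 1)) (at z)"
          by (auto intro!: derivative_eq_intros)
        then show "\<exists>d. ((\<lambda>z. sinh z - z) has_real_derivative d) (at z) \<and> 0 \<le> d"
          using cosh_real_ge_1[of z] by fastforce
      qed (use assms in simp)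
      then show ?thesis by simp
    qed
    then show ?thesis by (simp add: sinh_field_def)
  qed
  then have "(h * x)\<^sup>2 \<le> (?y - ?y')\<^sup>2" using assms by (intro power_mono) auto
  also have "\<dots> = exp (h * x) - 2 + ?z"
    by (simp add: power2_eq_square algebra_simps flip: exp_add)
  finally have "exp (-t * x) * (h * x)\<^sup>2 \<le> exp (-t * x) * (exp (h * x) - 2 + ?z)" by (intro mult_left_mono) auto
  also have "\<dots> = exp (-(t - h) * x) - 2 * exp (-t * x) + exp (-(t + h) * x)"
    unfolding e1 by (simp add: algebra_simps)
  finally show "x\<^sup>2 * exp (-t * x) \<le> (exp (-(t - h) * x) - 2 * exp (-t * x) + exp (-(t + h) * x)) / h\<^sup>2"
    using assms by (simp add: pos_le_divide_eq power_mult_distrib mult_ac)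
qed

lemma growth_ratio:
  assumes n: "n > 0" and j: "j \<le> n"
  defines "x \<equiv> real j / real n"
  shows "growth a (n - j) / growth a n
    = exp (2 * real n * tn n * (sqrt (1 - x) - 1)) * (1 / (1 - real j / (real n + 1))) powr a"
proof -
  have "sqrt (real (n - j)) = sqrt (real n) * sqrt (1 - x)"
    using n j by (simp add: x_def of_nat_diff right_diff_distrib flip: real_sqrt_mult)
  then have e: "2 * pi / sqrt 6 * sqrt (real (n - j)) = 2 * real n * tn n * sqrt (1 - x)"
    using exponent_tn[OF n] by (metis mult.assoc)
  have "1 / (1 - real j / (real n + 1)) = (real n + 1) / (real (n - j) + 1)"
    using j by (simp add: field_simps of_nat_diff)
  then have "(1 / (1 - real j / (real n + 1))) powr a = (real n + 1) powr a / (real (n - j) + 1) powr a"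
    by (simp only: powr_divide)
  then have p: "(1 / (1 - real j / (real n + 1))) powr a = (real (n - j) + 1) powr (-a) / (real n + 1) powr (-a)"
    by (simp only: powr_minus_divide divide_divide_eq_left divide_divide_eq_right) simp
  show ?thesis
    unfolding growth_def e exponent_tn[OF n] p by (simp add: exp_diff right_diff_distrib)
qed

text \<open>The square root expanded to second order gives \<open>- t x - t x^2 / (4 N)\<close> in
  the exponent, and the power of \<open>n - j + 1\<close> contributes \<open>a x / N\<close>. The
  last term, with its factor \<open>N + 1\<close>, covers \<open>j\<close> close to
  \<open>n\<close>, where the ratio of the powers may grow with \<open>N\<close>.\<close>

lemma growth_ratio_upper:
  assumes n: "n > 0" and j: "1 \<le> j" "j \<le> n" and a: "0 \<le> a" "a \<le> 1"
  defines "t \<equiv> tn n" and "x \<equiv> real j" and "N \<equiv> real n"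
  shows "growth a (n - j) / growth a n \<le> exp (-t * x) *
    (1 - t * x\<^sup>2 / (4 * N) + a * (x / N) + (t * x\<^sup>2 / (4 * N))\<^sup>2 + 2 * (x / N)\<^sup>2 + 8 * (N + 1) * (x / N) ^ 4)"
proof -
  have t: "t > 0" using n by (simp add: t_def tn_pos)
  have N: "N > 0" "x \<ge> 1" "x \<le> N" using n j by (auto simp: N_def x_def)
  define u where "u = t * x\<^sup>2 / (4 * N)"
  define y where "y = x / N"
  define y' where "y' = x / (N + 1)"
  have u: "u \<ge> 0" using t N by (simp add: u_def)
  have y: "0 \<le> y" "y \<le> 1" "0 \<le> y'" "y' \<le> y" "y' < 1" using N by (auto simp: y_def y'_def field_simps)
  have "2 * N * t * (sqrt (1 - y) - 1) \<le> 2 * N * t * (- y / 2 - y\<^sup>2 / 8)"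
    using sqrt_1_minus_upper[of y] y N t by (intro mult_left_mono) auto
  also have "\<dots> = - t * x - u" using N by (simp add: y_def u_def field_simps power2_eq_square)
  finally have "exp (2 * N * t * (sqrt (1 - y) - 1)) \<le> exp (- t * x) * exp (- u)" by (simp flip: exp_add)
  moreover have "(1 / (1 - y')) powr a \<le> 1 + a * y + (2 * y\<^sup>2 + 8 * (N + 1) * y ^ 4)"
  proof -
    have "(1 / (1 - y')) powr a \<le> 1 + a * (1 / (1 - y') - 1)"
      using y a by (intro powr_Bernoulli_le) auto
    also have "1 / (1 - y') - 1 = y' / (1 - y')" using y by (simp add: field_simps)
    finally have powr_le: "(1 / (1 - y')) powr a \<le> 1 + a * (y' / (1 - y'))" .
    have "y' / (1 - y') \<le> y + (2 * y\<^sup>2 + 8 * (N + 1) * y ^ 4)"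
    proof (cases "y' \<le> 1/2")
      case True
      have "y' / (1 - y') = y' + y'\<^sup>2 / (1 - y')" using y by (simp add: field_simps power2_eq_square)
      also have "\<dots> \<le> y' + y'\<^sup>2 / (1/2)" using True y by (intro add_left_mono divide_left_mono) auto
      also have "\<dots> \<le> y + 2 * y\<^sup>2" using y by (simp add: power_mono add_mono)
      finally have "y' / (1 - y') \<le> y + 2 * y\<^sup>2" .
      moreover have "0 \<le> 8 * (N + 1) * y ^ 4" using N y by simp
      ultimately show ?thesis by linarith
    next
      case False
      have y1: "1 - y' \<ge> 1 / (N + 1)" using N by (simp add: y'_def field_simps)
      have "y' / (1 - y') \<le> y' / (1 / (N + 1))" using y y1 N by (intro divide_left_mono) auto
      also have "\<dots> = (N + 1) * y'" by simp
      also have "\<dots> \<le> (N + 1) * y" using y N by (intro mult_left_mono) auto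
      also have "\<dots> \<le> (N + 1) * (8 * y ^ 4)"
      proof (rule mult_left_mono)
        have "(1/2) ^ 3 \<le> y ^ 3" using False y by (intro power_mono) auto
        then have "1 * y \<le> 8 * y ^ 3 * y" using y by (intro mult_right_mono) (auto simp: power3_eq_cube)
        then show "y \<le> 8 * y ^ 4" by (simp add: power3_eq_cube power4_eq_xxxx)
      qed (use N in simp)
      finally have "y' / (1 - y') \<le> 8 * (N + 1) * y ^ 4" by (simp only: mult_ac)
      also have "\<dots> \<le> (y + 2 * y\<^sup>2) + 8 * (N + 1) * y ^ 4" using y by simp
      finally show ?thesis by (simp only: add.assoc)
    qed
    then have "a * (y' / (1 - y')) \<le> a * (y + (2 * y\<^sup>2 + 8 * (N + 1) * y ^ 4))"
      using a by (intro mult_left_mono)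
    also have "\<dots> = a * y + a * (2 * y\<^sup>2 + 8 * (N + 1) * y ^ 4)" by (rule distrib_left)
    also have "\<dots> \<le> a * y + 1 * (2 * y\<^sup>2 + 8 * (N + 1) * y ^ 4)"
      using a y N by (intro add_left_mono mult_right_mono) auto
    finally have "1 + a * (y' / (1 - y')) \<le> 1 + (a * y + 1 * (2 * y\<^sup>2 + 8 * (N + 1) * y ^ 4))"
      by (rule add_left_mono)
    from order_trans[OF powr_le this] show ?thesis by (simp only: mult_1_left add.assoc)
  qed
  ultimately have "growth a (n - j) / growth a n
      \<le> (exp (- t * x) * exp (- u)) * (1 + a * y + (2 * y\<^sup>2 + 8 * (N + 1) * y ^ 4))"
    unfolding growth_ratio[OF n j(2)] using y
    by (intro mult_mono) (auto simp: t_def x_def N_def y_def y'_def)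
  also have "\<dots> = exp (- t * x) * (exp (- u) * (1 + a * y) + exp (- u) * (2 * y\<^sup>2 + 8 * (N + 1) * y ^ 4))"
    by (simp add: algebra_simps)
  also have "\<dots> \<le> exp (- t * x) * ((1 - u + a * y + u\<^sup>2) + 1 * (2 * y\<^sup>2 + 8 * (N + 1) * y ^ 4))"
  proof (intro mult_left_mono add_mono mult_right_mono)
    have ay: "0 \<le> a * y" "a * y \<le> 1" using a y by (auto intro: mult_le_one)
    have "exp (- u) * (1 + a * y) \<le> (1 - u + u\<^sup>2 / 2) * (1 + a * y)"
      using exp_minus_le[OF u] ay by (intro mult_right_mono) auto
    also have "\<dots> = 1 - u + a * y + u\<^sup>2 / 2 * (1 + a * y) - u * (a * y)" by (simp add: algebra_simps)
    also have "\<dots> \<le> 1 - u + a * y + u\<^sup>2 / 2 * 2 - 0"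
      using u ay by (intro diff_mono add_left_mono mult_left_mono) auto
    finally show "exp (- u) * (1 + a * y) \<le> 1 - u + a * y + u\<^sup>2" by simp
  qed (use u N y in auto)
  finally show ?thesis by (simp add: u_def y_def algebra_simps)
qed

text \<open>The same expansion with the errors on the other side; the cross term of the two
  corrections is bounded by means of \<open>a \<le> 2\<close>.\<close>

lemma growth_ratio_lower:
  assumes n: "n > 0" and j: "1 \<le> j" "j \<le> n" and a: "1 \<le> a" "a \<le> 2"
  defines "t \<equiv> tn n" and "x \<equiv> real j" and "N \<equiv> real n"
  shows "exp (-t * x) * (1 + a * (x / (N + 1)) - t * x\<^sup>2 / (4 * N) - 3/2 * (t * x ^ 3 / N\<^sup>2) - 2 * (t * x ^ 4 / N ^ 3))
    \<le> growth a (n - j) / growth a n"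
proof -
  have t: "t > 0" using n by (simp add: t_def tn_pos)
  have N: "N > 0" "x \<ge> 1" "x \<le> N" using n j by (auto simp: N_def x_def)
  define u where "u = t * x\<^sup>2 / (4 * N) + t * x ^ 3 / N\<^sup>2"
  define y where "y = x / N"
  define y' where "y' = x / (N + 1)"
  have u: "u \<ge> 0" using t N by (simp add: u_def)
  have y: "0 \<le> y" "y \<le> 1" "0 \<le> y'" "y' \<le> y" "y' < 1" using N by (auto simp: y_def y'_def field_simps)
  have "- t * x - u = 2 * N * t * (- y / 2 - y\<^sup>2 / 8 - y ^ 3 / 2)"
    using N by (simp add: y_def u_def field_simps power2_eq_square power3_eq_cube)
  also have "\<dots> \<le> 2 * N * t * (sqrt (1 - y) - 1)"
    using sqrt_1_minus_lower[of y] y N t by (intro mult_left_mono) auto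
  finally have "exp (- t * x) * exp (- u) \<le> exp (2 * N * t * (sqrt (1 - y) - 1))" by (simp flip: exp_add)
  moreover have "1 + a * y' \<le> (1 / (1 - y')) powr a"
  proof -
    have "y' \<le> 1 / (1 - y') - 1" using y by (simp add: field_simps)
    then have "1 + a * y' \<le> 1 + a * (1 / (1 - y') - 1)" using a by (intro add_left_mono mult_left_mono) auto
    also have "\<dots> \<le> (1 / (1 - y')) powr a" using y a by (intro powr_Bernoulli_ge) auto
    finally show ?thesis .
  qed
  ultimately have "(exp (- t * x) * exp (- u)) * (1 + a * y') \<le> growth a (n - j) / growth a n"
    unfolding growth_ratio[OF n j(2)] using y a
    by (intro mult_mono) (auto simp: t_def x_def N_def y_def y'_def)
  moreover have "exp (- t * x) * ((1 - u) * (1 + a * y')) \<le> (exp (- t * x) * exp (- u)) * (1 + a * y')"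
    unfolding mult.assoc using exp_ge_add_one_self[of "-u"] y a by (intro mult_left_mono mult_right_mono) auto
  moreover have "1 + a * y' - t * x\<^sup>2 / (4 * N) - 3/2 * (t * x ^ 3 / N\<^sup>2) - 2 * (t * x ^ 4 / N ^ 3)
     \<le> (1 - u) * (1 + a * y')"
  proof -
    have "a * y' \<le> 2 * y" using a y by (intro mult_mono) auto
    then have "u * (a * y') \<le> u * (2 * y)" using u by (rule mult_left_mono)
    also have "\<dots> = 1/2 * (t * x ^ 3 / N\<^sup>2) + 2 * (t * x ^ 4 / N ^ 3)"
      using N by (simp add: u_def y_def field_simps power2_eq_square power3_eq_cube power4_eq_xxxx)
    moreover have "(1 - u) * (1 + a * y') = 1 + a * y' - u - u * (a * y')" by (simp add: algebra_simps)
    moreover have "u = t * x\<^sup>2 / (4 * N) + t * x ^ 3 / N\<^sup>2" by (simp add: u_def)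
    ultimately show ?thesis by linarith
  qed
  then have "exp (- t * x) * (1 + a * y' - t * x\<^sup>2 / (4 * N) - 3/2 * (t * x ^ 3 / N\<^sup>2) - 2 * (t * x ^ 4 / N ^ 3))
     \<le> exp (- t * x) * ((1 - u) * (1 + a * y'))" by (intro mult_left_mono) auto
  ultimately show ?thesis unfolding y'_def by linarith
qed

section \<open>Summing the comparison function over divisor pairs\<close>

definition wexp :: "real \<Rightarrow> nat \<times> nat \<Rightarrow> real" where
  "wexp s = (\<lambda>(k, v). real v * exp (- s * real (k * v)))"

lemma has_sum_wexp: "s > 0 \<Longrightarrow> (wexp s has_sum bose_sum s) (posn \<times> posn)"
  unfolding wexp_def by (rule has_sum_bose_sum)

lemma has_sum_diff:
  fixes f g :: "'a \<Rightarrow> real"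
  assumes "(f has_sum a) A" "(g has_sum b) A"
  shows "((\<lambda>x. f x - g x) has_sum (a - b)) A"
  using has_sum_add[OF assms(1) has_sum_uminusI[OF assms(2)]] by simp

abbreviation \<zeta>2 :: real where "\<zeta>2 \<equiv> pi\<^sup>2 / 6"

lemma bose_sum_scaled: "b > 0 \<Longrightarrow> ((\<lambda>t. t\<^sup>2 * bose_sum (b * t)) \<longlongrightarrow> \<zeta>2 / b\<^sup>2) (at_right 0)"
proof -
  assume b: "b > 0"
  have "filterlim (\<lambda>t. b * t) (at_right 0) (at_right (0::real))"
    using b by real_asymp
  from filterlim_compose[OF bose_sum_asymp' this]
  have "((\<lambda>t. bose_sum (b * t) * (b * t)\<^sup>2 / b\<^sup>2) \<longlongrightarrow> \<zeta>2 / b\<^sup>2) (at_right 0)"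
    by (intro tendsto_divide tendsto_const) (use b in auto)
  then show ?thesis using b by (simp add: power_mult_distrib mult.commute)
qed

text \<open>The sum of the majorant minus \<open>n\<close>, multiplied by \<open>t\<close>, for
  difference step \<open>h = \<eta> t\<close>. Apart from the secondary term at the front, each
  \<open>bose_sum\<close>, being of order \<open>1 / t^2\<close>, carries a factor
  \<open>t^2\<close>, so that all summands converge as \<open>t\<close> tends to 0 with
  \<open>\<eta>\<close> fixed; the last line tends to 0.\<close>

definition upper_total :: "real \<Rightarrow> real \<Rightarrow> real \<Rightarrow> real" where
  "upper_total a \<eta> t = (bose_sum t - \<zeta>2 / t\<^sup>2) * t + (a / \<zeta>2) * (t\<^sup>2 * bose_sum ((1 - \<eta>) * t) - t\<^sup>2 * bose_sum t) / \<eta>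
    - (t\<^sup>2 * bose_sum t - 2 * (t\<^sup>2 * bose_sum ((1 + \<eta>) * t)) + t\<^sup>2 * bose_sum ((1 + 2 * \<eta>) * t)) / (4 * \<zeta>2 * \<eta>\<^sup>2)
    + ((40 / \<zeta>2\<^sup>2) * t + 3072 * (\<zeta>2 + t\<^sup>2) / \<zeta>2 ^ 4 * t) * (t\<^sup>2 * bose_sum (1/2 * t))"

definition lower_total :: "real \<Rightarrow> real \<Rightarrow> real \<Rightarrow> real" where
  "lower_total a \<eta> t = (bose_sum t - \<zeta>2 / t\<^sup>2) * t + (a / (\<zeta>2 + t\<^sup>2)) * (t\<^sup>2 * bose_sum t - t\<^sup>2 * bose_sum ((1 + \<eta>) * t)) / \<eta>
    - (t\<^sup>2 * bose_sum ((1 - \<eta>) * t) - 2 * (t\<^sup>2 * bose_sum t) + t\<^sup>2 * bose_sum ((1 + \<eta>) * t)) / (4 * \<zeta>2 * \<eta>\<^sup>2)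
    - (72 / \<zeta>2\<^sup>2 * t + 768 * t ^ 2 / \<zeta>2 ^ 3 + 1152 * t ^ 3 / \<zeta>2 ^ 4) * (t\<^sup>2 * bose_sum (1/2 * t))"

text \<open>Both this and \<open>lower_lim\<close> tend to \<open>2 a - 2\<close> as
  \<open>\<eta>\<close> tends to 0: \<open>-1/2\<close> from the secondary term of
  \<open>bose_sum\<close>, \<open>2 a\<close> from the polynomial factor of \<open>growth\<close>,
  and \<open>-3/2\<close> from the curvature of the square root. The sign changes at
  \<open>a = 1\<close>.\<close>

definition upper_lim :: "real \<Rightarrow> real \<Rightarrow> real" where
  "upper_lim a \<eta> = - (1/2) + a * ((1 / (1 - \<eta>)\<^sup>2 - 1) / \<eta>) - (1 - 2 / (1 + \<eta>)\<^sup>2 + 1 / (1 + 2 * \<eta>)\<^sup>2) / (4 * \<eta>\<^sup>2)"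

definition lower_lim :: "real \<Rightarrow> real \<Rightarrow> real" where
  "lower_lim a \<eta> = - (1/2) + a * ((1 - 1 / (1 + \<eta>)\<^sup>2) / \<eta>) - (1 / (1 - \<eta>)\<^sup>2 - 2 + 1 / (1 + \<eta>)\<^sup>2) / (4 * \<eta>\<^sup>2)"

lemma upper_total_tendsto:
  assumes "0 < \<eta>" "\<eta> < 1"
  shows "(upper_total a \<eta> \<longlongrightarrow> upper_lim a \<eta>) (at_right 0)"
proof -
  have [simp]: "\<zeta>2 > 0" "\<zeta>2 \<noteq> 0" by simp_all
  have S1: "((\<lambda>t. t\<^sup>2 * bose_sum t) \<longlongrightarrow> \<zeta>2) (at_right 0)" using bose_sum_scaled[of 1] by simp
  have "(upper_total a \<eta> \<longlongrightarrow> -1/2 + (a / \<zeta>2) * (\<zeta>2 / (1 - \<eta>)\<^sup>2 - \<zeta>2) / \<eta>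
    - (\<zeta>2 - 2 * (\<zeta>2 / (1 + \<eta>)\<^sup>2) + \<zeta>2 / (1 + 2 * \<eta>)\<^sup>2) / (4 * \<zeta>2 * \<eta>\<^sup>2)
    + ((40 / \<zeta>2\<^sup>2) * 0 + 3072 * (\<zeta>2 + 0\<^sup>2) / \<zeta>2 ^ 4 * 0) * (\<zeta>2 / (1/2)\<^sup>2)) (at_right 0)"
    unfolding upper_total_def
    by (intro tendsto_intros bose_sum_asymp bose_sum_scaled S1) (use assms in auto)
  moreover have "(a / \<zeta>2) * (\<zeta>2 / (1 - \<eta>)\<^sup>2 - \<zeta>2) = a * (1 / (1 - \<eta>)\<^sup>2 - 1)"
    by (simp add: field_simps)
  moreover have "(\<zeta>2 - 2 * (\<zeta>2 / (1 + \<eta>)\<^sup>2) + \<zeta>2 / (1 + 2 * \<eta>)\<^sup>2) / (4 * \<zeta>2 * \<eta>\<^sup>2)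
      = \<zeta>2 * (1 - 2 / (1 + \<eta>)\<^sup>2 + 1 / (1 + 2 * \<eta>)\<^sup>2) / (\<zeta>2 * (4 * \<eta>\<^sup>2))"
    by (simp add: algebra_simps)
  ultimately show ?thesis unfolding upper_lim_def by (elim tendsto_eq_rhs) (simp only:, simp)
qed

lemma lower_total_tendsto:
  assumes "0 < \<eta>" "\<eta> < 1"
  shows "(lower_total a \<eta> \<longlongrightarrow> lower_lim a \<eta>) (at_right 0)"
proof -
  have [simp]: "\<zeta>2 > 0" "\<zeta>2 \<noteq> 0" by simp_all
  have S1: "((\<lambda>t. t\<^sup>2 * bose_sum t) \<longlongrightarrow> \<zeta>2) (at_right 0)" using bose_sum_scaled[of 1] by simp
  have "(lower_total a \<eta> \<longlongrightarrow> -1/2 + (a / (\<zeta>2 + 0\<^sup>2)) * (\<zeta>2 - \<zeta>2 / (1 + \<eta>)\<^sup>2) / \<eta>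
    - (\<zeta>2 / (1 - \<eta>)\<^sup>2 - 2 * \<zeta>2 + \<zeta>2 / (1 + \<eta>)\<^sup>2) / (4 * \<zeta>2 * \<eta>\<^sup>2)
    - (72 / \<zeta>2\<^sup>2 * 0 + 768 * 0 ^ 2 / \<zeta>2 ^ 3 + 1152 * 0 ^ 3 / \<zeta>2 ^ 4) * (\<zeta>2 / (1/2)\<^sup>2)) (at_right 0)"
    unfolding lower_total_def
    by (intro tendsto_intros bose_sum_asymp bose_sum_scaled S1) (use assms in auto)
  moreover have "(a / (\<zeta>2 + 0\<^sup>2)) * (\<zeta>2 - \<zeta>2 / (1 + \<eta>)\<^sup>2) = a * (1 - 1 / (1 + \<eta>)\<^sup>2)"
    by (simp add: field_simps)
  moreover have "(\<zeta>2 / (1 - \<eta>)\<^sup>2 - 2 * \<zeta>2 + \<zeta>2 / (1 + \<eta>)\<^sup>2) / (4 * \<zeta>2 * \<eta>\<^sup>2)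
      = \<zeta>2 * (1 / (1 - \<eta>)\<^sup>2 - 2 + 1 / (1 + \<eta>)\<^sup>2) / (\<zeta>2 * (4 * \<eta>\<^sup>2))"
    by (simp add: algebra_simps)
  ultimately show ?thesis unfolding lower_lim_def by (elim tendsto_eq_rhs) (simp only:, simp)
qed

lemma upper_lim_neg:
  assumes "a < 1"
  obtains \<eta> where "0 < \<eta>" "\<eta> < 1" "upper_lim a \<eta> < 0"
proof -
  have 1: "((\<lambda>\<eta>::real. (1 / (1 - \<eta>)\<^sup>2 - 1) / \<eta>) \<longlongrightarrow> 2) (at_right 0)" by real_asymp
  have 2: "((\<lambda>\<eta>::real. (1 - 2 / (1 + \<eta>)\<^sup>2 + 1 / (1 + 2 * \<eta>)\<^sup>2) / (4 * \<eta>\<^sup>2)) \<longlongrightarrow> 3/2) (at_right 0)" by real_asymp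
  have "(upper_lim a \<longlongrightarrow> - (1/2) + a * 2 - 3/2) (at_right 0)"
    unfolding upper_lim_def by (intro tendsto_intros 1 2)
  then have "\<forall>\<^sub>F \<eta> in at_right 0. upper_lim a \<eta> < 0"
    using assms by (intro order_tendstoD(2)) auto
  moreover have "\<forall>\<^sub>F \<eta> in at_right 0. (0::real) < \<eta> \<and> \<eta> < 1"
    by (rule eventually_at_rightI[of 0 1]) auto
  ultimately have "\<forall>\<^sub>F \<eta> in at_right 0. upper_lim a \<eta> < 0 \<and> 0 < \<eta> \<and> \<eta> < 1"
    by eventually_elim auto
  then show ?thesis using that eventually_happens[of _ "at_right (0::real)"] by (auto simp: trivial_limit_at_right_real)
qed

lemma lower_lim_pos:
  assumes "a > 1"
  obtains \<eta> where "0 < \<eta>" "\<eta> < 1" "lower_lim a \<eta> > 0"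
proof -
  have 1: "((\<lambda>\<eta>::real. (1 - 1 / (1 + \<eta>)\<^sup>2) / \<eta>) \<longlongrightarrow> 2) (at_right 0)" by real_asymp
  have 2: "((\<lambda>\<eta>::real. (1 / (1 - \<eta>)\<^sup>2 - 2 + 1 / (1 + \<eta>)\<^sup>2) / (4 * \<eta>\<^sup>2)) \<longlongrightarrow> 3/2) (at_right 0)" by real_asymp
  have "(lower_lim a \<longlongrightarrow> - (1/2) + a * 2 - 3/2) (at_right 0)"
    unfolding lower_lim_def by (intro tendsto_intros 1 2)
  then have "\<forall>\<^sub>F \<eta> in at_right 0. lower_lim a \<eta> > 0"
    using assms by (intro order_tendstoD(1)) auto
  moreover have "\<forall>\<^sub>F \<eta> in at_right 0. (0::real) < \<eta> \<and> \<eta> < 1"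
    by (rule eventually_at_rightI[of 0 1]) auto
  ultimately have "\<forall>\<^sub>F \<eta> in at_right 0. lower_lim a \<eta> > 0 \<and> 0 < \<eta> \<and> \<eta> < 1"
    by eventually_elim auto
  then show ?thesis using that eventually_happens[of _ "at_right (0::real)"] by (auto simp: trivial_limit_at_right_real)
qed

text \<open>The ratio bound supplies a nonnegative majorant for each pair, so the sum over
  \<open>div_pairs n\<close> may be enlarged to all pairs, where it is a combination of values of
  \<open>bose_sum\<close>. Writing \<open>n\<close> as \<open>\<zeta>2 / t^2\<close> identifies it
  with \<open>upper_total\<close>.\<close>

lemma growth_upper_step_bound:
  assumes n: "n > 0" and a: "0 \<le> a" "a \<le> 1" and \<eta>: "0 < \<eta>" "\<eta> < 1"
  shows "((\<Sum>(k, v)\<in>div_pairs n. real v * growth a (n - k * v)) / growth a n - real n) * tn n \<le> upper_total a \<eta> (tn n)"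
proof -
  define t where "t = tn n"
  define N where "N = real n"
  have t: "t > 0" using n by (simp add: t_def tn_pos)
  have N: "N > 0" using n by (simp add: N_def)
  have Nt: "N = \<zeta>2 / t\<^sup>2" unfolding N_def t_def by (rule tn_sq[OF n])
  define h where "h = \<eta> * t"
  have h: "h > 0" using \<eta> t by (simp add: h_def)
  define c1 where "c1 = a / N / h"
  define c2 where "c2 = t / (4 * N) / h\<^sup>2"
  \<comment> \<open>The error terms after \<open>power_exp_le\<close>; the constants 8 and 384 are
    \<open>2! 2^2\<close> and \<open>4! 2^4\<close>.\<close>
  define K where "K = t\<^sup>2 / (16 * N\<^sup>2) * (384 / t ^ 4) + 2 / N\<^sup>2 * (8 / t\<^sup>2) + 8 * (N + 1) / N ^ 4 * (384 / t ^ 4)"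
  define \<Psi> where "\<Psi> = (\<lambda>p. wexp t p + c1 * (wexp (t - h) p - wexp t p)
     - c2 * (wexp t p - 2 * wexp (t + h) p + wexp (t + 2 * h) p) + K * wexp (t / 2) p)"
  define W where "W x = 1 - t * x\<^sup>2 / (4 * N) + a * (x / N) + (t * x\<^sup>2 / (4 * N))\<^sup>2 + 2 * (x / N)\<^sup>2 + 8 * (N + 1) * (x / N) ^ 4" for x
  have W0: "0 \<le> W x" if "x \<ge> 0" for x
  proof -
    have "0 \<le> 1 - u + u\<^sup>2" for u :: real
      using zero_le_power2[of "u - 1/2"] by (simp add: power2_eq_square algebra_simps)
    from this[of "t * x\<^sup>2 / (4 * N)"] have "0 \<le> 1 - t * x\<^sup>2 / (4 * N) + (t * x\<^sup>2 / (4 * N))\<^sup>2" by simp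
    moreover have "0 \<le> a * (x / N) + 2 * (x / N)\<^sup>2 + 8 * (N + 1) * (x / N) ^ 4"
      using a N that by simp
    ultimately show ?thesis unfolding W_def by linarith
  qed
  have W_le: "exp (- t * x) * W x \<le> exp (- t * x) + c1 * (exp (- (t - h) * x) - exp (- t * x))
      - c2 * (exp (- t * x) - 2 * exp (- (t + h) * x) + exp (- (t + 2 * h) * x)) + K * exp (- (t / 2) * x)"
    if x: "x \<ge> 0" for x
  proof -
    define E where "E = exp (- t * x)"
    define Eh where "Eh = exp (- (t / 2) * x)"
    have p2: "x\<^sup>2 * E \<le> 8 / t\<^sup>2 * Eh" and p4: "x ^ 4 * E \<le> 384 / t ^ 4 * Eh"
      using power_exp_le[OF t x, of 2] power_exp_le[OF t x, of 4]
      by (simp_all add: E_def Eh_def fact_numeral power_divide)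
    have "exp (- t * x) * W x = E - t / (4 * N) * (x\<^sup>2 * E) + a / N * (x * E)
       + (t\<^sup>2 / (16 * N\<^sup>2) * (x ^ 4 * E) + 2 / N\<^sup>2 * (x\<^sup>2 * E) + 8 * (N + 1) / N ^ 4 * (x ^ 4 * E))"
      unfolding W_def E_def[symmetric] using N
      by (simp add: field_simps power2_eq_square power4_eq_xxxx)
    also have "\<dots> \<le> E - t / (4 * N) * ((E - 2 * exp (- (t + h) * x) + exp (- (t + 2 * h) * x)) / h\<^sup>2)
       + a / N * ((exp (- (t - h) * x) - E) / h)
       + (t\<^sup>2 / (16 * N\<^sup>2) * (384 / t ^ 4 * Eh) + 2 / N\<^sup>2 * (8 / t\<^sup>2 * Eh) + 8 * (N + 1) / N ^ 4 * (384 / t ^ 4 * Eh))"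
      using second_difference(1)[OF h x, of t] first_difference(1)[OF h x, of t] p2 p4 a N t
      by (intro add_mono diff_mono mult_left_mono) (auto simp: E_def)
    also have "\<dots> = E + c1 * (exp (- (t - h) * x) - E)
      - c2 * (E - 2 * exp (- (t + h) * x) + exp (- (t + 2 * h) * x)) + K * Eh"
    proof -
      have r: "u * (v / w) = u / w * v" for u v w :: real by simp
      show ?thesis unfolding c1_def c2_def K_def r[of _ "_ - _"] r[of _ "_ + _"] by algebra
    qed
    finally show ?thesis unfolding E_def Eh_def .
  qed
  have \<Psi>: "real v * (exp (- t * real (k * v)) * W (real (k * v))) \<le> \<Psi> (k, v)" for k v
  proof -
    have "real v * (exp (- t * real (k * v)) * W (real (k * v))) \<le> real v * (exp (- t * real (k * v)) + c1 * (exp (- (t - h) * real (k * v)) - exp (- t * real (k * v)))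
      - c2 * (exp (- t * real (k * v)) - 2 * exp (- (t + h) * real (k * v)) + exp (- (t + 2 * h) * real (k * v))) + K * exp (- (t / 2) * real (k * v)))"
      by (intro mult_left_mono W_le) auto
    also have "\<dots> = \<Psi> (k, v)" by (simp only: \<Psi>_def wexp_def split: prod.split) (simp add: algebra_simps)
    finally show ?thesis .
  qed
  have pos: "t - h > 0" "t + h > 0" "t + 2 * h > 0" "t / 2 > 0"
  proof -
    have "h < t" using t \<eta> by (simp add: h_def)
    then show "t - h > 0" by simp
  qed (use t h in simp_all)
  define M where "M = bose_sum t + c1 * (bose_sum (t - h) - bose_sum t) - c2 * (bose_sum t - 2 * bose_sum (t + h) + bose_sum (t + 2 * h)) + K * bose_sum (t / 2)"
  have hs: "(\<Psi> has_sum M) (posn \<times> posn)"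
    unfolding \<Psi>_def M_def
    by (intro has_sum_add has_sum_diff has_sum_cmult_right has_sum_wexp t pos)
  have "(\<Sum>(k, v)\<in>div_pairs n. real v * growth a (n - k * v)) / growth a n
      = (\<Sum>(k, v)\<in>div_pairs n. real v * (growth a (n - k * v) / growth a n))"
    by (simp add: sum_divide_distrib case_prod_beta)
  also have "\<dots> \<le> (\<Sum>p\<in>div_pairs n. \<Psi> p)"
  proof (rule sum_mono, clarify)
    fix k v assume kv: "(k, v) \<in> div_pairs n"
    then have "1 \<le> k * v" "k * v \<le> n" by (auto simp: div_pairs_def)
    then have "growth a (n - k * v) / growth a n \<le> exp (- t * real (k * v)) * W (real (k * v))"
      using growth_ratio_upper[OF n _ _ a, of "k * v"] unfolding W_def t_def N_def by blast
    then have "real v * (growth a (n - k * v) / growth a n) \<le> real v * (exp (- t * real (k * v)) * W (real (k * v)))"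
      by (intro mult_left_mono) auto
    then show "real v * (growth a (n - k * v) / growth a n) \<le> \<Psi> (k, v)" using \<Psi>[of v k] by linarith
  qed
  also have "\<dots> \<le> M"
  proof (rule finite_sum_le_has_sum[OF hs finite_div_pairs div_pairs_subset])
    fix p :: "nat \<times> nat"
    obtain k v where p: "p = (k, v)" by (cases p)
    have "0 \<le> real v * (exp (- t * real (k * v)) * W (real (k * v)))" using W0[of "real (k * v)"] by simp
    then show "0 \<le> \<Psi> p" unfolding p using \<Psi>[of v k] by linarith
  qed
  finally have "((\<Sum>(k, v)\<in>div_pairs n. real v * growth a (n - k * v)) / growth a n - N) * t \<le> (M - N) * t"
    using t by (intro mult_right_mono) auto
  also have "(M - N) * t = upper_total a \<eta> t"
  proof -
    have e1: "t - h = (1 - \<eta>) * t" "t + h = (1 + \<eta>) * t" "t + 2 * h = (1 + 2 * \<eta>) * t" "t / 2 = 1/2 * t"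
      by (simp_all add: h_def algebra_simps)
    have z: "\<zeta>2 > 0" by simp
    have c1: "c1 * t = a / \<zeta>2 * t\<^sup>2 / \<eta>" unfolding c1_def h_def Nt using t \<eta> z by (simp add: field_simps)
    have c2: "c2 * t = t\<^sup>2 / (4 * \<zeta>2 * \<eta>\<^sup>2)" unfolding c2_def h_def Nt using t \<eta> z
      by (simp add: field_simps power2_eq_square)
    define Z where "Z = \<zeta>2"
    have Z: "Z > 0" by (simp add: Z_def)
    have K: "K * t = ((40 / \<zeta>2\<^sup>2) * t + 3072 * (\<zeta>2 + t\<^sup>2) / \<zeta>2 ^ 4 * t) * t\<^sup>2"
    proof -
      have e: "t\<^sup>2 / (16 * N\<^sup>2) * (384 / t ^ 4) = 24 * t\<^sup>2 / Z\<^sup>2" "2 / N\<^sup>2 * (8 / t\<^sup>2) = 16 * t\<^sup>2 / Z\<^sup>2"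
        "8 * (N + 1) / N ^ 4 * (384 / t ^ 4) = 3072 * (Z + t\<^sup>2) / Z ^ 4 * t\<^sup>2"
        unfolding Nt Z_def[symmetric] using t Z
        by (simp_all add: field_simps power2_eq_square power4_eq_xxxx)
      show ?thesis unfolding K_def Z_def[symmetric] e
        by (simp add: algebra_simps add_divide_distrib power2_eq_square)
    qed
    have "(M - N) * t = (bose_sum t - N) * t + (c1 * t) * (bose_sum (t - h) - bose_sum t) - (c2 * t) * (bose_sum t - 2 * bose_sum (t + h) + bose_sum (t + 2 * h)) + (K * t) * bose_sum (t / 2)"
      by (simp add: M_def algebra_simps)
    then show ?thesis unfolding c1 c2 K upper_total_def e1 Nt by (simp add: algebra_simps diff_divide_distrib add_divide_distrib)
  qed
  finally show ?thesis by (simp add: t_def N_def)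
qed

lemma growth_lower_step_bound:
  assumes n: "n > 0" and a: "1 \<le> a" "a \<le> 2" and \<eta>: "0 < \<eta>" "\<eta> < 1"
  shows "lower_total a \<eta> (tn n) \<le> ((\<Sum>(k, v)\<in>div_pairs n. real v * growth a (n - k * v)) / growth a n - real n) * tn n"
proof -
  define t where "t = tn n"
  define N where "N = real n"
  have t: "t > 0" using n by (simp add: t_def tn_pos)
  have N: "N > 0" "N \<ge> 1" using n by (simp_all add: N_def)
  have Nt: "N = \<zeta>2 / t\<^sup>2" unfolding N_def t_def by (rule tn_sq[OF n])
  define h where "h = \<eta> * t"
  have h: "h > 0" using \<eta> t by (simp add: h_def)
  define c1 where "c1 = a / (N + 1) / h"
  define c2 where "c2 = t / (4 * N) / h\<^sup>2"
  define K where "K = 3/2 * (t / N\<^sup>2) * (48 / t ^ 3) + 2 * (t / N ^ 3) * (384 / t ^ 4) + 3 / N ^ 4 * (384 / t ^ 4)"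
  define \<Psi> where "\<Psi> = (\<lambda>p. wexp t p + c1 * (wexp t p - wexp (t + h) p)
     - c2 * (wexp (t - h) p - 2 * wexp t p + wexp (t + h) p) - K * wexp (t / 2) p)"
  \<comment> \<open>The additional term \<open>- 3 (x / N)^4\<close> makes the minorant nonpositive
    for \<open>x > N\<close>, where \<open>1 + a x / (N + 1)\<close> is at most
    \<open>3 x / N\<close>. Extending the sum beyond \<open>n\<close> therefore only lowers
    it.\<close>
  define W where "W x = 1 + a * (x / (N + 1)) - t * x\<^sup>2 / (4 * N) - 3/2 * (t * x ^ 3 / N\<^sup>2) - 2 * (t * x ^ 4 / N ^ 3) - 3 * (x / N) ^ 4" for x
  have W0: "W x \<le> 0" if x: "x > N" for x
  proof -
    have "1 \<le> x / N" using x N by simp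
    then have p: "x / N \<le> (x / N) ^ 4" "1 \<le> (x / N) ^ 4" by (simp_all add: self_le_power)
    have "a * (x / (N + 1)) \<le> 2 * (x / N)"
      using a x N by (intro mult_mono divide_left_mono) auto
    moreover have "0 \<le> t * x\<^sup>2 / (4 * N)" "0 \<le> 3/2 * (t * x ^ 3 / N\<^sup>2)" "0 \<le> 2 * (t * x ^ 4 / N ^ 3)"
      using t N x by auto
    ultimately show ?thesis using p unfolding W_def by linarith
  qed
  have W_ge: "exp (- t * x) + c1 * (exp (- t * x) - exp (- (t + h) * x))
      - c2 * (exp (- (t - h) * x) - 2 * exp (- t * x) + exp (- (t + h) * x)) - K * exp (- (t / 2) * x)
      \<le> exp (- t * x) * W x"
    if x: "x \<ge> 0" for x
  proof -
    define E where "E = exp (- t * x)"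
    define Eh where "Eh = exp (- (t / 2) * x)"
    have p3: "x ^ 3 * E \<le> 48 / t ^ 3 * Eh" and p4: "x ^ 4 * E \<le> 384 / t ^ 4 * Eh"
      using power_exp_le[OF t x, of 3] power_exp_le[OF t x, of 4]
      by (simp_all add: E_def Eh_def fact_numeral power_divide)
    have "E + c1 * (E - exp (- (t + h) * x))
      - c2 * (exp (- (t - h) * x) - 2 * E + exp (- (t + h) * x)) - K * Eh
      = E + a / (N + 1) * ((E - exp (- (t + h) * x)) / h)
       - t / (4 * N) * ((exp (- (t - h) * x) - 2 * E + exp (- (t + h) * x)) / h\<^sup>2)
       - (3/2 * (t / N\<^sup>2) * (48 / t ^ 3 * Eh) + 2 * (t / N ^ 3) * (384 / t ^ 4 * Eh) + 3 / N ^ 4 * (384 / t ^ 4 * Eh))"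
    proof -
      have r: "u * (v / w) = u / w * v" for u v w :: real by simp
      show ?thesis unfolding c1_def c2_def K_def r[of _ "_ - _"] r[of _ "_ + _"] by algebra
    qed
    also have "\<dots> \<le> E + a / (N + 1) * (x * E) - t / (4 * N) * (x\<^sup>2 * E)
       - (3/2 * (t / N\<^sup>2) * (x ^ 3 * E) + 2 * (t / N ^ 3) * (x ^ 4 * E) + 3 / N ^ 4 * (x ^ 4 * E))"
      using second_difference(2)[OF h x, of t] first_difference(2)[OF h x, of t] p3 p4 a N t
      by (intro add_mono diff_mono mult_left_mono) (auto simp: E_def)
    also have "\<dots> = exp (- t * x) * W x"
      unfolding W_def E_def[symmetric] power_divide by (simp add: algebra_simps)
    finally show ?thesis unfolding E_def Eh_def .
  qed
  have \<Psi>: "\<Psi> (k, v) \<le> real v * (exp (- t * real (k * v)) * W (real (k * v)))" for k v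
  proof -
    have "\<Psi> (k, v) = real v * (exp (- t * real (k * v)) + c1 * (exp (- t * real (k * v)) - exp (- (t + h) * real (k * v)))
      - c2 * (exp (- (t - h) * real (k * v)) - 2 * exp (- t * real (k * v)) + exp (- (t + h) * real (k * v))) - K * exp (- (t / 2) * real (k * v)))"
      by (simp only: \<Psi>_def wexp_def split: prod.split) (simp add: algebra_simps)
    also have "\<dots> \<le> real v * (exp (- t * real (k * v)) * W (real (k * v)))"
      by (intro mult_left_mono W_ge) auto
    finally show ?thesis .
  qed
  have pos: "t - h > 0" "t + h > 0" "t / 2 > 0"
  proof -
    have "h < t" using t \<eta> by (simp add: h_def)
    then show "t - h > 0" by simp
  qed (use t h in simp_all)
  define M where "M = bose_sum t + c1 * (bose_sum t - bose_sum (t + h)) - c2 * (bose_sum (t - h) - 2 * bose_sum t + bose_sum (t + h)) - K * bose_sum (t / 2)"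
  have hs: "(\<Psi> has_sum M) (posn \<times> posn)"
    unfolding \<Psi>_def M_def
    by (intro has_sum_add has_sum_diff has_sum_cmult_right has_sum_wexp t pos)
  have "- (\<Sum>p\<in>div_pairs n. \<Psi> p) \<le> - M"
    unfolding sum_negf[symmetric]
  proof (rule finite_sum_le_has_sum[OF has_sum_uminusI[OF hs] finite_div_pairs div_pairs_subset])
    fix p assume "p \<in> posn \<times> posn - div_pairs n"
    then obtain k v where p: "p = (k, v)" and "n < k * v" by (cases p) (auto simp: div_pairs_def)
    then have "N < real (k * v)" by (simp only: N_def of_nat_less_iff)
    from W0[OF this] have "real v * (exp (- t * real (k * v)) * W (real (k * v))) \<le> 0"
      by (intro mult_nonneg_nonpos) auto
    then show "0 \<le> - \<Psi> p" unfolding p using \<Psi>[of k v] by linarith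
  qed
  then have "M \<le> (\<Sum>p\<in>div_pairs n. \<Psi> p)" by simp
  also have "\<dots> \<le> (\<Sum>(k, v)\<in>div_pairs n. real v * (growth a (n - k * v) / growth a n))"
  proof (rule sum_mono, clarify)
    fix k v assume kv: "(k, v) \<in> div_pairs n"
    then have kv1: "1 \<le> k * v" "k * v \<le> n" by (auto simp: div_pairs_def)
    have "W (real (k * v)) \<le> 1 + a * (real (k * v) / (N + 1)) - t * (real (k * v))\<^sup>2 / (4 * N) - 3/2 * (t * real (k * v) ^ 3 / N\<^sup>2) - 2 * (t * real (k * v) ^ 4 / N ^ 3)"
      unfolding W_def by simp
    then have "exp (- t * real (k * v)) * W (real (k * v)) \<le> growth a (n - k * v) / growth a n"
      using growth_ratio_lower[OF n kv1 a] unfolding t_def N_def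
      by (meson exp_ge_zero mult_left_mono order_trans)
    then have "real v * (exp (- t * real (k * v)) * W (real (k * v))) \<le> real v * (growth a (n - k * v) / growth a n)"
      by (intro mult_left_mono) auto
    then show "\<Psi> (k, v) \<le> real v * (growth a (n - k * v) / growth a n)" using \<Psi>[of k v] by linarith
  qed
  also have "\<dots> = (\<Sum>(k, v)\<in>div_pairs n. real v * growth a (n - k * v)) / growth a n"
    by (simp add: sum_divide_distrib case_prod_beta)
  finally have "(M - N) * t \<le> ((\<Sum>(k, v)\<in>div_pairs n. real v * growth a (n - k * v)) / growth a n - N) * t"
    using t by (intro mult_right_mono) auto
  moreover have "(M - N) * t = lower_total a \<eta> t"
  proof -
    have e1: "t - h = (1 - \<eta>) * t" "t + h = (1 + \<eta>) * t" "t / 2 = 1/2 * t"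
      by (simp_all add: h_def algebra_simps)
    define Z where "Z = \<zeta>2"
    have Z: "Z > 0" by (simp add: Z_def)
    have N1: "N + 1 = (Z + t\<^sup>2) / t\<^sup>2" unfolding Nt Z_def[symmetric] using t by (simp add: field_simps)
    have c1: "c1 * t = a / (Z + t\<^sup>2) * t\<^sup>2 / \<eta>" unfolding c1_def h_def N1 using t \<eta> by simp
    have c2: "c2 * t = t\<^sup>2 / (4 * Z * \<eta>\<^sup>2)" unfolding c2_def h_def Nt Z_def[symmetric] using t \<eta> Z
      by (simp add: field_simps power2_eq_square)
    have K: "K * t = (72 / Z\<^sup>2 * t + 768 * t ^ 2 / Z ^ 3 + 1152 * t ^ 3 / Z ^ 4) * t\<^sup>2"
    proof -
      have e: "3/2 * (t / N\<^sup>2) * (48 / t ^ 3) = 72 * t\<^sup>2 / Z\<^sup>2" "2 * (t / N ^ 3) * (384 / t ^ 4) = 768 * t ^ 3 / Z ^ 3"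
        "3 / N ^ 4 * (384 / t ^ 4) = 1152 * t ^ 4 / Z ^ 4"
        unfolding Nt Z_def[symmetric] using t Z
        by (simp_all add: field_simps power2_eq_square power3_eq_cube power4_eq_xxxx)
      show ?thesis unfolding K_def e
        by (simp add: algebra_simps power2_eq_square power3_eq_cube power4_eq_xxxx)
    qed
    have "(M - N) * t = (bose_sum t - N) * t + (c1 * t) * (bose_sum t - bose_sum (t + h)) - (c2 * t) * (bose_sum (t - h) - 2 * bose_sum t + bose_sum (t + h)) - (K * t) * bose_sum (t / 2)"
      by (simp add: M_def algebra_simps)
    then show ?thesis unfolding c1 c2 K lower_total_def e1 Nt Z_def[symmetric]
      by (simp add: algebra_simps diff_divide_distrib add_divide_distrib)
  qed
  ultimately show ?thesis by (simp add: t_def N_def)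
qed

text \<open>First \<open>\<eta>\<close> is fixed so small that the limit is negative, then
  \<open>n\<close> is taken large enough for \<open>upper_total\<close> to be negative at
  \<open>tn n\<close>.\<close>

theorem growth_upper_step:
  assumes a: "0 \<le> a" "a < 1"
  shows "\<forall>\<^sub>F n in sequentially. (\<Sum>(k, v)\<in>div_pairs n. real v * growth a (n - k * v)) \<le> real n * growth a n"
proof -
  obtain \<eta> where \<eta>: "0 < \<eta>" "\<eta> < 1" "upper_lim a \<eta> < 0" using upper_lim_neg[OF a(2)] .
  have "((\<lambda>n. upper_total a \<eta> (tn n)) \<longlonglongrightarrow> upper_lim a \<eta>)"
    by (rule filterlim_compose[OF upper_total_tendsto[OF \<eta>(1,2)] filterlim_tn])
  then have "\<forall>\<^sub>F n in sequentially. upper_total a \<eta> (tn n) < 0" using \<eta>(3) by (rule order_tendstoD(2))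
  then show ?thesis using eventually_gt_at_top[of 0]
  proof eventually_elim
    case (elim n)
    let ?s = "\<Sum>(k, v)\<in>div_pairs n. real v * growth a (n - k * v)"
    have "(?s / growth a n - real n) * tn n < 0"
      using growth_upper_step_bound[OF elim(2) a(1) _ \<eta>(1,2)] a elim by linarith
    then have "?s / growth a n - real n < 0" using tn_pos[OF elim(2)] by (simp add: mult_less_0_iff)
    then have "?s / growth a n \<le> real n" by simp
    then show ?case using growth_pos[of a n] by (simp add: pos_divide_le_eq)
  qed
qed

theorem growth_lower_step:
  assumes a: "1 < a" "a \<le> 2"
  shows "\<forall>\<^sub>F n in sequentially. real n * growth a n \<le> (\<Sum>(k, v)\<in>div_pairs n. real v * growth a (n - k * v))"
proof -
  obtain \<eta> where \<eta>: "0 < \<eta>" "\<eta> < 1" "lower_lim a \<eta> > 0" using lower_lim_pos[OF a(1)] .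
  have "((\<lambda>n. lower_total a \<eta> (tn n)) \<longlonglongrightarrow> lower_lim a \<eta>)"
    by (rule filterlim_compose[OF lower_total_tendsto[OF \<eta>(1,2)] filterlim_tn])
  then have "\<forall>\<^sub>F n in sequentially. lower_total a \<eta> (tn n) > 0" using \<eta>(3) by (rule order_tendstoD(1))
  then show ?thesis using eventually_gt_at_top[of 0]
  proof eventually_elim
    case (elim n)
    let ?s = "\<Sum>(k, v)\<in>div_pairs n. real v * growth a (n - k * v)"
    have "(?s / growth a n - real n) * tn n > 0"
      using growth_lower_step_bound[OF elim(2) _ a(2) \<eta>(1,2)] a elim by linarith
    then have "?s / growth a n - real n > 0" using tn_pos[OF elim(2)] by (simp add: zero_less_mult_iff)
    then have "real n \<le> ?s / growth a n" by simp
    then show ?case using growth_pos[of a n] by (simp add: pos_le_divide_eq)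
  qed
qed

text \<open>From \<open>n0\<close> on, \<open>growth a\<close> is a supersolution of the recursion,
  and \<open>C\<close> absorbs the finitely many initial values; strong induction compares the
  two.\<close>

lemma recursion_upper:
  fixes P :: "nat \<Rightarrow> real"
  assumes rec: "\<And>n. real n * P n = (\<Sum>(k, v)\<in>div_pairs n. real v * P (n - k * v))"
    and pos: "\<And>n. P n > 0" and a: "0 \<le> a" "a < 1"
  obtains C where "C > 0" "\<And>n. P n \<le> C * growth a n"
proof -
  obtain n0 where n0: "\<And>n. n \<ge> n0 \<Longrightarrow> (\<Sum>(k, v)\<in>div_pairs n. real v * growth a (n - k * v)) \<le> real n * growth a n"
    using growth_upper_step[OF a] unfolding eventually_sequentially by blast
  define C where "C = (\<Sum>m\<le>n0. P m / growth a m)"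
  have q: "P m / growth a m > 0" for m using pos growth_pos by simp
  have "C > 0" unfolding C_def by (intro sum_pos q) auto
  moreover have "P n \<le> C * growth a n" for n
  proof (induction n rule: less_induct)
    case (less n)
    show ?case
    proof (cases "n \<le> n0")
      case True
      have "P n / growth a n \<le> C" unfolding C_def
        by (rule member_le_sum) (use True q in \<open>auto intro: less_imp_le\<close>)
      then show ?thesis using growth_pos[of a n] by (simp add: pos_divide_le_eq)
    next
      case False
      have "real n * P n = (\<Sum>(k, v)\<in>div_pairs n. real v * P (n - k * v))" by (rule rec)
      also have "\<dots> \<le> (\<Sum>(k, v)\<in>div_pairs n. real v * (C * growth a (n - k * v)))"
      proof (rule sum_mono, clarify)
        fix k v assume "(k, v) \<in> div_pairs n"
        then have "n - k * v < n" using False by (auto simp: div_pairs_def)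
        then show "real v * P (n - k * v) \<le> real v * (C * growth a (n - k * v))"
          by (intro mult_left_mono less.IH) auto
      qed
      also have "\<dots> = C * (\<Sum>(k, v)\<in>div_pairs n. real v * growth a (n - k * v))"
        by (simp add: sum_distrib_left case_prod_beta mult_ac)
      also have "\<dots> \<le> C * (real n * growth a n)"
        using n0[of n] False \<open>C > 0\<close> by (intro mult_left_mono) auto
      finally have "real n * P n \<le> real n * (C * growth a n)" by (simp only: mult_ac)
      then show ?thesis using False by (simp add: mult_le_cancel_left)
    qed
  qed
  ultimately show ?thesis using that by blast
qed

lemma recursion_lower:
  fixes P :: "nat \<Rightarrow> real"
  assumes rec: "\<And>n. real n * P n = (\<Sum>(k, v)\<in>div_pairs n. real v * P (n - k * v))"
    and pos: "\<And>n. P n > 0" and a: "1 < a" "a \<le> 2"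
  obtains C where "C > 0" "\<And>n. C * growth a n \<le> P n"
proof -
  obtain n0 where n0: "\<And>n. n \<ge> n0 \<Longrightarrow> real n * growth a n \<le> (\<Sum>(k, v)\<in>div_pairs n. real v * growth a (n - k * v))"
    using growth_lower_step[OF a] unfolding eventually_sequentially by blast
  define C where "C = Min ((\<lambda>m. P m / growth a m) ` {..n0})"
  have "C \<in> (\<lambda>m. P m / growth a m) ` {..n0}" unfolding C_def by (rule Min_in) auto
  then have "C > 0" using pos growth_pos by auto
  moreover have "C * growth a n \<le> P n" for n
  proof (induction n rule: less_induct)
    case (less n)
    show ?case
    proof (cases "n \<le> n0")
      case True
      have "C \<le> P n / growth a n" unfolding C_def by (rule Min_le) (use True in auto)
      then show ?thesis using growth_pos[of a n] by (simp add: pos_le_divide_eq)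
    next
      case False
      have "real n * (C * growth a n) = C * (real n * growth a n)" by (simp only: mult_ac)
      also have "\<dots> \<le> C * (\<Sum>(k, v)\<in>div_pairs n. real v * growth a (n - k * v))"
        using n0[of n] False \<open>C > 0\<close> by (intro mult_left_mono) auto
      also have "\<dots> = (\<Sum>(k, v)\<in>div_pairs n. real v * (C * growth a (n - k * v)))"
        by (simp add: sum_distrib_left case_prod_beta mult_ac)
      also have "\<dots> \<le> (\<Sum>(k, v)\<in>div_pairs n. real v * P (n - k * v))"
      proof (rule sum_mono, clarify)
        fix k v assume "(k, v) \<in> div_pairs n"
        then have "n - k * v < n" using False by (auto simp: div_pairs_def)
        then show "real v * (C * growth a (n - k * v)) \<le> real v * P (n - k * v)"
          by (intro mult_left_mono less.IH) auto
      qed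
      also have "\<dots> = real n * P n" by (rule rec[symmetric])
      finally show ?thesis using False by (simp add: mult_le_cancel_left)
    qed
  qed
  ultimately show ?thesis using that by blast
qed

section \<open>The recursion for the number of partitions\<close>

definition num_parts :: "nat \<Rightarrow> nat" where "num_parts n = card (partitions_of n)"

lemma finite_partitions_of: "finite (partitions_of n)"
proof (rule finite_subset)
  show "partitions_of n \<subseteq> {xs. set xs \<subseteq> {..n} \<and> length xs \<le> n}"
    using length_le_sum_list member_le_sum_list by (fastforce simp: partitions_of_def)
qed (rule finite_lists_length_le, simp)

text \<open>Multisets give access to the multiplicities of parts, on which both the recursion and
  the random model operate.\<close>

definition part_msets :: "nat \<Rightarrow> nat multiset set" where
  "part_msets n = {M. 0 \<notin># M \<and> sum_mset M = n}"

lemma bij_betw_mset_partitions: "bij_betw mset (partitions_of n) (part_msets n)"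
  unfolding bij_betw_def
proof
  show "inj_on mset (partitions_of n)"
  proof (rule inj_onI)
    fix xs ys assume xy: "xs \<in> partitions_of n" "ys \<in> partitions_of n" "mset xs = mset ys"
    then have "sorted (rev xs)" "sorted (rev ys)" by (auto simp: partitions_of_def sorted_wrt_rev)
    moreover have "mset (rev xs) = mset (rev ys)" using xy by simp
    ultimately have "rev xs = rev ys" by (metis properties_for_sort)
    then show "xs = ys" by simp
  qed
  show "mset ` partitions_of n = part_msets n"
  proof (intro equalityI subsetI)
    fix M assume M: "M \<in> part_msets n"
    have "rev (sorted_list_of_multiset M) \<in> partitions_of n"
      using M by (simp add: partitions_of_def part_msets_def sorted_wrt_rev flip: sum_mset_sum_list)
    then show "M \<in> mset ` partitions_of n" by (intro image_eqI[of _ _ "rev (sorted_list_of_multiset M)"]) simp_all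
  qed (auto simp: partitions_of_def part_msets_def sum_mset_sum_list)
qed

lemma card_part_msets: "card (part_msets n) = num_parts n"
  unfolding num_parts_def by (rule bij_betw_same_card[OF bij_betw_mset_partitions, symmetric])

lemma finite_part_msets: "finite (part_msets n)"
  using bij_betw_finite[OF bij_betw_mset_partitions[of n]] finite_partitions_of[of n] by simp

lemma num_parts_pos: "num_parts n > 0"
proof -
  have "(if n = 0 then [] else [n]) \<in> partitions_of n" by (simp add: partitions_of_def)
  then show ?thesis unfolding num_parts_def using finite_partitions_of card_gt_0_iff by blast
qed

lemma sum_mset_count:
  fixes M :: "nat multiset"
  assumes "finite A" "set_mset M \<subseteq> A"
  shows "sum_mset M = (\<Sum>v\<in>A. v * count M v)"
  using assms(2)
proof (induction M)
  case (add x M)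
  have "(\<Sum>v\<in>A. v * count (add_mset x M) v) = (\<Sum>v\<in>A. (if v = x then v else 0) + v * count M v)"
    by (intro sum.cong refl) (simp add: add.commute)
  then show ?case using add assms(1) by (simp add: sum.distrib)
qed simp

text \<open>Removing \<open>k\<close> copies of \<open>v\<close> is a bijection onto the partitions
  of \<open>n - k * v\<close>.\<close>

lemma card_count_ge:
  assumes "1 \<le> v"
  shows "card {M\<in>part_msets n. k \<le> count M v} = (if k * v \<le> n then num_parts (n - k * v) else 0)"
proof (cases "k * v \<le> n")
  case True
  have "bij_betw (\<lambda>M. M + replicate_mset k v) (part_msets (n - k * v)) {M\<in>part_msets n. k \<le> count M v}"
    by (rule bij_betw_byWitness[of _ "\<lambda>M. M - replicate_mset k v"])
      (use True assms in \<open>auto simp: part_msets_def sum_mset_replicate_mset count_le_replicate_mset_subset_eq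
         sum_mset_diff in_diff_count split: if_splits dest: in_diffD\<close>)
  from bij_betw_same_card[OF this] show ?thesis using True card_part_msets by simp
next
  case False
  have "{M\<in>part_msets n. k \<le> count M v} = {}"
  proof (rule equals0I)
    fix M assume M: "M \<in> {M\<in>part_msets n. k \<le> count M v}"
    then have "replicate_mset k v \<subseteq># M" unfolding count_le_replicate_mset_subset_eq[symmetric] by simp
    then obtain M' where "M = replicate_mset k v + M'" by (auto simp: mset_subset_eq_exists_conv)
    then have "sum_mset M = k * v + sum_mset M'" by simp
    then show False using M False by (simp add: part_msets_def)
  qed
  then show ?thesis using False by (simp only: card.empty) simp
qed

text \<open>Double counting: the parts of all partitions of \<open>n\<close> add up to
  \<open>n p(n)\<close>, and a multiplicity is the number of \<open>k \<ge> 1\<close> not exceeding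
  it, so a pair \<open>(k, v)\<close> counts the partitions with at least \<open>k\<close> parts
  \<open>v\<close>.\<close>

lemma num_parts_recursion:
  "real n * real (num_parts n) = (\<Sum>(k, v)\<in>div_pairs n. real v * real (num_parts (n - k * v)))"
proof -
  let ?I = "{1..n}"
  have elem: "set_mset M \<subseteq> ?I" and cnt: "v \<in> ?I \<Longrightarrow> count M v = (\<Sum>k\<in>?I. if k \<le> count M v then 1 else 0)"
    if M: "M \<in> part_msets n" for M v
  proof -
    have "v \<le> n" if "v \<in># M" for v
      using M that by (auto dest!: multi_member_split simp: part_msets_def)
    moreover have "v \<noteq> 0" if "v \<in># M" for v using M that by (metis mem_Collect_eq part_msets_def)
    ultimately show sub: "set_mset M \<subseteq> ?I" by (meson atLeastAtMost_iff less_one not_less subsetI)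
    assume v: "v \<in> ?I"
    have le1: "v * count M v \<le> n"
      using sum_mset_count[OF _ sub] M member_le_sum[of v ?I "\<lambda>v. v * count M v"] v by (simp add: part_msets_def)
    have "1 * count M v \<le> v * count M v" using v by (intro mult_le_mono1) simp
    from order_trans[OF this le1] have "count M v \<le> n" by simp
    then have "{k\<in>?I. k \<le> count M v} = {1..count M v}" by auto
    then show "count M v = (\<Sum>k\<in>?I. if k \<le> count M v then 1 else 0)"
      by (simp add: sum.inter_filter[symmetric])
  qed
  have "n * num_parts n = (\<Sum>M\<in>part_msets n. sum_mset M)"
    by (simp add: part_msets_def flip: card_part_msets)
  also have "\<dots> = (\<Sum>M\<in>part_msets n. \<Sum>v\<in>?I. v * (\<Sum>k\<in>?I. if k \<le> count M v then 1 else 0))"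
  proof (rule sum.cong[OF refl])
    fix M assume M: "M \<in> part_msets n"
    have "sum_mset M = (\<Sum>v\<in>?I. v * count M v)" by (rule sum_mset_count[OF _ elem[OF M]]) simp
    also have "\<dots> = (\<Sum>v\<in>?I. v * (\<Sum>k\<in>?I. if k \<le> count M v then 1 else 0))"
      by (intro sum.cong refl arg_cong2[where f = "(*)"] cnt[OF M])
    finally show "sum_mset M = (\<Sum>v\<in>?I. v * (\<Sum>k\<in>?I. if k \<le> count M v then 1 else 0))" .
  qed
  also have "\<dots> = (\<Sum>v\<in>?I. \<Sum>M\<in>part_msets n. v * (\<Sum>k\<in>?I. if k \<le> count M v then 1 else 0))"
    by (rule sum.swap)
  also have "\<dots> = (\<Sum>v\<in>?I. v * (\<Sum>k\<in>?I. \<Sum>M\<in>part_msets n. if k \<le> count M v then 1 else 0))"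
    unfolding sum_distrib_left by (rule sum.cong[OF refl], rule sum.swap)
  also have "\<dots> = (\<Sum>v\<in>?I. \<Sum>k\<in>?I. if k * v \<le> n then v * num_parts (n - k * v) else 0)"
    unfolding sum_distrib_left
  proof (intro sum.cong refl)
    fix v k assume "v \<in> ?I"
    then have "(\<Sum>M\<in>part_msets n. if k \<le> count M v then 1 else 0) = (if k * v \<le> n then num_parts (n - k * v) else 0)"
      using card_count_ge[of v n k] by (simp add: sum.inter_filter[OF finite_part_msets, symmetric])
    then have "v * (\<Sum>M\<in>part_msets n. if k \<le> count M v then 1 else 0) = (if k * v \<le> n then v * num_parts (n - k * v) else 0)"
      by simp
    then show "(\<Sum>M\<in>part_msets n. v * (if k \<le> count M v then 1 else 0)) = (if k * v \<le> n then v * num_parts (n - k * v) else 0)"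
      by (simp only: sum_distrib_left)
  qed
  also have "\<dots> = (\<Sum>k\<in>?I. \<Sum>v\<in>?I. if k * v \<le> n then v * num_parts (n - k * v) else 0)"
    by (rule sum.swap)
  also have "\<dots> = (\<Sum>p\<in>?I \<times> ?I. if fst p * snd p \<le> n then snd p * num_parts (n - fst p * snd p) else 0)"
    by (simp add: sum.cartesian_product case_prod_beta)
  also have "\<dots> = (\<Sum>p\<in>{p\<in>?I \<times> ?I. fst p * snd p \<le> n}. snd p * num_parts (n - fst p * snd p))"
    by (rule sum.inter_filter[symmetric]) simp
  also have "{p\<in>?I \<times> ?I. fst p * snd p \<le> n} = div_pairs n"
  proof (intro equalityI subsetI)
    fix p assume p: "p \<in> div_pairs n"
    obtain k v where kv: "p = (k, v)" "1 \<le> k" "1 \<le> v" "k * v \<le> n"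
      using p by (auto simp: div_pairs_def)
    have "k \<le> k * v" "v \<le> k * v" using kv by simp_all
    then have "k \<le> n" "v \<le> n" using kv(4) by (meson order_trans)+
    then show "p \<in> {p\<in>?I \<times> ?I. fst p * snd p \<le> n}" using kv by simp
  qed (auto simp: div_pairs_def)
  finally have "real (n * num_parts n) = real (\<Sum>p\<in>div_pairs n. snd p * num_parts (n - fst p * snd p))" by simp
  then show ?thesis by (simp add: case_prod_beta)
qed

theorem num_parts_upper:
  assumes "0 \<le> a" "a < 1"
  obtains C where "C > 0" "\<And>n. real (num_parts n) \<le> C * growth a n"
proof (rule recursion_upper[of "\<lambda>n. real (num_parts n)" a])
  show "real n * real (num_parts n) = (\<Sum>(k, v)\<in>div_pairs n. real v * real (num_parts (n - k * v)))" for n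
    by (rule num_parts_recursion)
  show "real (num_parts n) > 0" for n using num_parts_pos by simp
  show "0 \<le> a" "a < 1" by (fact assms)+
  show thesis if "C > 0" "\<And>n. real (num_parts n) \<le> C * growth a n" for C
    by (rule \<open>\<And>C. 0 < C \<Longrightarrow> (\<And>n. real (num_parts n) \<le> C * growth a n) \<Longrightarrow> thesis\<close>[OF that])
qed

theorem num_parts_lower:
  assumes "1 < a" "a \<le> 2"
  obtains C where "C > 0" "\<And>n. C * growth a n \<le> real (num_parts n)"
proof (rule recursion_lower[of "\<lambda>n. real (num_parts n)" a])
  show "real n * real (num_parts n) = (\<Sum>(k, v)\<in>div_pairs n. real v * real (num_parts (n - k * v)))" for n
    by (rule num_parts_recursion)
  show "real (num_parts n) > 0" for n using num_parts_pos by simp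
  show "1 < a" "a \<le> 2" by (fact assms)+
  show thesis if "C > 0" "\<And>n. C * growth a n \<le> real (num_parts n)" for C
    by (rule \<open>\<And>C. 0 < C \<Longrightarrow> (\<And>n. C * growth a n \<le> real (num_parts n)) \<Longrightarrow> thesis\<close>[OF that])
qed

section \<open>Cores\<close>

text \<open>Abacus configurations with \<open>l\<close> beads. The ground state
  \<open>{0, ..., l - 1}\<close> has total \<open>\<Sum>i<l. i\<close>, and the excess over it is
  the size of the partition.\<close>

definition beads :: "nat \<Rightarrow> nat \<Rightarrow> nat set set" where
  "beads l n = {X. finite X \<and> card X = l \<and> \<Sum>X = n + (\<Sum>i<l. i)}"

definition bead_pos :: "nat \<Rightarrow> nat list \<Rightarrow> nat \<Rightarrow> nat" where
  "bead_pos l \<alpha> i = (if i < length \<alpha> then \<alpha> ! i else 0) + (l - 1 - i)"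

definition bead_set :: "nat \<Rightarrow> nat list \<Rightarrow> nat set" where
  "bead_set l \<alpha> = bead_pos l \<alpha> ` {..<l}"

lemma beta_set_eq: "beta_set l \<alpha> = int ` bead_set l \<alpha>"
  unfolding beta_set_def bead_set_def image_image
  by (rule image_cong) (auto simp: shape_exp_def bead_pos_def of_nat_diff)

lemma bead_pos_strict:
  assumes "\<alpha> \<in> partitions_of n" "i < j" "j < l"
  shows "bead_pos l \<alpha> j < bead_pos l \<alpha> i"
proof -
  have "sorted_wrt (\<ge>) \<alpha>" using assms by (simp add: partitions_of_def)
  then have "(if j < length \<alpha> then \<alpha> ! j else 0) \<le> (if i < length \<alpha> then \<alpha> ! i else 0)"
    using assms(2) by (auto simp: sorted_wrt_iff_nth_less)
  then show ?thesis using assms(2,3) by (simp add: bead_pos_def)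
qed

lemma inj_on_bead_pos: "\<alpha> \<in> partitions_of n \<Longrightarrow> inj_on (bead_pos l \<alpha>) {..<l}"
proof (rule linorder_inj_onI)
  fix i j assume "\<alpha> \<in> partitions_of n" "i < j" "j \<in> {..<l}"
  then have "bead_pos l \<alpha> j < bead_pos l \<alpha> i" by (intro bead_pos_strict) auto
  then show "bead_pos l \<alpha> i \<noteq> bead_pos l \<alpha> j" by simp
qed auto

lemma bead_set_in_beads:
  assumes a: "\<alpha> \<in> partitions_of n" and l: "n \<le> l"
  shows "bead_set l \<alpha> \<in> beads l n"
proof -
  have len: "length \<alpha> \<le> l" using length_le_sum_list[of \<alpha>] a l by (auto simp: partitions_of_def)
  have "\<Sum>(bead_set l \<alpha>) = (\<Sum>i<l. bead_pos l \<alpha> i)"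
    unfolding bead_set_def by (simp add: sum.reindex[OF inj_on_bead_pos[OF a]])
  also have "\<dots> = (\<Sum>i<l. if i < length \<alpha> then \<alpha> ! i else 0) + (\<Sum>i<l. l - Suc i)"
    unfolding bead_pos_def sum.distrib by simp
  also have "(\<Sum>i<l. l - Suc i) = (\<Sum>i<l. i)" by (rule sum.nat_diff_reindex)
  also have "(\<Sum>i<l. if i < length \<alpha> then \<alpha> ! i else 0) = (\<Sum>i<length \<alpha>. \<alpha> ! i)"
    by (rule sum.mono_neutral_cong_right) (use len in auto)
  also have "\<dots> = n" using a by (simp add: partitions_of_def sum_list_sum_nth atLeast0LessThan)
  finally have "\<Sum>(bead_set l \<alpha>) = n + (\<Sum>i<l. i)" .
  moreover have "card (bead_set l \<alpha>) = l" by (simp add: bead_set_def card_image[OF inj_on_bead_pos[OF a]])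
  ultimately show ?thesis by (simp add: beads_def bead_set_def)
qed

lemma inj_on_bead_set:
  assumes l: "n \<le> l"
  shows "inj_on (bead_set l) (partitions_of n)"
proof (rule inj_onI)
  fix \<alpha> \<beta> assume ab: "\<alpha> \<in> partitions_of n" "\<beta> \<in> partitions_of n" "bead_set l \<alpha> = bead_set l \<beta>"
  have srt: "sorted_wrt (<) (rev (map (bead_pos l \<gamma>) [0..<l]))" if "\<gamma> \<in> partitions_of n" for \<gamma>
    unfolding sorted_wrt_rev using bead_pos_strict[OF that] by (simp add: sorted_wrt_iff_nth_less)
  have "set (rev (map (bead_pos l \<alpha>) [0..<l])) = set (rev (map (bead_pos l \<beta>) [0..<l]))"
    using ab(3) by (simp add: bead_set_def atLeast0LessThan)
  then have "rev (map (bead_pos l \<alpha>) [0..<l]) = rev (map (bead_pos l \<beta>) [0..<l])"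
    using srt ab by (meson strict_sorted_equal)
  then have eq: "bead_pos l \<alpha> i = bead_pos l \<beta> i" if "i < l" for i
    using that by (simp add: map_eq_conv)
  have len: "length \<gamma> \<le> l" if "\<gamma> \<in> partitions_of n" for \<gamma>
    using length_le_sum_list[of \<gamma>] that l by (auto simp: partitions_of_def)
  have nz: "\<gamma> ! i \<noteq> 0" if "\<gamma> \<in> partitions_of n" "i < length \<gamma>" for \<gamma> i
  proof -
    have "\<gamma> ! i \<in> set \<gamma>" "0 \<notin> set \<gamma>" using that by (auto simp: partitions_of_def)
    then show ?thesis by metis
  qed
  have part: "(if i < length \<alpha> then \<alpha> ! i else 0) = (if i < length \<beta> then \<beta> ! i else 0)" if "i < l" for i
    using eq[OF that] by (simp only: bead_pos_def add_right_cancel)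
  have le: "length \<gamma> \<le> length \<delta>"
    if "\<gamma> \<in> partitions_of n" "\<And>i. i < l \<Longrightarrow> (if i < length \<gamma> then \<gamma> ! i else 0) = (if i < length \<delta> then \<delta> ! i else 0)" for \<gamma> \<delta>
  proof (rule ccontr)
    assume "\<not> length \<gamma> \<le> length \<delta>"
    then show False using that(2)[of "length \<delta>"] len[OF that(1)] nz[OF that(1), of "length \<delta>"] by simp
  qed
  have "length \<alpha> = length \<beta>" using le[OF ab(1), of \<beta>] le[OF ab(2), of \<alpha>] part by fastforce
  then show "\<alpha> = \<beta>"
  proof (rule nth_equalityI)
    fix i assume "i < length \<alpha>"
    then show "\<alpha> ! i = \<beta> ! i" using part[of i] len[OF ab(1)] \<open>length \<alpha> = length \<beta>\<close> by simp
  qed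
qed

lemma finite_beads: "finite (beads l n)"
proof (rule finite_subset)
  show "beads l n \<subseteq> Pow {..n + (\<Sum>i<l. i)}"
  proof
    fix X assume X: "X \<in> beads l n"
    then have "x \<le> \<Sum>X" if "x \<in> X" for x
      using member_le_sum[of x X "\<lambda>x. x"] that by (simp add: beads_def)
    then show "X \<in> Pow {..n + (\<Sum>i<l. i)}" using X by (auto simp: beads_def)
  qed
qed simp

lemma sorted_eq_replicate_filter:
  "sorted ys \<Longrightarrow> (ys :: nat list) = replicate (length ys - length (filter (\<lambda>x. x \<noteq> 0) ys)) 0 @ filter (\<lambda>x. x \<noteq> 0) ys"
proof (induction ys)
  case (Cons y ys)
  show ?case
  proof (cases "y = 0")
    case True
    have "length (filter (\<lambda>x. x \<noteq> 0) ys) \<le> length ys" by simp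
    then show ?thesis using Cons True by (simp add: Suc_diff_le)
  next
    case False
    then have "filter (\<lambda>x. x \<noteq> 0) (y # ys) = y # ys" using Cons.prems by (auto simp: filter_id_conv)
    then show ?thesis by simp
  qed
qed simp

text \<open>Subtracting \<open>i\<close> from the \<open>i\<close>-th smallest bead leaves a weakly
  increasing list with sum \<open>k\<close>. Its zeros come first and its length is
  \<open>l\<close>, so dropping them loses no information.\<close>

lemma card_beads_le: "card (beads l k) \<le> num_parts k"
proof -
  define ys where "ys X = map (\<lambda>i. sorted_list_of_set X ! i - i) [0..<l]" for X
  define \<phi> where "\<phi> X = filter (\<lambda>x. x \<noteq> 0) (rev (ys X))" for X
  have props: "i \<le> sorted_list_of_set X ! i" "Suc i < l \<Longrightarrow> sorted_list_of_set X ! i < sorted_list_of_set X ! Suc i"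
    if X: "X \<in> beads l k" and i: "i < l" for X i
  proof -
    have len: "length (sorted_list_of_set X) = l" using X by (simp add: beads_def)
    have st: "sorted_wrt (<) (sorted_list_of_set X)" by simp
    then show "sorted_list_of_set X ! i < sorted_list_of_set X ! Suc i" if "Suc i < l"
      using that len by (simp only: sorted_wrt_iff_nth_less)
    show "i \<le> sorted_list_of_set X ! i" using i
    proof (induction i)
      case (Suc i)
      then have "sorted_list_of_set X ! i < sorted_list_of_set X ! Suc i"
        using st len by (simp only: sorted_wrt_iff_nth_less)
      then show ?case using Suc by simp
    qed simp
  qed
  have srt: "sorted (ys X)" if X: "X \<in> beads l k" for X
  proof -
    have "ys X ! i \<le> ys X ! Suc i" if "Suc i < length (ys X)" for i
      using that props[OF X, of i] by (simp add: ys_def)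
    then show ?thesis by (simp add: sorted_iff_nth_Suc)
  qed
  have sumys: "sum_list (ys X) = k" if X: "X \<in> beads l k" for X
  proof -
    have "sum_list (ys X) + (\<Sum>i<l. i) = (\<Sum>i<l. sorted_list_of_set X ! i - i) + (\<Sum>i<l. i)"
      by (simp add: ys_def sum_list_distinct_conv_sum_set atLeast0LessThan)
    also have "\<dots> = (\<Sum>i<l. sorted_list_of_set X ! i)"
      unfolding sum.distrib[symmetric] by (intro sum.cong refl) (use props(1)[OF X] in simp)
    also have "\<dots> = sum_list (sorted_list_of_set X)"
      using X by (simp add: sum_list_sum_nth beads_def atLeast0LessThan)
    also have "\<dots> = \<Sum>X" using sum_list_distinct_conv_sum_set[of "sorted_list_of_set X" "\<lambda>x. x"] X by (simp add: beads_def)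
    finally show ?thesis using X by (simp add: beads_def)
  qed
  have mem: "\<phi> X \<in> partitions_of k" if X: "X \<in> beads l k" for X
  proof -
    have "sum_list (filter (\<lambda>x. x \<noteq> 0) zs) = sum_list zs" for zs :: "nat list" by (induction zs) auto
    moreover have "sorted_wrt (\<ge>) (filter (\<lambda>x. x \<noteq> 0) (rev (ys X)))"
      using srt[OF X] by (intro sorted_wrt_filter) (simp add: sorted_wrt_rev)
    ultimately show ?thesis using sumys[OF X] by (simp add: \<phi>_def partitions_of_def)
  qed
  have "inj_on \<phi> (beads l k)"
  proof (rule inj_onI)
    fix X Y assume XY: "X \<in> beads l k" "Y \<in> beads l k" "\<phi> X = \<phi> Y"
    then have "filter (\<lambda>x. x \<noteq> 0) (ys X) = filter (\<lambda>x. x \<noteq> 0) (ys Y)" by (simp add: \<phi>_def flip: rev_filter)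
    moreover have "length (ys X) = length (ys Y)" by (simp add: ys_def)
    ultimately have eq: "ys X = ys Y"
      using sorted_eq_replicate_filter[OF srt[OF XY(1)]] sorted_eq_replicate_filter[OF srt[OF XY(2)]] by metis
    have "sorted_list_of_set X = sorted_list_of_set Y"
    proof (rule nth_equalityI)
      fix i assume "i < length (sorted_list_of_set X)"
      then have i: "i < l" using XY(1) by (simp add: beads_def)
      then have "ys X ! i = ys Y ! i" using eq by simp
      then show "sorted_list_of_set X ! i = sorted_list_of_set Y ! i"
        using props(1)[OF XY(1) i] props(1)[OF XY(2) i] i by (simp add: ys_def)
    qed (use XY in \<open>simp add: beads_def\<close>)
    then have "set (sorted_list_of_set X) = set (sorted_list_of_set Y)" by simp
    then show "X = Y" using XY by (simp add: beads_def)
  qed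
  then have "card (beads l k) \<le> card (partitions_of k)"
    by (rule card_inj_on_le) (use mem finite_partitions_of in auto)
  then show ?thesis by (simp add: num_parts_def)
qed

definition hooks :: "nat \<Rightarrow> nat set \<Rightarrow> nat set" where
  "hooks m X = {x\<in>X. m \<le> x \<and> x - m \<notin> X}"

text \<open>Moving a bead from \<open>x\<close> down to \<open>x - m\<close> removes a hook of
  length \<open>m\<close>; together with the new position the move can be undone.\<close>

lemma sum_hooks_le:
  assumes m: "0 < m" "m \<le> n"
  shows "(\<Sum>X\<in>beads l n. card (hooks m X)) \<le> (\<Sum>Y\<in>beads l (n - m). card {y\<in>Y. y + m \<notin> Y})"
proof -
  define f where "f = (\<lambda>(X, x). (insert (x - m) (X - {x}), x - m))"
  have "(\<Sum>X\<in>beads l n. card (hooks m X)) = card (SIGMA X:beads l n. hooks m X)"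
    by (subst card_SigmaI[OF finite_beads]) (auto simp: hooks_def beads_def)
  also have "\<dots> \<le> card (SIGMA Y:beads l (n - m). {y\<in>Y. y + m \<notin> Y})"
  proof (rule card_inj_on_le[of f])
    show "inj_on f (SIGMA X:beads l n. hooks m X)"
    proof (rule inj_onI, clarify)
      fix X x Y y assume h: "x \<in> hooks m X" "y \<in> hooks m Y" "f (X, x) = f (Y, y)"
      then have xy: "x - m = y - m" "insert (x - m) (X - {x}) = insert (y - m) (Y - {y})" by (auto simp: f_def)
      moreover have "m \<le> x" "m \<le> y" using h by (simp_all add: hooks_def)
      ultimately have e: "x = y" by (metis le_add_diff_inverse)
      have "x - m \<notin> X" "x - m \<notin> Y" "x \<in> X" "x \<in> Y" using h e by (auto simp: hooks_def)
      then have "X = Y" using xy(2) e by (metis Diff_iff insert_Diff insert_ident)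
      then show "X = Y \<and> x = y" using e by simp
    qed
    show "f ` (SIGMA X:beads l n. hooks m X) \<subseteq> (SIGMA Y:beads l (n - m). {y\<in>Y. y + m \<notin> Y})"
    proof clarify
      fix X x Y y assume X: "X \<in> beads l n" and x: "x \<in> hooks m X" and f: "(Y, y) = f (X, x)"
      have xp: "x \<in> X" "m \<le> x" "x - m \<notin> X" using x by (auto simp: hooks_def)
      have fin: "finite X" "card X = l" "\<Sum>X = n + (\<Sum>i<l. i)" using X by (auto simp: beads_def)
      have Y: "Y = insert (x - m) (X - {x})" "y = x - m" using f by (auto simp: f_def)
      have "card Y = l" using fin xp m unfolding Y by (simp add: card_insert_if card_Diff_singleton)
        (metis Suc_pred card_gt_0_iff empty_iff)
      moreover have "\<Sum>Y = x - m + \<Sum>(X - {x})" using fin xp unfolding Y by simp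
      then have "\<Sum>Y + m = \<Sum>X" using fin xp by (simp add: sum.remove[of X x])
      moreover have "y + m \<notin> Y" using xp m unfolding Y by auto
      ultimately show "Y \<in> beads l (n - m) \<and> y \<in> {y\<in>Y. y + m \<notin> Y}"
        using fin m Y by (auto simp: beads_def)
    qed
    show "finite (SIGMA Y:beads l (n - m). {y\<in>Y. y + m \<notin> Y})"
      by (intro finite_SigmaI finite_beads) (auto simp: beads_def)
  qed
  also have "\<dots> = (\<Sum>Y\<in>beads l (n - m). card {y\<in>Y. y + m \<notin> Y})"
    by (subst card_SigmaI[OF finite_beads]) (auto simp: beads_def)
  finally show ?thesis .
qed

text \<open>Beads with a bead \<open>m\<close> places above are as many as beads with one
  \<open>m\<close> places below. Any bead outside the second kind has a vacant place below it, and
  so is counted by \<open>hooks\<close>, or lies among the first \<open>m\<close> positions.\<close>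

lemma card_addable_le:
  assumes "finite Y"
  shows "card {y\<in>Y. y + m \<notin> Y} \<le> m + card (hooks m Y)"
proof -
  let ?A = "{y\<in>Y. y + m \<in> Y}" and ?B = "{x\<in>Y. m \<le> x \<and> x - m \<in> Y}" and ?L = "{x\<in>Y. x < m}"
  have "bij_betw (\<lambda>y. y + m) ?A ?B"
    by (rule bij_betw_byWitness[of _ "\<lambda>x. x - m"]) auto
  then have AB: "card ?A = card ?B" by (rule bij_betw_same_card)
  have "Y = {y\<in>Y. y + m \<notin> Y} \<union> ?A" by auto
  then have "card Y = card ({y\<in>Y. y + m \<notin> Y} \<union> ?A)" by simp
  also have "\<dots> = card {y\<in>Y. y + m \<notin> Y} + card ?A"
    by (rule card_Un_disjoint) (use assms in auto)
  finally have 1: "card Y = card {y\<in>Y. y + m \<notin> Y} + card ?A" .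
  have "Y \<subseteq> (hooks m Y \<union> ?B) \<union> ?L" by (auto simp: hooks_def)
  then have "card Y \<le> card ((hooks m Y \<union> ?B) \<union> ?L)"
    by (rule card_mono[rotated]) (use assms in \<open>auto simp: hooks_def\<close>)
  also have "\<dots> \<le> card (hooks m Y) + card ?B + card ?L"
    by (meson add_le_mono card_Un_le le_trans order_refl)
  also have "card ?L \<le> card {..<m}" by (rule card_mono) auto
  finally show ?thesis using 1 AB by simp
qed

text \<open>First moment bound on the number of \<open>m\<close>-hooks, unrolled twice. Estimating
  by \<open>n\<close> hooks per partition at once would cost \<open>n p(n - m)\<close>, far too much
  when \<open>p(n - m) / p(n)\<close> is only about \<open>n^(-1/2)\<close>; after the second
  removal the factor \<open>n\<close> is affordable.\<close>

theorem card_noncore_le: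
  assumes m: "0 < m" "2 * m \<le> n"
  shows "card {\<alpha>\<in>partitions_of n. \<exists>x\<in>beta_set n \<alpha>. int m \<le> x \<and> x - int m \<notin> beta_set n \<alpha>}
    \<le> m * num_parts (n - m) + n * num_parts (n - 2 * m)"
proof -
  have "card {\<alpha>\<in>partitions_of n. \<exists>x\<in>beta_set n \<alpha>. int m \<le> x \<and> x - int m \<notin> beta_set n \<alpha>}
      \<le> card {X\<in>beads n n. hooks m X \<noteq> {}}"
  proof (rule card_inj_on_le[of "bead_set n"])
    show "inj_on (bead_set n) {\<alpha>\<in>partitions_of n. \<exists>x\<in>beta_set n \<alpha>. int m \<le> x \<and> x - int m \<notin> beta_set n \<alpha>}"
      by (rule inj_on_subset[OF inj_on_bead_set[of n n]]) auto
    show "bead_set n ` {\<alpha>\<in>partitions_of n. \<exists>x\<in>beta_set n \<alpha>. int m \<le> x \<and> x - int m \<notin> beta_set n \<alpha>}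
        \<subseteq> {X\<in>beads n n. hooks m X \<noteq> {}}"
    proof (intro image_subsetI, elim CollectE conjE bexE)
      fix \<alpha> x assume a: "\<alpha> \<in> partitions_of n" and x: "x \<in> beta_set n \<alpha>" "int m \<le> x" "x - int m \<notin> beta_set n \<alpha>"
      obtain z where z: "x = int z" "z \<in> bead_set n \<alpha>" using x(1) unfolding beta_set_eq by blast
      have "m \<le> z" using x(2) z by simp
      moreover have "z - m \<notin> bead_set n \<alpha>"
      proof
        assume "z - m \<in> bead_set n \<alpha>"
        then have "int (z - m) \<in> beta_set n \<alpha>" unfolding beta_set_eq by (rule imageI)
        then show False using x(3) z \<open>m \<le> z\<close> by (simp add: of_nat_diff)
      qed
      ultimately have "z \<in> hooks m (bead_set n \<alpha>)" using z by (simp add: hooks_def)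
      then show "bead_set n \<alpha> \<in> {X\<in>beads n n. hooks m X \<noteq> {}}" using bead_set_in_beads[OF a, of n] by blast
    qed
  qed (simp add: finite_beads)
  also have "\<dots> = (\<Sum>X\<in>{X\<in>beads n n. hooks m X \<noteq> {}}. 1)" by simp
  also have "\<dots> \<le> (\<Sum>X\<in>{X\<in>beads n n. hooks m X \<noteq> {}}. card (hooks m X))"
    by (intro sum_mono) (auto simp: Suc_le_eq card_gt_0_iff hooks_def beads_def)
  also have "\<dots> \<le> (\<Sum>X\<in>beads n n. card (hooks m X))"
    by (rule sum_mono2) (auto simp: finite_beads)
  also have "\<dots> \<le> (\<Sum>Y\<in>beads n (n - m). card {y\<in>Y. y + m \<notin> Y})" using m by (intro sum_hooks_le) auto
  also have "\<dots> \<le> (\<Sum>Y\<in>beads n (n - m). m + card (hooks m Y))"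
    by (intro sum_mono card_addable_le) (simp add: beads_def)
  also have "\<dots> = m * card (beads n (n - m)) + (\<Sum>Y\<in>beads n (n - m). card (hooks m Y))"
    by (simp add: sum.distrib)
  also have "(\<Sum>Y\<in>beads n (n - m). card (hooks m Y)) \<le> (\<Sum>Y\<in>beads n (n - m - m). card {y\<in>Y. y + m \<notin> Y})"
    using m by (intro sum_hooks_le) auto
  \<comment> \<open>At most one position per bead, and there are \<open>n\<close> beads.\<close>
  also have "\<dots> \<le> (\<Sum>Y\<in>beads n (n - m - m). n)"
  proof (rule sum_mono)
    fix Y assume "Y \<in> beads n (n - m - m)"
    then have "finite Y" "card Y = n" by (auto simp: beads_def)
    then show "card {y\<in>Y. y + m \<notin> Y} \<le> n" using card_mono[of Y "{y\<in>Y. y + m \<notin> Y}"] by auto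
  qed
  also have "\<dots> = n * card (beads n (n - 2 * m))" by (simp add: mult_2 diff_diff_eq)
  also have "m * card (beads n (n - m)) + n * card (beads n (n - 2 * m)) \<le> m * num_parts (n - m) + n * num_parts (n - 2 * m)"
    by (intro add_mono mult_le_mono card_beads_le order_refl)
  finally show ?thesis by simp
qed

section \<open>Random partitions\<close>

lemma prob_pair_pmf:
  "measure_pmf.prob (pair_pmf M N) (A \<times> B) = measure_pmf.prob M A * measure_pmf.prob N B"
proof -
  have "measure_pmf.prob (pair_pmf M N) (A \<times> B) = measure_pmf.prob (pair_pmf M N) ((A \<times> B) \<inter> set_pmf (pair_pmf M N))"
    by (rule measure_Int_set_pmf[symmetric])
  also have "(A \<times> B) \<inter> set_pmf (pair_pmf M N) = (A \<inter> set_pmf M) \<times> (B \<inter> set_pmf N)" by auto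
  also have "measure_pmf.prob (pair_pmf M N) \<dots> = measure_pmf.prob M (A \<inter> set_pmf M) * measure_pmf.prob N (B \<inter> set_pmf N)"
    by (rule measure_pmf_prob_product) (auto intro: countable_Int2)
  finally show ?thesis by (simp add: measure_Int_set_pmf)
qed

definition depends_on :: "'a set \<Rightarrow> (('a \<Rightarrow> 'b) \<Rightarrow> bool) \<Rightarrow> bool" where
  "depends_on A P \<longleftrightarrow> (\<forall>f g. (\<forall>x\<in>A. f x = g x) \<longrightarrow> P f = P g)"

lemma prob_Pi_pmf_Un:
  assumes fin: "finite A" "finite B" "A \<inter> B = {}" and P: "depends_on A P" and Q: "depends_on B Q"
  shows "measure_pmf.prob (Pi_pmf (A \<union> B) d p) {f. P f \<and> Q f}
    = measure_pmf.prob (Pi_pmf A d p) {f. P f} * measure_pmf.prob (Pi_pmf B d p) {f. Q f}"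
proof -
  let ?h = "\<lambda>(f, g) x. if x \<in> A then f x else g x"
  have "P (?h (f, g)) = P f" for f g
  proof -
    have "\<forall>x\<in>A. ?h (f, g) x = f x" by simp
    then show ?thesis using P unfolding depends_on_def by blast
  qed
  moreover have "Q (?h (f, g)) = Q g" for f g
  proof -
    have "\<forall>x\<in>B. ?h (f, g) x = g x" using fin(3) by auto
    then show ?thesis using Q unfolding depends_on_def by blast
  qed
  ultimately have "?h -` {f. P f \<and> Q f} = {f. P f} \<times> {f. Q f}" by auto
  then show ?thesis
    unfolding Pi_pmf_union[OF fin] measure_map_pmf by (simp only: prob_pair_pmf)
qed

lemma prob_Pi_pmf_UN:
  fixes E :: "'k \<Rightarrow> ('a \<Rightarrow> 'b) \<Rightarrow> bool" and I :: "'k \<Rightarrow> 'a set"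
  assumes "finite K" "\<And>k. k \<in> K \<Longrightarrow> finite (I k)" "disjoint_family_on I K"
    and "\<And>k. k \<in> K \<Longrightarrow> depends_on (I k) (E k)"
  shows "measure_pmf.prob (Pi_pmf (\<Union>k\<in>K. I k) d p) {f. \<forall>k\<in>K. E k f}
    = (\<Prod>k\<in>K. measure_pmf.prob (Pi_pmf (I k) d p) {f. E k f})"
  using assms
proof (induction K rule: finite_induct)
  case empty
  then show ?case by simp
next
  case (insert x K)
  have disj: "I x \<inter> (\<Union>k\<in>K. I k) = {}"
    using insert.prems(2) insert.hyps(2) by (auto simp: disjoint_family_on_def)
  have dep: "depends_on (\<Union>k\<in>K. I k) (\<lambda>f. \<forall>k\<in>K. E k f)"
    unfolding depends_on_def
  proof (intro allI impI)
    fix f g :: "'a \<Rightarrow> 'b" assume fg: "\<forall>x\<in>\<Union>k\<in>K. I k. f x = g x"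
    have "E k f = E k g" if "k \<in> K" for k
      using insert.prems(3)[of k] that fg unfolding depends_on_def by blast
    then show "(\<forall>k\<in>K. E k f) = (\<forall>k\<in>K. E k g)" by blast
  qed
  have "measure_pmf.prob (Pi_pmf (I x \<union> (\<Union>k\<in>K. I k)) d p) {f. E x f \<and> (\<forall>k\<in>K. E k f)}
      = measure_pmf.prob (Pi_pmf (I x) d p) {f. E x f} * measure_pmf.prob (Pi_pmf (\<Union>k\<in>K. I k) d p) {f. \<forall>k\<in>K. E k f}"
    by (rule prob_Pi_pmf_Un[OF _ _ disj _ dep]) (use insert in auto)
  also have "measure_pmf.prob (Pi_pmf (\<Union>k\<in>K. I k) d p) {f. \<forall>k\<in>K. E k f}
      = (\<Prod>k\<in>K. measure_pmf.prob (Pi_pmf (I k) d p) {f. E k f})"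
    by (rule insert.IH) (use insert.prems in \<open>auto simp: disjoint_family_on_def\<close>)
  finally show ?case using insert.hyps by simp
qed

lemma prob_Pi_pmf_subset:
  assumes "finite A" "U \<subseteq> A" "depends_on U P"
  shows "measure_pmf.prob (Pi_pmf A d p) {f. P f} = measure_pmf.prob (Pi_pmf U d p) {f. P f}"
proof -
  have U: "A = U \<union> (A - U)" using assms(2) by blast
  have "measure_pmf.prob (Pi_pmf (U \<union> (A - U)) d p) {f. P f \<and> True}
     = measure_pmf.prob (Pi_pmf U d p) {f. P f} * measure_pmf.prob (Pi_pmf (A - U) d p) {f. True}"
    by (rule prob_Pi_pmf_Un) (use assms finite_subset in \<open>auto simp: depends_on_def\<close>)
  then show ?thesis using U by simp
qed

lemma prob_geometric_atLeast:
  assumes "0 < q" "q \<le> 1"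
  shows "measure_pmf.prob (geometric_pmf q) {a..} = (1 - q) ^ a"
proof -
  have "measure_pmf.prob (geometric_pmf q) {..<a} = (\<Sum>m<a. (1 - q) ^ m * q)"
    using assms by (simp add: measure_measure_pmf_finite)
  also have "\<dots> = 1 - (1 - q) ^ a" by (induction a) (simp_all add: algebra_simps)
  finally have "measure_pmf.prob (geometric_pmf q) (UNIV - {..<a}) = (1 - q) ^ a"
    using measure_pmf.prob_compl[of "{..<a}" "geometric_pmf q"] by simp
  moreover have "UNIV - {..<a} = {a..}" by auto
  ultimately show ?thesis by simp
qed

text \<open>The Boltzmann model: multiplicities of the parts \<open>j\<close> are independent and
  geometric with ratio \<open>r ^ j\<close>. \<open>J\<close> is the level of the part to be
  assembled and \<open>L\<close> the last level of the chain.\<close>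

locale chains =
  fixes p L J :: nat and r :: real
  assumes p: "2 \<le> p" and L: "0 < L" "L \<le> J" and r: "0 < r" "r < 1"
begin

definition chain :: "nat \<Rightarrow> nat set" where "chain k = (\<lambda>i. p ^ i * k) ` {..L}"

definition heavy :: "nat \<Rightarrow> (nat \<Rightarrow> nat) \<Rightarrow> bool" where
  "heavy k f \<longleftrightarrow> p ^ J \<le> (\<Sum>i\<le>L. f (p ^ i * k) * p ^ i)"

text \<open>A lower bound for the probability that the chain of \<open>k\<close> is heavy:
  \<open>r ^ (k * p ^ J)\<close> is the weight of one way to reach the total \<open>p ^ J\<close>,
  and the factors \<open>p ^ (J - i) / L\<close> count the multiplicities allowed at level
  \<open>i\<close>.\<close>

definition q :: "nat \<Rightarrow> real" where
  "q k = r ^ (k * p ^ J) * (\<Prod>i\<in>{1..L}. (real (p ^ (J - i)) / real L) * (1 - r ^ (p ^ i * k)))"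

definition geo :: "nat \<Rightarrow> nat pmf" where "geo j = geometric_pmf (1 - r ^ j)"

lemma geo_valid: "0 < j \<Longrightarrow> 0 < 1 - r ^ j" "0 < j \<Longrightarrow> 1 - r ^ j \<le> 1"
  using r by (auto simp: power_less_one_iff)

lemma inj_chain: "0 < k \<Longrightarrow> inj_on (\<lambda>i. p ^ i * k) {..L}"
  using p by (auto intro!: inj_onI)

lemma depends_on_heavy: "depends_on (chain k) (\<lambda>f. \<not> heavy k f)"
  unfolding depends_on_def
proof (intro allI impI)
  fix f g :: "nat \<Rightarrow> nat" assume fg: "\<forall>x\<in>chain k. f x = g x"
  have "(\<Sum>i\<le>L. f (p ^ i * k) * p ^ i) = (\<Sum>i\<le>L. g (p ^ i * k) * p ^ i)"
    by (intro sum.cong refl) (use fg in \<open>auto simp: chain_def\<close>)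
  then show "(\<not> heavy k f) = (\<not> heavy k g)" by (simp add: heavy_def)
qed

text \<open>At each level \<open>i\<close> from 1 to \<open>L\<close> any multiplicity up to
  \<open>p ^ (J - i) / L\<close> may be prescribed: it takes at most a share \<open>1 / L\<close> of
  the target, and the multiplicity of \<open>k\<close> fills the remainder. The events are disjoint
  and equally likely, since the weight sees only the total.\<close>

lemma prob_heavy_ge:
  assumes k: "0 < k"
  shows "q k \<le> measure_pmf.prob (Pi_pmf (chain k) 0 geo) {f. heavy k f}"
proof -
  define b where "b i = p ^ (J - i) div L + 1" for i
  define Cs where "Cs = PiE {1..L} (\<lambda>i. {..<b i})"
  have finCs: "finite Cs" unfolding Cs_def by (intro finite_PiE) auto
  define tot where "tot c = (\<Sum>i\<in>{1..L}. c i * p ^ i)" for c :: "nat \<Rightarrow> nat"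
  have tot_le: "tot c \<le> p ^ J" if c: "c \<in> Cs" for c
  proof -
    have "L * tot c = (\<Sum>i\<in>{1..L}. L * (c i * p ^ i))" by (simp add: tot_def sum_distrib_left)
    also have "\<dots> \<le> (\<Sum>i\<in>{1..L}. p ^ J)"
    proof (rule sum_mono)
      fix i assume i: "i \<in> {1..L}"
      then have "c i < b i" using c by (auto simp: Cs_def PiE_iff)
      then have "c i \<le> p ^ (J - i) div L" by (simp add: b_def)
      then have "L * c i \<le> L * (p ^ (J - i) div L)" by (rule mult_le_mono2)
      also have "\<dots> \<le> p ^ (J - i)" by (simp add: times_div_less_eq_dividend)
      finally have "L * c i * p ^ i \<le> p ^ (J - i) * p ^ i" by (rule mult_le_mono1)
      also have "\<dots> = p ^ J" using i L by (simp flip: power_add)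
      finally show "L * (c i * p ^ i) \<le> p ^ J" by (simp only: mult.assoc)
    qed
    also have "\<dots> = L * p ^ J" by simp
    finally show ?thesis using L by simp
  qed
  define idx where "idx = inv_into {..L} (\<lambda>i. p ^ i * k)"
  have idx: "idx (p ^ i * k) = i" if "i \<le> L" for i
    unfolding idx_def using inv_into_f_f[OF inj_chain[OF k], of i] that by simp
  \<comment> \<open>Level 0 asks for a tail and not for an exact value, so its probability is the
    pure power \<open>(r ^ k) ^ (p ^ J - tot c)\<close>, without a small factor
    \<open>1 - r ^ k\<close>.\<close>
  define B where "B c j = (if idx j = 0 then {p ^ J - tot c..} else {c (idx j)})" for c j
  define ev where "ev c = PiE_dflt (chain k) 0 (B c)" for c
  have fin: "finite (chain k)" by (simp add: chain_def)
  have ev_prob: "measure_pmf.prob (Pi_pmf (chain k) 0 geo) (ev c)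
      = r ^ (k * p ^ J) * (\<Prod>i\<in>{1..L}. 1 - r ^ (p ^ i * k))" if c: "c \<in> Cs" for c
  proof -
    have pos: "0 < p ^ i * k" for i using k p by simp
    have "measure_pmf.prob (Pi_pmf (chain k) 0 geo) (ev c) = (\<Prod>i\<le>L. measure_pmf.prob (geo (p ^ i * k)) (B c (p ^ i * k)))"
      unfolding ev_def measure_Pi_pmf_PiE_dflt[OF fin] unfolding chain_def
      by (subst prod.reindex[OF inj_chain[OF k]]) simp
    also have "\<dots> = measure_pmf.prob (geo (p ^ 0 * k)) (B c (p ^ 0 * k))
        * (\<Prod>i\<in>{1..L}. measure_pmf.prob (geo (p ^ i * k)) (B c (p ^ i * k)))"
    proof -
      have "{..L} = insert 0 {1..L}" by auto
      then show ?thesis by simp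
    qed
    also have "measure_pmf.prob (geo (p ^ 0 * k)) (B c (p ^ 0 * k)) = (r ^ k) ^ (p ^ J - tot c)"
      using prob_geometric_atLeast[OF geo_valid[OF k], of "p ^ J - tot c"] idx[of 0] by (simp add: B_def geo_def)
    also have "(\<Prod>i\<in>{1..L}. measure_pmf.prob (geo (p ^ i * k)) (B c (p ^ i * k)))
        = (\<Prod>i\<in>{1..L}. (r ^ (p ^ i * k)) ^ c i * (1 - r ^ (p ^ i * k)))"
    proof (rule prod.cong[OF refl])
      fix i assume i: "i \<in> {1..L}"
      then have "B c (p ^ i * k) = {c i}" using idx[of i] by (simp add: B_def)
      then show "measure_pmf.prob (geo (p ^ i * k)) (B c (p ^ i * k)) = (r ^ (p ^ i * k)) ^ c i * (1 - r ^ (p ^ i * k))"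
        using geo_valid[OF pos[of i]] by (simp add: measure_pmf_single geo_def)
    qed
    also have "(r ^ k) ^ (p ^ J - tot c) * (\<Prod>i\<in>{1..L}. (r ^ (p ^ i * k)) ^ c i * (1 - r ^ (p ^ i * k)))
       = ((r ^ k) ^ (p ^ J - tot c) * (\<Prod>i\<in>{1..L}. (r ^ k) ^ (c i * p ^ i))) * (\<Prod>i\<in>{1..L}. 1 - r ^ (p ^ i * k))"
      by (simp add: prod.distrib mult_ac flip: power_mult)
    also have "(\<Prod>i\<in>{1..L}. (r ^ k) ^ (c i * p ^ i)) = (r ^ k) ^ tot c"
      by (simp add: tot_def power_sum)
    also have "(r ^ k) ^ (p ^ J - tot c) * (r ^ k) ^ tot c = r ^ (k * p ^ J)"
      using tot_le[OF c] by (simp add: power_mult flip: power_add)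
    finally show ?thesis .
  qed
  have sub: "ev c \<subseteq> {f. heavy k f}" if c: "c \<in> Cs" for c
  proof
    fix f assume f: "f \<in> ev c"
    have fB: "f (p ^ i * k) \<in> B c (p ^ i * k)" if "i \<le> L" for i
    proof -
      have "p ^ i * k \<in> chain k" using that by (auto simp: chain_def)
      then show ?thesis using f unfolding ev_def PiE_dflt_def by blast
    qed
    have f0: "p ^ J - tot c \<le> f (p ^ 0 * k)" using fB[of 0] idx[of 0] by (simp add: B_def)
    have fi: "f (p ^ i * k) = c i" if "i \<in> {1..L}" for i
      using fB[of i] idx[of i] that by (simp add: B_def)
    have "(\<Sum>i\<le>L. f (p ^ i * k) * p ^ i) = f (p ^ 0 * k) * p ^ 0 + (\<Sum>i\<in>{1..L}. f (p ^ i * k) * p ^ i)"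
    proof -
      have "{..L} = insert 0 {1..L}" by auto
      then show ?thesis by simp
    qed
    also have "(\<Sum>i\<in>{1..L}. f (p ^ i * k) * p ^ i) = tot c"
      unfolding tot_def by (intro sum.cong refl) (simp only: fi)
    finally have "p ^ J \<le> (\<Sum>i\<le>L. f (p ^ i * k) * p ^ i)" using f0 by simp
    then show "f \<in> {f. heavy k f}" by (simp add: heavy_def)
  qed
  have disj: "disjoint_family_on ev Cs"
    unfolding disjoint_family_on_def
  proof (intro ballI impI, rule ccontr)
    fix c c' assume cc: "c \<in> Cs" "c' \<in> Cs" "c \<noteq> c'" "ev c \<inter> ev c' \<noteq> {}"
    then obtain f where f: "f \<in> ev c" "f \<in> ev c'" by blast
    have "c i = c' i" if i: "i \<in> {1..L}" for i
    proof -
      have "f (p ^ i * k) \<in> B c (p ^ i * k)" "f (p ^ i * k) \<in> B c' (p ^ i * k)"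
      proof -
        have "p ^ i * k \<in> chain k" using i by (auto simp: chain_def)
        then show "f (p ^ i * k) \<in> B c (p ^ i * k)" "f (p ^ i * k) \<in> B c' (p ^ i * k)"
          using f unfolding ev_def PiE_dflt_def by blast+
      qed
      then show ?thesis using idx[of i] i by (simp add: B_def)
    qed
    then have "c = c'" using cc(1,2) unfolding Cs_def by (intro PiE_ext[of c _ _ c']) auto
    then show False using cc(3) by simp
  qed
  have "q k \<le> (\<Sum>c\<in>Cs. r ^ (k * p ^ J) * (\<Prod>i\<in>{1..L}. 1 - r ^ (p ^ i * k)))"
  proof -
    have "real (card Cs) = (\<Prod>i\<in>{1..L}. real (b i))"
      unfolding Cs_def by (subst card_PiE) auto
    then have "(\<Sum>c\<in>Cs. r ^ (k * p ^ J) * (\<Prod>i\<in>{1..L}. 1 - r ^ (p ^ i * k)))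
       = r ^ (k * p ^ J) * (\<Prod>i\<in>{1..L}. real (b i) * (1 - r ^ (p ^ i * k)))"
      by (simp add: prod.distrib)
    moreover have "(\<Prod>i\<in>{1..L}. (real (p ^ (J - i)) / real L) * (1 - r ^ (p ^ i * k)))
        \<le> (\<Prod>i\<in>{1..L}. real (b i) * (1 - r ^ (p ^ i * k)))"
    proof (rule prod_mono, intro conjI mult_right_mono)
      fix i
      have pos: "0 < p ^ i * k" using k p by simp
      show g: "0 \<le> 1 - r ^ (p ^ i * k)" using geo_valid(1)[OF pos] by simp
      show "0 \<le> real (p ^ (J - i)) / real L * (1 - r ^ (p ^ i * k))" using g by simp
      have "p ^ (J - i) \<le> b i * L"
        unfolding b_def using L by (simp add: add.commute dividend_less_div_times less_imp_le)
      then have "real (p ^ (J - i)) \<le> real (b i) * real L" by (metis of_nat_le_iff of_nat_mult)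
      then show "real (p ^ (J - i)) / real L \<le> real (b i)" using L by (simp add: pos_divide_le_eq)
    qed
    ultimately show ?thesis unfolding q_def using r by (simp add: mult_left_mono)
  qed
  also have "\<dots> = (\<Sum>c\<in>Cs. measure_pmf.prob (Pi_pmf (chain k) 0 geo) (ev c))"
    by (intro sum.cong refl ev_prob[symmetric])
  also have "\<dots> = measure_pmf.prob (Pi_pmf (chain k) 0 geo) (\<Union>c\<in>Cs. ev c)"
    by (rule measure_pmf.finite_measure_finite_Union[symmetric]) (use finCs disj in auto)
  also have "\<dots> \<le> measure_pmf.prob (Pi_pmf (chain k) 0 geo) {f. heavy k f}"
    by (rule measure_pmf.finite_measure_mono) (use sub in auto)
  finally show ?thesis .
qed

text \<open>All partitions of \<open>n\<close> have the same probability in the model, so counting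
  reduces to the probability of an event, with no conditioning on the size. No \<open>k\<close> in
  \<open>K\<close> is divisible by \<open>p\<close>, hence the chains are disjoint and the events
  independent.\<close>

theorem card_light_le:
  assumes K: "finite K" "\<And>k. k \<in> K \<Longrightarrow> 0 < k \<and> \<not> p dvd k \<and> p ^ L * k \<le> n"
  shows "real (card {M\<in>part_msets n. \<forall>k\<in>K. \<not> heavy k (count M)}) * (r ^ n * (\<Prod>j\<in>{1..n}. 1 - r ^ j))
    \<le> (\<Prod>k\<in>K. 1 - q k)"
proof -
  let ?P = "Pi_pmf {1..n} 0 geo"
  let ?bad = "{M\<in>part_msets n. \<forall>k\<in>K. \<not> heavy k (count M)}"
  have fin: "finite ?bad" using finite_part_msets[of n] by simp
  have inj: "inj_on count ?bad" by (rule inj_onI) (simp add: multiset_eq_iff)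
  have pm: "pmf ?P (count M) = r ^ n * (\<Prod>j\<in>{1..n}. 1 - r ^ j)" if M: "M \<in> part_msets n" for M
  proof -
    have sub: "set_mset M \<subseteq> {1..n}"
    proof
      fix v assume v: "v \<in># M"
      then have "v \<le> n" using M by (auto dest!: multi_member_split simp: part_msets_def)
      moreover have "v \<noteq> 0" using M v by (metis mem_Collect_eq part_msets_def)
      ultimately show "v \<in> {1..n}" by simp
    qed
    have "pmf ?P (count M) = (\<Prod>j\<in>{1..n}. pmf (geo j) (count M j))"
      by (rule pmf_Pi') (use sub in \<open>auto simp: count_eq_zero_iff\<close>)
    also have "\<dots> = (\<Prod>j\<in>{1..n}. (r ^ j) ^ count M j * (1 - r ^ j))"
    proof (rule prod.cong[OF refl])
      fix j assume "j \<in> {1..n}"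
      then show "pmf (geo j) (count M j) = (r ^ j) ^ count M j * (1 - r ^ j)"
        using geo_valid[of j] by (simp add: geo_def)
    qed
    also have "\<dots> = (\<Prod>j\<in>{1..n}. r ^ (j * count M j)) * (\<Prod>j\<in>{1..n}. 1 - r ^ j)"
      by (simp add: prod.distrib power_mult)
    also have "(\<Prod>j\<in>{1..n}. r ^ (j * count M j)) = r ^ (\<Sum>j\<in>{1..n}. j * count M j)"
      by (simp add: power_sum)
    also have "(\<Sum>j\<in>{1..n}. j * count M j) = n"
      using sum_mset_count[OF _ sub] M by (simp add: part_msets_def)
    finally show ?thesis .
  qed
  have "real (card ?bad) * (r ^ n * (\<Prod>j\<in>{1..n}. 1 - r ^ j)) = (\<Sum>M\<in>?bad. pmf ?P (count M))"
    using pm by simp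
  also have "\<dots> = measure_pmf.prob ?P (count ` ?bad)"
    using fin by (simp add: measure_measure_pmf_finite sum.reindex[OF inj])
  also have "\<dots> \<le> measure_pmf.prob ?P {f. \<forall>k\<in>K. \<not> heavy k f}"
    by (rule measure_pmf.finite_measure_mono) auto
  also have "\<dots> = measure_pmf.prob (Pi_pmf (\<Union>k\<in>K. chain k) 0 geo) {f. \<forall>k\<in>K. \<not> heavy k f}"
  proof (rule prob_Pi_pmf_subset)
    show "(\<Union>k\<in>K. chain k) \<subseteq> {1..n}"
    proof clarify
      fix k x assume kx: "k \<in> K" "x \<in> chain k"
      then obtain i where i: "i \<le> L" "x = p ^ i * k" by (auto simp: chain_def)
      have "p ^ i * k \<le> p ^ L * k" using i p by (intro mult_le_mono1 power_increasing) auto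
      also have "\<dots> \<le> n" using K(2)[OF kx(1)] by simp
      finally have "x \<le> n" using i by simp
      moreover have "0 < x" using i K(2)[OF kx(1)] p by simp
      ultimately show "x \<in> {1..n}" by simp
    qed
    show "depends_on (\<Union>k\<in>K. chain k) (\<lambda>f. \<forall>k\<in>K. \<not> heavy k f)"
      unfolding depends_on_def
    proof (intro allI impI)
      fix f g :: "nat \<Rightarrow> nat" assume fg: "\<forall>x\<in>\<Union>k\<in>K. chain k. f x = g x"
      have "(\<not> heavy k f) = (\<not> heavy k g)" if "k \<in> K" for k
        using depends_on_heavy[of k] that fg unfolding depends_on_def by blast
      then show "(\<forall>k\<in>K. \<not> heavy k f) = (\<forall>k\<in>K. \<not> heavy k g)" by blast
    qed
  qed simp
  also have "\<dots> = (\<Prod>k\<in>K. measure_pmf.prob (Pi_pmf (chain k) 0 geo) {f. \<not> heavy k f})"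
  proof (rule prob_Pi_pmf_UN[OF K(1)])
    show "disjoint_family_on chain K"
      unfolding disjoint_family_on_def
    proof (intro ballI impI, rule ccontr)
      fix k k' assume kk: "k \<in> K" "k' \<in> K" "k \<noteq> k'" "chain k \<inter> chain k' \<noteq> {}"
      then obtain i i' where e: "p ^ i * k = p ^ i' * k'" by (auto simp: chain_def)
      have *: False if lt: "i < i'" and e: "p ^ i * k = p ^ i' * k'" and nd: "\<not> p dvd k" for i i' k k'
      proof -
        obtain d where "i' = Suc (i + d)" using less_imp_Suc_add[OF lt] by blast
        then have "p ^ i * k = p ^ i * (p * (p ^ d * k'))" using e by (simp add: power_add mult_ac)
        then have "k = p * (p ^ d * k')" using p by simp
        then show False using nd by simp
      qed
      show False
      proof (cases i i' rule: linorder_cases)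
        case equal
        then show ?thesis using e kk(3) p by simp
      next
        case less
        then show ?thesis using *[OF less e] K(2) kk(1) by blast
      next
        case greater
        then show ?thesis using *[OF greater e[symmetric]] K(2) kk(2) by blast
      qed
    qed
  qed (use depends_on_heavy in \<open>auto simp: chain_def\<close>)
  also have "\<dots> \<le> (\<Prod>k\<in>K. 1 - q k)"
  proof (rule prod_mono, intro conjI)
    fix k assume "k \<in> K"
    then have k: "0 < k" using K(2) by blast
    have "{f. \<not> heavy k f} = UNIV - {f. heavy k f}" by auto
    then have "measure_pmf.prob (Pi_pmf (chain k) 0 geo) {f. \<not> heavy k f} = 1 - measure_pmf.prob (Pi_pmf (chain k) 0 geo) {f. heavy k f}"
      using measure_pmf.prob_compl[of "{f. heavy k f}" "Pi_pmf (chain k) 0 geo"] by simp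
    then show "measure_pmf.prob (Pi_pmf (chain k) 0 geo) {f. \<not> heavy k f} \<le> 1 - q k"
      using prob_heavy_ge[OF k] by simp
  qed simp
  finally show ?thesis .
qed

end

text \<open>Expanding \<open>- ln (1 - z j)\<close> in powers and summing over \<open>j\<close>
  first leaves geometric sums bounded by \<open>1 / (m t)\<close>, so the double series is at most
  \<open>\<zeta>(2) / t\<close>.\<close>

lemma prod_one_minus_exp_ge:
  assumes t: "t > 0"
  shows "exp (- (pi\<^sup>2 / 6 / t)) \<le> (\<Prod>j\<in>{1..n}. 1 - exp (- t) ^ j)"
proof -
  define z where "z j = exp (- t) ^ j" for j
  have z: "0 < z j" "j \<ge> 1 \<Longrightarrow> z j < 1" for j
    using t by (auto simp: z_def power_less_one_iff)
  have ln_sums: "(\<lambda>m. z j ^ Suc m / real (Suc m)) sums (- ln (1 - z j))" if "j \<ge> 1" for j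
  proof -
    have "(\<lambda>m. - ((- (- z j)) ^ m) / real m) sums ln (1 + - z j)"
      by (rule ln_series') (use z(1)[of j] z(2)[OF that] in simp)
    then have "(\<lambda>m. - (- (z j ^ m) / real m)) sums (- ln (1 - z j))" by (intro sums_minus) simp
    then have "(\<lambda>m. z j ^ m / real m) sums (- ln (1 - z j))" by simp
    then show ?thesis by (subst sums_Suc_iff) simp
  qed
  have geo: "(\<Sum>j\<in>{1..n}. z j ^ Suc m) \<le> 1 / (real (Suc m) * t)" for m
  proof -
    define y where "y = exp (- (real (Suc m) * t))"
    have y: "0 < y" "y < 1" using t by (auto simp: y_def mult_less_0_iff)
    have "z j ^ Suc m = y ^ j" for j
      unfolding z_def y_def by (simp add: algebra_simps flip: exp_of_nat_mult exp_add)
    then have "(\<Sum>j\<in>{1..n}. z j ^ Suc m) = (\<Sum>j\<in>{1..n}. y ^ j)" by simp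
    also have "\<dots> = y * (\<Sum>j<n. y ^ j)"
      by (simp add: sum_distrib_left sum.atLeast1_atMost_eq flip: power_Suc)
    also have "(\<Sum>j<n. y ^ j) = (1 - y ^ n) / (1 - y)" using y by (subst sum_gp_strict) auto
    also have "y * ((1 - y ^ n) / (1 - y)) \<le> y * (1 / (1 - y))"
      using y by (intro mult_left_mono divide_right_mono) auto
    also have "\<dots> \<le> 1 / (real (Suc m) * t)"
    proof -
      have "1 + real (Suc m) * t \<le> 1 / y"
        using exp_ge_add_one_self[of "real (Suc m) * t"] by (simp add: y_def exp_minus inverse_eq_divide)
      then have "real (Suc m) * t \<le> (1 - y) / y" using y by (simp add: field_simps)
      then have "1 / ((1 - y) / y) \<le> 1 / (real (Suc m) * t)" using t y by (intro divide_left_mono) auto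
      then show ?thesis by simp
    qed
    finally show ?thesis .
  qed
  have "(\<lambda>m. \<Sum>j\<in>{1..n}. z j ^ Suc m / real (Suc m)) sums (\<Sum>j\<in>{1..n}. - ln (1 - z j))"
    by (intro sums_sum ln_sums) auto
  moreover have "(\<lambda>m. 1 / (real (Suc m))\<^sup>2 / t) sums (pi\<^sup>2 / 6 / t)"
    using sums_divide[OF inverse_squares_sums, of t] by simp
  ultimately have "(\<Sum>j\<in>{1..n}. - ln (1 - z j)) \<le> pi\<^sup>2 / 6 / t"
  proof (rule sums_le[rotated])
    fix m
    have "(\<Sum>j\<in>{1..n}. z j ^ Suc m / real (Suc m)) = (\<Sum>j\<in>{1..n}. z j ^ Suc m) / real (Suc m)"
      by (simp add: sum_divide_distrib)
    also have "\<dots> \<le> 1 / (real (Suc m) * t) / real (Suc m)" by (intro divide_right_mono geo) simp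
    also have "\<dots> = 1 / (real (Suc m))\<^sup>2 / t" by (simp add: power2_eq_square mult_ac)
    finally show "(\<Sum>j\<in>{1..n}. z j ^ Suc m / real (Suc m)) \<le> 1 / (real (Suc m))\<^sup>2 / t" .
  qed
  then have "exp (- (pi\<^sup>2 / 6 / t)) \<le> exp (\<Sum>j\<in>{1..n}. ln (1 - z j))" by (simp add: sum_negf)
  also have "\<dots> = (\<Prod>j\<in>{1..n}. exp (ln (1 - z j)))" by (rule exp_sum) simp
  also have "\<dots> = (\<Prod>j\<in>{1..n}. 1 - z j)" by (intro prod.cong refl exp_ln) (use z in auto)
  finally show ?thesis by (simp add: z_def)
qed

section \<open>Choice of parameters for the chains\<close>

lemma tn_bounds:
  assumes "n > 0"
  shows "1 / sqrt (real n) \<le> tn n" "tn n \<le> 2 / sqrt (real n)"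
proof -
  have s: "sqrt 6 \<le> 3" "2 \<le> sqrt 6" by (auto intro: real_le_lsqrt real_le_rsqrt)
  have "3 \<le> pi" "pi \<le> 4" using pi_gt3 pi_less_4 by auto
  then have "1 \<le> pi / sqrt 6" "pi / sqrt 6 \<le> 2" using s by (auto simp: pos_le_divide_eq pos_divide_le_eq)
  moreover have "tn n = pi / sqrt 6 / sqrt (real n)" by (simp add: tn_def real_sqrt_mult)
  ultimately show "1 / sqrt (real n) \<le> tn n" "tn n \<le> 2 / sqrt (real n)"
    using assms by (simp_all only: \<open>tn n = _\<close>) (auto intro!: divide_right_mono simp del: divide_divide_eq_left)
qed

text \<open>The members are congruent to 1 modulo \<open>p\<close>, which keeps them prime to the
  chain factor at density \<open>1 / p\<close>; the loss of 2 absorbs the rounding at both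
  ends.\<close>

lemma residue_one_interval:
  assumes p: "2 \<le> (p::nat)" and u: "0 \<le> u"
  obtains K where "finite K" "A / real p - 2 \<le> real (card K)"
    "\<And>k. k \<in> K \<Longrightarrow> 0 < k \<and> \<not> p dvd k \<and> u \<le> real k \<and> real k \<le> u + A"
proof -
  define i0 where "i0 = nat \<lceil>u / real p\<rceil>"
  define m where "m = nat \<lfloor>(A - 1) / real p\<rfloor>"
  define K where "K = (\<lambda>i. p * i + 1) ` {i0..<i0 + m}"
  have i0: "u / real p \<le> real i0" "real i0 \<le> u / real p + 1"
    using u p unfolding i0_def by (simp_all add: of_nat_ceiling)
  have up: "u \<le> real p * real i0" "real p * real i0 \<le> u + real p"
    using i0 p by (simp_all add: pos_divide_le_eq field_simps)
  have cK: "card K = m"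
    unfolding K_def using p by (subst card_image) (auto intro!: inj_onI)
  have "(A - 1) / real p \<le> real m + 1" unfolding m_def by linarith
  moreover have "1 / real p \<le> 1" using p by simp
  ultimately have "A / real p - 2 \<le> real m" by (simp add: diff_divide_distrib)
  moreover have "0 < k \<and> \<not> p dvd k \<and> u \<le> real k \<and> real k \<le> u + A" if k: "k \<in> K" for k
  proof -
    from k obtain i where i: "i0 \<le> i" "i < i0 + m" "k = p * i + 1" by (auto simp: K_def)
    have "0 < m" using i by simp
    then have "real m \<le> (A - 1) / real p" unfolding m_def by linarith
    then have m: "real p * real m \<le> A - 1" using p by (simp add: pos_le_divide_eq mult.commute)
    have "\<not> p dvd k"
    proof
      assume "p dvd k"
      then have "p dvd 1" using i(3) by (metis dvd_add_right_iff dvd_triv_left)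
      then show False using p by simp
    qed
    moreover have "real p * real i0 \<le> real p * real i" using i by (intro mult_left_mono) auto
    moreover have "real p * real i \<le> real p * (real i0 + real m - 1)" using i by (intro mult_left_mono) auto
    then have "real p * real i \<le> real p * real i0 + real p * real m - real p" by (simp add: algebra_simps)
    moreover have "real k = real p * real i + 1" using i(3) by simp
    ultimately show ?thesis using up m i(3) by simp
  qed
  ultimately show ?thesis using that[of K] cK by (simp add: K_def)
qed

lemma power_between:
  assumes "2 \<le> (p::nat)" "1 \<le> (y::real)"
  obtains s where "y \<le> real p ^ s" "real p ^ s \<le> real p * y"
proof -
  obtain m where m: "y < real p ^ m" using real_arch_pow[of "real p" y] assms(1) by auto
  define s where "s = (LEAST s. y \<le> real p ^ s)"
  have s: "y \<le> real p ^ s" unfolding s_def by (rule LeastI[of _ m]) (use m in simp)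
  have "real p ^ s \<le> real p * y"
  proof (cases s)
    case 0
    have "1 * 1 \<le> real p * y" using assms by (intro mult_mono) auto
    then show ?thesis using 0 by simp
  next
    case (Suc s')
    then have "\<not> y \<le> real p ^ s'" using not_less_Least[of s' "\<lambda>s. y \<le> real p ^ s"] by (simp add: s_def)
    then have "real p * real p ^ s' \<le> real p * y" by (intro mult_left_mono) auto
    then show ?thesis using Suc by simp
  qed
  with s show ?thesis using that by blast
qed

lemma one_minus_exp_ge:
  assumes "0 \<le> (y::real)" "y \<le> 1"
  shows "y / 2 \<le> 1 - exp (- y)"
proof -
  have "exp (- y) \<le> 1 / (1 + y)"
    using exp_ge_add_one_self[of y] assms by (simp add: exp_minus inverse_eq_divide divide_left_mono)
  moreover have "1 / (1 + y) \<le> 1 - y / 2"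
  proof -
    have "1 \<le> (1 - y / 2) * (1 + y)" using mult_left_mono[OF assms(2,1)] by (simp add: algebra_simps)
    then show ?thesis using assms by (simp add: pos_divide_le_eq)
  qed
  ultimately show ?thesis by simp
qed

text \<open>With \<open>t k p\<^sup>J\<close> between \<open>(1/2 + \<xi>) ln n\<close> and \<open>(1/2 + 2 \<xi>) ln n\<close>, every factor of \<open>q k\<close> is
  at least \<open>3 p\<close>; the gain \<open>(3 p)\<^sup>L\<close> beats the loss \<open>p\<^sup>L\<close> in the number of admissible \<open>k\<close>.\<close>

lemma light_partitions_bound:
  fixes p :: nat
  assumes p: "2 \<le> p" and l: "l = 1 / (12 * real p)" and \<xi>: "\<xi> = l / 4"
  obtains c where "c > 0" "\<forall>\<^sub>F n in sequentially. \<exists>L J K. finite K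
    \<and> (\<forall>k\<in>K. 0 < k \<and> (1/2 + \<xi>) * ln (real n) \<le> tn n * real (p ^ J * k) \<and> tn n * real (p ^ J * k) \<le> ln (real n))
    \<and> real (card {M\<in>part_msets n. \<forall>k\<in>K. \<not> p ^ J \<le> (\<Sum>i\<le>L. count M (p ^ i * k) * p ^ i)})
        \<le> exp (2 * real n * tn n) * exp (- (c * real n powr (l / 2)))"
proof -
  \<comment> \<open>\<open>c\<close> collects \<open>\<xi> / (4 p^2)\<close> from the size of
    \<open>K\<close>, \<open>1/2\<close> from \<open>t \<le> 2 / sqrt n\<close>, and
    \<open>1 / e\<close> from rounding \<open>L\<close> down.\<close>
  define c where "c = \<xi> / (8 * (real p)\<^sup>2 * exp 1)"
  define \<kappa> where "\<kappa> = \<xi> / (16 * (real p)\<^sup>2)"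
  have pos: "0 < l" "0 < \<xi>" "0 < c" "0 < \<kappa>" using p by (simp_all add: l \<xi> c_def \<kappa>_def)
  have l_le: "l \<le> 1 / 24" "\<xi> \<le> 1 / 96" using p by (simp_all add: l \<xi> field_simps)
  have ev1: "\<forall>\<^sub>F n in sequentially. 1 \<le> l * ln (real n)" using pos by real_asymp
  have ev2: "\<forall>\<^sub>F n in sequentially. real n powr (1 / 12) \<le> \<kappa> * real n powr (1 / 2)" using pos by real_asymp
  have "\<forall>\<^sub>F n in sequentially. \<exists>L J K. finite K
    \<and> (\<forall>k\<in>K. 0 < k \<and> (1/2 + \<xi>) * ln (real n) \<le> tn n * real (p ^ J * k) \<and> tn n * real (p ^ J * k) \<le> ln (real n))
    \<and> real (card {M\<in>part_msets n. \<forall>k\<in>K. \<not> p ^ J \<le> (\<Sum>i\<le>L. count M (p ^ i * k) * p ^ i)})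
        \<le> exp (2 * real n * tn n) * exp (- (c * real n powr (l / 2)))"
    using ev1 ev2 eventually_gt_at_top[of 0]
  proof eventually_elim
    case (elim n)
    define t where "t = tn n"
    define y where "y = ln (real n)"
    have n: "n > 0" "real n > 0" using elim(3) by auto
    have t: "t > 0" "1 / sqrt (real n) \<le> t" "t \<le> 2 / sqrt (real n)"
      using n tn_pos[of n] tn_bounds[of n] by (auto simp: t_def)
    have npow: "real n powr a = exp (a * y)" for a using n by (simp add: powr_def y_def)
    have ly: "1 \<le> l * y" using elim(1) by (simp add: y_def)
    have y1: "24 \<le> y"
    proof -
      have "0 \<le> y" using n by (simp add: y_def)
      then have "l * y \<le> 1 / 24 * y" by (rule mult_right_mono[OF l_le(1)])
      then show ?thesis using ly by simp
    qed
    \<comment> \<open>With \<open>L\<close> about \<open>l ln n\<close>, a constant factor per level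
      amounts to a power of \<open>n\<close>. The value of \<open>l\<close> keeps
      \<open>p ^ L\<close> below \<open>n ^ (1/12)\<close>, so that enough \<open>k\<close>
      remain.\<close>
    define L where "L = nat \<lfloor>l * y\<rfloor>"
    have Ly: "0 < L" "real L \<le> l * y" "l * y - 1 \<le> real L" using ly unfolding L_def by linarith+
    \<comment> \<open>The margin of the target level above the chain: \<open>p ^ s \<ge> 2 y\<close>
      keeps \<open>t p^L k\<close> at most 1/2, so that \<open>1 - exp\<close> is comparable to its
      argument along the whole chain, and \<open>p ^ s \<le> 2 p y\<close> costs only a logarithm in
      the number of \<open>k\<close>.\<close>
    obtain s where s: "2 * y \<le> real p ^ s" "real p ^ s \<le> real p * (2 * y)"
      using power_between[of p "2 * y"] p y1 by auto
    define J where "J = L + s"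
    define r where "r = exp (- t)"
    interpret chains p L J r
      by unfold_locales (use p Ly t in \<open>auto simp: J_def r_def\<close>)
    define P where "P = real p ^ J"
    have P: "P > 0" "P = real p ^ L * real p ^ s" using p by (auto simp: P_def J_def power_add)
    define u where "u = (1/2 + \<xi>) * y / (t * P)"
    define A where "A = \<xi> * y / (t * P)"
    have tP: "t * P > 0" using t P by simp
    obtain K where K: "finite K" "A / real p - 2 \<le> real (card K)"
      "\<And>k. k \<in> K \<Longrightarrow> 0 < k \<and> \<not> p dvd k \<and> u \<le> real k \<and> real k \<le> u + A"
      using residue_one_interval[OF p, of u A] y1 tP pos by (auto simp: u_def)
    have Kt: "(1/2 + \<xi>) * y \<le> t * P * real k" "t * P * real k \<le> (1/2 + 2 * \<xi>) * y" if "k \<in> K" for k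
    proof -
      have "t * P * u \<le> t * P * real k" using K(3)[OF that] tP by (intro mult_left_mono) auto
      then show "(1/2 + \<xi>) * y \<le> t * P * real k" using t P(1) by (simp add: u_def)
      have "t * P * real k \<le> t * P * (u + A)" using K(3)[OF that] tP by (intro mult_left_mono) auto
      also have "\<dots> = (1/2 + 2 * \<xi>) * y" using t P(1) by (simp add: u_def A_def field_simps)
      finally show "t * P * real k \<le> (1/2 + 2 * \<xi>) * y" .
    qed
    have Kle: "(1/2 + 2 * \<xi>) * y \<le> y" using l_le y1 by (simp add: mult_le_cancel_right1)
    have KL: "t * real (p ^ L * k) \<le> 1 / 2" if "k \<in> K" for k
    proof -
      have "t * real (p ^ L * k) * (2 * y) \<le> t * real (p ^ L * k) * real p ^ s"
        using t s by (intro mult_left_mono) auto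
      also have "\<dots> = t * P * real k" by (simp add: P(2))
      also have "\<dots> \<le> 1 / 2 * (2 * y)" using Kt(2)[OF that] Kle by simp
      finally show ?thesis using y1 by (subst (asm) mult_le_cancel_right_pos) auto
    qed
    have Kn: "p ^ L * k \<le> n" if "k \<in> K" for k
    proof -
      have "1 / sqrt (real n) * real (p ^ L * k) \<le> t * real (p ^ L * k)" using t by (intro mult_right_mono) auto
      also have "\<dots> \<le> 1" using KL[OF that] by simp
      finally have "real (p ^ L * k) \<le> sqrt (real n)" using n by (simp add: field_simps)
      also have "\<dots> \<le> real n" using n by (intro real_le_lsqrt) (auto simp: power2_eq_square)
      finally show ?thesis by linarith
    qed
    have q_ge: "exp (- ((1/2 + 2 * \<xi>) * y)) * (3 * real p) ^ L \<le> q k" if k: "k \<in> K" for k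
    proof -
      have "r ^ (k * p ^ J) = exp (- (t * P * real k))"
        unfolding r_def P_def by (simp add: mult_ac flip: exp_of_nat_mult)
      then have 1: "exp (- ((1/2 + 2 * \<xi>) * y)) \<le> r ^ (k * p ^ J)" using Kt(2)[OF k] by simp
      have "(\<Prod>i\<in>{1..L}. 3 * real p) \<le> (\<Prod>i\<in>{1..L}. (real (p ^ (J - i)) / real L) * (1 - r ^ (p ^ i * k)))"
      proof (rule prod_mono, intro conjI)
        fix i assume i: "i \<in> {1..L}"
        define z where "z = t * real (p ^ i * k)"
        have "p ^ i * k \<le> p ^ L * k" using i p by (intro mult_le_mono1 power_increasing) auto
        then have "real (p ^ i * k) \<le> real (p ^ L * k)" by (simp only: of_nat_le_iff)
        then have "z \<le> t * real (p ^ L * k)" unfolding z_def using t by (intro mult_left_mono) auto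
        also have "\<dots> \<le> 1" using KL[OF k] by simp
        finally have z: "0 \<le> z" "z \<le> 1" using t by (simp_all add: z_def)
        have "r ^ (p ^ i * k) = exp (- z)"
          unfolding r_def z_def by (simp add: mult_ac flip: exp_of_nat_mult)
        then have zz: "z / 2 \<le> 1 - r ^ (p ^ i * k)" using one_minus_exp_ge[OF z] by simp
        have Pi: "real p ^ (J - i) * real p ^ i = P"
          unfolding P_def using i by (simp add: J_def flip: power_add)
        \<comment> \<open>Here \<open>l = 1 / (12 p)\<close> is calibrated: \<open>3 p l y\<close>
          is \<open>y / 4\<close>, half of the lower bound \<open>y / 2\<close> for
          \<open>t P k\<close>.\<close>
        have "3 * real p * real L \<le> 3 * real p * (l * y)" using Ly(2) by (intro mult_left_mono) auto
        also have "\<dots> = (1/2 * y) / 2" using p by (simp add: l)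
        also have "\<dots> \<le> (t * P * real k) / 2"
        proof -
          have "0 \<le> \<xi> * y" using pos y1 by simp
          then show ?thesis using Kt(1)[OF k] by (simp only: distrib_right)
        qed
        also have "\<dots> = real (p ^ (J - i)) * (z / 2)" by (simp add: z_def flip: Pi)
        finally have "3 * real p \<le> real (p ^ (J - i)) / real L * (z / 2)"
          using Ly(1) by (simp add: field_simps)
        also have "\<dots> \<le> real (p ^ (J - i)) / real L * (1 - r ^ (p ^ i * k))"
          by (intro mult_left_mono zz) auto
        finally show "3 * real p \<le> real (p ^ (J - i)) / real L * (1 - r ^ (p ^ i * k))" .
      qed simp
      then have 2: "(3 * real p) ^ L \<le> (\<Prod>i\<in>{1..L}. (real (p ^ (J - i)) / real L) * (1 - r ^ (p ^ i * k)))" by simp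
      show ?thesis unfolding q_def by (rule mult_mono[OF 1 2]) (use r in auto)
    qed
    have A: "A / (2 * real p) \<le> real (card K)" "\<xi> / (4 * (real p)\<^sup>2 * t * real p ^ L) \<le> A / (2 * real p)"
    proof -
      have e: "A / real p = \<xi> * y / (t * real p ^ L * real p * real p ^ s)" by (simp add: A_def P(2) mult_ac)
      have "\<xi> * y / (t * real p ^ L * real p * (real p * (2 * y))) \<le> A / real p"
        unfolding e using s(2) t p pos y1 by (intro divide_left_mono mult_left_mono mult_pos_pos) auto
      moreover have "\<xi> * y / (t * real p ^ L * real p * (real p * (2 * y))) = \<xi> / (2 * (real p)\<^sup>2 * t * real p ^ L)"
        using y1 by (simp add: power2_eq_square mult_ac)
      ultimately have Ap: "\<xi> / (2 * (real p)\<^sup>2 * t * real p ^ L) \<le> A / real p" by simp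
      then show "\<xi> / (4 * (real p)\<^sup>2 * t * real p ^ L) \<le> A / (2 * real p)" by (simp add: field_simps)
      \<comment> \<open>The loss of 2 in \<open>residue_one_interval\<close> must not empty
        \<open>K\<close>. Since \<open>p ^ L\<close> is at most \<open>n ^ (1/12)\<close> while
        \<open>t\<close> is of order \<open>n ^ (-1/2)\<close>, the length \<open>A / p\<close> is
        at least 4.\<close>
      have "real p ^ L = exp (real L * ln (real p))" using p by (simp add: exp_of_nat_mult)
      also have "\<dots> \<le> exp (l * y * real p)"
        using Ly(2) p ln_le_minus_one[of "real p"] ly by (simp only: exp_le_cancel_iff) (intro mult_mono, auto)
      also have "l * y * real p = 1 / 12 * y" using p by (simp add: l)
      finally have "real p ^ L \<le> real n powr (1 / 12)" by (simp add: npow)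
      also have "\<dots> \<le> \<kappa> * sqrt (real n)" using elim(2) by (simp add: powr_half_sqrt)
      finally have "t * real p ^ L \<le> 2 / sqrt (real n) * (\<kappa> * sqrt (real n))" using t n by (intro mult_mono) auto
      then have "t * real p ^ L \<le> 2 * \<kappa>" using n by simp
      then have "4 * (2 * (real p)\<^sup>2 * (t * real p ^ L)) \<le> 4 * (2 * (real p)\<^sup>2 * (2 * \<kappa>))" by (intro mult_left_mono) auto
      also have "\<dots> = \<xi>" using p by (simp add: \<kappa>_def)
      finally have "4 \<le> \<xi> / (2 * (real p)\<^sup>2 * t * real p ^ L)" using t p by (simp add: pos_le_divide_eq mult_ac)
      then have "4 \<le> A / real p" using Ap by simp
      then show "A / (2 * real p) \<le> real (card K)" using K(2) by simp
    qed
    have "c * real n powr (l / 2) \<le> (\<Sum>k\<in>K. q k)"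
    proof -
      have 3: "exp (l * y - 1) \<le> 3 ^ L"
      proof -
        have "exp (l * y - 1) \<le> exp (real L)" using Ly(3) by simp
        also have "\<dots> = exp 1 ^ L" by (simp flip: exp_of_nat_mult)
        also have "\<dots> \<le> 3 ^ L" using exp_le by (intro power_mono) auto
        finally show ?thesis .
      qed
      have sq: "exp (y / 2) / 2 \<le> 1 / t"
      proof -
        have "exp (y / 2) = sqrt (real n)" using npow[of "1/2"] by (simp add: powr_half_sqrt)
        moreover have "t * sqrt (real n) \<le> 2" using t(3) n by (simp add: pos_le_divide_eq)
        ultimately show ?thesis using t by (simp add: field_simps)
      qed
      \<comment> \<open>The coefficients of \<open>y\<close> add up to
        \<open>l - 2 \<xi> = l / 2\<close>, which is the reason for
        \<open>\<xi> = l / 4\<close>.\<close>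
      have "exp (y / 2) * (exp (l * y - 1) * exp (- ((1/2 + 2 * \<xi>) * y))) = exp (l / 2 * y) / exp 1"
        by (simp add: \<xi> algebra_simps flip: exp_add exp_diff)
      then have "c * real n powr (l / 2) = \<xi> / (4 * (real p)\<^sup>2) * (exp (y / 2) / 2) * (exp (l * y - 1) * exp (- ((1/2 + 2 * \<xi>) * y)))"
        by (simp add: c_def npow mult_ac)
      also have "\<dots> \<le> \<xi> / (4 * (real p)\<^sup>2) * (1 / t) * (3 ^ L * exp (- ((1/2 + 2 * \<xi>) * y)))"
        using pos t by (intro mult_mono sq 3 mult_nonneg_nonneg) auto
      also have "\<dots> = \<xi> / (4 * (real p)\<^sup>2 * t * real p ^ L) * (exp (- ((1/2 + 2 * \<xi>) * y)) * (3 * real p) ^ L)"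
        using p t by (simp add: power_mult_distrib mult_ac)
      also have "\<dots> \<le> real (card K) * (exp (- ((1/2 + 2 * \<xi>) * y)) * (3 * real p) ^ L)"
        by (rule mult_right_mono[OF order_trans[OF A(2,1)]]) simp
      also have "\<dots> \<le> (\<Sum>k\<in>K. q k)" using sum_bounded_below[of K _ q] q_ge by auto
      finally show ?thesis .
    qed
    note sum_q = this
    let ?bad = "{M\<in>part_msets n. \<forall>k\<in>K. \<not> heavy k (count M)}"
    have "real (card ?bad) * (r ^ n * (\<Prod>j\<in>{1..n}. 1 - r ^ j)) \<le> (\<Prod>k\<in>K. 1 - q k)"
      by (rule card_light_le) (use K Kn in auto)
    also have "\<dots> \<le> (\<Prod>k\<in>K. exp (- q k))"
    proof (rule prod_mono, intro conjI)
      fix k assume "k \<in> K"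
      then have "q k \<le> 1" using prob_heavy_ge[of k] K(3) measure_pmf.prob_le_1 order_trans by blast
      then show "0 \<le> 1 - q k" by simp
      show "1 - q k \<le> exp (- q k)" using exp_ge_add_one_self[of "- q k"] by simp
    qed
    also have "\<dots> = exp (- (\<Sum>k\<in>K. q k))" using K(1) by (simp add: exp_sum flip: sum_negf)
    also have "\<dots> \<le> exp (- (c * real n powr (l / 2)))" using sum_q by simp
    finally have main: "real (card ?bad) * (r ^ n * (\<Prod>j\<in>{1..n}. 1 - r ^ j)) \<le> exp (- (c * real n powr (l / 2)))" .
    \<comment> \<open>At \<open>t = tn n\<close> the two factors balance:
      \<open>r ^ n = exp (- n t)\<close>, and the product is at least \<open>exp (- n t)\<close>
      because \<open>\<zeta>2 / t = n t\<close>.\<close>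
    have "exp (- (2 * real n * t)) \<le> r ^ n * (\<Prod>j\<in>{1..n}. 1 - r ^ j)"
    proof -
      have "pi\<^sup>2 / 6 / t = real n * t" using tn_sq[OF n(1)] t by (simp add: t_def power2_eq_square)
      then have "exp (- (real n * t)) \<le> (\<Prod>j\<in>{1..n}. 1 - r ^ j)"
        using prod_one_minus_exp_ge[OF t(1), of n] by (simp add: r_def)
      then have "r ^ n * exp (- (real n * t)) \<le> r ^ n * (\<Prod>j\<in>{1..n}. 1 - r ^ j)"
        using r by (intro mult_left_mono) auto
      moreover have "r ^ n = exp (- (real n * t))" by (simp add: r_def flip: exp_of_nat_mult)
      moreover have "exp (- (2 * real n * t)) = exp (- (real n * t)) * exp (- (real n * t))"
        by (simp flip: exp_add)
      ultimately show ?thesis by (simp only:)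
    qed
    then have "real (card ?bad) * exp (- (2 * real n * t)) \<le> real (card ?bad) * (r ^ n * (\<Prod>j\<in>{1..n}. 1 - r ^ j))"
      by (rule mult_left_mono) simp
    with main have "real (card ?bad) * exp (- (2 * real n * t)) \<le> exp (- (c * real n powr (l / 2)))" by linarith
    then have "real (card ?bad) \<le> exp (2 * real n * t) * exp (- (c * real n powr (l / 2)))"
      by (simp add: exp_minus field_simps)
    then have "real (card {M\<in>part_msets n. \<forall>k\<in>K. \<not> p ^ J \<le> (\<Sum>i\<le>L. count M (p ^ i * k) * p ^ i)})
        \<le> exp (2 * real n * tn n) * exp (- (c * real n powr (l / 2)))"
      by (simp only: heavy_def t_def)
    moreover have "0 < k \<and> (1/2 + \<xi>) * ln (real n) \<le> tn n * real (p ^ J * k) \<and> tn n * real (p ^ J * k) \<le> ln (real n)"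
      if "k \<in> K" for k
      using K(3)[OF that] Kt[OF that] Kle by (simp add: t_def y_def P_def mult_ac)
    ultimately show ?case using K(1) by blast
  qed
  with pos(3) show ?thesis using that by blast
qed

text \<open>Playing the upper bound with exponent \<open>1 - e\<close> against the lower bound with
  \<open>1 + e\<close> costs \<open>n^(2 e)\<close>. The linear term of the square root gives
  \<open>exp (- t m)\<close>, and \<open>2 m \<le> n\<close> keeps the polynomial factors
  comparable.\<close>

lemma num_parts_diff_le:
  assumes e: "0 < e" "e < 1"
  obtains D where "D > 0" "\<And>n m. 0 < n \<Longrightarrow> 2 * m \<le> n \<Longrightarrow>
    real (num_parts (n - m)) \<le> D * (real n + 1) powr (2 * e) * exp (- (tn n * real m)) * real (num_parts n)"
proof -
  obtain C where C: "C > 0" "\<And>n. real (num_parts n) \<le> C * growth (1 - e) n"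
    using num_parts_upper[of "1 - e"] e by auto
  obtain c where c: "c > 0" "\<And>n. c * growth (1 + e) n \<le> real (num_parts n)"
    using num_parts_lower[of "1 + e"] e by auto
  have "real (num_parts (n - m)) \<le> 2 * C / c * (real n + 1) powr (2 * e) * exp (- (tn n * real m)) * real (num_parts n)"
    if n: "0 < n" "2 * m \<le> n" for n m
  proof -
    have "sqrt (real (n - m)) \<le> sqrt (real n) * (1 - real m / real n / 2)"
    proof -
      have "real (n - m) = real n * (1 - real m / real n)" using n by (simp add: of_nat_diff field_simps)
      then have "sqrt (real (n - m)) = sqrt (real n) * sqrt (1 - real m / real n)" by (simp add: real_sqrt_mult)
      moreover have "sqrt (1 - real m / real n) \<le> 1 - real m / real n / 2"
      proof -
        have "sqrt (1 - real m / real n) \<le> 1 - real m / real n / 2 - (real m / real n)\<^sup>2 / 8"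
          by (rule sqrt_1_minus_upper) (use n in auto)
        moreover have "0 \<le> (real m / real n)\<^sup>2 / 8" by simp
        ultimately show ?thesis by linarith
      qed
      ultimately show ?thesis by (simp add: mult_left_mono)
    qed
    then have "2 * pi / sqrt 6 * sqrt (real (n - m)) \<le> 2 * pi / sqrt 6 * (sqrt (real n) * (1 - real m / real n / 2))"
      by (rule mult_left_mono) simp
    also have "\<dots> = 2 * real n * tn n * (1 - real m / real n / 2)" by (simp only: mult.assoc[symmetric] exponent_tn[OF n(1)])
    also have "\<dots> = 2 * real n * tn n - tn n * real m" using n by (simp add: field_simps)
    finally have ex: "2 * pi / sqrt 6 * sqrt (real (n - m)) \<le> 2 * pi / sqrt 6 * sqrt (real n) - tn n * real m"
      using exponent_tn[OF n(1)] by simp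
    have "(real (n - m) + 1) powr (- (1 - e)) \<le> ((real n + 1) / 2) powr (- (1 - e))"
      using n e by (intro powr_mono2') auto
    also have "\<dots> = 2 powr (1 - e) * (real n + 1) powr (- (1 - e))"
      by (simp add: powr_divide powr_minus_divide powr_diff field_simps)
    also have "\<dots> \<le> 2 powr 1 * (real n + 1) powr (- (1 - e))"
      using e by (intro mult_right_mono powr_mono) auto
    also have "(real n + 1) powr (- (1 - e)) = (real n + 1) powr (2 * e) * (real n + 1) powr (- (1 + e))"
      by (simp flip: powr_add)
    finally have pw: "(real (n - m) + 1) powr (- (1 - e)) \<le> 2 * ((real n + 1) powr (2 * e) * (real n + 1) powr (- (1 + e)))"
      by simp
    have "growth (1 - e) (n - m) \<le> exp (2 * pi / sqrt 6 * sqrt (real n) - tn n * real m)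
        * (2 * ((real n + 1) powr (2 * e) * (real n + 1) powr (- (1 + e))))"
      unfolding growth_def using ex pw by (intro mult_mono) auto
    also have "\<dots> = 2 * (real n + 1) powr (2 * e) * exp (- (tn n * real m)) * growth (1 + e) n"
      by (simp add: growth_def exp_diff exp_minus divide_inverse)
    finally have "C * growth (1 - e) (n - m) \<le> C * (2 * (real n + 1) powr (2 * e) * exp (- (tn n * real m)) * growth (1 + e) n)"
      using C(1) by (intro mult_left_mono) auto
    also have "\<dots> = 2 * C / c * (real n + 1) powr (2 * e) * exp (- (tn n * real m)) * (c * growth (1 + e) n)"
      using c(1) by simp
    also have "\<dots> \<le> 2 * C / c * (real n + 1) powr (2 * e) * exp (- (tn n * real m)) * real (num_parts n)"
      using c C(1) by (intro mult_left_mono) auto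
    finally show ?thesis using C(2)[of "n - m"] by linarith
  qed
  moreover have "2 * C / c > 0" using C c by simp
  ultimately show ?thesis using that by blast
qed

text \<open>Relative to \<open>p(n)\<close>, the two terms of \<open>card_noncore_le\<close> are
  about \<open>m n^(-1/2 - \<xi>)\<close> with \<open>m \<le> sqrt n ln n\<close>, and
  \<open>n n^(-1 - 2 \<xi>)\<close>. Both leave a saving of about \<open>n^(-\<xi>)\<close>, of
  which half is given up for the losses.\<close>

lemma noncore_bound:
  assumes \<xi>: "0 < \<xi>" "\<xi> \<le> 1"
  shows "\<forall>\<^sub>F n in sequentially. \<forall>m>0. (1/2 + \<xi>) * ln (real n) \<le> tn n * real m \<longrightarrow> tn n * real m \<le> ln (real n) \<longrightarrow>
    real (card {\<alpha>\<in>partitions_of n. \<exists>x\<in>beta_set n \<alpha>. int m \<le> x \<and> x - int m \<notin> beta_set n \<alpha>})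
      \<le> real n powr (- (\<xi> / 2)) * real (num_parts n)"
proof -
  \<comment> \<open>With \<open>e = \<xi> / 8\<close> the loss is \<open>n^(\<xi> / 4)\<close>,
    which together with the logarithm fits into \<open>n^(\<xi> / 2)\<close>.\<close>
  obtain D where D: "D > 0" "\<And>n m. 0 < n \<Longrightarrow> 2 * m \<le> n \<Longrightarrow>
    real (num_parts (n - m)) \<le> D * (real n + 1) powr (2 * (\<xi> / 8)) * exp (- (tn n * real m)) * real (num_parts n)"
    using num_parts_diff_le[of "\<xi> / 8"] \<xi> by auto
  have ev1: "\<forall>\<^sub>F n in sequentially. 4 * (sqrt (real n) * ln (real n)) \<le> real n" by real_asymp
  have ev2: "\<forall>\<^sub>F n in sequentially. D * (real n + 1) powr (2 * (\<xi> / 8)) * (ln (real n) + 1) \<le> real n powr (\<xi> / 2)"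
    using \<xi> D(1) by real_asymp
  show ?thesis using ev1 ev2 eventually_gt_at_top[of 0]
  proof eventually_elim
    case (elim n)
    define y where "y = ln (real n)"
    define E where "E = D * (real n + 1) powr (2 * (\<xi> / 8))"
    have n: "n > 0" "real n > 0" using elim(3) by auto
    have npow: "exp (a * y) = real n powr a" for a using n by (simp add: powr_def y_def)
    have y0: "0 \<le> y" using n by (simp add: y_def)
    have E0: "0 \<le> E" using D(1) by (simp add: E_def)
    show ?case
    proof (intro allI impI)
      fix m :: nat assume m: "0 < m" "(1/2 + \<xi>) * ln (real n) \<le> tn n * real m" "tn n * real m \<le> ln (real n)"
      have "1 / sqrt (real n) * real m \<le> tn n * real m" using tn_bounds[OF n(1)] by (intro mult_right_mono) auto
      then have "1 / sqrt (real n) * real m \<le> y" using m(3) by (simp add: y_def)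
      then have msq: "real m \<le> sqrt (real n) * y" using n by (simp add: field_simps)
      then have "4 * real m \<le> real n" using elim(1) by (simp add: y_def)
      then have m4: "4 * m \<le> n" by linarith
      let ?P = "real (num_parts n)"
      have e1: "exp (- (tn n * real m)) \<le> real n powr (- (1/2 + \<xi>))"
        using m(2) by (simp only: npow[symmetric] exp_le_cancel_iff mult_minus_left neg_le_iff_le y_def)
      have e2: "exp (- (tn n * real (2 * m))) \<le> real n powr (- (1 + 2 * \<xi>))"
      proof -
        have "(1 + 2 * \<xi>) * y \<le> tn n * real (2 * m)" using m(2) by (simp add: y_def algebra_simps)
        then show ?thesis by (simp only: npow[symmetric] exp_le_cancel_iff mult_minus_left neg_le_iff_le)
      qed
      have "real (num_parts (n - m)) \<le> E * exp (- (tn n * real m)) * ?P"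
        using D(2)[of n m] n m4 by (simp add: E_def)
      also have "\<dots> \<le> E * real n powr (- (1/2 + \<xi>)) * ?P"
        by (intro mult_right_mono mult_left_mono e1 E0) simp
      finally have 1: "real m * real (num_parts (n - m)) \<le> (sqrt (real n) * y) * (E * real n powr (- (1/2 + \<xi>)) * ?P)"
        using msq y0 by (intro mult_mono) auto
      have "real (num_parts (n - 2 * m)) \<le> E * exp (- (tn n * real (2 * m))) * ?P"
        using D(2)[of n "2 * m"] n m4 by (simp add: E_def)
      also have "\<dots> \<le> E * real n powr (- (1 + 2 * \<xi>)) * ?P"
        by (intro mult_right_mono mult_left_mono e2 E0) simp
      finally have 2: "real n * real (num_parts (n - 2 * m)) \<le> real n * (E * real n powr (- (1 + 2 * \<xi>)) * ?P)"
        by (intro mult_left_mono) auto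
      have "card {\<alpha>\<in>partitions_of n. \<exists>x\<in>beta_set n \<alpha>. int m \<le> x \<and> x - int m \<notin> beta_set n \<alpha>}
          \<le> m * num_parts (n - m) + n * num_parts (n - 2 * m)"
        by (rule card_noncore_le) (use m m4 in auto)
      then have "real (card {\<alpha>\<in>partitions_of n. \<exists>x\<in>beta_set n \<alpha>. int m \<le> x \<and> x - int m \<notin> beta_set n \<alpha>})
          \<le> real m * real (num_parts (n - m)) + real n * real (num_parts (n - 2 * m))"
        by (simp flip: of_nat_mult of_nat_add)
      also have "\<dots> \<le> (sqrt (real n) * y) * (E * real n powr (- (1/2 + \<xi>)) * ?P) + real n * (E * real n powr (- (1 + 2 * \<xi>)) * ?P)"
        by (rule add_mono[OF 1 2])
      also have "\<dots> = E * (y * (sqrt (real n) * real n powr (- (1/2 + \<xi>))) + real n * real n powr (- (1 + 2 * \<xi>))) * ?P"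
        by (simp add: algebra_simps)
      also have "sqrt (real n) * real n powr (- (1/2 + \<xi>)) = real n powr (- \<xi>)"
        using n by (simp add: powr_half_sqrt[symmetric] flip: powr_add)
      also have "real n * real n powr (- (1 + 2 * \<xi>)) = real n powr (- (2 * \<xi>))"
        using n powr_add[of "real n" 1 "- (1 + 2 * \<xi>)"] by simp
      also have "E * (y * real n powr (- \<xi>) + real n powr (- (2 * \<xi>))) * ?P
          \<le> E * (y * real n powr (- \<xi>) + real n powr (- \<xi>)) * ?P"
        using n \<xi> by (intro mult_right_mono mult_left_mono add_left_mono E0 powr_mono) auto
      also have "\<dots> = E * (y + 1) * real n powr (- \<xi>) * ?P" by (simp add: algebra_simps)
      also have "\<dots> \<le> real n powr (\<xi> / 2) * real n powr (- \<xi>) * ?P"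
        using elim(2) by (intro mult_right_mono) (auto simp: E_def y_def)
      also have "real n powr (\<xi> / 2) * real n powr (- \<xi>) = real n powr (- (\<xi> / 2))"
        by (simp flip: powr_add)
      finally show "real (card {\<alpha>\<in>partitions_of n. \<exists>x\<in>beta_set n \<alpha>. int m \<le> x \<and> x - int m \<notin> beta_set n \<alpha>})
          \<le> real n powr (- (\<xi> / 2)) * ?P" .
    qed
  qed
qed

text \<open>Exceptional second entries are charged with all first entries, the others with
  \<open>d\<close> each.\<close>

lemma card_pairs_le:
  assumes fin: "finite A" "finite B" "B' \<subseteq> B" and c: "\<And>b. b \<in> B - B' \<Longrightarrow> real (card {a\<in>A. R a b}) \<le> d" and d: "0 \<le> d"
  shows "real (card {(a, b). a \<in> A \<and> b \<in> B \<and> R a b}) \<le> real (card B') * real (card A) + real (card B) * d"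
proof -
  have finB': "finite B'" using fin finite_subset by blast
  have "{(a, b). a \<in> A \<and> b \<in> B \<and> R a b} = prod.swap ` (SIGMA b:B. {a\<in>A. R a b})" by force
  then have "real (card {(a, b). a \<in> A \<and> b \<in> B \<and> R a b}) = real (card (SIGMA b:B. {a\<in>A. R a b}))"
    by (simp add: card_image)
  also have "\<dots> = (\<Sum>b\<in>B. real (card {a\<in>A. R a b}))" using fin by simp
  also have "\<dots> \<le> (\<Sum>b\<in>B. (if b \<in> B' then real (card A) else 0) + d)"
  proof (rule sum_mono)
    fix b assume b: "b \<in> B"
    show "real (card {a\<in>A. R a b}) \<le> (if b \<in> B' then real (card A) else 0) + d"
    proof (cases "b \<in> B'")
      case True
      have "card {a\<in>A. R a b} \<le> card A" using fin by (intro card_mono) auto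
      then show ?thesis using True d by simp
    qed (use c b in auto)
  qed
  also have "\<dots> = real (card B') * real (card A) + real (card B) * d"
    using fin finB' by (simp add: sum.distrib sum.If_cases Int_absorb1)
  finally show ?thesis .
qed

lemma nondivisible_proportion_le_1: "nondivisible_proportion p n \<le> 1"
proof -
  have "card {(\<alpha>, \<beta>). \<alpha> \<in> partitions_of n \<and> \<beta> \<in> partitions_of n \<and> \<not> int_divisible p (char_entry \<alpha> \<beta>)}
      \<le> card (partitions_of n \<times> partitions_of n)"
    using finite_partitions_of by (intro card_mono) auto
  then have "nondivisible_proportion p n
      \<le> real (card (partitions_of n \<times> partitions_of n)) / real (card (partitions_of n \<times> partitions_of n))"
    unfolding nondivisible_proportion_def by (intro divide_right_mono) (simp_all only: of_nat_le_iff of_nat_0_le_iff)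
  then show ?thesis by (rule order_trans) (simp add: divide_self_if)
qed

text \<open>A partition \<open>\<beta>\<close> outside \<open>B\<close> has a heavy chain, so a
  nondivisible entry forces \<open>\<alpha>\<close> not to be a core for the corresponding
  \<open>m = p ^ J * k\<close>. This \<open>k\<close> may depend on \<open>\<beta>\<close>, since
  \<open>noncore_bound\<close> holds for all admissible \<open>m\<close> at once. The exponent
  obtained is \<open>\<xi> / 2 = 1 / (96 p)\<close>.\<close>

theorem nondivisible_proportion_bound:
  fixes p :: nat
  assumes p: "prime p"
  shows "\<exists>\<delta>::real. \<delta> > 0 \<and> (\<exists>C::real. \<forall>n\<ge>1. nondivisible_proportion p n \<le> C * real n powr (- \<delta>))"
proof -
  have p2: "2 \<le> p" using p by (rule prime_ge_2_nat)
  define l where "l = 1 / (12 * real p)"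
  define \<xi> where "\<xi> = l / 4"
  have l0: "0 < l" using p2 by (simp add: l_def)
  have \<xi>: "0 < \<xi>" "\<xi> \<le> 1" using p2 by (auto simp: \<xi>_def l_def field_simps)
  obtain c where c: "c > 0" "\<forall>\<^sub>F n in sequentially. \<exists>L J K. finite K
    \<and> (\<forall>k\<in>K. 0 < k \<and> (1/2 + \<xi>) * ln (real n) \<le> tn n * real (p ^ J * k) \<and> tn n * real (p ^ J * k) \<le> ln (real n))
    \<and> real (card {M\<in>part_msets n. \<forall>k\<in>K. \<not> p ^ J \<le> (\<Sum>i\<le>L. count M (p ^ i * k) * p ^ i)})
        \<le> exp (2 * real n * tn n) * exp (- (c * real n powr (l / 2)))"
    using light_partitions_bound[OF p2 l_def \<xi>_def] by blast
  obtain c2 where c2: "c2 > 0" "\<And>n. c2 * growth 2 n \<le> real (num_parts n)"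
    using num_parts_lower[of 2] by auto
  \<comment> \<open>The stretched exponential of \<open>light_partitions_bound\<close> beats the
    factor \<open>(n + 1)^2\<close> lost in comparing \<open>exp (2 n t)\<close> with
    \<open>p(n)\<close>.\<close>
  have ev: "\<forall>\<^sub>F n in sequentially. 1 / c2 * (real n + 1) powr 2 * exp (- (c * real n powr (l / 2))) \<le> real n powr (- (\<xi> / 2))"
    using l0 c(1) c2(1) \<xi> by real_asymp
  have "\<forall>\<^sub>F n in sequentially. nondivisible_proportion p n \<le> 2 * real n powr (- (\<xi> / 2))"
    using c(2) ev noncore_bound[OF \<xi>] eventually_gt_at_top[of 0]
  proof eventually_elim
    case (elim n)
    let ?N = "real (num_parts n)" and ?d = "real n powr (- (\<xi> / 2))"
    obtain L J K where K: "finite K"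
      "\<And>k. k \<in> K \<Longrightarrow> 0 < k \<and> (1/2 + \<xi>) * ln (real n) \<le> tn n * real (p ^ J * k) \<and> tn n * real (p ^ J * k) \<le> ln (real n)"
      "real (card {M\<in>part_msets n. \<forall>k\<in>K. \<not> p ^ J \<le> (\<Sum>i\<le>L. count M (p ^ i * k) * p ^ i)})
        \<le> exp (2 * real n * tn n) * exp (- (c * real n powr (l / 2)))"
      using elim(1) by blast
    define bad where "bad = {M\<in>part_msets n. \<forall>k\<in>K. \<not> p ^ J \<le> (\<Sum>i\<le>L. count M (p ^ i * k) * p ^ i)}"
    define B where "B = {\<beta>\<in>partitions_of n. mset \<beta> \<in> bad}"
    have N: "?N > 0" using num_parts_pos[of n] by simp
    have "bij_betw mset B bad"
    proof (rule bij_betw_subset[OF bij_betw_mset_partitions])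
      show "mset ` B = bad"
      proof -
        have "mset ` B = mset ` partitions_of n \<inter> bad" by (auto simp: B_def)
        also have "\<dots> = part_msets n \<inter> bad" using bij_betw_imp_surj_on[OF bij_betw_mset_partitions[of n]] by simp
        finally show ?thesis by (auto simp: bad_def)
      qed
    qed (auto simp: B_def)
    then have "card B = card bad" by (rule bij_betw_same_card)
    then have "real (card B) \<le> exp (2 * real n * tn n) * exp (- (c * real n powr (l / 2)))" using K(3) by (simp only: bad_def)
    also have "exp (2 * real n * tn n) = (real n + 1) powr 2 * growth 2 n"
    proof -
      have "(real n + 1) powr 2 * (real n + 1) powr (- 2) = 1" by (subst powr_add[symmetric]) simp
      then show ?thesis
        using exponent_tn[OF elim(4)] unfolding growth_def by (simp only: mult.left_commute[of "(real n + 1) powr 2"] mult_1_right)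
    qed
    also have "(real n + 1) powr 2 * growth 2 n \<le> (real n + 1) powr 2 * (?N / c2)"
      using c2 by (intro mult_left_mono) (auto simp: pos_le_divide_eq mult.commute)
    then have "(real n + 1) powr 2 * growth 2 n * exp (- (c * real n powr (l / 2)))
        \<le> (real n + 1) powr 2 * (?N / c2) * exp (- (c * real n powr (l / 2)))" by (rule mult_right_mono) simp
    also have "\<dots> = 1 / c2 * (real n + 1) powr 2 * exp (- (c * real n powr (l / 2))) * ?N" by simp
    also have "\<dots> \<le> ?d * ?N" using elim(2) by (rule mult_right_mono) simp
    finally have B: "real (card B) \<le> ?d * ?N" .
    have good: "real (card {\<alpha>\<in>partitions_of n. \<not> int_divisible p (char_entry \<alpha> \<beta>)}) \<le> ?d * ?N"
      if \<beta>: "\<beta> \<in> partitions_of n - B" for \<beta>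
    proof -
      have "mset \<beta> \<in> part_msets n" using \<beta> bij_betw_mset_partitions[of n] by (auto simp: bij_betw_def)
      then obtain k where k: "k \<in> K" "p ^ J \<le> (\<Sum>i\<le>L. count (mset \<beta>) (p ^ i * k) * p ^ i)"
        using \<beta> unfolding B_def bad_def by blast
      define m where "m = p ^ J * k"
      have m: "0 < m" using K(2)[OF k(1)] p2 by (simp add: m_def)
      let ?nc = "{\<alpha>\<in>partitions_of n. \<exists>x\<in>beta_set n \<alpha>. int m \<le> x \<and> x - int m \<notin> beta_set n \<alpha>}"
      have "{\<alpha>\<in>partitions_of n. \<not> int_divisible p (char_entry \<alpha> \<beta>)} \<subseteq> ?nc"
      proof (intro subsetI, rule ccontr)
        fix \<alpha> assume a: "\<alpha> \<in> {\<alpha>\<in>partitions_of n. \<not> int_divisible p (char_entry \<alpha> \<beta>)}" "\<alpha> \<notin> ?nc"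
        have an: "\<alpha> \<in> partitions_of n" "sum_list \<alpha> = n" using a(1) by (auto simp: partitions_of_def)
        have "int p dvd frob_char \<alpha> (mset \<beta>)"
        proof (rule frob_char_dvd[OF p _ k(2)])
          show "0 < k" using K(2)[OF k(1)] by blast
          show "x - int (p ^ J * k) \<in> beta_set (sum_list \<alpha>) \<alpha>"
            if "x \<in> beta_set (sum_list \<alpha>) \<alpha>" "int (p ^ J * k) \<le> x" for x
            using a(2) an that unfolding m_def by blast
        qed
        then have "int_divisible p (char_entry \<alpha> \<beta>)"
          using char_entry_eq[OF an(1), of \<beta>] \<beta> int_divisible_of_int by simp
        then show False using a(1) by blast
      qed
      then have "card {\<alpha>\<in>partitions_of n. \<not> int_divisible p (char_entry \<alpha> \<beta>)} \<le> card ?nc"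
        using finite_partitions_of[of n] by (intro card_mono) auto
      moreover have "real (card ?nc) \<le> ?d * ?N"
        using elim(3) m K(2)[OF k(1)] unfolding m_def by blast
      ultimately show ?thesis by linarith
    qed
    have "real (card {(\<alpha>, \<beta>). \<alpha> \<in> partitions_of n \<and> \<beta> \<in> partitions_of n \<and> \<not> int_divisible p (char_entry \<alpha> \<beta>)})
        \<le> real (card B) * real (card (partitions_of n)) + real (card (partitions_of n)) * (?d * ?N)"
      by (rule card_pairs_le) (use finite_partitions_of good in \<open>auto simp: B_def\<close>)
    also have "\<dots> = real (card B) * ?N + ?N * (?d * ?N)" by (simp add: num_parts_def)
    also have "\<dots> \<le> (?d * ?N) * ?N + ?N * (?d * ?N)"
      using B by (intro add_right_mono mult_right_mono) auto
    also have "\<dots> = 2 * ?d * (?N * ?N)" by simp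
    finally have "real (card {(\<alpha>, \<beta>). \<alpha> \<in> partitions_of n \<and> \<beta> \<in> partitions_of n \<and> \<not> int_divisible p (char_entry \<alpha> \<beta>)})
      \<le> 2 * ?d * (?N * ?N)" .
    then show ?case
      using N unfolding nondivisible_proportion_def by (simp add: card_cartesian_product pos_divide_le_eq flip: num_parts_def)
  qed
  then obtain n0 where n0: "\<And>n. n0 \<le> n \<Longrightarrow> nondivisible_proportion p n \<le> 2 * real n powr (- (\<xi> / 2))"
    unfolding eventually_sequentially by blast
  \<comment> \<open>The second entry of the maximum serves \<open>n < n0\<close>, where the
    proportion is bounded by 1.\<close>
  define C where "C = max 2 (real n0 powr (\<xi> / 2))"
  have "nondivisible_proportion p n \<le> C * real n powr (- (\<xi> / 2))" if n: "n \<ge> 1" for n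
  proof (cases "n0 \<le> n")
    case True
    have "2 * real n powr (- (\<xi> / 2)) \<le> C * real n powr (- (\<xi> / 2))" by (intro mult_right_mono) (auto simp: C_def)
    then show ?thesis using n0[OF True] by linarith
  next
    case False
    have "1 = real n powr (\<xi> / 2) * real n powr (- (\<xi> / 2))" using n by (simp flip: powr_add)
    also have "real n powr (\<xi> / 2) \<le> real n0 powr (\<xi> / 2)" using False \<xi> n by (intro powr_mono2) auto
    then have "real n powr (\<xi> / 2) * real n powr (- (\<xi> / 2)) \<le> C * real n powr (- (\<xi> / 2))"
      by (intro mult_right_mono) (auto simp: C_def)
    finally show ?thesis using nondivisible_proportion_le_1[of p n] by linarith
  qed
  then show ?thesis using \<xi>(1) by (intro exI[of _ "\<xi> / 2"]) auto
qed

theorem theorem1p2: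
  fixes p :: nat
  assumes "p \<in> {2, 3, 5, 7, 11, 13}"
  shows "\<exists>\<delta>::real. \<delta> > 0 \<and>
           (\<exists>C::real. \<forall>n\<ge>1. nondivisible_proportion p n \<le> C * real n powr (- \<delta>))"
proof (rule nondivisible_proportion_bound)
  show "prime p" using assms by (elim insertE) simp_all
qed

end
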